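(* For all $k\in(0,\infty)$, the function $$\theta\in(0,1)\setminus\mathbb{Q}\longmapsto\left(\mathfrak{AF}_\theta,L_\theta^k\right)$$ is continuous from $(0,1)\setminus\mathbb{Q}$, with its topology as a subset of $\mathbb{R}$, to the class of $(2,0)$-quasi-Leibniz quantum compact metric spaces metrized by the quantum propinquity $\Lambda$.
   Context: $\mathbb{N}=\{0,1,2,\ldots\}$; $\mathfrak{M}(d)$ is the algebra of $d\times d$ complex matrices. Effros-Shen algebras: for $\theta\in(0,1)\setminus\mathbb{Q}$ with continued fraction expansion $\theta=[r_0,r_1,r_2,\ldots]$ (so $r_0=0$ and $r_n\in\mathbb{N}\setminus\{0\}$ for $n\geq1$), define $p_0^\theta=r_0$, $q_0^\theta=1$, $p_1^\theta=r_0r_1+1$, $q_1^\theta=r_1$, and $p_{n+1}^\theta=r_{n+1}p_n^\theta+p_{n-1}^\theta$, $q_{n+1}^\theta=r_{n+1}q_n^\theta+q_{n-1}^\theta$ for $n\geq1$. Let $\mathfrak{AF}_{\theta,0}=\mathbb{C}$, $\mathfrak{AF}_{\theta,n}=\mathfrak{M}(q_n^\theta)\oplus\mathfrak{M}(q_{n-1}^\theta)$ for $n\geq1$, $\alpha_{\theta,n}(a\oplus b)=\mathrm{diag}(a,\ldots,a,b)\oplus a$ for $n\geq1$ with $a$ appearing $r_{n+1}$ times in the first summand, and $\alpha_{\theta,0}$ the unital *-morphism $\mathbb{C}\to\mathfrak{AF}_{\theta,1}$. Let $\mathfrak{AF}_\theta=\varinjlim(\mathfrak{AF}_{\theta,n},\alpha_{\theta,n})$,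 with canonical maps $\iota_{\theta,n}:\mathfrak{AF}_{\theta,n}\to\mathfrak{AF}_\theta$. It is simple with a unique tracial state $\sigma_\theta$, which is faithful. Let $E_{\theta,n}$ be the unique $\sigma_\theta$-preserving conditional expectation of $\mathfrak{AF}_\theta$ onto $\iota_{\theta,n}(\mathfrak{AF}_{\theta,n})$. For $k\in(0,\infty)$ and $a\in\mathfrak{sa}(\mathfrak{AF}_\theta)$ set $L_\theta^k(a)=\sup_{n\in\mathbb{N}}\dim(\mathfrak{AF}_{\theta,n})^k\|a-E_{\theta,n}(a)\|$; then $(\mathfrak{AF}_\theta,L_\theta^k)$ is a $(2,0)$-quasi-Leibniz quantum compact metric space. For a unital C*-algebra $A$, $\mathfrak{sa}(A)$ is its self-adjoint part, $\mathscr{S}(A)$ its state space. A $(2,0)$-quasi-Leibniz quantum compact metric space is a pair $(A,L)$ of a unital C*-algebra $A$ and a seminorm $L$ defined on a dense Jordan-Lie subalgebra $\mathrm{dom}(L)$ of $\mathfrak{sa}(A)$ (with $L=\infty$ off $\mathrm{dom}(L)$) such that: (1) $\{a\in\mathfrak{sa}(A):L(a)=0\}=\mathbb{R}1_A$; (2) $\max\{L(\frac{ab+ba}{2}),L(\frac{ab-ba}{2i})\}\leq 2(\|a\|_AL(b)+\|b\|_AL(a))$ for all $a,b\in\mathrm{dom}(L)$; (3) $\mathsf{mk}_L(\varphi,\psi)=\sup\{|\varphi(a)-\psi(a)|:a\in\mathrm{dom}(L),L(a)\leq1\}$ metrizes the weak* topology of $\mathscr{S}(A)$; (4) $L$ is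 lower semi-continuous for $\|\cdot\|_A$. Quantum propinquity $\Lambda$. A bridge from $A$ to $B$ is $\gamma=(D,\pi_A,\pi_B,\omega)$ where $D$ is a unital C*-algebra, $\pi_A:A\to D$, $\pi_B:B\to D$ are unital *-monomorphisms, and $\omega\in D$ with $\mathscr{S}_1(D|\omega)=\{\varphi\in\mathscr{S}(D):\varphi(1-\omega^*\omega)=\varphi(1-\omega\omega^* )=0\}\neq\emptyset$. The height of $\gamma$ is the maximum of the Hausdorff distance for $\mathsf{mk}_{L_A}$ between $\mathscr{S}(A)$ and $\{\varphi\circ\pi_A:\varphi\in\mathscr{S}_1(D|\omega)\}$ and the Hausdorff distance for $\mathsf{mk}_{L_B}$ between $\mathscr{S}(B)$ and $\{\varphi\circ\pi_B:\varphi\in\mathscr{S}_1(D|\omega)\}$. The reach of $\gamma$ is the Hausdorff distance between $\{a\in\mathfrak{sa}(A):L_A(a)\leq1\}$ and $\{b\in\mathfrak{sa}(B):L_B(b)\leq1\}$ when the distance between $a$ and $b$ is $\|\pi_A(a)\omega-\omega\pi_B(b)\|_D$. The length of $\gamma$ is the maximum of its height and reach. $\Lambda$ is the largest function from pairs of $(2,0)$-quasi-Leibniz quantum compact metric spaces to $[0,\infty)$ which is symmetric, satisfies the triangle inequality, and is bounded above by the length of any bridge between its arguments. It vanishes exactly on pairs for which there is a *-isomorphism $\pi:A\to B$ with $L_B\circ\pi=L_A$. *)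

theory Defs
  imports
    "HOL-Analysis.Analysis"
    "Jordan_Normal_Form.Schur_Decomposition"
    "Jordan_Normal_Form.VS_Connect"
begin

section \<open>Unital C*-algebras\<close>

text \<open>
  The algebras of the statement depend on a real parameter, so C*-algebras are carrier-based
  structures: a complex algebra in the style of HOL-Algebra with an involution and a norm.
\<close>

record 'a cstar = "(complex, 'a) module" +
  star :: "'a \<Rightarrow> 'a"
  cnorm :: "'a \<Rightarrow> real"

locale unital_cstar =
  A?: Ring.ring A + Module.module "class_ring :: complex ring" A
  for A :: "('a, 'm) cstar_scheme" (structure) +
  assumes one_not_zero: "\<one> \<noteq> \<zero>"
    and smult_mult_left:
      "\<lbrakk>x \<in> carrier A; y \<in> carrier A\<rbrakk> \<Longrightarrow> (c \<odot> x) \<otimes> y = c \<odot> (x \<otimes> y)"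
    and smult_mult_right:
      "\<lbrakk>x \<in> carrier A; y \<in> carrier A\<rbrakk> \<Longrightarrow> x \<otimes> (c \<odot> y) = c \<odot> (x \<otimes> y)"
    and star_closed: "x \<in> carrier A \<Longrightarrow> star A x \<in> carrier A"
    and star_star: "x \<in> carrier A \<Longrightarrow> star A (star A x) = x"
    and star_add:
      "\<lbrakk>x \<in> carrier A; y \<in> carrier A\<rbrakk> \<Longrightarrow> star A (x \<oplus> y) = star A x \<oplus> star A y"
    and star_smult: "x \<in> carrier A \<Longrightarrow> star A (c \<odot> x) = cnj c \<odot> star A x"
    and star_mult:
      "\<lbrakk>x \<in> carrier A; y \<in> carrier A\<rbrakk> \<Longrightarrow> star A (x \<otimes> y) = star A y \<otimes> star A x"
    and cnorm_nonneg: "x \<in> carrier A \<Longrightarrow> 0 \<le> cnorm A x"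
    and cnorm_eq_0_iff: "x \<in> carrier A \<Longrightarrow> cnorm A x = 0 \<longleftrightarrow> x = \<zero>"
    and cnorm_triangle:
      "\<lbrakk>x \<in> carrier A; y \<in> carrier A\<rbrakk> \<Longrightarrow> cnorm A (x \<oplus> y) \<le> cnorm A x + cnorm A y"
    and cnorm_smult: "x \<in> carrier A \<Longrightarrow> cnorm A (c \<odot> x) = cmod c * cnorm A x"
    and cnorm_mult:
      "\<lbrakk>x \<in> carrier A; y \<in> carrier A\<rbrakk> \<Longrightarrow> cnorm A (x \<otimes> y) \<le> cnorm A x * cnorm A y"
    and cstar_identity: "x \<in> carrier A \<Longrightarrow> cnorm A (star A x \<otimes> x) = (cnorm A x)\<^sup>2"
    and complete:
      "\<lbrakk>\<And>n. s n \<in> carrier A;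
        \<And>e. 0 < e \<Longrightarrow> \<exists>N. \<forall>m\<ge>N. \<forall>n\<ge>N. cnorm A (s m \<ominus> s n) < e\<rbrakk>
       \<Longrightarrow> \<exists>x\<in>carrier A. (\<lambda>n::nat. cnorm A (s n \<ominus> x)) \<longlonglongrightarrow> 0"

definition self_adjoint :: "('a, 'm) cstar_scheme \<Rightarrow> 'a set" where
  "self_adjoint A = {a \<in> carrier A. star A a = a}"

definition unital_star_hom ::
    "('a, 'm) cstar_scheme \<Rightarrow> ('b, 'n) cstar_scheme \<Rightarrow> ('a \<Rightarrow> 'b) \<Rightarrow> bool" where
  "unital_star_hom A B \<pi> \<longleftrightarrow>
     \<pi> \<in> Ring.ring_hom A B \<and>
     (\<forall>c. \<forall>a\<in>carrier A. \<pi> (c \<odot>\<^bsub>A\<^esub> a) = c \<odot>\<^bsub>B\<^esub> \<pi> a) \<and>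
     (\<forall>a\<in>carrier A. \<pi> (star A a) = star B (\<pi> a))"

definition unital_star_mono ::
    "('a, 'm) cstar_scheme \<Rightarrow> ('b, 'n) cstar_scheme \<Rightarrow> ('a \<Rightarrow> 'b) \<Rightarrow> bool" where
  "unital_star_mono A B \<pi> \<longleftrightarrow> unital_star_hom A B \<pi> \<and> inj_on \<pi> (carrier A)"

definition linear_functional :: "('a, 'm) cstar_scheme \<Rightarrow> ('a \<Rightarrow> complex) \<Rightarrow> bool" where
  "linear_functional A \<phi> \<longleftrightarrow>
     (\<forall>a\<in>carrier A. \<forall>b\<in>carrier A. \<phi> (a \<oplus>\<^bsub>A\<^esub> b) = \<phi> a + \<phi> b) \<and>
     (\<forall>c. \<forall>a\<in>carrier A. \<phi> (c \<odot>\<^bsub>A\<^esub> a) = c * \<phi> a)"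

text \<open>
  States are extensional functions, so that equality of states is equality on the carrier.  The
  order on the complex numbers is that of \<^theory>\<open>HOL-Library.Complex_Order\<close>: \<open>0 \<le> z\<close> says that \<open>z\<close>
  is real and nonnegative.
\<close>

definition states :: "('a, 'm) cstar_scheme \<Rightarrow> ('a \<Rightarrow> complex) set" where
  "states A = {\<phi> \<in> extensional (carrier A).
     linear_functional A \<phi> \<and>
     (\<forall>a\<in>carrier A. 0 \<le> \<phi> (star A a \<otimes>\<^bsub>A\<^esub> a)) \<and> \<phi> \<one>\<^bsub>A\<^esub> = 1}"

definition weak_star_topology :: "('a, 'm) cstar_scheme \<Rightarrow> ('a \<Rightarrow> complex) topology" where
  "weak_star_topology A =
     subtopology (product_topology (\<lambda>_. euclidean) (carrier A)) (states A)"

definition tracial_state :: "('a, 'm) cstar_scheme \<Rightarrow> ('a \<Rightarrow> complex) \<Rightarrow> bool" where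
  "tracial_state A \<sigma> \<longleftrightarrow>
     \<sigma> \<in> states A \<and>
     (\<forall>a\<in>carrier A. \<forall>b\<in>carrier A. \<sigma> (a \<otimes>\<^bsub>A\<^esub> b) = \<sigma> (b \<otimes>\<^bsub>A\<^esub> a))"

text \<open>Here \<open>B\<close> is the carrier of a unital C*-subalgebra of \<open>A\<close>.\<close>

definition conditional_expectation ::
    "('a, 'm) cstar_scheme \<Rightarrow> 'a set \<Rightarrow> ('a \<Rightarrow> 'a) \<Rightarrow> bool" where
  "conditional_expectation A B E \<longleftrightarrow>
     E \<in> carrier A \<rightarrow>\<^sub>E B \<and>
     (\<forall>a\<in>carrier A. \<forall>b\<in>carrier A. E (a \<oplus>\<^bsub>A\<^esub> b) = E a \<oplus>\<^bsub>A\<^esub> E b) \<and>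
     (\<forall>c. \<forall>a\<in>carrier A. E (c \<odot>\<^bsub>A\<^esub> a) = c \<odot>\<^bsub>A\<^esub> E a) \<and>
     (\<forall>b\<in>B. E b = b) \<and>
     (\<forall>b\<in>B. \<forall>c\<in>B. \<forall>a\<in>carrier A. E (b \<otimes>\<^bsub>A\<^esub> a \<otimes>\<^bsub>A\<^esub> c) = b \<otimes>\<^bsub>A\<^esub> E a \<otimes>\<^bsub>A\<^esub> c) \<and>
     (\<forall>a\<in>carrier A. \<exists>b\<in>carrier A. E (star A a \<otimes>\<^bsub>A\<^esub> a) = star A b \<otimes>\<^bsub>A\<^esub> b) \<and>
     (\<forall>a\<in>carrier A. cnorm A (E a) \<le> cnorm A a)"


section \<open>\<open>(2,0)\<close>-quasi-Leibniz quantum compact metric spaces\<close>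

text \<open>
  The function \<open>L\<close> takes the value infinity off its domain \<open>lip_dom A L\<close>.  The values of \<open>L\<close> outside the self-adjoint part of \<open>A\<close> are irrelevant.
\<close>

type_synonym 'a lip_pair = "'a cstar \<times> ('a \<Rightarrow> ennreal)"

definition lip_dom :: "('a, 'm) cstar_scheme \<Rightarrow> ('a \<Rightarrow> ennreal) \<Rightarrow> 'a set" where
  "lip_dom A L = {a \<in> self_adjoint A. L a < \<infinity>}"

definition lip_ball :: "('a, 'm) cstar_scheme \<Rightarrow> ('a \<Rightarrow> ennreal) \<Rightarrow> 'a set" where
  "lip_ball A L = {a \<in> self_adjoint A. L a \<le> 1}"

definition jordan_prod :: "('a, 'm) cstar_scheme \<Rightarrow> 'a \<Rightarrow> 'a \<Rightarrow> 'a" where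
  "jordan_prod A a b = (1 / 2) \<odot>\<^bsub>A\<^esub> ((a \<otimes>\<^bsub>A\<^esub> b) \<oplus>\<^bsub>A\<^esub> (b \<otimes>\<^bsub>A\<^esub> a))"

definition lie_prod :: "('a, 'm) cstar_scheme \<Rightarrow> 'a \<Rightarrow> 'a \<Rightarrow> 'a" where
  "lie_prod A a b = (1 / (2 * \<i>)) \<odot>\<^bsub>A\<^esub> ((a \<otimes>\<^bsub>A\<^esub> b) \<ominus>\<^bsub>A\<^esub> (b \<otimes>\<^bsub>A\<^esub> a))"

definition jordan_lie_subalgebra :: "('a, 'm) cstar_scheme \<Rightarrow> 'a set \<Rightarrow> bool" where
  "jordan_lie_subalgebra A S \<longleftrightarrow>
     S \<subseteq> self_adjoint A \<and> \<zero>\<^bsub>A\<^esub> \<in> S \<and>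
     (\<forall>a\<in>S. \<forall>b\<in>S. a \<oplus>\<^bsub>A\<^esub> b \<in> S \<and> jordan_prod A a b \<in> S \<and> lie_prod A a b \<in> S) \<and>
     (\<forall>t::real. \<forall>a\<in>S. of_real t \<odot>\<^bsub>A\<^esub> a \<in> S)"

definition dense_in_self_adjoint :: "('a, 'm) cstar_scheme \<Rightarrow> 'a set \<Rightarrow> bool" where
  "dense_in_self_adjoint A S \<longleftrightarrow>
     (\<forall>a\<in>self_adjoint A. \<forall>e>0. \<exists>b\<in>S. cnorm A (a \<ominus>\<^bsub>A\<^esub> b) < e)"

definition seminorm_on :: "('a, 'm) cstar_scheme \<Rightarrow> 'a set \<Rightarrow> ('a \<Rightarrow> ennreal) \<Rightarrow> bool" where
  "seminorm_on A S L \<longleftrightarrow>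
     (\<forall>a\<in>S. \<forall>b\<in>S. L (a \<oplus>\<^bsub>A\<^esub> b) \<le> L a + L b) \<and>
     (\<forall>t::real. \<forall>a\<in>S. L (of_real t \<odot>\<^bsub>A\<^esub> a) = ennreal \<bar>t\<bar> * L a)"

definition mk_dist ::
    "('a, 'm) cstar_scheme \<Rightarrow> ('a \<Rightarrow> ennreal) \<Rightarrow> ('a \<Rightarrow> complex) \<Rightarrow> ('a \<Rightarrow> complex) \<Rightarrow> ennreal" where
  "mk_dist A L \<phi> \<psi> = (SUP a\<in>lip_ball A L. ennreal (cmod (\<phi> a - \<psi> a)))"

definition mk_metrizes_weak_star :: "('a, 'm) cstar_scheme \<Rightarrow> ('a \<Rightarrow> ennreal) \<Rightarrow> bool" where
  "mk_metrizes_weak_star A L \<longleftrightarrow>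
     (let d = (\<lambda>\<phi> \<psi>. enn2real (mk_dist A L \<phi> \<psi>)) in
       (\<forall>\<phi>\<in>states A. \<forall>\<psi>\<in>states A. mk_dist A L \<phi> \<psi> < \<infinity>) \<and>
       Metric_space (states A) d \<and>
       Metric_space.mtopology (states A) d = weak_star_topology A)"

definition lower_semicontinuous_lip :: "('a, 'm) cstar_scheme \<Rightarrow> ('a \<Rightarrow> ennreal) \<Rightarrow> bool" where
  "lower_semicontinuous_lip A L \<longleftrightarrow>
     (\<forall>s. \<forall>a\<in>self_adjoint A. (\<forall>n::nat. s n \<in> self_adjoint A) \<and>
        (\<lambda>n. cnorm A (s n \<ominus>\<^bsub>A\<^esub> a)) \<longlonglongrightarrow> 0 \<longrightarrow> L a \<le> liminf (\<lambda>n. L (s n)))"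

definition qcms_class :: "'a lip_pair set" where
  "qcms_class = {(A, L).
     unital_cstar A \<and>
     jordan_lie_subalgebra A (lip_dom A L) \<and>
     dense_in_self_adjoint A (lip_dom A L) \<and>
     seminorm_on A (lip_dom A L) L \<and>
     {a \<in> self_adjoint A. L a = 0} = range (\<lambda>t::real. of_real t \<odot>\<^bsub>A\<^esub> \<one>\<^bsub>A\<^esub>) \<and>
     (\<forall>a\<in>lip_dom A L. \<forall>b\<in>lip_dom A L.
        max (L (jordan_prod A a b)) (L (lie_prod A a b))
          \<le> 2 * (ennreal (cnorm A a) * L b + ennreal (cnorm A b) * L a)) \<and>
     mk_metrizes_weak_star A L \<and>
     lower_semicontinuous_lip A L}"


section \<open>The quantum propinquity\<close>

definition hausdorff_dist :: "('a \<Rightarrow> 'b \<Rightarrow> ennreal) \<Rightarrow> 'a set \<Rightarrow> 'b set \<Rightarrow> ennreal" where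
  "hausdorff_dist d X Y = max (SUP x\<in>X. INF y\<in>Y. d x y) (SUP y\<in>Y. INF x\<in>X. d x y)"

type_synonym 'a bridge = "'a cstar \<times> ('a \<Rightarrow> 'a) \<times> ('a \<Rightarrow> 'a) \<times> 'a"

definition one_level_states :: "('a, 'm) cstar_scheme \<Rightarrow> 'a \<Rightarrow> ('a \<Rightarrow> complex) set" where
  "one_level_states D \<omega> = {\<phi> \<in> states D.
     \<phi> (\<one>\<^bsub>D\<^esub> \<ominus>\<^bsub>D\<^esub> (star D \<omega> \<otimes>\<^bsub>D\<^esub> \<omega>)) = 0 \<and>
     \<phi> (\<one>\<^bsub>D\<^esub> \<ominus>\<^bsub>D\<^esub> (\<omega> \<otimes>\<^bsub>D\<^esub> star D \<omega>)) = 0}"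

fun is_bridge :: "'a lip_pair \<Rightarrow> 'a lip_pair \<Rightarrow> 'a bridge \<Rightarrow> bool" where
  "is_bridge (A, L\<^sub>A) (B, L\<^sub>B) (D, \<pi>\<^sub>A, \<pi>\<^sub>B, \<omega>) \<longleftrightarrow>
     unital_cstar D \<and> unital_star_mono A D \<pi>\<^sub>A \<and> unital_star_mono B D \<pi>\<^sub>B \<and>
     \<omega> \<in> carrier D \<and> one_level_states D \<omega> \<noteq> {}"

definition pullback_states ::
    "('a, 'm) cstar_scheme \<Rightarrow> ('a \<Rightarrow> 'b) \<Rightarrow> ('b \<Rightarrow> complex) set \<Rightarrow> ('a \<Rightarrow> complex) set" where
  "pullback_states A \<pi> S = (\<lambda>\<phi>. restrict (\<phi> \<circ> \<pi>) (carrier A)) ` S"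

fun bridge_height :: "'a lip_pair \<Rightarrow> 'a lip_pair \<Rightarrow> 'a bridge \<Rightarrow> ennreal" where
  "bridge_height (A, L\<^sub>A) (B, L\<^sub>B) (D, \<pi>\<^sub>A, \<pi>\<^sub>B, \<omega>) =
     max (hausdorff_dist (mk_dist A L\<^sub>A) (states A) (pullback_states A \<pi>\<^sub>A (one_level_states D \<omega>)))
         (hausdorff_dist (mk_dist B L\<^sub>B) (states B) (pullback_states B \<pi>\<^sub>B (one_level_states D \<omega>)))"

fun bridge_reach :: "'a lip_pair \<Rightarrow> 'a lip_pair \<Rightarrow> 'a bridge \<Rightarrow> ennreal" where
  "bridge_reach (A, L\<^sub>A) (B, L\<^sub>B) (D, \<pi>\<^sub>A, \<pi>\<^sub>B, \<omega>) =
     hausdorff_dist (\<lambda>a b. ennreal (cnorm D ((\<pi>\<^sub>A a \<otimes>\<^bsub>D\<^esub> \<omega>) \<ominus>\<^bsub>D\<^esub> (\<omega> \<otimes>\<^bsub>D\<^esub> \<pi>\<^sub>B b))))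
       (lip_ball A L\<^sub>A) (lip_ball B L\<^sub>B)"

definition bridge_length :: "'a lip_pair \<Rightarrow> 'a lip_pair \<Rightarrow> 'a bridge \<Rightarrow> ennreal" where
  "bridge_length X Y \<gamma> = max (bridge_height X Y \<gamma>) (bridge_reach X Y \<gamma>)"

text \<open>
  Spaces and bridge algebras have their carriers in one type \<open>'a\<close>.  If \<open>'a\<close> has at least the
  cardinality of the continuum this is no restriction, up to isomorphism.  A quantum compact metric
  space is separable, since its state space is weak* metrizable.  In a bridge, \<open>D\<close> may be replaced
  by the separable C*-subalgebra generated by \<open>\<omega>\<close> and the images of \<open>\<pi>\<^sub>A\<close> and \<open>\<pi>\<^sub>B\<close>: states restrict
  and extend, so neither height nor reach changes.
\<close>

definition propinquity_candidates :: "('a lip_pair \<Rightarrow> 'a lip_pair \<Rightarrow> real) set" where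
  "propinquity_candidates = {d.
     \<forall>X\<in>qcms_class. \<forall>Y\<in>qcms_class.
       0 \<le> d X Y \<and> d X Y = d Y X \<and>
       (\<forall>Z\<in>qcms_class. d X Z \<le> d X Y + d Y Z) \<and>
       (\<forall>\<gamma>. is_bridge X Y \<gamma> \<longrightarrow> ennreal (d X Y) \<le> bridge_length X Y \<gamma>)}"

text \<open>
  The largest candidate is the pointwise supremum, which is again symmetric, satisfies the
  triangle inequality, and is bounded by the lengths of bridges.
\<close>

definition propinquity :: "'a lip_pair \<Rightarrow> 'a lip_pair \<Rightarrow> ennreal" where
  "propinquity X Y = (SUP d\<in>propinquity_candidates. ennreal (d X Y))"

text \<open>
  The propinquity vanishes on isomorphic pairs, so it is only a pseudometric on the class itself
  and \<^locale>\<open>Metric_space\<close> does not apply.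
\<close>

definition propinquity_topology :: "'a lip_pair topology" where
  "propinquity_topology = topology (\<lambda>U. U \<subseteq> qcms_class \<and>
     (\<forall>X\<in>U. \<exists>e>0. \<forall>Y\<in>qcms_class. propinquity X Y < ennreal e \<longrightarrow> Y \<in> U))"

lemma openin_propinquity_topology:
  fixes U :: "'a lip_pair set"
  shows "openin propinquity_topology U \<longleftrightarrow> U \<subseteq> qcms_class \<and>
     (\<forall>X\<in>U. \<exists>e>0. \<forall>Y\<in>qcms_class. propinquity X Y < ennreal e \<longrightarrow> Y \<in> U)"
proof -
  have "istopology (\<lambda>U :: 'a lip_pair set. U \<subseteq> qcms_class \<and>
     (\<forall>X\<in>U. \<exists>e>0. \<forall>Y\<in>qcms_class. propinquity X Y < ennreal e \<longrightarrow> Y \<in> U))"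
    (is "istopology ?P")
    unfolding istopology_def
  proof (intro conjI allI impI)
    fix S T :: "'a lip_pair set"
    assume S: "?P S" and T: "?P T"
    show "S \<inter> T \<subseteq> qcms_class" using S by blast
    show "\<forall>X\<in>S \<inter> T. \<exists>e>0. \<forall>Y\<in>qcms_class. propinquity X Y < ennreal e \<longrightarrow> Y \<in> S \<inter> T"
    proof
      fix X assume "X \<in> S \<inter> T"
      with S T obtain e f where e: "e > 0" "\<forall>Y\<in>qcms_class. propinquity X Y < ennreal e \<longrightarrow> Y \<in> S"
        and f: "f > 0" "\<forall>Y\<in>qcms_class. propinquity X Y < ennreal f \<longrightarrow> Y \<in> T"
        by blast
      have "propinquity X Y < ennreal e \<and> propinquity X Y < ennreal f"
        if "propinquity X Y < ennreal (min e f)" for Y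
        using that by (meson ennreal_leI min.cobounded1 min.cobounded2 order_less_le_trans)
      then show "\<exists>e>0. \<forall>Y\<in>qcms_class. propinquity X Y < ennreal e \<longrightarrow> Y \<in> S \<inter> T"
        using e f by (intro exI[of _ "min e f"]) auto
    qed
  next
    fix \<K> :: "'a lip_pair set set"
    assume K: "\<forall>K\<in>\<K>. ?P K"
    show "\<Union>\<K> \<subseteq> qcms_class" using K by blast
    show "\<forall>X\<in>\<Union>\<K>. \<exists>e>0. \<forall>Y\<in>qcms_class. propinquity X Y < ennreal e \<longrightarrow> Y \<in> \<Union>\<K>"
      using K by (meson UnionE UnionI)
  qed
  then show ?thesis
    by (simp add: propinquity_topology_def topology_inverse')
qed

lemma topspace_propinquity_topology:
  "topspace propinquity_topology = (qcms_class :: 'a lip_pair set)" (is "?T = ?Q")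
proof
  show "?T \<subseteq> ?Q"
    using openin_topspace[of propinquity_topology] unfolding openin_propinquity_topology by blast
  have "openin propinquity_topology ?Q"
    unfolding openin_propinquity_topology by (auto intro: exI[of _ 1])
  then show "?Q \<subseteq> ?T"
    by (rule openin_subset)
qed


section \<open>Matrix algebras, direct sums and inductive limits\<close>

definition vec_l2norm :: "complex Matrix.vec \<Rightarrow> real" where
  "vec_l2norm v = sqrt (Re (v \<bullet>c v))"

definition mat_op_norm :: "complex mat \<Rightarrow> real" where
  "mat_op_norm a =
     (SUP v\<in>{v \<in> carrier_vec (dim_col a). vec_l2norm v \<le> 1}. vec_l2norm (a *\<^sub>v v))"

text \<open>For \<open>d = 0\<close> this is the zero algebra, with the empty matrix as its only element.\<close>

definition mat_cstar :: "nat \<Rightarrow> complex mat cstar" where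
  "mat_cstar d = \<lparr>
     carrier = carrier_mat d d,
     mult = (*),
     one = 1\<^sub>m d,
     zero = 0\<^sub>m d d,
     add = (+),
     smult = (\<cdot>\<^sub>m),
     star = mat_adjoint,
     cnorm = mat_op_norm\<rparr>"

definition cstar_sum :: "'a cstar \<Rightarrow> 'b cstar \<Rightarrow> ('a \<times> 'b) cstar" where
  "cstar_sum A B = \<lparr>
     carrier = carrier A \<times> carrier B,
     mult = (\<lambda>(a, b) (a', b'). (a \<otimes>\<^bsub>A\<^esub> a', b \<otimes>\<^bsub>B\<^esub> b')),
     one = (\<one>\<^bsub>A\<^esub>, \<one>\<^bsub>B\<^esub>),
     zero = (\<zero>\<^bsub>A\<^esub>, \<zero>\<^bsub>B\<^esub>),
     add = (\<lambda>(a, b) (a', b'). (a \<oplus>\<^bsub>A\<^esub> a', b \<oplus>\<^bsub>B\<^esub> b')),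
     smult = (\<lambda>c (a, b). (c \<odot>\<^bsub>A\<^esub> a, c \<odot>\<^bsub>B\<^esub> b)),
     star = (\<lambda>(a, b). (star A a, star B b)),
     cnorm = (\<lambda>(a, b). max (cnorm A a) (cnorm B b))\<rparr>"

text \<open>\<open>ind_conn \<alpha> n k\<close> is the composition \<open>\<alpha>\<^bsub>n+k-1\<^esub> \<circ> \<dots> \<circ> \<alpha>\<^bsub>n\<^esub>\<close>.\<close>

primrec ind_conn :: "(nat \<Rightarrow> 'a \<Rightarrow> 'a) \<Rightarrow> nat \<Rightarrow> nat \<Rightarrow> 'a \<Rightarrow> 'a" where
  "ind_conn \<alpha> n 0 a = a"
| "ind_conn \<alpha> n (Suc k) a = \<alpha> (n + k) (ind_conn \<alpha> n k a)"

text \<open>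
  The inductive limit of a sequence of C*-algebras is the completion of the algebraic limit.  Its
  elements are classes of asymptotically coherent sequences: a sequence \<open>x\<close> represents the limit of
  the images of the \<open>x n\<close>, and null sequences represent zero.
\<close>

definition ind_threads :: "(nat \<Rightarrow> 'a cstar) \<Rightarrow> (nat \<Rightarrow> 'a \<Rightarrow> 'a) \<Rightarrow> (nat \<Rightarrow> 'a) set" where
  "ind_threads A \<alpha> = {x. (\<forall>n. x n \<in> carrier (A n)) \<and>
     (\<forall>e>0. \<exists>N. \<forall>n\<ge>N. \<forall>k.
        cnorm (A (n + k)) (x (n + k) \<ominus>\<^bsub>A (n + k)\<^esub> ind_conn \<alpha> n k (x n)) < e)}"

definition ind_rel ::
    "(nat \<Rightarrow> 'a cstar) \<Rightarrow> (nat \<Rightarrow> 'a \<Rightarrow> 'a) \<Rightarrow> ((nat \<Rightarrow> 'a) \<times> (nat \<Rightarrow> 'a)) set" where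
  "ind_rel A \<alpha> = {(x, y). x \<in> ind_threads A \<alpha> \<and> y \<in> ind_threads A \<alpha> \<and>
     (\<lambda>n. cnorm (A n) (x n \<ominus>\<^bsub>A n\<^esub> y n)) \<longlonglongrightarrow> 0}"

definition ind_lim :: "(nat \<Rightarrow> 'a cstar) \<Rightarrow> (nat \<Rightarrow> 'a \<Rightarrow> 'a) \<Rightarrow> (nat \<Rightarrow> 'a) set cstar" where
  "ind_lim A \<alpha> = (let R = ind_rel A \<alpha> in \<lparr>
     carrier = ind_threads A \<alpha> // R,
     mult = (\<lambda>X Y. \<Union>x\<in>X. \<Union>y\<in>Y. R `` {\<lambda>n. x n \<otimes>\<^bsub>A n\<^esub> y n}),
     one = R `` {\<lambda>n. \<one>\<^bsub>A n\<^esub>},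
     zero = R `` {\<lambda>n. \<zero>\<^bsub>A n\<^esub>},
     add = (\<lambda>X Y. \<Union>x\<in>X. \<Union>y\<in>Y. R `` {\<lambda>n. x n \<oplus>\<^bsub>A n\<^esub> y n}),
     smult = (\<lambda>c X. \<Union>x\<in>X. R `` {\<lambda>n. c \<odot>\<^bsub>A n\<^esub> x n}),
     star = (\<lambda>X. \<Union>x\<in>X. R `` {\<lambda>n. star (A n) (x n)}),
     cnorm = (\<lambda>X. THE r. \<forall>x\<in>X. (\<lambda>n. cnorm (A n) (x n)) \<longlonglongrightarrow> r)\<rparr>)"

definition ind_can ::
    "(nat \<Rightarrow> 'a cstar) \<Rightarrow> (nat \<Rightarrow> 'a \<Rightarrow> 'a) \<Rightarrow> nat \<Rightarrow> 'a \<Rightarrow> (nat \<Rightarrow> 'a) set" where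
  "ind_can A \<alpha> n a =
     ind_rel A \<alpha> `` {\<lambda>m. if n \<le> m then ind_conn \<alpha> n (m - n) a else \<zero>\<^bsub>A m\<^esub>}"


section \<open>The Effros-Shen algebras\<close>

text \<open>
  For irrational \<open>\<theta>\<close> the continued fraction digits are \<open>r\<^sub>n = \<lfloor>x\<^sub>n\<rfloor>\<close> for the complete quotients
  \<open>x\<^sub>0 = \<theta>\<close> and \<open>x\<^bsub>n+1\<^esub> = 1 / (x\<^sub>n - \<lfloor>x\<^sub>n\<rfloor>)\<close>.
\<close>

primrec cf_quotient :: "real \<Rightarrow> nat \<Rightarrow> real" where
  "cf_quotient \<theta> 0 = \<theta>"
| "cf_quotient \<theta> (Suc n) = 1 / frac (cf_quotient \<theta> n)"

definition cf_digit :: "real \<Rightarrow> nat \<Rightarrow> nat" where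
  "cf_digit \<theta> n = nat \<lfloor>cf_quotient \<theta> n\<rfloor>"

fun cf_q :: "real \<Rightarrow> nat \<Rightarrow> nat" where
  "cf_q \<theta> 0 = 1"
| "cf_q \<theta> (Suc 0) = cf_digit \<theta> 1"
| "cf_q \<theta> (Suc (Suc n)) = cf_digit \<theta> (Suc (Suc n)) * cf_q \<theta> (Suc n) + cf_q \<theta> n"

text \<open>
  The summand of size \<open>q\<^bsub>n-1\<^esub>\<close> is the zero algebra when \<open>n = 0\<close>, so that the level \<open>0\<close> algebra is the
  algebra of \<open>1 \<times> 1\<close> matrices.  In the connecting map at \<open>n = 0\<close> the block \<open>b\<close> is then empty, and
  the map is the unital morphism \<open>a \<mapsto> a 1\<close>.
\<close>

definition effros_shen_fd :: "real \<Rightarrow> nat \<Rightarrow> (complex mat \<times> complex mat) cstar" where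
  "effros_shen_fd \<theta> n =
     cstar_sum (mat_cstar (cf_q \<theta> n)) (mat_cstar (if n = 0 then 0 else cf_q \<theta> (n - 1)))"

definition effros_shen_map ::
    "real \<Rightarrow> nat \<Rightarrow> complex mat \<times> complex mat \<Rightarrow> complex mat \<times> complex mat" where
  "effros_shen_map \<theta> n =
     (\<lambda>(a, b). (diag_block_mat (replicate (cf_digit \<theta> (Suc n)) a @ [b]), a))"

type_synonym af_elem = "(nat \<Rightarrow> complex mat \<times> complex mat) set"

definition effros_shen :: "real \<Rightarrow> af_elem cstar" where
  "effros_shen \<theta> = ind_lim (effros_shen_fd \<theta>) (effros_shen_map \<theta>)"

definition effros_shen_can :: "real \<Rightarrow> nat \<Rightarrow> complex mat \<times> complex mat \<Rightarrow> af_elem" where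
  "effros_shen_can \<theta> = ind_can (effros_shen_fd \<theta>) (effros_shen_map \<theta>)"

definition effros_shen_trace :: "real \<Rightarrow> af_elem \<Rightarrow> complex" where
  "effros_shen_trace \<theta> = (THE \<sigma>. tracial_state (effros_shen \<theta>) \<sigma>)"

definition effros_shen_expect :: "real \<Rightarrow> nat \<Rightarrow> af_elem \<Rightarrow> af_elem" where
  "effros_shen_expect \<theta> n = (THE E.
     conditional_expectation (effros_shen \<theta>)
       (effros_shen_can \<theta> n ` carrier (effros_shen_fd \<theta> n)) E \<and>
     (\<forall>a\<in>carrier (effros_shen \<theta>). effros_shen_trace \<theta> (E a) = effros_shen_trace \<theta> a))"

definition cstar_dim :: "'a cstar \<Rightarrow> nat" where
  "cstar_dim A = vectorspace.dim (class_ring :: complex ring) A"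

definition effros_shen_lip :: "real \<Rightarrow> real \<Rightarrow> af_elem \<Rightarrow> ennreal" where
  "effros_shen_lip k \<theta> a = (SUP n.
     ennreal (real (cstar_dim (effros_shen_fd \<theta> n)) powr k *
       cnorm (effros_shen \<theta>) (a \<ominus>\<^bsub>effros_shen \<theta>\<^esub> effros_shen_expect \<theta> n a)))"

end

theory Submission
  imports Defs
begin

text \<open>
  If the digits of \<open>\<theta>\<close> and \<open>\<theta>'\<close> agree up to position \<open>n + 1\<close>, then the two inductive sequences have
  the same levels and the same connecting maps up to level \<open>n + 1\<close>.  Both limits embed into one algebra:
  with \<open>q\<close> and \<open>q'\<close> the two sequences of denominators, the first summands of both levels \<open>m\<close> repeat
  unitally into matrices of size \<open>q m * q' m\<close>, and threads become bounded sequences of such matrices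
  modulo null sequences (\<open>tower_embedding\<close>).  The pivot \<open>om\<close> of the bridge is the projection onto the
  first \<open>q (n + 1)\<close> coordinates.  An element of the common level \<open>n\<close> is block diagonal with respect to
  this projection, with the same upper left block for both embeddings.  Hence the pivot intertwines the
  two embeddings of level \<open>n\<close> (\<open>emb_can_om\<close>), and a state of one limit can be copied on level \<open>n\<close> by a
  state concentrated on the corner (\<open>one_level_extension\<close>).  Compactness enters through a generalized
  limit of states of the matrix levels (\<open>limit_state\<close>).

  Elements of Lipschitz seminorm at most one are within \<open>1 / dim n powr k\<close> of level \<open>n\<close>, so the height
  of the bridge is at most \<open>2 / dim n powr k\<close> (\<open>side_height\<close>).  For the reach, the part of such an element
  in level \<open>n\<close> is moved to the other algebra, where the expectations onto lower levels are different:
  their weights are the tails \<open>f\<close> of the continued fraction.  Finitely many weights are involved, so the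
  seminorm grows by a factor \<open>1 + \<eta>\<close> only, with \<open>\<eta>\<close> small when the weights are close (\<open>reach_half\<close>).
  At an irrational \<open>\<theta>\<close> finitely many digits are locally constant and finitely many weights are
  continuous, and \<open>2 / dim n powr k\<close> tends to zero, which gives continuity.

  All this needs that the limits are the spaces of the statement: that the inductive limit is a
  C*-algebra, that its trace is unique, that the trace preserving expectations exist, and that the
  seminorm metrizes the weak* topology.  The expectations are written down level by level: onto level
  \<open>n\<close> one averages the diagonal blocks of level \<open>n + 1\<close> with weights determined by the continued
  fraction (\<open>FF\<close>), and everything about the limit follows from the finite levels (\<open>ind_tower\<close>,
  \<open>traced_tower\<close>, \<open>af_tower\<close>).
\<close>

abbreviation sqm :: "nat => 'a mat set" where
 "sqm d \<equiv> carrier_mat d d"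

abbreviation cor :: "real => complex" where
 "cor \<equiv> of_real"

abbreviation cdist :: "('a, 'm) cstar_scheme => 'a => 'a => real" where
 "cdist A x y \<equiv> cnorm A (x \<ominus>\<^bsub>A\<^esub> y)"

section \<open>The operator norm of a matrix\<close>

lemma null_seq_le:
 fixes f g :: "nat => real"
 assumes "\<And>n. 0 \<le> f n" "\<And>n. f n \<le> g n" "g \<longlonglongrightarrow> 0"
 shows "f \<longlonglongrightarrow> 0"
 by (rule tendsto_sandwich[of "\<lambda>_. 0" f sequentially g]) (use assms in auto)

lemma vec_l2norm_L2_set: "vec_l2norm v = L2_set (\<lambda>i. cmod (v $ i)) {0..<dim_vec v}"
proof -
 have "v \<bullet>c v = (\<Sum>i\<in>{0..<dim_vec v}. cor ((cmod (v $ i))\<^sup>2))"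
  unfolding scalar_prod_def by (auto intro!: sum.cong simp: complex_norm_square[symmetric])
 hence "Re (v \<bullet>c v) = (\<Sum>i\<in>{0..<dim_vec v}. (cmod (v $ i))\<^sup>2)"
  by (simp flip: of_real_sum)
 thus ?thesis by (simp add: vec_l2norm_def L2_set_def)
qed

lemma vec_l2norm_nonneg [simp]: "0 \<le> vec_l2norm v"
 by (simp add: vec_l2norm_L2_set)

lemma vec_l2norm_sq: "(vec_l2norm v)\<^sup>2 = (\<Sum>i\<in>{0..<dim_vec v}. (cmod (v $ i))\<^sup>2)"
 by (simp add: vec_l2norm_L2_set L2_set_def sum_nonneg)

lemma cscalar_self: "v \<bullet>c v = cor ((vec_l2norm v)\<^sup>2)"
 unfolding vec_l2norm_sq scalar_prod_def
 by (auto intro!: sum.cong simp: complex_norm_square[symmetric] simp flip: of_real_power)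

lemma vec_l2norm_zero [simp]: "vec_l2norm (0\<^sub>v n) = 0"
 by (simp add: vec_l2norm_L2_set L2_set_def)

lemma vec_l2norm_eq_0: "vec_l2norm v = 0 \<longleftrightarrow> v = 0\<^sub>v (dim_vec v)"
proof
 assume "vec_l2norm v = 0"
 thus "v = 0\<^sub>v (dim_vec v)"
  by (auto simp: vec_l2norm_L2_set L2_set_eq_0_iff intro!: eq_vecI)
qed (metis vec_l2norm_zero)

lemma vec_l2norm_smult [simp]: "vec_l2norm (c \<cdot>\<^sub>v v) = cmod c * vec_l2norm v"
 by (simp add: vec_l2norm_L2_set L2_set_def norm_mult power_mult_distrib real_sqrt_mult
   flip: sum_distrib_left)

lemma vec_l2norm_triangle:
 assumes "v \<in> carrier_vec n" "w \<in> carrier_vec n"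
 shows "vec_l2norm (v + w) \<le> vec_l2norm v + vec_l2norm w"
proof -
 have "vec_l2norm (v + w) \<le> L2_set (\<lambda>i. cmod (v $ i) + cmod (w $ i)) {0..<n}"
  unfolding vec_l2norm_L2_set using assms by (auto intro!: L2_set_mono norm_triangle_ineq)
 also have "\<dots> \<le> vec_l2norm v + vec_l2norm w"
  unfolding vec_l2norm_L2_set using assms L2_set_triangle_ineq by auto
 finally show ?thesis .
qed

lemma cauchy_schwarz_cscalar:
 assumes "v \<in> carrier_vec n" "w \<in> carrier_vec n"
 shows "cmod (v \<bullet>c w) \<le> vec_l2norm v * vec_l2norm w"
proof -
 have "cmod (v \<bullet>c w) \<le> (\<Sum>i\<in>{0..<n}. \<bar>cmod (v $ i)\<bar> * \<bar>cmod (w $ i)\<bar>)"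
  unfolding scalar_prod_def using assms
  by (auto intro!: order.trans[OF norm_sum] sum_mono simp: norm_mult)
 also have "\<dots> \<le> vec_l2norm v * vec_l2norm w"
  unfolding vec_l2norm_L2_set using assms L2_set_mult_ineq[of "\<lambda>i. cmod (v $ i)" "\<lambda>i. cmod (w $ i)" "{0..<n}"]
  by auto
 finally show ?thesis .
qed

lemma cmod_entry_le_vec_l2norm: "i < dim_vec v ==> cmod (v $ i) \<le> vec_l2norm v"
 unfolding vec_l2norm_L2_set by (rule member_le_L2_set) auto

lemma mult_mat_vec_crude:
 assumes "A \<in> carrier_mat m n" "v \<in> carrier_vec n"
 shows "vec_l2norm (A *\<^sub>v v) \<le> (\<Sum>i<m. \<Sum>j<n. cmod (A $$ (i,j))) * vec_l2norm v"
proof -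
 have "vec_l2norm (A *\<^sub>v v) \<le> (\<Sum>i\<in>{0..<m}. cmod ((A *\<^sub>v v) $ i))"
  unfolding vec_l2norm_L2_set using assms
  by (metis L2_set_le_sum carrier_matD(1) dim_mult_mat_vec norm_ge_zero)
 also have "\<dots> \<le> (\<Sum>i\<in>{0..<m}. \<Sum>j<n. cmod (A $$ (i,j)) * vec_l2norm v)"
 proof (rule sum_mono)
  fix i assume i: "i \<in> {0..<m}"
  have "cmod ((A *\<^sub>v v) $ i) \<le> (\<Sum>j\<in>{0..<n}. cmod (A $$ (i,j)) * cmod (v $ j))"
   using assms i by (auto simp: scalar_prod_def norm_mult intro!: order.trans[OF norm_sum] sum_mono)
  also have "\<dots> \<le> (\<Sum>j\<in>{0..<n}. cmod (A $$ (i,j)) * vec_l2norm v)"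
   using assms by (auto intro!: sum_mono mult_left_mono cmod_entry_le_vec_l2norm)
  finally show "cmod ((A *\<^sub>v v) $ i) \<le> (\<Sum>j<n. cmod (A $$ (i,j)) * vec_l2norm v)"
   by (simp add: lessThan_atLeast0)
 qed
 finally show ?thesis by (simp add: sum_distrib_right lessThan_atLeast0)
qed

lemma mat_op_norm_bdd:
 assumes "A \<in> carrier_mat m n"
 shows "bdd_above ((\<lambda>v. vec_l2norm (A *\<^sub>v v)) ` {v \<in> carrier_vec (dim_col A). vec_l2norm v \<le> 1})"
proof (rule bdd_aboveI2)
 fix v assume "v \<in> {v \<in> carrier_vec (dim_col A). vec_l2norm v \<le> 1}"
 thus "vec_l2norm (A *\<^sub>v v) \<le> (\<Sum>i<m. \<Sum>j<n. cmod (A $$ (i,j)))"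
  using assms mult_mat_vec_crude[OF assms, of v]
  by (smt (verit) carrier_matD(2) mem_Collect_eq mult_left_le norm_ge_zero sum_nonneg)
qed

lemma mat_op_norm_nonneg: "0 \<le> mat_op_norm A"
proof -
 have "vec_l2norm (A *\<^sub>v 0\<^sub>v (dim_col A)) \<le> mat_op_norm A"
  unfolding mat_op_norm_def by (rule cSUP_upper[OF _ mat_op_norm_bdd]) auto
 thus ?thesis using vec_l2norm_nonneg order_trans by blast
qed

lemma mult_mat_vec_norm:
 assumes A: "A \<in> carrier_mat m n" and v: "v \<in> carrier_vec n"
 shows "vec_l2norm (A *\<^sub>v v) \<le> mat_op_norm A * vec_l2norm v"
proof (cases "vec_l2norm v = 0")
 case True
 hence "v = 0\<^sub>v n" using v vec_l2norm_eq_0 by auto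
 hence "A *\<^sub>v v = 0\<^sub>v m" using A by auto
 thus ?thesis using True by simp
next
 case False
 define t where "t = vec_l2norm v"
 have t: "t > 0" using False vec_l2norm_nonneg[of v] by (simp add: t_def less_le)
 define w where "w = cor (1/t) \<cdot>\<^sub>v v"
 have w: "w \<in> carrier_vec n" "vec_l2norm w = 1" using v t by (auto simp: w_def t_def norm_divide)
 have "vec_l2norm (A *\<^sub>v w) \<le> mat_op_norm A"
  unfolding mat_op_norm_def by (rule cSUP_upper[OF _ mat_op_norm_bdd[OF A]]) (use A w in auto)
 moreover have "A *\<^sub>v w = cor (1/t) \<cdot>\<^sub>v (A *\<^sub>v v)"
  unfolding w_def using A v by (rule mult_mat_vec)
 ultimately have "(1/t) * vec_l2norm (A *\<^sub>v v) \<le> mat_op_norm A"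
  using t by (simp add: norm_divide)
 thus ?thesis using t by (simp add: field_simps t_def)
qed

lemma mat_op_norm_le:
 assumes A: "A \<in> carrier_mat m n" and c: "0 \<le> c"
  and le: "\<And>v. v \<in> carrier_vec n ==> vec_l2norm (A *\<^sub>v v) \<le> c * vec_l2norm v"
 shows "mat_op_norm A \<le> c"
 unfolding mat_op_norm_def
proof (rule cSUP_least)
 show "{v \<in> carrier_vec (dim_col A). vec_l2norm v \<le> 1} \<noteq> {}"
  using zero_carrier_vec vec_l2norm_zero by (metis (mono_tags, lifting) empty_iff mem_Collect_eq zero_le_one)
 fix v assume "v \<in> {v \<in> carrier_vec (dim_col A). vec_l2norm v \<le> 1}"
 thus "vec_l2norm (A *\<^sub>v v) \<le> c" using le[of v] A c
  by (smt (verit) carrier_matD(2) mem_Collect_eq mult_left_le)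
qed

lemma mat_op_norm_le_sum:
 assumes "A \<in> carrier_mat m n"
 shows "mat_op_norm A \<le> (\<Sum>i<m. \<Sum>j<n. cmod (A $$ (i,j)))"
 by (rule mat_op_norm_le[OF assms]) (auto intro!: sum_nonneg mult_mat_vec_crude[OF assms])

lemma cmod_entry_le_mat_op_norm:
 assumes A: "A \<in> carrier_mat m n" and "i < m" "j < n"
 shows "cmod (A $$ (i,j)) \<le> mat_op_norm A"
proof -
 have u: "vec_l2norm (unit_vec n j :: complex Matrix.vec) = 1"
 proof -
  have "(\<Sum>i\<in>{0..<n}. (cmod (unit_vec n j $ i))\<^sup>2) = (\<Sum>i\<in>{0..<n}. if i = j then 1 else 0)"
   using assms by (intro sum.cong) (auto simp: unit_vec_def)
  hence "(vec_l2norm (unit_vec n j :: complex Matrix.vec))\<^sup>2 = 1"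
   unfolding vec_l2norm_sq using assms by (simp add: sum.delta)
  thus ?thesis using vec_l2norm_nonneg power2_eq_1_iff by (smt (verit))
 qed
 have "A *\<^sub>v unit_vec n j = col A j"
  using assms by (intro eq_vecI) (auto simp: scalar_prod_right_unit)
 hence "cmod (A $$ (i,j)) \<le> vec_l2norm (A *\<^sub>v unit_vec n j)"
  using assms cmod_entry_le_vec_l2norm[of i "col A j"] by auto
 also have "\<dots> \<le> mat_op_norm A"
  using mult_mat_vec_norm[OF A, of "unit_vec n j"] u by simp
 finally show ?thesis .
qed

lemma mat_op_norm_eq_0:
 assumes "A \<in> carrier_mat m n"
 shows "mat_op_norm A = 0 \<longleftrightarrow> A = 0\<^sub>m m n"
proof
 assume "mat_op_norm A = 0"
 thus "A = 0\<^sub>m m n" using cmod_entry_le_mat_op_norm[OF assms] assms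
  by (intro eq_matI) auto
next
 assume "A = 0\<^sub>m m n"
 thus "mat_op_norm A = 0"
  using mat_op_norm_le_sum[OF assms] mat_op_norm_nonneg[of A] by auto
qed

lemma mat_op_norm_triangle:
 assumes "A \<in> carrier_mat m n" "B \<in> carrier_mat m n"
 shows "mat_op_norm (A + B) \<le> mat_op_norm A + mat_op_norm B"
proof (rule mat_op_norm_le)
 fix v :: "complex Matrix.vec" assume v: "v \<in> carrier_vec n"
 have "(A + B) *\<^sub>v v = A *\<^sub>v v + B *\<^sub>v v" using assms v by (simp add: add_mult_distrib_mat_vec)
 hence "vec_l2norm ((A + B) *\<^sub>v v) \<le> vec_l2norm (A *\<^sub>v v) + vec_l2norm (B *\<^sub>v v)"
  using vec_l2norm_triangle[of "A *\<^sub>v v" m "B *\<^sub>v v"] assms v by auto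
 also have "\<dots> \<le> (mat_op_norm A + mat_op_norm B) * vec_l2norm v"
  using mult_mat_vec_norm assms v by (simp add: distrib_right add_mono)
 finally show "vec_l2norm ((A + B) *\<^sub>v v) \<le> (mat_op_norm A + mat_op_norm B) * vec_l2norm v" .
qed (use assms mat_op_norm_nonneg in auto)

lemma mat_op_norm_mult:
 assumes "A \<in> carrier_mat m n" "B \<in> carrier_mat n l"
 shows "mat_op_norm (A * B) \<le> mat_op_norm A * mat_op_norm B"
proof (rule mat_op_norm_le)
 fix v :: "complex Matrix.vec" assume v: "v \<in> carrier_vec l"
 have "vec_l2norm ((A * B) *\<^sub>v v) = vec_l2norm (A *\<^sub>v (B *\<^sub>v v))" using assms v by simp
 also have "\<dots> \<le> mat_op_norm A * vec_l2norm (B *\<^sub>v v)" by (rule mult_mat_vec_norm) (use assms v in auto)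
 also have "\<dots> \<le> mat_op_norm A * (mat_op_norm B * vec_l2norm v)"
  by (intro mult_left_mono mult_mat_vec_norm mat_op_norm_nonneg) (use assms v in auto)
 finally show "vec_l2norm ((A * B) *\<^sub>v v) \<le> mat_op_norm A * mat_op_norm B * vec_l2norm v" by (simp add: mult.assoc)
qed (use assms mat_op_norm_nonneg in auto)

lemma mat_op_norm_smult_le:
 assumes "A \<in> carrier_mat m n"
 shows "mat_op_norm (c \<cdot>\<^sub>m A) \<le> cmod c * mat_op_norm A"
proof (rule mat_op_norm_le)
 fix v :: "complex Matrix.vec" assume v: "v \<in> carrier_vec n"
 have "(c \<cdot>\<^sub>m A) *\<^sub>v v = c \<cdot>\<^sub>v (A *\<^sub>v v)" using assms v by (intro eq_vecI) auto
 thus "vec_l2norm ((c \<cdot>\<^sub>m A) *\<^sub>v v) \<le> cmod c * mat_op_norm A * vec_l2norm v"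
  using mult_mat_vec_norm[OF assms v] by (simp add: mult_left_mono mult.assoc)
qed (use assms mat_op_norm_nonneg in auto)

lemma mat_op_norm_smult:
 assumes A: "A \<in> carrier_mat m n"
 shows "mat_op_norm (c \<cdot>\<^sub>m A) = cmod c * mat_op_norm A"
proof (cases "c = 0")
 case True
 thus ?thesis using mat_op_norm_smult_le[OF A, of c] mat_op_norm_nonneg[of "c \<cdot>\<^sub>m A"] by simp
next
 case False
 have "A = (1/c) \<cdot>\<^sub>m (c \<cdot>\<^sub>m A)" using False by (intro eq_matI) auto
 hence "mat_op_norm A \<le> (1 / cmod c) * mat_op_norm (c \<cdot>\<^sub>m A)"
  using mat_op_norm_smult_le[of "c \<cdot>\<^sub>m A" m n "1/c"] A by (simp add: norm_divide)
 thus ?thesis using False mat_op_norm_smult_le[OF A, of c] by (simp add: field_simps)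
qed

lemma mat_adjoint_dim [simp]: "dim_row (mat_adjoint A) = dim_col A" "dim_col (mat_adjoint A) = dim_row A"
 by (simp_all add: mat_adjoint_def)

lemma mat_adjoint_carrier [simp]: "A \<in> carrier_mat m n ==> mat_adjoint A \<in> carrier_mat n m"
 by (auto intro: carrier_matI)

lemma mat_adjoint_index [simp]:
 "i < dim_col A ==> j < dim_row A ==> mat_adjoint (A :: complex mat) $$ (i,j) = cnj (A $$ (j,i))"
 by (simp add: mat_adjoint_def mat_of_rows_index)

lemma mat_adjoint_adjoint [simp]: "mat_adjoint (mat_adjoint A) = (A :: complex mat)"
 by (rule eq_matI) auto

lemma mat_adjoint_add:
 "A \<in> carrier_mat m n ==> B \<in> carrier_mat m n ==>
  mat_adjoint (A + B :: complex mat) = mat_adjoint A + mat_adjoint B"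
 by (rule eq_matI) auto

lemma mat_adjoint_smult: "mat_adjoint (c \<cdot>\<^sub>m A :: complex mat) = cnj c \<cdot>\<^sub>m mat_adjoint A"
 by (rule eq_matI) auto

lemma mat_adjoint_mult:
 "A \<in> carrier_mat m n ==> B \<in> carrier_mat n l ==>
  mat_adjoint (A * B :: complex mat) = mat_adjoint B * mat_adjoint A"
 by (rule eq_matI) (auto simp: scalar_prod_def mult.commute intro!: sum.cong)

lemma mat_adjoint_one [simp]: "mat_adjoint (1\<^sub>m n :: complex mat) = 1\<^sub>m n"
 by (rule eq_matI) auto

lemma cscalar_adjoint:
 fixes A :: "complex mat"
 assumes "A \<in> carrier_mat m n" "v \<in> carrier_vec n" "w \<in> carrier_vec m"
 shows "(A *\<^sub>v v) \<bullet>c w = v \<bullet>c (mat_adjoint A *\<^sub>v w)"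
proof -
 have "(A *\<^sub>v v) \<bullet>c w = (\<Sum>i\<in>{0..<m}. \<Sum>j\<in>{0..<n}. A $$ (i,j) * v $ j * cnj (w $ i))"
  using assms by (auto simp: scalar_prod_def sum_distrib_right intro!: sum.cong)
 also have "\<dots> = (\<Sum>j\<in>{0..<n}. \<Sum>i\<in>{0..<m}. A $$ (i,j) * v $ j * cnj (w $ i))"
  by (rule sum.swap)
 also have "\<dots> = v \<bullet>c (mat_adjoint A *\<^sub>v w)"
  using assms by (auto simp: scalar_prod_def sum_distrib_left mult_ac intro!: sum.cong)
 finally show ?thesis .
qed

lemma norm_sq_adjoint:
 assumes "A \<in> carrier_mat m n" "v \<in> carrier_vec n"
 shows "cor ((vec_l2norm (A *\<^sub>v v))\<^sup>2) = v \<bullet>c (mat_adjoint A *\<^sub>v (A *\<^sub>v v))"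
 using cscalar_adjoint[OF assms, of "A *\<^sub>v v"] assms cscalar_self by auto

text \<open>For a vector \<open>v\<close>, the square of the length of \<open>A v\<close> is the inner product of \<open>A\<^sup>* A v\<close> with \<open>v\<close>.\<close>

lemma mat_op_norm_sq_le:
 assumes A: "A \<in> carrier_mat m n"
 shows "(mat_op_norm A)\<^sup>2 \<le> mat_op_norm (mat_adjoint A * A)"
proof -
 have H: "mat_adjoint A * A \<in> sqm n" using A by auto
 have "mat_op_norm A \<le> sqrt (mat_op_norm (mat_adjoint A * A))"
 proof (rule mat_op_norm_le[OF A])
  fix v :: "complex Matrix.vec" assume v: "v \<in> carrier_vec n"
  have "(vec_l2norm (A *\<^sub>v v))\<^sup>2 = cmod (v \<bullet>c (mat_adjoint A *\<^sub>v (A *\<^sub>v v)))"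
   using norm_sq_adjoint[OF A v] by (metis abs_of_nonneg norm_of_real zero_le_power2)
  also have "\<dots> \<le> vec_l2norm v * vec_l2norm ((mat_adjoint A * A) *\<^sub>v v)"
   using cauchy_schwarz_cscalar[OF v mult_mat_vec_carrier[OF H v]]
   unfolding assoc_mult_mat_vec[OF mat_adjoint_carrier[OF A] A v] .
  also have "\<dots> \<le> vec_l2norm v * (mat_op_norm (mat_adjoint A * A) * vec_l2norm v)"
   by (intro mult_left_mono mult_mat_vec_norm[OF H] v) auto
  finally have "(vec_l2norm (A *\<^sub>v v))\<^sup>2 \<le> (sqrt (mat_op_norm (mat_adjoint A * A)) * vec_l2norm v)\<^sup>2"
   by (simp add: power_mult_distrib mat_op_norm_nonneg power2_eq_square mult_ac)
  thus "vec_l2norm (A *\<^sub>v v) \<le> sqrt (mat_op_norm (mat_adjoint A * A)) * vec_l2norm v"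
   by (rule power2_le_imp_le) (auto simp: mat_op_norm_nonneg)
 qed (auto simp: mat_op_norm_nonneg)
 hence "(mat_op_norm A)\<^sup>2 \<le> (sqrt (mat_op_norm (mat_adjoint A * A)))\<^sup>2"
  by (rule power_mono) (rule mat_op_norm_nonneg)
 thus ?thesis by (simp add: mat_op_norm_nonneg)
qed

lemma mat_op_norm_adjoint:
 assumes A: "A \<in> carrier_mat m n"
 shows "mat_op_norm (mat_adjoint A) = mat_op_norm A"
proof -
 have le: "mat_op_norm B \<le> mat_op_norm (mat_adjoint B)" if B: "B \<in> carrier_mat m n" for B m n
 proof -
  have "mat_op_norm B * mat_op_norm B \<le> mat_op_norm (mat_adjoint B) * mat_op_norm B"
   using mat_op_norm_sq_le[OF B] mat_op_norm_mult[of "mat_adjoint B" n m B n] B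
   by (simp add: power2_eq_square)
  thus ?thesis
   by (metis mat_op_norm_nonneg mult_right_le_imp_le order_le_less)
 qed
 show ?thesis using le[OF A] le[of "mat_adjoint A"] A by (metis mat_adjoint_adjoint mat_adjoint_carrier order_antisym)
qed

lemma mat_op_norm_cstar:
 assumes A: "A \<in> carrier_mat m n"
 shows "mat_op_norm (mat_adjoint A * A) = (mat_op_norm A)\<^sup>2"
 using mat_op_norm_sq_le[OF A] mat_op_norm_mult[of "mat_adjoint A" n m A n] mat_op_norm_adjoint[OF A] A
 by (simp add: power2_eq_square)

lemma mat_op_norm_one: "mat_op_norm (1\<^sub>m n) \<le> 1"
 by (rule mat_op_norm_le[of _ n n]) auto

lemma mat_op_norm_compl_le:
 assumes A: "A \<in> carrier_mat m n" and r: "(mat_op_norm A)\<^sup>2 \<le> r"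
 shows "mat_op_norm (cor r \<cdot>\<^sub>m 1\<^sub>m n - mat_adjoint A * A) \<le> r"
proof (rule mat_op_norm_le)
 let ?H = "cor r \<cdot>\<^sub>m 1\<^sub>m n - mat_adjoint A * A"
 have r0: "0 \<le> r" using r by (meson order_trans zero_le_power2)
 fix v :: "complex Matrix.vec" assume v: "v \<in> carrier_vec n"
 define w where "w = A *\<^sub>v v"
 define u where "u = mat_adjoint A *\<^sub>v w"
 have w: "w \<in> carrier_vec m" unfolding w_def using A v by (rule mult_mat_vec_carrier)
 have u: "u \<in> carrier_vec n" unfolding u_def using mat_adjoint_carrier[OF A] w by (rule mult_mat_vec_carrier)
 note wu = w u
 have H: "?H *\<^sub>v v = cor r \<cdot>\<^sub>v v - u"
 proof -
  have "?H *\<^sub>v v = (cor r \<cdot>\<^sub>m 1\<^sub>m n) *\<^sub>v v - (mat_adjoint A * A) *\<^sub>v v"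
   using A v by (intro minus_mult_distrib_mat_vec) auto
  moreover have "(cor r \<cdot>\<^sub>m 1\<^sub>m n) *\<^sub>v v = cor r \<cdot>\<^sub>v v"
   using v by (intro eq_vecI) (auto simp: scalar_prod_left_unit)
  ultimately show ?thesis unfolding u_def w_def using A v by (simp add: assoc_mult_mat_vec[of _ n m _ n])
 qed
 have vu: "v \<bullet>c u = cor ((vec_l2norm w)\<^sup>2)"
  using norm_sq_adjoint[OF A v] by (simp add: u_def w_def)
 have "(vec_l2norm (?H *\<^sub>v v))\<^sup>2 = (\<Sum>i\<in>{0..<n}. (cmod (cor r * v $ i - u $ i))\<^sup>2)"
  unfolding H vec_l2norm_sq using v wu by auto
 also have "\<dots> = (\<Sum>i\<in>{0..<n}. r\<^sup>2 * (cmod (v $ i))\<^sup>2 - 2 * r * Re (v $ i * cnj (u $ i)) + (cmod (u $ i))\<^sup>2)"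
  by (intro sum.cong refl) (simp add: cmod_power2, simp add: power2_eq_square algebra_simps)
 also have "\<dots> = r\<^sup>2 * (vec_l2norm v)\<^sup>2 - 2 * r * Re (v \<bullet>c u) + (vec_l2norm u)\<^sup>2"
  unfolding vec_l2norm_sq scalar_prod_def using v wu
  by (simp add: sum.distrib sum_subtractf sum_distrib_left distrib_left mult.assoc)
 also have "\<dots> \<le> r\<^sup>2 * (vec_l2norm v)\<^sup>2 - 2 * r * (vec_l2norm w)\<^sup>2 + r * (vec_l2norm w)\<^sup>2"
 proof -
  have "vec_l2norm u \<le> mat_op_norm A * vec_l2norm w"
   unfolding u_def using mult_mat_vec_norm[of "mat_adjoint A" n m w] A wu mat_op_norm_adjoint[OF A] by auto
  hence "(vec_l2norm u)\<^sup>2 \<le> (mat_op_norm A)\<^sup>2 * (vec_l2norm w)\<^sup>2"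
   by (metis power_mono power_mult_distrib vec_l2norm_nonneg)
  also have "\<dots> \<le> r * (vec_l2norm w)\<^sup>2" using r by (intro mult_right_mono) auto
  finally show ?thesis unfolding vu by simp
 qed
 also have "\<dots> \<le> (r * vec_l2norm v)\<^sup>2" using r0 by (simp add: power_mult_distrib)
 finally show "vec_l2norm (?H *\<^sub>v v) \<le> r * vec_l2norm v"
  by (rule power2_le_imp_le) (use r0 in simp)
qed (use A r in \<open>auto intro: order_trans[OF zero_le_power2]\<close>)

lemma mat_op_norm_sq_le_of_sum:
 assumes A: "A \<in> carrier_mat m n" and C: "C \<in> carrier_mat l n" and r: "0 \<le> r"
  and eq: "mat_adjoint A * A + mat_adjoint C * C = cor r \<cdot>\<^sub>m 1\<^sub>m n"
 shows "(mat_op_norm A)\<^sup>2 \<le> r"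
proof -
 have "mat_op_norm A \<le> sqrt r"
 proof (rule mat_op_norm_le[OF A])
  fix v :: "complex Matrix.vec" assume v: "v \<in> carrier_vec n"
  have "cor ((vec_l2norm (A *\<^sub>v v))\<^sup>2 + (vec_l2norm (C *\<^sub>v v))\<^sup>2)
   = v \<bullet>c ((mat_adjoint A * A) *\<^sub>v v) + v \<bullet>c ((mat_adjoint C * C) *\<^sub>v v)"
   using norm_sq_adjoint[OF A v] norm_sq_adjoint[OF C v] A C v
   by (simp add: assoc_mult_mat_vec[of _ n m _ n] assoc_mult_mat_vec[of _ n l _ n])
  also have "\<dots> = v \<bullet>c ((mat_adjoint A * A) *\<^sub>v v + (mat_adjoint C * C) *\<^sub>v v)"
  proof -
   have 1: "(mat_adjoint A * A) *\<^sub>v v \<in> carrier_vec n"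
    using A v by (intro mult_mat_vec_carrier[of _ n n] mult_carrier_mat[of _ n m]) auto
   have 2: "(mat_adjoint C * C) *\<^sub>v v \<in> carrier_vec n"
    using C v by (intro mult_mat_vec_carrier[of _ n n] mult_carrier_mat[of _ n l]) auto
   show ?thesis
    unfolding conjugate_add_vec[OF 1 2] using v 1 2 by (subst scalar_prod_add_distrib[of _ n]) (simp_all only: carrier_vec_conjugate)
  qed
  also have "\<dots> = v \<bullet>c ((cor r \<cdot>\<^sub>m 1\<^sub>m n) *\<^sub>v v)"
   unfolding eq[symmetric] using A C v by (subst add_mult_distrib_mat_vec[of _ n n]) auto
  also have "(cor r \<cdot>\<^sub>m 1\<^sub>m n) *\<^sub>v v = cor r \<cdot>\<^sub>v v"
   using v by (intro eq_vecI) (auto simp: scalar_prod_left_unit)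
  also have "v \<bullet>c (cor r \<cdot>\<^sub>v v) = cor (r * (vec_l2norm v)\<^sup>2)"
   using v by (simp add: conjugate_smult_vec cscalar_self)
  finally have "(vec_l2norm (A *\<^sub>v v))\<^sup>2 + (vec_l2norm (C *\<^sub>v v))\<^sup>2 = r * (vec_l2norm v)\<^sup>2"
   using of_real_eq_iff by blast
  hence "(vec_l2norm (A *\<^sub>v v))\<^sup>2 \<le> (sqrt r * vec_l2norm v)\<^sup>2"
   using r by (simp add: power_mult_distrib) (smt (verit) zero_le_power2)
  thus "vec_l2norm (A *\<^sub>v v) \<le> sqrt r * vec_l2norm v"
   by (rule power2_le_imp_le) (use r in auto)
 qed (use r in auto)
 hence "(mat_op_norm A)\<^sup>2 \<le> (sqrt r)\<^sup>2" by (rule power_mono) (rule mat_op_norm_nonneg)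
 thus ?thesis using r by simp
qed

text \<open>The operator norm dominates the entries and is dominated by their sum, so Cauchy sequences converge
  entrywise.\<close>

lemma mat_op_norm_complete:
 assumes s: "\<And>n. s n \<in> carrier_mat a b"
  and cau: "\<And>e. 0 < e ==> \<exists>N. \<forall>m\<ge>N. \<forall>n\<ge>N. mat_op_norm (s m - s n) < e"
 shows "\<exists>x\<in>carrier_mat a b. (\<lambda>n::nat. mat_op_norm (s n - x)) \<longlonglongrightarrow> 0"
proof -
 define l where "l i j = lim (\<lambda>n. s n $$ (i,j))" for i j
 have l: "(\<lambda>n. s n $$ (i,j)) \<longlonglongrightarrow> l i j" if ij: "i < a" "j < b" for i j
 proof -
  have "Cauchy (\<lambda>n. s n $$ (i,j))"
  proof (rule CauchyI)
   fix e :: real assume "0 < e"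
   then obtain N where N: "\<forall>m\<ge>N. \<forall>n\<ge>N. mat_op_norm (s m - s n) < e" using cau by blast
   have "cmod (s m $$ (i,j) - s n $$ (i,j)) < e" if "m \<ge> N" "n \<ge> N" for m n
   proof -
    have 1: "cmod ((s m - s n) $$ (i,j)) \<le> mat_op_norm (s m - s n)"
     by (rule cmod_entry_le_mat_op_norm[OF minus_carrier_mat[OF s] ij])
    have 2: "(s m - s n) $$ (i,j) = s m $$ (i,j) - s n $$ (i,j)"
     using carrier_matD[OF s[of n]] ij by simp
    have 3: "mat_op_norm (s m - s n) < e" using N that by blast
    show ?thesis using order_le_less_trans[OF 1[unfolded 2] 3] .
   qed
   thus "\<exists>M. \<forall>m\<ge>M. \<forall>n\<ge>M. cmod (s m $$ (i,j) - s n $$ (i,j)) < e" by blast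
  qed
  thus ?thesis unfolding l_def by (simp add: Cauchy_convergent_iff convergent_LIMSEQ_iff)
 qed
 define x where "x = mat a b (\<lambda>(i,j). l i j)"
 have x: "x \<in> carrier_mat a b" by (simp add: x_def)
 have "(\<lambda>n. \<Sum>i<a. \<Sum>j<b. cmod (s n $$ (i,j) - l i j)) \<longlonglongrightarrow> (\<Sum>i<a. \<Sum>j<b. cmod (l i j - l i j))"
  by (intro tendsto_sum tendsto_norm tendsto_diff tendsto_const l) simp_all
 hence lim: "(\<lambda>n. \<Sum>i<a. \<Sum>j<b. cmod (s n $$ (i,j) - l i j)) \<longlonglongrightarrow> 0" by simp
 have le: "mat_op_norm (s n - x) \<le> (\<Sum>i<a. \<Sum>j<b. cmod (s n $$ (i,j) - l i j))" for n
 proof -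
  have "mat_op_norm (s n - x) \<le> (\<Sum>i<a. \<Sum>j<b. cmod ((s n - x) $$ (i,j)))"
   by (rule mat_op_norm_le_sum[OF minus_carrier_mat[OF x]])
  also have "\<dots> = (\<Sum>i<a. \<Sum>j<b. cmod (s n $$ (i,j) - l i j))"
   by (intro sum.cong refl) (simp add: x_def)
  finally show ?thesis .
 qed
 have "(\<lambda>n. mat_op_norm (s n - x)) \<longlonglongrightarrow> 0"
  by (rule null_seq_le[OF mat_op_norm_nonneg le lim])
 thus ?thesis using x by blast
qed

section \<open>C*-algebras, square roots and states\<close>

text \<open>The axiom \<open>one_not_zero\<close> is dropped so that the zero algebra is allowed as a summand.  In its place
  stands the only consequence of spectral theory that is used below: \<open>r - x\<^sup>* x\<close> has norm at most \<open>r\<close>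
  when \<open>r\<close> is at least \<open>\<parallel>x\<parallel>\<^sup>2\<close>.  It is easy for matrices and passes to sums, to limits and to quotients
  by null sequences, so no spectrum has to be defined.\<close>

locale pos_cstar =
 A?: Ring.ring A + Module.module "class_ring :: complex ring" A
 for A :: "('a, 'm) cstar_scheme" (structure) +
 assumes smult_mult_left:
   "[|x \<in> carrier A; y \<in> carrier A|] ==> (c \<odot> x) \<otimes> y = c \<odot> (x \<otimes> y)"
  and smult_mult_right:
   "[|x \<in> carrier A; y \<in> carrier A|] ==> x \<otimes> (c \<odot> y) = c \<odot> (x \<otimes> y)"
  and star_closed [intro, simp]: "x \<in> carrier A ==> star A x \<in> carrier A"
  and star_star [simp]: "x \<in> carrier A ==> star A (star A x) = x"
  and star_add:
   "[|x \<in> carrier A; y \<in> carrier A|] ==> star A (x \<oplus> y) = star A x \<oplus> star A y"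
  and star_smult: "x \<in> carrier A ==> star A (c \<odot> x) = cnj c \<odot> star A x"
  and star_mult:
   "[|x \<in> carrier A; y \<in> carrier A|] ==> star A (x \<otimes> y) = star A y \<otimes> star A x"
  and cnorm_nonneg [simp]: "x \<in> carrier A ==> 0 \<le> cnorm A x"
  and cnorm_eq_0_iff: "x \<in> carrier A ==> cnorm A x = 0 \<longleftrightarrow> x = \<zero>"
  and cnorm_triangle:
   "[|x \<in> carrier A; y \<in> carrier A|] ==> cnorm A (x \<oplus> y) \<le> cnorm A x + cnorm A y"
  and cnorm_smult: "x \<in> carrier A ==> cnorm A (c \<odot> x) = cmod c * cnorm A x"
  and cnorm_mult:
   "[|x \<in> carrier A; y \<in> carrier A|] ==> cnorm A (x \<otimes> y) \<le> cnorm A x * cnorm A y"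
  and cstar_identity: "x \<in> carrier A ==> cnorm A (star A x \<otimes> x) = (cnorm A x)\<^sup>2"
  and complete:
   "[|\<And>n. s n \<in> carrier A;
    \<And>e. 0 < e ==> \<exists>N. \<forall>m\<ge>N. \<forall>n\<ge>N. cnorm A (s m \<ominus> s n) < e|]
   ==> \<exists>x\<in>carrier A. (\<lambda>n::nat. cnorm A (s n \<ominus> x)) \<longlonglongrightarrow> 0"
  and square_positive:
   "[|x \<in> carrier A; (cnorm A x)\<^sup>2 \<le> r|]
   ==> cnorm A (cor r \<odot> \<one> \<ominus> star A x \<otimes> x) \<le> r"

lemma pos_cstar_imp_unital_cstar:
 assumes "pos_cstar A" "\<one>\<^bsub>A\<^esub> \<noteq> \<zero>\<^bsub>A\<^esub>"
 shows "unital_cstar A"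
proof -
 interpret pos_cstar A by fact
 show ?thesis
  by unfold_locales
   (use assms(2) in \<open>simp_all add: smult_mult_left smult_mult_right star_add star_smult star_mult
    cnorm_eq_0_iff cnorm_triangle cnorm_smult cnorm_mult cstar_identity complete\<close>)
qed

context pos_cstar
begin

lemma sclosed [intro, simp]: "x \<in> carrier A ==> c \<odot> x \<in> carrier A"
 by (rule smult_closed) (simp_all add: class_ring_simps)

lemma smult_one' [simp]: "x \<in> carrier A ==> (1::complex) \<odot> x = x"
 using smult_one by (simp add: class_ring_simps)

lemma smult_assoc': "x \<in> carrier A ==> (c * d) \<odot> x = c \<odot> (d \<odot> x)"
 using smult_assoc1[of c d x] by (simp add: class_ring_simps)

lemma smult_add_left: "x \<in> carrier A ==> (c + d) \<odot> x = c \<odot> x \<oplus> d \<odot> x"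
 using smult_l_distr[of c d x] by (simp add: class_ring_simps)

lemma smult_add_right: "x \<in> carrier A ==> y \<in> carrier A ==> c \<odot> (x \<oplus> y) = c \<odot> x \<oplus> c \<odot> y"
 using smult_r_distr[of c x y] by (simp add: class_ring_simps)

lemma smult_zero_left [simp]: "x \<in> carrier A ==> (0::complex) \<odot> x = \<zero>"
 using smult_l_null[of x] by (simp add: class_ring_simps)

lemma smult_zero_right [simp]: "c \<odot> \<zero> = \<zero>"
 using smult_r_null[of c] by (simp add: class_ring_simps)

lemma uminus_smult: "x \<in> carrier A ==> \<ominus> x = (- 1::complex) \<odot> x"
proof -
 assume x: "x \<in> carrier A"
 have "(-1::complex) \<odot> x \<oplus> x = \<zero>"
  using smult_add_left[OF x, of "-1" 1] x by simp
 from A.minus_equality[OF this x] show ?thesis using x by simp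
qed

lemma minus_smult: "x \<in> carrier A ==> y \<in> carrier A ==> x \<ominus> y = x \<oplus> (- 1::complex) \<odot> y"
 by (simp add: a_minus_def uminus_smult)

lemma smult_uminus: "x \<in> carrier A ==> c \<odot> (\<ominus> x) = \<ominus> (c \<odot> x)"
 by (simp add: uminus_smult flip: smult_assoc')

lemma smult_minus_right:
 "x \<in> carrier A ==> y \<in> carrier A ==> c \<odot> (x \<ominus> y) = c \<odot> x \<ominus> c \<odot> y"
 by (simp add: a_minus_def smult_add_right smult_uminus)

lemma smult_minus_left: "x \<in> carrier A ==> (c - d) \<odot> x = c \<odot> x \<ominus> d \<odot> x"
 using smult_add_left[of x c "-d"] smult_assoc'[of x "-1" d]
 by (simp add: a_minus_def uminus_smult)

lemma star_zero [simp]: "star A \<zero> = \<zero>"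
 using star_smult[of \<zero> 0] by simp

lemma star_one [simp]: "star A \<one> = \<one>"
proof -
 have "star A \<one> = star A \<one> \<otimes> star A (star A \<one>)" by simp
 also have "\<dots> = star A (star A \<one> \<otimes> \<one>)" by (rule star_mult[symmetric]) auto
 finally show ?thesis by simp
qed

lemma star_uminus: "x \<in> carrier A ==> star A (\<ominus> x) = \<ominus> star A x"
 by (simp add: uminus_smult star_smult)

lemma star_minus:
 "x \<in> carrier A ==> y \<in> carrier A ==> star A (x \<ominus> y) = star A x \<ominus> star A y"
 by (simp add: a_minus_def star_add star_uminus)

lemma cnorm_zero [simp]: "cnorm A \<zero> = 0"
 by (simp add: cnorm_eq_0_iff)

lemma cnorm_uminus [simp]: "x \<in> carrier A ==> cnorm A (\<ominus> x) = cnorm A x"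
 by (simp add: uminus_smult cnorm_smult)

lemma minus_swap: "x \<in> carrier A ==> y \<in> carrier A ==> x \<ominus> y = \<ominus> (y \<ominus> x)"
 by algebra

lemma cnorm_minus_commute:
 "x \<in> carrier A ==> y \<in> carrier A ==> cnorm A (x \<ominus> y) = cnorm A (y \<ominus> x)"
 using minus_swap[of x y] by simp

lemma cnorm_minus_le:
 "x \<in> carrier A ==> y \<in> carrier A ==> cnorm A (x \<ominus> y) \<le> cnorm A x + cnorm A y"
 using cnorm_triangle[of x "\<ominus> y"] by (simp add: a_minus_def)

lemma cnorm_dist_triangle:
 assumes "x \<in> carrier A" "y \<in> carrier A" "z \<in> carrier A"
 shows "cnorm A (x \<ominus> z) \<le> cnorm A (x \<ominus> y) + cnorm A (y \<ominus> z)"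
proof -
 have "x \<ominus> z = (x \<ominus> y) \<oplus> (y \<ominus> z)" using assms by algebra
 thus ?thesis using assms by (simp add: cnorm_triangle)
qed

lemma cnorm_le_dist:
 assumes "x \<in> carrier A" "y \<in> carrier A"
 shows "cnorm A x \<le> cnorm A (x \<ominus> y) + cnorm A y"
proof -
 have "x = (x \<ominus> y) \<oplus> y" using assms by algebra
 thus ?thesis using assms cnorm_triangle[of "x \<ominus> y" y] by simp
qed

lemma cnorm_mult_dist:
 assumes "a \<in> carrier A" "b \<in> carrier A" "c \<in> carrier A" "d \<in> carrier A"
 shows "cnorm A (a \<otimes> b \<ominus> c \<otimes> d) \<le> cnorm A a * cnorm A (b \<ominus> d) + cnorm A (a \<ominus> c) * cnorm A d"
proof -
 have "a \<otimes> b \<ominus> c \<otimes> d = a \<otimes> (b \<ominus> d) \<oplus> (a \<ominus> c) \<otimes> d" using assms by algebra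
 thus ?thesis
  using assms cnorm_triangle[of "a \<otimes> (b \<ominus> d)" "(a \<ominus> c) \<otimes> d"]
   cnorm_mult[of a "b \<ominus> d"] cnorm_mult[of "a \<ominus> c" d] by simp
qed

lemma cnorm_minus_eq_0: "x \<in> carrier A ==> y \<in> carrier A ==> cnorm A (x \<ominus> y) = 0 ==> x = y"
 by (simp add: cnorm_eq_0_iff)

lemma cnorm_star [simp]:
 assumes x: "x \<in> carrier A"
 shows "cnorm A (star A x) = cnorm A x"
proof -
 have le: "cnorm A y \<le> cnorm A (star A y)" if y: "y \<in> carrier A" for y
 proof -
  have "cnorm A y * cnorm A y \<le> cnorm A (star A y) * cnorm A y"
   using cstar_identity[OF y] cnorm_mult[of "star A y" y] y by (simp add: power2_eq_square)
  thus ?thesis using y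
   by (metis cnorm_nonneg mult_right_le_imp_le order_le_less star_closed)
 qed
 show ?thesis using le[OF x] le[of "star A x"] x by (metis star_closed star_star order_antisym)
qed

lemma cnorm_one_le: "cnorm A \<one> \<le> 1"
proof -
 have "cnorm A \<one> = (cnorm A \<one>)\<^sup>2" using cstar_identity[of \<one>] by simp
 hence "cnorm A \<one> * (cnorm A \<one> - 1) = 0" by (simp add: power2_eq_square algebra_simps)
 thus ?thesis by auto
qed

lemma limit_unique:
 assumes s: "\<And>n. s n \<in> carrier A" and x: "x \<in> carrier A" and y: "y \<in> carrier A"
  and 1: "(\<lambda>n::nat. cnorm A (s n \<ominus> x)) \<longlonglongrightarrow> 0" and 2: "(\<lambda>n. cnorm A (s n \<ominus> y)) \<longlonglongrightarrow> 0"
 shows "x = y"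
proof -
 have "(\<lambda>n. cnorm A (x \<ominus> y)) \<longlonglongrightarrow> 0"
 proof (rule null_seq_le)
  show "cnorm A (x \<ominus> y) \<le> cnorm A (s n \<ominus> x) + cnorm A (s n \<ominus> y)" for n
   using cnorm_dist_triangle[OF x s[of n] y] cnorm_minus_commute[OF x s] by simp
  show "(\<lambda>n. cnorm A (s n \<ominus> x) + cnorm A (s n \<ominus> y)) \<longlonglongrightarrow> 0" using tendsto_add[OF 1 2] by simp
 qed (use x y in simp)
 hence "cnorm A (x \<ominus> y) = 0" using LIMSEQ_unique tendsto_const by blast
 thus ?thesis using x y cnorm_minus_eq_0 by blast
qed

lemma self_adjointD: "a \<in> self_adjoint A ==> a \<in> carrier A" "a \<in> self_adjoint A ==> star A a = a"
 by (simp_all add: self_adjoint_def)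

lemma self_adjointI: "a \<in> carrier A ==> star A a = a ==> a \<in> self_adjoint A"
 by (simp add: self_adjoint_def)

lemma limit_self_adjoint:
 assumes s: "\<And>n. s n \<in> self_adjoint A" and x: "x \<in> carrier A"
  and 1: "(\<lambda>n::nat. cnorm A (s n \<ominus> x)) \<longlonglongrightarrow> 0"
 shows "x \<in> self_adjoint A"
proof -
 have sc: "s n \<in> carrier A" for n using s self_adjointD by blast
 have "cnorm A (s n \<ominus> star A x) = cnorm A (s n \<ominus> x)" for n
  using cnorm_star[of "s n \<ominus> x"] star_minus[OF sc x, of n] self_adjointD(2)[OF s] sc x by simp
 hence "star A x = x" using limit_unique[of s "star A x" x] sc x 1 by simp
 thus ?thesis using x self_adjointI by blast
qed

text \<open>The iteration for \<open>1 - sqrt (1 - x)\<close>: its fixed points \<open>y\<close> satisfy \<open>(1 - y)\<^sup>2 = 1 - x\<close>.  All iterates are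
  polynomials in \<open>x\<close> with nonnegative coefficients, hence norms and increments are dominated by those of
  the scalar iteration \<open>sqrt_bound\<close> at \<open>x = 1\<close>.\<close>

fun sqrt_iter :: "'a => nat => 'a" where
 "sqrt_iter x 0 = \<zero>"
| "sqrt_iter x (Suc n) = (1/2) \<odot> (x \<oplus> sqrt_iter x n \<otimes> sqrt_iter x n)"

end

fun sqrt_bound :: "nat => real" where
 "sqrt_bound 0 = 0"
| "sqrt_bound (Suc n) = (1 + (sqrt_bound n)\<^sup>2) / 2"

lemma sqrt_bound_bounds: "0 \<le> sqrt_bound n \<and> sqrt_bound n \<le> 1"
 by (induction n) (auto simp: power_le_one)

lemma sqrt_bound_mono: "m \<le> n ==> sqrt_bound m \<le> sqrt_bound n"
proof (rule lift_Suc_mono_le[of sqrt_bound])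
 fix n show "sqrt_bound n \<le> sqrt_bound (Suc n)"
  using zero_le_power2[of "1 - sqrt_bound n"] by (simp add: power2_eq_square algebra_simps)
qed

lemma sqrt_bound_Cauchy: "Cauchy sqrt_bound"
proof -
 have "incseq sqrt_bound" using sqrt_bound_mono by (auto simp: incseq_def)
 moreover have "\<forall>n. sqrt_bound n \<le> 1" using sqrt_bound_bounds by blast
 ultimately obtain L where "sqrt_bound \<longlonglongrightarrow> L" using incseq_convergent[of sqrt_bound 1] by blast
 thus ?thesis using LIMSEQ_imp_Cauchy by blast
qed

context pos_cstar
begin

lemma sqrt_iter_closed [simp]: "x \<in> carrier A ==> sqrt_iter x n \<in> carrier A"
 by (induction n) auto

lemma sqrt_iter_self_adjoint:
 assumes "x \<in> self_adjoint A" shows "sqrt_iter x n \<in> self_adjoint A"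
proof (induction n)
 case (Suc n)
 have "sqrt_iter x n \<in> carrier A" "x \<in> carrier A" using Suc assms self_adjointD by auto
 thus ?case
  using self_adjointD(2)[OF assms] self_adjointD(2)[OF Suc]
  by (intro self_adjointI) (auto simp: star_smult star_add star_mult)
qed (auto intro: self_adjointI)

lemma sqrt_iter_norm:
 assumes x: "x \<in> carrier A" and n1: "cnorm A x \<le> 1"
 shows "cnorm A (sqrt_iter x n) \<le> sqrt_bound n"
proof (induction n)
 case (Suc n)
 let ?y = "sqrt_iter x n"
 have y: "?y \<in> carrier A" using x by simp
 have "cnorm A (x \<oplus> ?y \<otimes> ?y) \<le> cnorm A x + cnorm A (?y \<otimes> ?y)"
  using cnorm_triangle x y by simp
 also have "\<dots> \<le> 1 + sqrt_bound n * sqrt_bound n"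
  using cnorm_mult[OF y y] n1 mult_mono[OF Suc Suc] sqrt_bound_bounds[of n] y by (smt (verit) cnorm_nonneg)
 finally show ?case using x y by (simp add: cnorm_smult power2_eq_square)
qed simp

lemma sqrt_iter_step:
 assumes x: "x \<in> carrier A" and n1: "cnorm A x \<le> 1"
 shows "cnorm A (sqrt_iter x (Suc n) \<ominus> sqrt_iter x n) \<le> sqrt_bound (Suc n) - sqrt_bound n"
proof (induction n)
 case 0
 have "(1/2) \<odot> (x \<oplus> \<zero> \<otimes> \<zero>) \<ominus> \<zero> = (1/2) \<odot> x" using x by (simp add: a_minus_def)
 thus ?case using x n1 by (simp add: cnorm_smult)
next
 case (Suc n)
 let ?y = "sqrt_iter x n" and ?z = "sqrt_iter x (Suc n)"
 have y: "?y \<in> carrier A" and z: "?z \<in> carrier A" using x by (auto simp del: sqrt_iter.simps)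
 have "(x \<oplus> ?z \<otimes> ?z) \<ominus> (x \<oplus> ?y \<otimes> ?y) = ?z \<otimes> ?z \<ominus> ?y \<otimes> ?y"
  using x y z by algebra
 hence "sqrt_iter x (Suc (Suc n)) \<ominus> ?z = (1/2) \<odot> (?z \<otimes> ?z \<ominus> ?y \<otimes> ?y)"
  using smult_minus_right[of "x \<oplus> ?z \<otimes> ?z" "x \<oplus> ?y \<otimes> ?y" "1/2"] x y z
  by (metis A.a_closed A.m_closed sqrt_iter.simps(2))
 hence half: "cnorm A (sqrt_iter x (Suc (Suc n)) \<ominus> ?z) = (1/2) * cnorm A (?z \<otimes> ?z \<ominus> ?y \<otimes> ?y)"
  using y z by (simp add: cnorm_smult del: sqrt_iter.simps)
 have "cnorm A (?z \<otimes> ?z \<ominus> ?y \<otimes> ?y) \<le>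
   cnorm A ?z * cnorm A (?z \<ominus> ?y) + cnorm A (?z \<ominus> ?y) * cnorm A ?y"
  by (rule cnorm_mult_dist[OF z z y y])
 also have "\<dots> \<le> sqrt_bound (Suc n) * (sqrt_bound (Suc n) - sqrt_bound n)
   + (sqrt_bound (Suc n) - sqrt_bound n) * sqrt_bound n"
  using sqrt_iter_norm[OF x n1, of n] sqrt_iter_norm[OF x n1, of "Suc n"] Suc
   sqrt_bound_bounds[of n] sqrt_bound_bounds[of "Suc n"] sqrt_bound_mono[of n "Suc n"] y z
  by (intro add_mono mult_mono) (auto simp del: sqrt_iter.simps sqrt_bound.simps)
 also have "\<dots> = 2 * (sqrt_bound (Suc (Suc n)) - sqrt_bound (Suc n))"
  unfolding sqrt_bound.simps(2)[of "Suc n"] by (simp add: power2_eq_square field_simps)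
 finally show ?case using half by (simp del: sqrt_iter.simps sqrt_bound.simps)
qed

lemma sqrt_iter_dist:
 assumes x: "x \<in> carrier A" and n1: "cnorm A x \<le> 1" and "m \<le> n"
 shows "cnorm A (sqrt_iter x n \<ominus> sqrt_iter x m) \<le> sqrt_bound n - sqrt_bound m"
 using \<open>m \<le> n\<close>
proof (induction n rule: dec_induct)
 case base
 thus ?case using x by (simp add: a_minus_def A.r_neg)
next
 case (step n)
 thus ?case
  using cnorm_dist_triangle[of "sqrt_iter x (Suc n)" "sqrt_iter x n" "sqrt_iter x m"]
   sqrt_iter_step[OF x n1, of n] x sqrt_iter_closed[OF x]
  by (smt (verit))
qed

lemma sqrt_one_minus:
 assumes x: "x \<in> self_adjoint A" and n1: "cnorm A x \<le> 1"
 shows "\<exists>c\<in>self_adjoint A. \<one> \<ominus> x = c \<otimes> c"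
proof -
 have xc: "x \<in> carrier A" using x self_adjointD by blast
 let ?y = "sqrt_iter x"
 have yc: "?y n \<in> carrier A" for n using xc by simp
 have "\<exists>y\<in>carrier A. (\<lambda>n. cnorm A (?y n \<ominus> y)) \<longlonglongrightarrow> 0"
 proof (rule complete[OF yc])
  fix e :: real assume "0 < e"
  then obtain N where N: "\<And>m n. m \<ge> N ==> n \<ge> N ==> \<bar>sqrt_bound m - sqrt_bound n\<bar> < e"
   using sqrt_bound_Cauchy by (metis CauchyD real_norm_def)
  have "cnorm A (?y m \<ominus> ?y n) < e" if "m \<ge> N" "n \<ge> N" for m n
  proof (cases "n \<le> m")
   case True
   thus ?thesis using sqrt_iter_dist[OF xc n1 True] N[OF that] by linarith
  next
   case False
   thus ?thesis using sqrt_iter_dist[OF xc n1, of m n] N[OF that] cnorm_minus_commute[OF yc yc, of m n]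
    by linarith
  qed
  thus "\<exists>N. \<forall>m\<ge>N. \<forall>n\<ge>N. cnorm A (?y m \<ominus> ?y n) < e" by blast
 qed
 then obtain y where y: "y \<in> carrier A" and lim: "(\<lambda>n. cnorm A (?y n \<ominus> y)) \<longlonglongrightarrow> 0" by blast
 have ysa: "y \<in> self_adjoint A"
  by (rule limit_self_adjoint[OF _ y lim]) (rule sqrt_iter_self_adjoint[OF x])
 define w where "w = (1/2) \<odot> (x \<oplus> y \<otimes> y)"
 have w: "w \<in> carrier A" using xc y by (simp add: w_def)
 have "(\<lambda>n. cnorm A (?y (Suc n) \<ominus> w)) \<longlonglongrightarrow> 0"
 proof (rule null_seq_le)
  fix n
  have "(x \<oplus> ?y n \<otimes> ?y n) \<ominus> (x \<oplus> y \<otimes> y) = ?y n \<otimes> ?y n \<ominus> y \<otimes> y"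
   using xc y yc[of n] by algebra
  hence "?y (Suc n) \<ominus> w = (1/2) \<odot> (?y n \<otimes> ?y n \<ominus> y \<otimes> y)"
   unfolding w_def using smult_minus_right[of "x \<oplus> ?y n \<otimes> ?y n" "x \<oplus> y \<otimes> y" "1/2"] xc y yc[of n] by simp
  hence "cnorm A (?y (Suc n) \<ominus> w) = (1/2) * cnorm A (?y n \<otimes> ?y n \<ominus> y \<otimes> y)"
   using y yc[of n] by (simp add: cnorm_smult)
  also have "\<dots> \<le> (1/2) * (cnorm A (?y n) * cnorm A (?y n \<ominus> y) + cnorm A (?y n \<ominus> y) * cnorm A y)"
   using cnorm_mult_dist[OF yc yc y y, of n n] by simp
  also have "\<dots> \<le> (1/2) * (1 * cnorm A (?y n \<ominus> y) + cnorm A (?y n \<ominus> y) * cnorm A y)"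
   using sqrt_iter_norm[OF xc n1, of n] sqrt_bound_bounds[of n] y yc[of n]
   by (intro mult_left_mono add_mono mult_right_mono) auto
  finally show "cnorm A (?y (Suc n) \<ominus> w) \<le> (1/2) * (1 * cnorm A (?y n \<ominus> y) + cnorm A (?y n \<ominus> y) * cnorm A y)" .
 next
  show "(\<lambda>n. (1/2) * (1 * cnorm A (?y n \<ominus> y) + cnorm A (?y n \<ominus> y) * cnorm A y)) \<longlonglongrightarrow> 0"
   using tendsto_mult_left[OF tendsto_add[OF lim tendsto_mult_right[OF lim, of "cnorm A y"]], of "1/2"]
   by simp
 qed (use w yc in \<open>simp del: sqrt_iter.simps\<close>)
 moreover have "(\<lambda>n. cnorm A (?y (Suc n) \<ominus> y)) \<longlonglongrightarrow> 0" using lim LIMSEQ_Suc by blast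
 ultimately have "w = y" using limit_unique[of "\<lambda>n. ?y (Suc n)" w y] w y yc by blast
 hence "x \<oplus> y \<otimes> y = (2::complex) \<odot> y" unfolding w_def using smult_assoc'[of "x \<oplus> y \<otimes> y" 2 "1/2"] xc y by simp
 also have "\<dots> = y \<oplus> y" using smult_add_left[of y 1 1] y by simp
 finally have e2: "x \<oplus> y \<otimes> y = y \<oplus> y" .
 have "x = (x \<oplus> y \<otimes> y) \<ominus> y \<otimes> y" using xc y by algebra
 hence eq: "x = y \<oplus> y \<ominus> y \<otimes> y" unfolding e2 .
 have "\<one> \<ominus> x = (\<one> \<ominus> y) \<otimes> (\<one> \<ominus> y)"
 proof -
  have "(\<one> \<ominus> y) \<otimes> (\<one> \<ominus> y) = \<one> \<ominus> (y \<oplus> y \<otimes> \<one> \<ominus> y \<otimes> y)" using y by algebra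
  thus ?thesis unfolding eq using y by simp
 qed
 moreover have "\<one> \<ominus> y \<in> self_adjoint A" using y ysa self_adjointD(2)[OF ysa] by (intro self_adjointI) (auto simp: star_minus)
 ultimately show ?thesis by blast
qed

text \<open>The norm condition is the substitute for positivity of \<open>h\<close>: dividing by \<open>r\<close> turns \<open>h\<close> into one minus a
  contraction.\<close>

lemma sqrt_exists:
 assumes h: "h \<in> self_adjoint A" and r: "cnorm A (cor r \<odot> \<one> \<ominus> h) \<le> r"
 shows "\<exists>c\<in>self_adjoint A. h = c \<otimes> c"
proof -
 have hc: "h \<in> carrier A" using h self_adjointD by blast
 have r0: "0 \<le> r" by (rule order_trans[OF cnorm_nonneg r]) (use hc in auto)
 show ?thesis
 proof (cases "r = 0")
  case True
  hence "cnorm A (\<zero> \<ominus> h) \<le> 0" using r hc by simp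
  hence "cnorm A (\<zero> \<ominus> h) = 0" by (rule order_antisym) (use hc in simp)
  hence "h = \<zero>" using hc cnorm_minus_eq_0[of \<zero> h] by simp
  thus ?thesis by (intro bexI[of _ \<zero>]) (auto intro: self_adjointI)
 next
  case False
  hence r0: "0 < r" using r0 by simp
  define x where "x = cor (1/r) \<odot> (cor r \<odot> \<one> \<ominus> h)"
  have xe: "x = \<one> \<ominus> cor (1/r) \<odot> h"
   unfolding x_def using hc r0 smult_assoc'[of \<one> "cor (1/r)" "cor r"]
   by (simp add: smult_minus_right)
  have "x \<in> self_adjoint A" unfolding xe using h hc self_adjointD(2)[OF h]
   by (intro self_adjointI) (auto simp: star_minus star_smult)
  moreover have "cnorm A x \<le> 1" unfolding x_def using r r0 hc by (simp add: cnorm_smult norm_divide)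
  ultimately obtain c where c: "c \<in> self_adjoint A" "\<one> \<ominus> x = c \<otimes> c" using sqrt_one_minus by blast
  have cc: "c \<in> carrier A" using c self_adjointD by blast
  have e: "\<one> \<ominus> x = cor (1/r) \<odot> h"
  proof -
   have "cor (1/r) \<odot> h \<in> carrier A" using hc by simp
   thus ?thesis unfolding xe by algebra
  qed
  have "h = cor r \<odot> (c \<otimes> c)"
   using hc r0 smult_assoc'[OF hc, of "cor r" "cor (1/r)"] unfolding c(2)[symmetric] e by simp
  also have "\<dots> = (cor (sqrt r) \<odot> c) \<otimes> (cor (sqrt r) \<odot> c)"
   using cc r0 by (simp add: smult_mult_left smult_mult_right flip: smult_assoc' of_real_mult)
  finally show ?thesis using c cc self_adjointD(2)[OF c(1)]
   by (intro bexI[of _ "cor (sqrt r) \<odot> c"] self_adjointI) (auto simp: star_smult)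
 qed
qed

lemma states_D:
 assumes "\<phi> \<in> states A"
 shows "a \<in> carrier A ==> b \<in> carrier A ==> \<phi> (a \<oplus> b) = \<phi> a + \<phi> b"
  "a \<in> carrier A ==> \<phi> (c \<odot> a) = c * \<phi> a"
  "a \<in> carrier A ==> 0 \<le> \<phi> (star A a \<otimes> a)"
  "\<phi> \<one> = 1" "\<phi> \<in> extensional (carrier A)"
 using assms by (auto simp: states_def linear_functional_def)

lemma states_minus:
 assumes "\<phi> \<in> states A" "a \<in> carrier A" "b \<in> carrier A"
 shows "\<phi> (a \<ominus> b) = \<phi> a - \<phi> b"
 using assms states_D(1)[OF assms(1), of a "\<ominus> b"] states_D(2)[OF assms(1), of b "-1"]
 by (simp add: a_minus_def uminus_smult)

lemma states_positive:
 assumes "\<phi> \<in> states A" "h \<in> self_adjoint A" "cnorm A (cor r \<odot> \<one> \<ominus> h) \<le> r"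
 shows "0 \<le> \<phi> h"
 using sqrt_exists[OF assms(2,3)] states_D(3)[OF assms(1)] self_adjointD by metis

text \<open>Both \<open>\<parallel>a\<parallel> 1 + a\<close> and \<open>\<parallel>a\<parallel> 1 - a\<close> are squares, so a state is nonnegative on them.\<close>

lemma states_self_adjoint_bound:
 assumes \<phi>: "\<phi> \<in> states A" and a: "a \<in> self_adjoint A"
 shows "Im (\<phi> a) = 0" "cmod (\<phi> a) \<le> cnorm A a"
proof -
 let ?r = "cnorm A a"
 have ac: "a \<in> carrier A" using a self_adjointD by blast
 let ?R = "cor ?r \<odot> \<one>"
 have R: "?R \<in> self_adjoint A" "?R \<in> carrier A" by (auto intro!: self_adjointI simp: star_smult)
 have p: "0 \<le> \<phi> (?R \<oplus> a)"
 proof (rule states_positive[OF \<phi>])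
  show "?R \<oplus> a \<in> self_adjoint A" using R ac self_adjointD(2)[OF a] self_adjointD(2)[OF R(1)]
   by (intro self_adjointI) (auto simp: star_add)
  have "?R \<ominus> (?R \<oplus> a) = \<ominus> a" using R(2) ac by algebra
  thus "cnorm A (?R \<ominus> (?R \<oplus> a)) \<le> ?r" using ac by simp
 qed
 have m: "0 \<le> \<phi> (?R \<ominus> a)"
 proof (rule states_positive[OF \<phi>])
  show "?R \<ominus> a \<in> self_adjoint A" using R ac self_adjointD(2)[OF a] self_adjointD(2)[OF R(1)]
   by (intro self_adjointI) (auto simp: star_minus)
  have "?R \<ominus> (?R \<ominus> a) = a" using R(2) ac by algebra
  thus "cnorm A (?R \<ominus> (?R \<ominus> a)) \<le> ?r" using ac by simp
 qed
 have fR: "\<phi> ?R = cor ?r" using states_D(2,4)[OF \<phi>] by simp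
 have p': "0 \<le> cor ?r + \<phi> a" using p states_D(1)[OF \<phi> R(2) ac] fR by simp
 have m': "0 \<le> cor ?r - \<phi> a" using m states_minus[OF \<phi> R(2) ac] fR by simp
 show im: "Im (\<phi> a) = 0" using p' by (simp add: less_eq_complex_def)
 have "\<bar>Re (\<phi> a)\<bar> \<le> ?r" using p' m' unfolding less_eq_complex_def abs_le_iff by auto
 thus "cmod (\<phi> a) \<le> ?r" using im by (simp add: cmod_eq_Re)
qed

definition re_part :: "'a => 'a" where "re_part a = (1/2) \<odot> (a \<oplus> star A a)"
definition im_part :: "'a => 'a" where "im_part a = (1/(2*\<i>)) \<odot> (a \<ominus> star A a)"

lemma re_im_part:
 assumes a: "a \<in> carrier A"
 shows "re_part a \<in> self_adjoint A" "im_part a \<in> self_adjoint A"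
  "a = re_part a \<oplus> \<i> \<odot> im_part a"
  "cnorm A (re_part a) \<le> cnorm A a" "cnorm A (im_part a) \<le> cnorm A a"
proof -
 have s: "star A a \<in> carrier A" using a by simp
 show "re_part a \<in> self_adjoint A" unfolding re_part_def
  using a by (intro self_adjointI) (auto simp: star_smult star_add A.a_comm)
 have "(- (1 / (2 * \<i>))) \<odot> (star A a \<ominus> a) = (1 / (2 * \<i>)) \<odot> (a \<ominus> star A a)"
  using smult_assoc'[of "star A a \<ominus> a" "1/(2*\<i>)" "-1"] uminus_smult[of "star A a \<ominus> a"] minus_swap[of a "star A a"] a by simp
 thus "im_part a \<in> self_adjoint A" unfolding im_part_def
  using a by (intro self_adjointI) (auto simp: star_smult star_minus)
 have "\<i> \<odot> im_part a = (1/2) \<odot> (a \<ominus> star A a)"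
  unfolding im_part_def using a smult_assoc'[of "a \<ominus> star A a" \<i> "1/(2*\<i>)"] by simp
 hence "re_part a \<oplus> \<i> \<odot> im_part a = (1/2) \<odot> ((a \<oplus> star A a) \<oplus> (a \<ominus> star A a))"
  unfolding re_part_def using a by (simp add: smult_add_right)
 also have "(a \<oplus> star A a) \<oplus> (a \<ominus> star A a) = a \<oplus> a" using a s by algebra
 also have "a \<oplus> a = (2::complex) \<odot> a" using smult_add_left[of a 1 1] a by simp
 also have "(1/2) \<odot> ((2::complex) \<odot> a) = a" using smult_assoc'[OF a, of "1/2" 2] a by simp
 finally show "a = re_part a \<oplus> \<i> \<odot> im_part a" by simp
 show "cnorm A (re_part a) \<le> cnorm A a"
  unfolding re_part_def using a cnorm_triangle[OF a s] by (simp add: cnorm_smult)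
 show "cnorm A (im_part a) \<le> cnorm A a"
  unfolding im_part_def using a cnorm_minus_le[OF a s] by (simp add: cnorm_smult norm_divide norm_mult)
qed

lemma states_bound:
 assumes \<phi>: "\<phi> \<in> states A" and a: "a \<in> carrier A"
 shows "cmod (\<phi> a) \<le> 2 * cnorm A a"
proof -
 note r = re_im_part[OF a]
 have c: "re_part a \<in> carrier A" "im_part a \<in> carrier A" using r self_adjointD by blast+
 have "\<phi> a = \<phi> (re_part a) + \<i> * \<phi> (im_part a)"
  using states_D(1)[OF \<phi> c(1), of "\<i> \<odot> im_part a"] states_D(2)[OF \<phi> c(2), of \<i>] c r(3) by simp
 hence "cmod (\<phi> a) \<le> cmod (\<phi> (re_part a)) + cmod (\<phi> (im_part a))"
  by (metis norm_triangle_ineq norm_mult norm_ii mult_1)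
 also have "\<dots> \<le> cnorm A a + cnorm A a"
  using states_self_adjoint_bound(2)[OF \<phi>] r by (meson add_mono order_trans)
 finally show ?thesis by simp
qed

end

lemma cring_class_ring_complex: "cring (class_ring :: complex ring)"
proof -
 interpret Ring.field "class_ring :: complex ring" by (rule class_field)
 show ?thesis ..
qed

text \<open>Differences are written with the scalar \<open>-1\<close>, because additive inverses of carrier based structures
  are defined by choice and are awkward to compute before the group laws are known.\<close>

lemma pos_cstarI:
 fixes A (structure)
 assumes closed: "\<And>x y. x \<in> carrier A ==> y \<in> carrier A ==> x \<oplus> y \<in> carrier A"
   "\<zero> \<in> carrier A"
   "\<And>x y. x \<in> carrier A ==> y \<in> carrier A ==> x \<otimes> y \<in> carrier A" "\<one> \<in> carrier A"
   "\<And>x c. x \<in> carrier A ==> c \<odot> x \<in> carrier A" "\<And>x. x \<in> carrier A ==> star A x \<in> carrier A"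
  and add: "\<And>x y z. x \<in> carrier A ==> y \<in> carrier A ==> z \<in> carrier A ==> (x \<oplus> y) \<oplus> z = x \<oplus> (y \<oplus> z)"
   "\<And>x y. x \<in> carrier A ==> y \<in> carrier A ==> x \<oplus> y = y \<oplus> x"
   "\<And>x. x \<in> carrier A ==> \<zero> \<oplus> x = x"
   "\<And>x. x \<in> carrier A ==> (-1) \<odot> x \<oplus> x = \<zero>"
  and mult: "\<And>x y z. x \<in> carrier A ==> y \<in> carrier A ==> z \<in> carrier A ==> (x \<otimes> y) \<otimes> z = x \<otimes> (y \<otimes> z)"
   "\<And>x. x \<in> carrier A ==> \<one> \<otimes> x = x" "\<And>x. x \<in> carrier A ==> x \<otimes> \<one> = x"
  and distr: "\<And>x y z. x \<in> carrier A ==> y \<in> carrier A ==> z \<in> carrier A ==> (x \<oplus> y) \<otimes> z = x \<otimes> z \<oplus> y \<otimes> z"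
   "\<And>x y z. x \<in> carrier A ==> y \<in> carrier A ==> z \<in> carrier A ==> z \<otimes> (x \<oplus> y) = z \<otimes> x \<oplus> z \<otimes> y"
  and smult: "\<And>x (c::complex) d. x \<in> carrier A ==> (c + d) \<odot> x = c \<odot> x \<oplus> d \<odot> x"
   "\<And>x y c. x \<in> carrier A ==> y \<in> carrier A ==> c \<odot> (x \<oplus> y) = c \<odot> x \<oplus> c \<odot> y"
   "\<And>x c d. x \<in> carrier A ==> (c * d) \<odot> x = c \<odot> (d \<odot> x)"
   "\<And>x. x \<in> carrier A ==> 1 \<odot> x = x"
   "\<And>x y c. x \<in> carrier A ==> y \<in> carrier A ==> (c \<odot> x) \<otimes> y = c \<odot> (x \<otimes> y)"
   "\<And>x y c. x \<in> carrier A ==> y \<in> carrier A ==> x \<otimes> (c \<odot> y) = c \<odot> (x \<otimes> y)"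
  and star: "\<And>x. x \<in> carrier A ==> star A (star A x) = x"
   "\<And>x y. x \<in> carrier A ==> y \<in> carrier A ==> star A (x \<oplus> y) = star A x \<oplus> star A y"
   "\<And>x c. x \<in> carrier A ==> star A (c \<odot> x) = cnj c \<odot> star A x"
   "\<And>x y. x \<in> carrier A ==> y \<in> carrier A ==> star A (x \<otimes> y) = star A y \<otimes> star A x"
  and norm: "\<And>x. x \<in> carrier A ==> 0 \<le> cnorm A x"
   "\<And>x. x \<in> carrier A ==> cnorm A x = 0 \<longleftrightarrow> x = \<zero>"
   "\<And>x y. x \<in> carrier A ==> y \<in> carrier A ==> cnorm A (x \<oplus> y) \<le> cnorm A x + cnorm A y"
   "\<And>x c. x \<in> carrier A ==> cnorm A (c \<odot> x) = cmod c * cnorm A x"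
   "\<And>x y. x \<in> carrier A ==> y \<in> carrier A ==> cnorm A (x \<otimes> y) \<le> cnorm A x * cnorm A y"
   "\<And>x. x \<in> carrier A ==> cnorm A (star A x \<otimes> x) = (cnorm A x)\<^sup>2"
  and compl: "\<And>s. (\<And>n. s n \<in> carrier A) ==>
    (\<And>e. 0 < e ==> \<exists>N. \<forall>m\<ge>N. \<forall>n\<ge>N. cnorm A (s m \<oplus> (-1) \<odot> s n) < e)
   ==> \<exists>x\<in>carrier A. (\<lambda>n::nat. cnorm A (s n \<oplus> (-1) \<odot> x)) \<longlonglongrightarrow> 0"
  and pos: "\<And>x r. x \<in> carrier A ==> (cnorm A x)\<^sup>2 \<le> r
   ==> cnorm A (cor r \<odot> \<one> \<oplus> (-1) \<odot> (star A x \<otimes> x)) \<le> r"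
 shows "pos_cstar A"
proof -
 have ag: "abelian_group A"
 proof (rule abelian_groupI)
  fix x assume x: "x \<in> carrier A"
  show "\<exists>y\<in>carrier A. y \<oplus> x = \<zero>" using add(4)[OF x] closed(5)[OF x] by blast
 qed (use closed add in auto)
 have mo: "monoid A" by (rule monoidI) (use closed mult in auto)
 have ri: "Ring.ring A" by (rule ringI[OF ag mo]) (use distr in auto)
 have md: "Module.module (class_ring :: complex ring) A"
  by (rule Module.moduleI[OF cring_class_ring_complex ag]) (use closed smult in \<open>auto simp: class_ring_simps\<close>)
 interpret A: Ring.ring A by (rule ri)
 have um: "\<ominus> x = (-1) \<odot> x" if "x \<in> carrier A" for x
  using A.minus_equality[OF add(4) that] that closed by simp
 have mi: "x \<ominus> y = x \<oplus> (-1) \<odot> y" if "y \<in> carrier A" for x y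
  using um[OF that] by (simp add: a_minus_def)
 show ?thesis
  unfolding pos_cstar_def
 proof (intro conjI ri md pos_cstar_axioms.intro)
  fix s :: "nat => _" assume s: "\<And>n. s n \<in> carrier A"
   and "\<And>e. 0 < e ==> \<exists>N. \<forall>m\<ge>N. \<forall>n\<ge>N. cnorm A (s m \<ominus> s n) < e"
  hence "\<exists>x\<in>carrier A. (\<lambda>n::nat. cnorm A (s n \<oplus> (-1) \<odot> x)) \<longlonglongrightarrow> 0"
   using mi by (intro compl) auto
  thus "\<exists>x\<in>carrier A. (\<lambda>n::nat. cnorm A (s n \<ominus> x)) \<longlonglongrightarrow> 0"
   using mi by simp
 qed (use closed smult star norm pos mi in auto)
qed

section \<open>Matrix algebras\<close>

lemma mat_cstar_simps [simp]:
 "carrier (mat_cstar d) = sqm d" "mult (mat_cstar d) = (*)" "one (mat_cstar d) = 1\<^sub>m d"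
 "zero (mat_cstar d) = 0\<^sub>m d d" "add (mat_cstar d) = (+)" "smult (mat_cstar d) = (\<cdot>\<^sub>m)"
 "star (mat_cstar d) = mat_adjoint" "cnorm (mat_cstar d) = mat_op_norm"
 by (simp_all add: mat_cstar_def)

lemma mat_minus_eq: "A \<in> carrier_mat m n ==> B \<in> carrier_mat m n ==> A + (- 1 :: complex) \<cdot>\<^sub>m B = A - B"
 by (rule eq_matI) auto

lemma smult_smult_mat: "c \<cdot>\<^sub>m (d \<cdot>\<^sub>m A) = (c * d) \<cdot>\<^sub>m (A :: complex mat)"
 by (rule eq_matI) auto

lemma pos_cstar_mat: "pos_cstar (mat_cstar d)"
proof (rule pos_cstarI; simp?)
 fix s :: "nat => complex mat"
 assume s: "\<And>n. s n \<in> sqm d"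
  and "\<And>e. 0 < e ==> \<exists>N. \<forall>m\<ge>N. \<forall>n\<ge>N. mat_op_norm (s m + - 1 \<cdot>\<^sub>m s n) < e"
 hence "\<And>e. 0 < e ==> \<exists>N. \<forall>m\<ge>N. \<forall>n\<ge>N. mat_op_norm (s m - s n) < e"
  by (simp add: mat_minus_eq[OF s s])
 from mat_op_norm_complete[OF s this]
 show "\<exists>x\<in>sqm d. (\<lambda>n. mat_op_norm (s n + - 1 \<cdot>\<^sub>m x)) \<longlonglongrightarrow> 0"
  by (simp add: mat_minus_eq[OF s])
next
 fix x :: "complex mat" and r :: real
 assume x: "x \<in> sqm d" and "(mat_op_norm x)\<^sup>2 \<le> r"
 moreover have "mat_adjoint x * x \<in> sqm d" using x by (intro mult_carrier_mat[of _ d d]) auto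
 ultimately show "mat_op_norm (cor r \<cdot>\<^sub>m 1\<^sub>m d + - 1 \<cdot>\<^sub>m (mat_adjoint x * x)) \<le> r"
  using mat_op_norm_compl_le[OF x, of r] mat_minus_eq[of "cor r \<cdot>\<^sub>m 1\<^sub>m d" d d "mat_adjoint x * x"] x by auto
qed (auto simp: mat_op_norm_nonneg mat_op_norm_eq_0 mat_op_norm_triangle mat_op_norm_smult mat_op_norm_mult
  mat_op_norm_cstar mat_adjoint_add mat_adjoint_smult mat_adjoint_mult comm_add_mat
  add_mult_distrib_mat mult_add_distrib_mat add_smult_distrib_left_mat add_smult_distrib_right_mat
  smult_smult_mat mult_smult_distrib intro!: eq_matI[of _ "0\<^sub>m d d"])

section \<open>Direct sums\<close>

lemma cstar_sum_simps [simp]: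
 "carrier (cstar_sum A B) = carrier A \<times> carrier B"
 "mult (cstar_sum A B) (a,b) (a',b') = (a \<otimes>\<^bsub>A\<^esub> a', b \<otimes>\<^bsub>B\<^esub> b')"
 "one (cstar_sum A B) = (\<one>\<^bsub>A\<^esub>, \<one>\<^bsub>B\<^esub>)"
 "zero (cstar_sum A B) = (\<zero>\<^bsub>A\<^esub>, \<zero>\<^bsub>B\<^esub>)"
 "add (cstar_sum A B) (a,b) (a',b') = (a \<oplus>\<^bsub>A\<^esub> a', b \<oplus>\<^bsub>B\<^esub> b')"
 "smult (cstar_sum A B) c (a,b) = (c \<odot>\<^bsub>A\<^esub> a, c \<odot>\<^bsub>B\<^esub> b)"
 "star (cstar_sum A B) (a,b) = (star A a, star B b)"
 "cnorm (cstar_sum A B) (a,b) = max (cnorm A a) (cnorm B b)"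
 by (simp_all add: cstar_sum_def)

lemma pos_cstar_sum:
 assumes "pos_cstar A" "pos_cstar B"
 shows "pos_cstar (cstar_sum A B)"
proof -
 interpret A: pos_cstar A by fact
 interpret B: pos_cstar B by fact
 show ?thesis
 proof (rule pos_cstarI; (clarsimp simp: A.a_ac B.a_ac A.m_assoc B.m_assoc A.l_distr B.l_distr A.r_distr B.r_distr
   A.smult_add_left B.smult_add_left A.smult_add_right B.smult_add_right A.smult_assoc' B.smult_assoc'
   A.smult_mult_left B.smult_mult_left A.smult_mult_right B.smult_mult_right
   A.star_add B.star_add A.star_smult B.star_smult A.star_mult B.star_mult
   A.uminus_smult[symmetric] B.uminus_smult[symmetric] A.l_neg B.l_neg A.r_neg B.r_neg
   A.minus_eq[symmetric] B.minus_eq[symmetric])?)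
  fix a b assume "a \<in> carrier A" "b \<in> carrier B"
  thus "(max (cnorm A a) (cnorm B b) = 0) = (a = \<zero>\<^bsub>A\<^esub> \<and> b = \<zero>\<^bsub>B\<^esub>)"
   by (smt (verit) A.cnorm_nonneg B.cnorm_nonneg A.cnorm_eq_0_iff B.cnorm_eq_0_iff)
 next
  fix a b and c :: complex assume ab: "a \<in> carrier A" "b \<in> carrier B"
  thus "max (cnorm A (c \<odot>\<^bsub>A\<^esub> a)) (cnorm B (c \<odot>\<^bsub>B\<^esub> b)) = cmod c * max (cnorm A a) (cnorm B b)"
   by (simp add: A.cnorm_smult B.cnorm_smult max_mult_distrib_left)
 next
  fix a b assume ab: "a \<in> carrier A" "b \<in> carrier B"
  thus "max (cnorm A (star A a \<otimes>\<^bsub>A\<^esub> a)) (cnorm B (star B b \<otimes>\<^bsub>B\<^esub> b)) = (max (cnorm A a) (cnorm B b))\<^sup>2"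
   using power_mono[of "cnorm A a" "cnorm B b" 2] power_mono[of "cnorm B b" "cnorm A a" 2]
   by (auto simp: A.cstar_identity B.cstar_identity max_def)
 next
  fix a b assume "a \<in> carrier A" "b \<in> carrier B"
  thus "0 \<le> max (cnorm A a) (cnorm B b)" by (simp add: le_max_iff_disj)
 next
  fix a a' b b' assume "a \<in> carrier A" "b \<in> carrier B" "a' \<in> carrier A" "b' \<in> carrier B"
  thus "cnorm A (a \<oplus>\<^bsub>A\<^esub> a') \<le> max (cnorm A a) (cnorm B b) + max (cnorm A a') (cnorm B b') \<and>
   cnorm B (b \<oplus>\<^bsub>B\<^esub> b') \<le> max (cnorm A a) (cnorm B b) + max (cnorm A a') (cnorm B b')"
   using A.cnorm_triangle[of a a'] B.cnorm_triangle[of b b'] by auto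
 next
  fix a a' b b' assume ab: "a \<in> carrier A" "b \<in> carrier B" "a' \<in> carrier A" "b' \<in> carrier B"
  have "cnorm A a * cnorm A a' \<le> max (cnorm A a) (cnorm B b) * max (cnorm A a') (cnorm B b')"
   by (rule mult_mono) (use ab in \<open>auto simp: le_max_iff_disj\<close>)
  moreover have "cnorm B b * cnorm B b' \<le> max (cnorm A a) (cnorm B b) * max (cnorm A a') (cnorm B b')"
   by (rule mult_mono) (use ab in \<open>auto simp: le_max_iff_disj\<close>)
  ultimately show "cnorm A (a \<otimes>\<^bsub>A\<^esub> a') \<le> max (cnorm A a) (cnorm B b) * max (cnorm A a') (cnorm B b') \<and>
   cnorm B (b \<otimes>\<^bsub>B\<^esub> b') \<le> max (cnorm A a) (cnorm B b) * max (cnorm A a') (cnorm B b')"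
   using A.cnorm_mult[of a a'] B.cnorm_mult[of b b'] ab by auto
 next
  fix s :: "nat => 'a \<times> 'b"
  assume s: "\<And>n. s n \<in> carrier A \<times> carrier B"
   and cau: "\<And>e. 0 < e ==> \<exists>N. \<forall>m\<ge>N. \<forall>n\<ge>N. cnorm (cstar_sum A B) (s m \<oplus>\<^bsub>cstar_sum A B\<^esub> (- 1) \<odot>\<^bsub>cstar_sum A B\<^esub> s n) < e"
  have s1: "fst (s n) \<in> carrier A" "snd (s n) \<in> carrier B" for n using s[of n] by (auto simp: mem_Times_iff)
  have eq: "cnorm (cstar_sum A B) (s m \<oplus>\<^bsub>cstar_sum A B\<^esub> (- 1) \<odot>\<^bsub>cstar_sum A B\<^esub> z)
   = max (cdist A (fst (s m)) (fst z)) (cdist B (snd (s m)) (snd z))"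
   if "fst z \<in> carrier A" "snd z \<in> carrier B" for m z
   using s1[of m] that by (cases "s m"; cases z) (simp add: A.minus_smult B.minus_smult)
  have c: "\<exists>N. \<forall>m\<ge>N. \<forall>n\<ge>N. max (cdist A (fst (s m)) (fst (s n))) (cdist B (snd (s m)) (snd (s n))) < e"
   if "0 < e" for e
   using cau[OF that] by (simp only: eq[OF s1])
  have "\<exists>x\<in>carrier A. (\<lambda>n. cdist A (fst (s n)) x) \<longlonglongrightarrow> 0"
   by (rule A.complete[OF s1(1)]) (use c in \<open>force simp: max_less_iff_conj\<close>)
  then obtain x where x: "x \<in> carrier A" "(\<lambda>n. cdist A (fst (s n)) x) \<longlonglongrightarrow> 0" by blast
  have "\<exists>x\<in>carrier B. (\<lambda>n. cdist B (snd (s n)) x) \<longlonglongrightarrow> 0"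
   by (rule B.complete[OF s1(2)]) (use c in \<open>force simp: max_less_iff_conj\<close>)
  then obtain y where y: "y \<in> carrier B" "(\<lambda>n. cdist B (snd (s n)) y) \<longlonglongrightarrow> 0" by blast
  have "(\<lambda>n. max (cdist A (fst (s n)) x) (cdist B (snd (s n)) y)) \<longlonglongrightarrow> 0"
   using tendsto_max[OF x(2) y(2)] by simp
  thus "\<exists>x\<in>carrier A. \<exists>y\<in>carrier B. (\<lambda>n. cnorm (cstar_sum A B) (s n \<oplus>\<^bsub>cstar_sum A B\<^esub> (\<ominus>\<^bsub>A\<^esub> x, \<ominus>\<^bsub>B\<^esub> y))) \<longlonglongrightarrow> 0"
   using eq[of "(x,y)"] x(1) y(1) by (intro bexI[of _ x] bexI[of _ y]) (auto simp: A.uminus_smult B.uminus_smult)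
 next
  fix a b and r :: real
  assume ab: "a \<in> carrier A" "b \<in> carrier B" and "(max (cnorm A a) (cnorm B b))\<^sup>2 \<le> r"
  hence "(cnorm A a)\<^sup>2 \<le> r" "(cnorm B b)\<^sup>2 \<le> r"
   using power_mono[of "cnorm A a" "max (cnorm A a) (cnorm B b)" 2] power_mono[of "cnorm B b" "max (cnorm A a) (cnorm B b)" 2] by auto
  thus "cdist A (cor r \<odot>\<^bsub>A\<^esub> \<one>\<^bsub>A\<^esub>) (star A a \<otimes>\<^bsub>A\<^esub> a) \<le> r \<and>
   cdist B (cor r \<odot>\<^bsub>B\<^esub> \<one>\<^bsub>B\<^esub>) (star B b \<otimes>\<^bsub>B\<^esub> b) \<le> r"
   using A.square_positive[of a r] B.square_positive[of b r] ab by blast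
 qed
qed

lemma le_of_eps_limit:
 fixes z l :: real and f :: "real => real"
 assumes "\<And>e. 0 < e ==> z \<le> f e" "(f \<longlongrightarrow> l) (at_right 0)"
 shows "z \<le> l"
proof (rule tendsto_lowerbound[OF assms(2)])
 show "\<forall>\<^sub>F e in at_right 0. z \<le> f e"
  by (rule eventually_mono[OF eventually_at_right_less[of "0::real"]]) (rule assms(1))
qed simp

section \<open>Sequences modulo null sequences\<close>

definition null_rel :: "(nat => 'a cstar) => (nat => 'a) set => ((nat => 'a) \<times> (nat => 'a)) set" where
 "null_rel A T = {(x, y). x \<in> T \<and> y \<in> T \<and> (\<lambda>n. cdist (A n) (x n) (y n)) \<longlonglongrightarrow> 0}"

text \<open>The operations of an inductive limit do not involve the connecting maps: they are those of an
  algebra \<open>T\<close> of sequences modulo null sequences.  The norm is a parameter, since the same construction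
  is used for the inductive limit, where norms converge, and for all bounded sequences.\<close>

definition seq_quot ::
  "(nat => 'a cstar) => (nat => 'a) set => ((nat => 'a) set => real) => (nat => 'a) set cstar" where
 "seq_quot A T N = (let R = null_rel A T in \<lparr>
  carrier = T // R,
  mult = (\<lambda>X Y. \<Union>x\<in>X. \<Union>y\<in>Y. R `` {\<lambda>n. x n \<otimes>\<^bsub>A n\<^esub> y n}),
  one = R `` {\<lambda>n. \<one>\<^bsub>A n\<^esub>},
  zero = R `` {\<lambda>n. \<zero>\<^bsub>A n\<^esub>},
  add = (\<lambda>X Y. \<Union>x\<in>X. \<Union>y\<in>Y. R `` {\<lambda>n. x n \<oplus>\<^bsub>A n\<^esub> y n}),
  smult = (\<lambda>c X. \<Union>x\<in>X. R `` {\<lambda>n. c \<odot>\<^bsub>A n\<^esub> x n}),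
  star = (\<lambda>X. \<Union>x\<in>X. R `` {\<lambda>n. star (A n) (x n)}),
  cnorm = N\<rparr>)"

definition seq_norm :: "(nat => 'a cstar) => (nat => 'a) => real" where
 "seq_norm A x = Inf {c. 0 \<le> c \<and> (\<forall>\<^sub>F n in sequentially. cnorm (A n) (x n) \<le> c)}"

text \<open>\<open>T_closed\<close> says that \<open>T\<close> is closed for the seminorm \<open>seq_norm\<close>, which is the limit superior of the norms;
  it gives completeness of the quotient.\<close>

locale seq_algebra =
 fixes A :: "nat => 'a cstar" and T :: "(nat => 'a) set" and N :: "(nat => 'a) set => real"
 assumes A: "pos_cstar (A n)"
  and T_carrier [simp]: "x \<in> T ==> x n \<in> carrier (A n)"
  and T_bounded: "x \<in> T ==> \<exists>C. \<forall>n. cnorm (A n) (x n) \<le> C"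
  and T_one [simp]: "(\<lambda>n. \<one>\<^bsub>A n\<^esub>) \<in> T"
  and T_add [simp]: "x \<in> T ==> y \<in> T ==> (\<lambda>n. x n \<oplus>\<^bsub>A n\<^esub> y n) \<in> T"
  and T_mult [simp]: "x \<in> T ==> y \<in> T ==> (\<lambda>n. x n \<otimes>\<^bsub>A n\<^esub> y n) \<in> T"
  and T_smult [simp]: "x \<in> T ==> (\<lambda>n. c \<odot>\<^bsub>A n\<^esub> x n) \<in> T"
  and T_star [simp]: "x \<in> T ==> (\<lambda>n. star (A n) (x n)) \<in> T"
  and T_closed: "(\<And>n. x n \<in> carrier (A n)) ==>
   (\<And>e. 0 < e ==> \<exists>y\<in>T. \<forall>\<^sub>F n in sequentially. cdist (A n) (x n) (y n) \<le> e) ==> x \<in> T"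
  and N: "x \<in> T ==> N (null_rel A T `` {x}) = seq_norm A x"
begin

abbreviation Q where "Q \<equiv> seq_quot A T N"
abbreviation R where "R \<equiv> null_rel A T"
definition cls where "cls x = R `` {x}"

abbreviation bounds where
 "bounds x \<equiv> {c. 0 \<le> c \<and> (\<forall>\<^sub>F n in sequentially. cnorm (A n) (x n) \<le> c)}"

lemma bounds_nonempty:
 assumes "x \<in> T" shows "bounds x \<noteq> {}"
proof -
 obtain C where C: "\<forall>n. cnorm (A n) (x n) \<le> C" using T_bounded[OF assms(1)] by blast
 have "cnorm (A n) (x n) \<le> max C 0" for n using C by (simp add: le_max_iff_disj)
 hence "max C 0 \<in> bounds x" by simp
 thus ?thesis by blast
qed

lemma eventually_norm_le:
 assumes "x \<in> T" "seq_norm A x < c"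
 shows "\<forall>\<^sub>F n in sequentially. cnorm (A n) (x n) \<le> c"
proof -
 obtain d where d: "d \<in> bounds x" "d < c"
  using cInf_lessD[OF bounds_nonempty[OF assms(1)] assms(2)[unfolded seq_norm_def]] by blast
 hence "\<forall>\<^sub>F n in sequentially. cnorm (A n) (x n) \<le> d" by simp
 thus ?thesis by (rule eventually_mono) (use d(2) in simp)
qed

lemma seq_norm_le:
 assumes "0 \<le> c" "\<forall>\<^sub>F n in sequentially. cnorm (A n) (x n) \<le> c"
 shows "seq_norm A x \<le> c"
 unfolding seq_norm_def
proof (rule cInf_lower)
 show "bdd_below (bounds x)" by (rule bdd_belowI[of _ 0]) simp
qed (use assms in simp)

lemma seq_norm_nonneg:
 assumes "x \<in> T" shows "0 \<le> seq_norm A x"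
 unfolding seq_norm_def by (rule cInf_greatest[OF bounds_nonempty[OF assms]]) simp

lemma seq_norm_eps:
 assumes "x \<in> T" "0 < e"
 shows "\<forall>\<^sub>F n in sequentially. cnorm (A n) (x n) \<le> seq_norm A x + e"
 using eventually_norm_le[OF assms(1)] assms(2) by simp

lemma seq_norm_unique:
 assumes x: "x \<in> T" and lim: "(\<lambda>n. cnorm (A n) (x n)) \<longlonglongrightarrow> l"
 shows "seq_norm A x = l"
proof (rule antisym)
 have l0: "0 \<le> l" by (rule LIMSEQ_le_const[OF lim]) (use pos_cstar.cnorm_nonneg[OF A] x in auto)
 show "seq_norm A x \<le> l"
 proof (rule field_le_epsilon)
  fix e :: real assume "0 < e"
  hence "\<forall>\<^sub>F n in sequentially. cnorm (A n) (x n) < l + e" using order_tendstoD(2)[OF lim] by simp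
  thus "seq_norm A x \<le> l + e" using l0 \<open>0 < e\<close> by (intro seq_norm_le) (auto elim: eventually_mono)
 qed
 show "l \<le> seq_norm A x"
 proof (rule field_le_epsilon)
  fix e :: real assume "0 < e"
  show "l \<le> seq_norm A x + e"
   by (rule tendsto_upperbound[OF lim seq_norm_eps[OF x \<open>0 < e\<close>]]) simp
 qed
qed

lemma T_minus [simp]:
 assumes "x \<in> T" "y \<in> T"
 shows "(\<lambda>n. x n \<ominus>\<^bsub>A n\<^esub> y n) \<in> T"
proof -
 have "(\<lambda>n. x n \<ominus>\<^bsub>A n\<^esub> y n) = (\<lambda>n. x n \<oplus>\<^bsub>A n\<^esub> (-1) \<odot>\<^bsub>A n\<^esub> y n)"
  by (rule ext, rule pos_cstar.minus_smult[OF A]) (rule T_carrier, fact)+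
 thus ?thesis using T_add[OF assms(1) T_smult[OF assms(2)]] by simp
qed

lemma T_zero [simp]: "(\<lambda>n. \<zero>\<^bsub>A n\<^esub>) \<in> T"
proof -
 have "(\<lambda>n. \<zero>\<^bsub>A n\<^esub>) = (\<lambda>n. 0 \<odot>\<^bsub>A n\<^esub> \<one>\<^bsub>A n\<^esub>)"
  by (rule ext, rule pos_cstar.smult_zero_left[OF A, symmetric]) (rule T_carrier[OF T_one])
 thus ?thesis using T_smult[OF T_one, of 0] by simp
qed

lemma null_iff_seq_norm:
 assumes x: "x \<in> T"
 shows "(\<lambda>n. cnorm (A n) (x n)) \<longlonglongrightarrow> 0 \<longleftrightarrow> seq_norm A x = 0"
proof
 assume 0: "seq_norm A x = 0"
 show "(\<lambda>n. cnorm (A n) (x n)) \<longlonglongrightarrow> 0"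
 proof (rule tendstoI)
  fix e :: real assume e: "0 < e"
  have "0 < e/2" using e by simp
  from seq_norm_eps[OF x this] show "\<forall>\<^sub>F n in sequentially. dist (cnorm (A n) (x n)) 0 < e"
  proof (rule eventually_mono)
   fix n assume "cnorm (A n) (x n) \<le> seq_norm A x + e / 2"
   thus "dist (cnorm (A n) (x n)) 0 < e" using 0 e pos_cstar.cnorm_nonneg[OF A, of "x n" n] x by simp
  qed
 qed
qed (use seq_norm_unique[OF x] in blast)

lemma equiv_R: "equiv T R"
proof (rule equivI)
 show "R \<subseteq> T \<times> T" by (auto simp: null_rel_def)
 have "cdist (A n) (x n) (x n) = 0" if "x \<in> T" for x n
 proof -
  interpret An: pos_cstar "A n" by (rule A)
  show ?thesis using that by (simp add: An.minus_eq An.r_neg)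
 qed
 thus "refl_on T R" by (auto simp: refl_on_def null_rel_def)
 show "sym R" by (auto simp: sym_def null_rel_def pos_cstar.cnorm_minus_commute[OF A])
 show "trans R"
 proof (rule transI)
  fix x y z assume "(x, y) \<in> R" "(y, z) \<in> R"
  hence T: "x \<in> T" "y \<in> T" "z \<in> T" and l: "(\<lambda>n. cdist (A n) (x n) (y n)) \<longlonglongrightarrow> 0" "(\<lambda>n. cdist (A n) (y n) (z n)) \<longlonglongrightarrow> 0"
   by (auto simp: null_rel_def)
  have "(\<lambda>n. cdist (A n) (x n) (z n)) \<longlonglongrightarrow> 0"
   by (rule null_seq_le[where g = "\<lambda>n. cdist (A n) (x n) (y n) + cdist (A n) (y n) (z n)"])
    (use T pos_cstar.cnorm_nonneg[OF A T_carrier[OF T_minus]] tendsto_add[OF l] in \<open>auto intro!: pos_cstar.cnorm_dist_triangle[OF A]\<close>)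
  thus "(x, z) \<in> R" using T by (simp add: null_rel_def)
 qed
qed

lemma cls_eq_iff: "x \<in> T ==> y \<in> T ==> cls x = cls y \<longleftrightarrow> (\<lambda>n. cdist (A n) (x n) (y n)) \<longlonglongrightarrow> 0"
 unfolding cls_def using eq_equiv_class_iff[OF equiv_R, of x y] by (simp add: null_rel_def)

lemma congruent_star: "congruent R (\<lambda>x. R `` {\<lambda>n. star (A n) (x n)})"
proof (rule congruentI)
 fix x y assume "(x,y) \<in> R"
 hence T: "x \<in> T" "y \<in> T" and l: "(\<lambda>n. cdist (A n) (x n) (y n)) \<longlonglongrightarrow> 0" by (auto simp: null_rel_def)
 have "cdist (A n) (star (A n) (x n)) (star (A n) (y n)) = cdist (A n) (x n) (y n)" for n
  using pos_cstar.star_minus[OF A, of "x n" n "y n"] pos_cstar.cnorm_star[OF A, of "x n \<ominus>\<^bsub>A n\<^esub> y n" n] T_carrier[OF T_minus[OF T]] T by simp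
 thus "R `` {\<lambda>n. star (A n) (x n)} = R `` {\<lambda>n. star (A n) (y n)}"
  using l T by (simp add: cls_eq_iff flip: cls_def)
qed

lemma congruent_smult: "congruent R (\<lambda>x. R `` {\<lambda>n. c \<odot>\<^bsub>A n\<^esub> x n})"
proof (rule congruentI)
 fix x y assume "(x,y) \<in> R"
 hence T: "x \<in> T" "y \<in> T" and l: "(\<lambda>n. cdist (A n) (x n) (y n)) \<longlonglongrightarrow> 0" by (auto simp: null_rel_def)
 have "cdist (A n) (c \<odot>\<^bsub>A n\<^esub> x n) (c \<odot>\<^bsub>A n\<^esub> y n) = cmod c * cdist (A n) (x n) (y n)" for n
  using pos_cstar.smult_minus_right[OF A, of "x n" n "y n" c] pos_cstar.cnorm_smult[OF A, of "x n \<ominus>\<^bsub>A n\<^esub> y n" n c] T_carrier[OF T_minus[OF T]] T by simp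
 thus "R `` {\<lambda>n. c \<odot>\<^bsub>A n\<^esub> x n} = R `` {\<lambda>n. c \<odot>\<^bsub>A n\<^esub> y n}"
  using tendsto_mult_left[OF l, of "cmod c"] T by (simp add: cls_eq_iff flip: cls_def)
qed

lemma congruent2_add: "congruent2 R R (\<lambda>x y. R `` {\<lambda>n. x n \<oplus>\<^bsub>A n\<^esub> y n})"
proof (rule congruent2I')
 fix x x' y y' assume "(x,x') \<in> R" "(y,y') \<in> R"
 hence T: "x \<in> T" "x' \<in> T" "y \<in> T" "y' \<in> T" and l: "(\<lambda>n. cdist (A n) (x n) (x' n)) \<longlonglongrightarrow> 0"
  "(\<lambda>n. cdist (A n) (y n) (y' n)) \<longlonglongrightarrow> 0" by (auto simp: null_rel_def)
 have "(\<lambda>n. cdist (A n) (x n \<oplus>\<^bsub>A n\<^esub> y n) (x' n \<oplus>\<^bsub>A n\<^esub> y' n)) \<longlonglongrightarrow> 0"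
 proof (rule null_seq_le)
  fix n
  interpret pos_cstar "A n" by (rule A)
  have "(x n \<oplus>\<^bsub>A n\<^esub> y n) \<ominus>\<^bsub>A n\<^esub> (x' n \<oplus>\<^bsub>A n\<^esub> y' n) = (x n \<ominus>\<^bsub>A n\<^esub> x' n) \<oplus>\<^bsub>A n\<^esub> (y n \<ominus>\<^bsub>A n\<^esub> y' n)"
   using T[THEN T_carrier, of n] by algebra
  thus "cdist (A n) (x n \<oplus>\<^bsub>A n\<^esub> y n) (x' n \<oplus>\<^bsub>A n\<^esub> y' n) \<le> cdist (A n) (x n) (x' n) + cdist (A n) (y n) (y' n)"
   using cnorm_triangle[of "x n \<ominus>\<^bsub>A n\<^esub> x' n" "y n \<ominus>\<^bsub>A n\<^esub> y' n"] T by simp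
  show "0 \<le> cdist (A n) (x n \<oplus>\<^bsub>A n\<^esub> y n) (x' n \<oplus>\<^bsub>A n\<^esub> y' n)" using T by simp
 next
  show "(\<lambda>n. cdist (A n) (x n) (x' n) + cdist (A n) (y n) (y' n)) \<longlonglongrightarrow> 0" using tendsto_add[OF l] by simp
 qed
 thus "R `` {\<lambda>n. x n \<oplus>\<^bsub>A n\<^esub> y n} = R `` {\<lambda>n. x' n \<oplus>\<^bsub>A n\<^esub> y' n}"
  using T by (simp add: cls_eq_iff flip: cls_def)
qed

lemma congruent2_mult: "congruent2 R R (\<lambda>x y. R `` {\<lambda>n. x n \<otimes>\<^bsub>A n\<^esub> y n})"
proof (rule congruent2I')
 fix x x' y y' assume "(x,x') \<in> R" "(y,y') \<in> R"
 hence T: "x \<in> T" "x' \<in> T" "y \<in> T" "y' \<in> T" and l: "(\<lambda>n. cdist (A n) (x n) (x' n)) \<longlonglongrightarrow> 0"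
  "(\<lambda>n. cdist (A n) (y n) (y' n)) \<longlonglongrightarrow> 0" by (auto simp: null_rel_def)
 obtain C where C: "\<And>n. cnorm (A n) (x n) \<le> C" using T_bounded[OF T(1)] by blast
 obtain D where D: "\<And>n. cnorm (A n) (y' n) \<le> D" using T_bounded[OF T(4)] by blast
 have "(\<lambda>n. cdist (A n) (x n \<otimes>\<^bsub>A n\<^esub> y n) (x' n \<otimes>\<^bsub>A n\<^esub> y' n)) \<longlonglongrightarrow> 0"
 proof (rule null_seq_le)
  fix n
  interpret pos_cstar "A n" by (rule A)
  have "cdist (A n) (x n \<otimes>\<^bsub>A n\<^esub> y n) (x' n \<otimes>\<^bsub>A n\<^esub> y' n) \<le> cnorm (A n) (x n) * cdist (A n) (y n) (y' n) + cdist (A n) (x n) (x' n) * cnorm (A n) (y' n)"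
   by (rule cnorm_mult_dist) (use T in auto)
  also have "\<dots> \<le> C * cdist (A n) (y n) (y' n) + cdist (A n) (x n) (x' n) * D"
   by (intro add_mono mult_left_mono mult_right_mono C D) (use T in auto)
  finally show "cdist (A n) (x n \<otimes>\<^bsub>A n\<^esub> y n) (x' n \<otimes>\<^bsub>A n\<^esub> y' n) \<le> C * cdist (A n) (y n) (y' n) + cdist (A n) (x n) (x' n) * D" .
  show "0 \<le> cdist (A n) (x n \<otimes>\<^bsub>A n\<^esub> y n) (x' n \<otimes>\<^bsub>A n\<^esub> y' n)" using T by simp
 next
  show "(\<lambda>n. C * cdist (A n) (y n) (y' n) + cdist (A n) (x n) (x' n) * D) \<longlonglongrightarrow> 0"
   using tendsto_add[OF tendsto_mult_left[OF l(2), of C] tendsto_mult_right[OF l(1), of D]] by simp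
 qed
 thus "R `` {\<lambda>n. x n \<otimes>\<^bsub>A n\<^esub> y n} = R `` {\<lambda>n. x' n \<otimes>\<^bsub>A n\<^esub> y' n}"
  using T by (simp add: cls_eq_iff flip: cls_def)
qed

lemma Q_simps:
 "carrier Q = T // R" "one Q = cls (\<lambda>n. \<one>\<^bsub>A n\<^esub>)" "zero Q = cls (\<lambda>n. \<zero>\<^bsub>A n\<^esub>)"
 "x \<in> T ==> y \<in> T ==> cls x \<otimes>\<^bsub>Q\<^esub> cls y = cls (\<lambda>n. x n \<otimes>\<^bsub>A n\<^esub> y n)"
 "x \<in> T ==> y \<in> T ==> cls x \<oplus>\<^bsub>Q\<^esub> cls y = cls (\<lambda>n. x n \<oplus>\<^bsub>A n\<^esub> y n)"
 "x \<in> T ==> c \<odot>\<^bsub>Q\<^esub> cls x = cls (\<lambda>n. c \<odot>\<^bsub>A n\<^esub> x n)"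
 "x \<in> T ==> star Q (cls x) = cls (\<lambda>n. star (A n) (x n))"
 "x \<in> T ==> cnorm Q (cls x) = seq_norm A x"
 by (simp_all add: seq_quot_def Let_def cls_def N UN_equiv_class2[OF equiv_R equiv_R congruent2_mult]
   UN_equiv_class2[OF equiv_R equiv_R congruent2_add] UN_equiv_class[OF equiv_R congruent_smult]
   UN_equiv_class[OF equiv_R congruent_star])

lemma carrier_Q: "X \<in> carrier Q \<longleftrightarrow> (\<exists>x\<in>T. X = cls x)"
 unfolding Q_simps cls_def quotient_def by auto

lemma carrier_QE:
 assumes "X \<in> carrier Q"
 obtains x where "x \<in> T" "X = cls x"
 using assms carrier_Q by blast

lemma cls_carrier [simp]: "x \<in> T ==> cls x \<in> carrier Q"
 using carrier_Q by blast

lemma seq_norm_triangle: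
 assumes x: "x \<in> T" and y: "y \<in> T"
 shows "seq_norm A (\<lambda>n. x n \<oplus>\<^bsub>A n\<^esub> y n) \<le> seq_norm A x + seq_norm A y"
proof (rule field_le_epsilon)
 fix e :: real assume e: "0 < e"
 hence e2: "0 < e/2" by simp
 show "seq_norm A (\<lambda>n. x n \<oplus>\<^bsub>A n\<^esub> y n) \<le> seq_norm A x + seq_norm A y + e"
 proof (rule seq_norm_le)
  show "\<forall>\<^sub>F n in sequentially. cnorm (A n) (x n \<oplus>\<^bsub>A n\<^esub> y n) \<le> seq_norm A x + seq_norm A y + e"
   using seq_norm_eps[OF x e2] seq_norm_eps[OF y e2]
  proof eventually_elim
   case (elim n)
   thus ?case using pos_cstar.cnorm_triangle[OF A T_carrier[OF x] T_carrier[OF y], of n] by linarith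
  qed
 qed (use seq_norm_nonneg[OF x] seq_norm_nonneg[OF y] e in simp)
qed

lemma seq_norm_mult:
 assumes x: "x \<in> T" and y: "y \<in> T"
 shows "seq_norm A (\<lambda>n. x n \<otimes>\<^bsub>A n\<^esub> y n) \<le> seq_norm A x * seq_norm A y"
proof (rule le_of_eps_limit[of _ "\<lambda>e. (seq_norm A x + e) * (seq_norm A y + e)"])
 fix e :: real assume e: "0 < e"
 show "seq_norm A (\<lambda>n. x n \<otimes>\<^bsub>A n\<^esub> y n) \<le> (seq_norm A x + e) * (seq_norm A y + e)"
 proof (rule seq_norm_le)
  show "\<forall>\<^sub>F n in sequentially. cnorm (A n) (x n \<otimes>\<^bsub>A n\<^esub> y n) \<le> (seq_norm A x + e) * (seq_norm A y + e)"
   using seq_norm_eps[OF x e] seq_norm_eps[OF y e]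
  proof eventually_elim
   case (elim n)
   have "cnorm (A n) (x n) * cnorm (A n) (y n) \<le> (seq_norm A x + e) * (seq_norm A y + e)"
    by (rule mult_mono[OF elim]) (use pos_cstar.cnorm_nonneg[OF A] seq_norm_nonneg[OF x] y e in auto)
   thus ?case using pos_cstar.cnorm_mult[OF A T_carrier[OF x] T_carrier[OF y], of n] by linarith
  qed
 qed (use seq_norm_nonneg[OF x] seq_norm_nonneg[OF y] e in simp)
next
 show "((\<lambda>e. (seq_norm A x + e) * (seq_norm A y + e)) \<longlongrightarrow> seq_norm A x * seq_norm A y) (at_right 0)"
  by (auto intro!: tendsto_eq_intros)
qed

lemma seq_norm_smult_le:
 assumes x: "x \<in> T"
 shows "seq_norm A (\<lambda>n. c \<odot>\<^bsub>A n\<^esub> x n) \<le> cmod c * seq_norm A x"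
proof (rule le_of_eps_limit[of _ "\<lambda>e. cmod c * (seq_norm A x + e)"])
 fix e :: real assume e: "0 < e"
 show "seq_norm A (\<lambda>n. c \<odot>\<^bsub>A n\<^esub> x n) \<le> cmod c * (seq_norm A x + e)"
 proof (rule seq_norm_le)
  show "\<forall>\<^sub>F n in sequentially. cnorm (A n) (c \<odot>\<^bsub>A n\<^esub> x n) \<le> cmod c * (seq_norm A x + e)"
   using seq_norm_eps[OF x e]
   by eventually_elim (use x in \<open>simp add: pos_cstar.cnorm_smult[OF A] mult_left_mono\<close>)
 qed (use seq_norm_nonneg[OF x] e in simp)
next
 show "((\<lambda>e. cmod c * (seq_norm A x + e)) \<longlongrightarrow> cmod c * seq_norm A x) (at_right 0)"
  by (auto intro!: tendsto_eq_intros)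
qed

lemma seq_norm_smult:
 assumes x: "x \<in> T"
 shows "seq_norm A (\<lambda>n. c \<odot>\<^bsub>A n\<^esub> x n) = cmod c * seq_norm A x"
proof (cases "c = 0")
 case True
 thus ?thesis using seq_norm_smult_le[OF x, of c] seq_norm_nonneg[OF T_smult[OF x], of c] by simp
next
 case False
 have "(\<lambda>n. (1/c) \<odot>\<^bsub>A n\<^esub> (c \<odot>\<^bsub>A n\<^esub> x n)) = x"
  using False x by (intro ext) (simp add: pos_cstar.smult_one'[OF A] flip: pos_cstar.smult_assoc'[OF A])
 hence "seq_norm A x \<le> (1 / cmod c) * seq_norm A (\<lambda>n. c \<odot>\<^bsub>A n\<^esub> x n)"
  using seq_norm_smult_le[OF T_smult[OF x], of "1/c" c] by (simp add: norm_divide)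
 thus ?thesis using False seq_norm_smult_le[OF x, of c] by (simp add: field_simps)
qed

lemma seq_norm_cstar:
 assumes x: "x \<in> T"
 shows "seq_norm A (\<lambda>n. star (A n) (x n) \<otimes>\<^bsub>A n\<^esub> x n) = (seq_norm A x)\<^sup>2"
proof (rule antisym)
 let ?y = "\<lambda>n. star (A n) (x n) \<otimes>\<^bsub>A n\<^esub> x n"
 have yT: "?y \<in> T" using x by simp
 have yn: "cnorm (A n) (?y n) = (cnorm (A n) (x n))\<^sup>2" for n using x by (simp add: pos_cstar.cstar_identity[OF A])
 show "seq_norm A ?y \<le> (seq_norm A x)\<^sup>2"
 proof (rule le_of_eps_limit[of _ "\<lambda>e. (seq_norm A x + e)\<^sup>2"])
  fix e :: real assume e: "0 < e"
  show "seq_norm A ?y \<le> (seq_norm A x + e)\<^sup>2"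
  proof (rule seq_norm_le)
   show "\<forall>\<^sub>F n in sequentially. cnorm (A n) (?y n) \<le> (seq_norm A x + e)\<^sup>2"
    using seq_norm_eps[OF x e]
    by eventually_elim (use x in \<open>simp add: yn power_mono pos_cstar.cnorm_nonneg[OF A]\<close>)
  qed simp
 next
  show "((\<lambda>e. (seq_norm A x + e)\<^sup>2) \<longlongrightarrow> (seq_norm A x)\<^sup>2) (at_right 0)"
   by (auto intro!: tendsto_eq_intros)
 qed
 show "(seq_norm A x)\<^sup>2 \<le> seq_norm A ?y"
 proof (rule field_le_epsilon)
  fix e :: real assume e: "0 < e"
  have nn: "0 \<le> seq_norm A ?y + e" using e seq_norm_nonneg[OF yT] by simp
  have "seq_norm A x \<le> sqrt (seq_norm A ?y + e)"
  proof (rule seq_norm_le)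
   show "\<forall>\<^sub>F n in sequentially. cnorm (A n) (x n) \<le> sqrt (seq_norm A ?y + e)"
    using seq_norm_eps[OF yT e] by eventually_elim (simp only: yn real_le_rsqrt)
  qed (use nn in simp)
  hence "(seq_norm A x)\<^sup>2 \<le> (sqrt (seq_norm A ?y + e))\<^sup>2"
   by (rule power_mono) (rule seq_norm_nonneg[OF x])
  thus "(seq_norm A x)\<^sup>2 \<le> seq_norm A ?y + e" using nn by simp
 qed
qed

lemma seq_norm_pos:
 assumes x: "x \<in> T" and r: "(seq_norm A x)\<^sup>2 \<le> r"
 shows "seq_norm A (\<lambda>n. cor r \<odot>\<^bsub>A n\<^esub> \<one>\<^bsub>A n\<^esub> \<ominus>\<^bsub>A n\<^esub> star (A n) (x n) \<otimes>\<^bsub>A n\<^esub> x n) \<le> r"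
proof (rule le_of_eps_limit[of _ "\<lambda>e. r + 2 * (2 * seq_norm A x * e + e\<^sup>2)"])
 fix e :: real assume e: "0 < e"
 let ?N = "seq_norm A x"
 have N0: "0 \<le> ?N" by (rule seq_norm_nonneg[OF x])
 have r0: "0 \<le> r" using r by (meson order_trans zero_le_power2)
 define d where "d = 2 * ?N * e + e\<^sup>2"
 have d0: "0 \<le> d" using N0 e by (simp add: d_def)
 have rd: "(?N + e)\<^sup>2 \<le> r + d" using r by (simp add: d_def power2_eq_square algebra_simps)
 have "\<forall>\<^sub>F n in sequentially. cdist (A n) (cor r \<odot>\<^bsub>A n\<^esub> \<one>\<^bsub>A n\<^esub>) (star (A n) (x n) \<otimes>\<^bsub>A n\<^esub> x n) \<le> r + 2 * d"
  using seq_norm_eps[OF x e]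
 proof eventually_elim
  case (elim n)
  interpret An: pos_cstar "A n" by (rule A)
  have xn: "x n \<in> carrier (A n)" using x by simp
  have "(cnorm (A n) (x n))\<^sup>2 \<le> (?N + e)\<^sup>2" by (rule power_mono[OF elim]) (use xn in simp)
  hence 1: "cdist (A n) (cor (r + d) \<odot>\<^bsub>A n\<^esub> \<one>\<^bsub>A n\<^esub>) (star (A n) (x n) \<otimes>\<^bsub>A n\<^esub> x n) \<le> r + d"
   using rd xn by (intro An.square_positive) auto
  have 2: "cdist (A n) (cor r \<odot>\<^bsub>A n\<^esub> \<one>\<^bsub>A n\<^esub>) (cor (r + d) \<odot>\<^bsub>A n\<^esub> \<one>\<^bsub>A n\<^esub>) \<le> d"
  proof -
   have "cor r \<odot>\<^bsub>A n\<^esub> \<one>\<^bsub>A n\<^esub> \<ominus>\<^bsub>A n\<^esub> cor (r + d) \<odot>\<^bsub>A n\<^esub> \<one>\<^bsub>A n\<^esub> = (- cor d) \<odot>\<^bsub>A n\<^esub> \<one>\<^bsub>A n\<^esub>"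
    by (simp flip: An.smult_minus_left)
   thus ?thesis using d0 An.cnorm_one_le by (simp add: An.cnorm_smult mult_left_le)
  qed
  show ?case
   using An.cnorm_dist_triangle[of "cor r \<odot>\<^bsub>A n\<^esub> \<one>\<^bsub>A n\<^esub>" "cor (r + d) \<odot>\<^bsub>A n\<^esub> \<one>\<^bsub>A n\<^esub>" "star (A n) (x n) \<otimes>\<^bsub>A n\<^esub> x n"] 1 2 xn
   by auto
 qed
 thus "seq_norm A (\<lambda>n. cor r \<odot>\<^bsub>A n\<^esub> \<one>\<^bsub>A n\<^esub> \<ominus>\<^bsub>A n\<^esub> star (A n) (x n) \<otimes>\<^bsub>A n\<^esub> x n) \<le> r + 2 * (2 * ?N * e + e\<^sup>2)"
  using r0 d0 by (intro seq_norm_le) (auto simp: d_def)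
next
 show "((\<lambda>e. r + 2 * (2 * seq_norm A x * e + e\<^sup>2)) \<longlongrightarrow> r) (at_right 0)"
  by (auto intro!: tendsto_eq_intros)
qed

text \<open>A diagonal argument: after passing to a rapidly converging subsequence, the limit follows its \<open>j\<close>-th
  member on the stretch of indices where the later members are already close to it.\<close>

lemma seq_complete:
 assumes s: "\<And>j. s j \<in> T"
  and cau: "\<And>e. 0 < e ==> \<exists>K. \<forall>i\<ge>K. \<forall>j\<ge>K. seq_norm A (\<lambda>n. s i n \<ominus>\<^bsub>A n\<^esub> s j n) < e"
 shows "\<exists>x\<in>T. (\<lambda>j. seq_norm A (\<lambda>n. s j n \<ominus>\<^bsub>A n\<^esub> x n)) \<longlonglongrightarrow> 0"
proof -
 have "\<exists>K. \<forall>k. \<forall>i\<ge>K k. \<forall>j\<ge>K k. seq_norm A (\<lambda>n. s i n \<ominus>\<^bsub>A n\<^esub> s j n) < (1/2)^k"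
  by (rule choice) (use cau in simp)
 then obtain K0 where K0: "\<And>k i j. i \<ge> K0 k ==> j \<ge> K0 k ==> seq_norm A (\<lambda>n. s i n \<ominus>\<^bsub>A n\<^esub> s j n) < (1/2)^k" by blast
 define K where "K k = (\<Sum>i\<le>k. K0 i)" for k
 have Km: "K0 k \<le> K l" if "k \<le> l" for k l
  unfolding K_def by (rule member_le_sum) (use that in auto)
 define z where "z k = s (K k)" for k
 have zT: "z k \<in> T" for k using s by (simp add: z_def)
 have "\<exists>M. \<forall>k. \<forall>n\<ge>M k. cdist (A n) (z k n) (z (Suc k) n) \<le> (1/2)^k"
 proof (rule choice, rule allI)
  fix k
  have "seq_norm A (\<lambda>n. z k n \<ominus>\<^bsub>A n\<^esub> z (Suc k) n) < (1/2)^k"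
   unfolding z_def by (rule K0) (use Km in auto)
  from eventually_norm_le[OF T_minus[OF zT zT] this]
  show "\<exists>M. \<forall>n\<ge>M. cdist (A n) (z k n) (z (Suc k) n) \<le> (1/2)^k"
   by (simp add: eventually_sequentially)
 qed
 then obtain M where M: "\<And>k n. n \<ge> M k ==> cdist (A n) (z k n) (z (Suc k) n) \<le> (1/2)^k" by blast
 have chain: "cdist (A n) (z (k + i) n) (z k n) \<le> 2 * (1/2)^k - 2 * (1/2)^(k+i)"
  if "\<And>l. l < k + i ==> M l \<le> n" for k i n
  using that
 proof (induction i)
  case 0
  interpret An: pos_cstar "A n" by (rule A)
  show ?case using zT by (simp add: An.minus_eq An.r_neg)
 next
  case (Suc i)
  interpret An: pos_cstar "A n" by (rule A)
  have "cdist (A n) (z (k + Suc i) n) (z k n) \<le> cdist (A n) (z (k + Suc i) n) (z (k+i) n) + cdist (A n) (z (k + i) n) (z k n)"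
   by (rule An.cnorm_dist_triangle) (use zT in auto)
  also have "cdist (A n) (z (k + Suc i) n) (z (k+i) n) \<le> (1/2)^(k+i)"
   using M[of "k+i" n] Suc.prems[of "k+i"] An.cnorm_minus_commute[of "z (k + Suc i) n" "z (k+i) n"] zT by simp
  also have "cdist (A n) (z (k + i) n) (z k n) \<le> 2 * (1/2)^k - 2 * (1/2)^(k+i)"
   by (rule Suc.IH) (use Suc.prems in simp)
  finally show ?case by simp
 qed
 define J where "J n = (GREATEST k. k \<le> n \<and> (\<forall>l<k. M l \<le> n))" for n
 have J: "J n \<le> n \<and> (\<forall>l<J n. M l \<le> n)" for n
  unfolding J_def by (rule GreatestI_nat[where b = n]) auto
 have J_ge: "k \<le> J n" if "k \<le> n" "\<And>l. l < k ==> M l \<le> n" for k n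
  unfolding J_def by (rule Greatest_le_nat[where b = n]) (use that in auto)
 define x where "x n = z (J n) n" for n
 have xz: "\<forall>\<^sub>F n in sequentially. cdist (A n) (x n) (z k n) \<le> 2 * (1/2)^k" for k
  unfolding eventually_sequentially
 proof (intro exI allI impI)
  fix n assume n: "k + (\<Sum>l<k. M l) \<le> n"
  have "k \<le> J n"
  proof (rule J_ge)
   fix l assume "l < k"
   hence "M l \<le> (\<Sum>l<k. M l)" by (intro member_le_sum) auto
   thus "M l \<le> n" using n by simp
  qed (use n in simp)
  then obtain i where i: "J n = k + i" using le_Suc_ex by blast
  have "cdist (A n) (z (k + i) n) (z k n) \<le> 2 * (1/2)^k - 2 * (1/2)^(k+i)"
   by (rule chain) (use J[of n] i in auto)
  thus "cdist (A n) (x n) (z k n) \<le> 2 * (1/2)^k"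
   unfolding x_def i by (rule order_trans) simp
 qed
 have xT: "x \<in> T"
 proof (rule T_closed)
  fix e :: real assume "0 < e"
  then obtain k where "(1/2)^k < e/2" using real_arch_pow_inv[of "e/2" "1/2"] by auto
  thus "\<exists>y\<in>T. \<forall>\<^sub>F n in sequentially. cdist (A n) (x n) (y n) \<le> e"
   using xz[of k] zT by (intro bexI[of _ "z k"]) (auto elim!: eventually_mono)
 qed (use zT in \<open>auto simp: x_def\<close>)
 have "(\<lambda>j. seq_norm A (\<lambda>n. s j n \<ominus>\<^bsub>A n\<^esub> x n)) \<longlonglongrightarrow> 0"
 proof (rule LIMSEQ_I)
  fix e :: real assume "0 < e"
  then obtain k where k: "(1/2)^k < e/3" using real_arch_pow_inv[of "e/3" "1/2"] by auto
  have "seq_norm A (\<lambda>n. s j n \<ominus>\<^bsub>A n\<^esub> x n) < e" if j: "K k \<le> j" for j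
  proof -
   have "seq_norm A (\<lambda>n. s j n \<ominus>\<^bsub>A n\<^esub> z k n) < (1/2)^k"
    unfolding z_def by (rule K0) (use j Km[of k k] in auto)
   from eventually_norm_le[OF T_minus[OF s zT] this] xz[of k]
   have "\<forall>\<^sub>F n in sequentially. cdist (A n) (s j n) (x n) \<le> 3 * (1/2)^k"
   proof eventually_elim
    case (elim n)
    interpret An: pos_cstar "A n" by (rule A)
    show ?case
     using An.cnorm_dist_triangle[of "s j n" "z k n" "x n"] An.cnorm_minus_commute[of "x n" "z k n"] elim s zT xT by simp
   qed
   hence "seq_norm A (\<lambda>n. s j n \<ominus>\<^bsub>A n\<^esub> x n) \<le> 3 * (1/2)^k" by (intro seq_norm_le) auto
   thus ?thesis using k by simp
  qed
  thus "\<exists>no. \<forall>n\<ge>no. norm (seq_norm A (\<lambda>m. s n m \<ominus>\<^bsub>A m\<^esub> x m) - 0) < e"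
   using seq_norm_nonneg[OF T_minus[OF s xT]] by auto
 qed
 thus ?thesis using xT by blast
qed

lemma Q_minus0: "x \<in> T ==> y \<in> T ==> cls x \<oplus>\<^bsub>Q\<^esub> (-1) \<odot>\<^bsub>Q\<^esub> cls y = cls (\<lambda>n. x n \<ominus>\<^bsub>A n\<^esub> y n)"
 by (simp add: Q_simps pos_cstar.minus_smult[OF A])

theorem pos_cstar_Q: "pos_cstar Q"
proof -
 note AR = pos_cstar.axioms(1)[OF A]
 note ag = ring.is_abelian_group[OF AR]
 have neg: "(-1) \<odot>\<^bsub>A n\<^esub> x \<oplus>\<^bsub>A n\<^esub> x = \<zero>\<^bsub>A n\<^esub>" if "x \<in> carrier (A n)" for n x
  using that abelian_group.l_neg[OF ag] by (simp add: pos_cstar.uminus_smult[OF A, symmetric])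
 note am = abelian_group.axioms(1)[OF ag]
 have norm0: "(cnorm Q x = 0) = (x = \<zero>\<^bsub>Q\<^esub>)" if "x \<in> carrier Q" for x
 proof -
  from that obtain x' where x: "x' \<in> T" "x = cls x'" using carrier_Q by blast
  have "x' n \<ominus>\<^bsub>A n\<^esub> \<zero>\<^bsub>A n\<^esub> = x' n" for n
  proof -
   interpret An: pos_cstar "A n" by (rule A)
   show ?thesis using x(1) by (simp add: An.minus_eq)
  qed
  hence "x = \<zero>\<^bsub>Q\<^esub> \<longleftrightarrow> (\<lambda>n. cnorm (A n) (x' n)) \<longlonglongrightarrow> 0"
   using cls_eq_iff[OF x(1) T_zero] unfolding x(2) Q_simps(3) by simp
  also have "\<dots> \<longleftrightarrow> cnorm Q x = 0"
   unfolding null_iff_seq_norm[OF x(1)] x(2) Q_simps(8)[OF x(1)] ..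
  finally show ?thesis by blast
 qed
 have compl: "\<exists>x\<in>carrier Q. (\<lambda>n. cnorm Q (s n \<oplus>\<^bsub>Q\<^esub> (- 1) \<odot>\<^bsub>Q\<^esub> x)) \<longlonglongrightarrow> 0"
  if s: "\<And>n::nat. s n \<in> carrier Q"
   and cau: "\<And>e. 0 < e ==> \<exists>N'. \<forall>m\<ge>N'. \<forall>n\<ge>N'. cnorm Q (s m \<oplus>\<^bsub>Q\<^esub> (- 1) \<odot>\<^bsub>Q\<^esub> s n) < e" for s
 proof -
  have "\<forall>n. \<exists>t. t \<in> T \<and> s n = cls t" using s carrier_Q by blast
  from choice[OF this] obtain t where t: "\<And>n. t n \<in> T" "\<And>n. s n = cls (t n)" by blast
  have eq: "cnorm Q (s m \<oplus>\<^bsub>Q\<^esub> (- 1) \<odot>\<^bsub>Q\<^esub> cls y) = seq_norm A (\<lambda>n. t m n \<ominus>\<^bsub>A n\<^esub> y n)" if "y \<in> T" for m y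
   unfolding t(2) Q_minus0[OF t(1) that] by (rule Q_simps(8)[OF T_minus[OF t(1) that]])
  have "\<exists>x\<in>T. (\<lambda>j. seq_norm A (\<lambda>n. t j n \<ominus>\<^bsub>A n\<^esub> x n)) \<longlonglongrightarrow> 0"
  proof (rule seq_complete[OF t(1)])
   fix e :: real assume "0 < e"
   from cau[OF this] show "\<exists>K. \<forall>i\<ge>K. \<forall>j\<ge>K. seq_norm A (\<lambda>n. t i n \<ominus>\<^bsub>A n\<^esub> t j n) < e"
    unfolding eq[OF t(1), folded t(2)] .
  qed
  then obtain x where x: "x \<in> T" "(\<lambda>j. seq_norm A (\<lambda>n. t j n \<ominus>\<^bsub>A n\<^esub> x n)) \<longlonglongrightarrow> 0" by blast
  show ?thesis
   by (rule bexI[of _ "cls x"]) (unfold eq[OF x(1)], rule x(2), rule cls_carrier[OF x(1)])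
 qed
 have posi: "cnorm Q (cor r \<odot>\<^bsub>Q\<^esub> \<one>\<^bsub>Q\<^esub> \<oplus>\<^bsub>Q\<^esub> (-1) \<odot>\<^bsub>Q\<^esub> (star Q x \<otimes>\<^bsub>Q\<^esub> x)) \<le> r"
  if xQ: "x \<in> carrier Q" and r: "(cnorm Q x)\<^sup>2 \<le> r" for x r
 proof -
  from xQ obtain x' where x: "x' \<in> T" "x = cls x'" using carrier_Q by blast
  have y: "star Q x \<otimes>\<^bsub>Q\<^esub> x = cls (\<lambda>n. star (A n) (x' n) \<otimes>\<^bsub>A n\<^esub> x' n)"
   unfolding x(2) Q_simps(7)[OF x(1)] by (rule Q_simps(4)[OF T_star[OF x(1)] x(1)])
  have z: "cor r \<odot>\<^bsub>Q\<^esub> \<one>\<^bsub>Q\<^esub> = cls (\<lambda>n. cor r \<odot>\<^bsub>A n\<^esub> \<one>\<^bsub>A n\<^esub>)"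
   unfolding Q_simps(2) by (rule Q_simps(6)[OF T_one])
  note T = T_smult[OF T_one, of "cor r"] T_mult[OF T_star[OF x(1)] x(1)]
  show ?thesis
   unfolding y z Q_minus0[OF T] Q_simps(8)[OF T_minus[OF T]]
   by (rule seq_norm_pos[OF x(1)]) (use r in \<open>simp only: x(2) Q_simps(8)[OF x(1)]\<close>)
 qed
 show ?thesis
  apply (rule pos_cstarI)
  subgoal by (elim carrier_QE; simp add: Q_simps(2-8) )
  subgoal by (simp add: Q_simps(2-8))
  subgoal by (elim carrier_QE; simp add: Q_simps(2-8) )
  subgoal by (simp add: Q_simps(2-8))
  subgoal by (elim carrier_QE; simp add: Q_simps(2-8) )
  subgoal by (elim carrier_QE; simp add: Q_simps(2-8) )
  subgoal by (elim carrier_QE; simp add: Q_simps(2-8) abelian_monoid.a_assoc[OF am])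
  subgoal by (elim carrier_QE; simp add: Q_simps(2-8) abelian_monoid.a_comm[OF am])
  subgoal by (elim carrier_QE; simp add: Q_simps(2-8) abelian_monoid.l_zero[OF am])
  subgoal by (elim carrier_QE; simp add: Q_simps(2-8) neg)
  subgoal by (elim carrier_QE; simp add: Q_simps(2-8) monoid.m_assoc[OF ring.is_monoid[OF AR]])
  subgoal by (elim carrier_QE; simp add: Q_simps(2-8) monoid.l_one[OF ring.is_monoid[OF AR]])
  subgoal by (elim carrier_QE; simp add: Q_simps(2-8) monoid.r_one[OF ring.is_monoid[OF AR]])
  subgoal by (elim carrier_QE; simp add: Q_simps(2-8) ring.ring_simprules(13)[OF AR])
  subgoal by (elim carrier_QE; simp add: Q_simps(2-8) ring.ring_simprules(23)[OF AR])
  subgoal by (elim carrier_QE; simp add: Q_simps(2-8) pos_cstar.smult_add_left[OF A])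
  subgoal by (elim carrier_QE; simp add: Q_simps(2-8) pos_cstar.smult_add_right[OF A])
  subgoal by (elim carrier_QE; simp add: Q_simps(2-8) pos_cstar.smult_assoc'[OF A])
  subgoal by (elim carrier_QE; simp add: Q_simps(2-8) pos_cstar.smult_one'[OF A])
  subgoal by (elim carrier_QE; simp add: Q_simps(2-8) pos_cstar.smult_mult_left[OF A])
  subgoal by (elim carrier_QE; simp add: Q_simps(2-8) pos_cstar.smult_mult_right[OF A])
  subgoal by (elim carrier_QE; simp add: Q_simps(2-8) pos_cstar.star_star[OF A])
  subgoal by (elim carrier_QE; simp add: Q_simps(2-8) pos_cstar.star_add[OF A])
  subgoal by (elim carrier_QE; simp add: Q_simps(2-8) pos_cstar.star_smult[OF A])
  subgoal by (elim carrier_QE; simp add: Q_simps(2-8) pos_cstar.star_mult[OF A])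
  subgoal by (elim carrier_QE; simp add: Q_simps(2-8) seq_norm_nonneg)
  subgoal by (rule norm0)
  subgoal by (elim carrier_QE; simp add: Q_simps(2-8) seq_norm_triangle)
  subgoal by (elim carrier_QE; simp add: Q_simps(2-8) seq_norm_smult)
  subgoal by (elim carrier_QE; simp add: Q_simps(2-8) seq_norm_mult)
  subgoal by (elim carrier_QE; simp add: Q_simps(2-8) seq_norm_cstar)
  subgoal by (rule compl)
  subgoal by (rule posi)
  done
qed

lemma Q_minus: "x \<in> T ==> y \<in> T ==> cls x \<ominus>\<^bsub>Q\<^esub> cls y = cls (\<lambda>n. x n \<ominus>\<^bsub>A n\<^esub> y n)"
 by (simp only: pos_cstar.minus_smult[OF pos_cstar_Q cls_carrier cls_carrier] Q_minus0)

lemma unital_cstar_Q: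
 assumes "\<And>n. \<one>\<^bsub>A n\<^esub> \<noteq> \<zero>\<^bsub>A n\<^esub>"
 shows "unital_cstar Q"
proof (rule pos_cstar_imp_unital_cstar[OF pos_cstar_Q])
 have "cnorm (A n) \<one>\<^bsub>A n\<^esub> = 1" for n
 proof -
  interpret An: pos_cstar "A n" by (rule A)
  have "cnorm (A n) \<one>\<^bsub>A n\<^esub> = (cnorm (A n) \<one>\<^bsub>A n\<^esub>)\<^sup>2" using An.cstar_identity[of "\<one>\<^bsub>A n\<^esub>"] by simp
  moreover have "cnorm (A n) \<one>\<^bsub>A n\<^esub> \<noteq> 0" using assms[of n] by (simp add: An.cnorm_eq_0_iff)
  ultimately show ?thesis by (simp add: power2_eq_square)
 qed
 hence "(\<lambda>n. cnorm (A n) \<one>\<^bsub>A n\<^esub>) \<longlonglongrightarrow> 1" by simp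
 hence "seq_norm A (\<lambda>n. \<one>\<^bsub>A n\<^esub>) = 1" by (rule seq_norm_unique[OF T_one])
 hence "cnorm Q \<one>\<^bsub>Q\<^esub> = 1" unfolding Q_simps(2) Q_simps(8)[OF T_one] .
 thus "\<one>\<^bsub>Q\<^esub> \<noteq> \<zero>\<^bsub>Q\<^esub>" using pos_cstar.cnorm_zero[OF pos_cstar_Q] by auto
qed

end

section \<open>Lipschitz seminorms from towers of expectations\<close>

definition tower_lip :: "('a, 'm) cstar_scheme => (nat => 'a => 'a) => (nat => real) => 'a => ennreal" where
 "tower_lip A E d a = (SUP n. ennreal (d n * cdist A a (E n a)))"

text \<open>An increasing sequence of subalgebras \<open>B n\<close> starting with the scalars, with contractive projections
  \<open>E n\<close> onto them.  \<open>B_coords\<close> is the trace of finite dimension: on \<open>B n\<close> two states are close in norm as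
  soon as they are close on finitely many elements.\<close>

locale af_tower = pos_cstar A for A :: "'a cstar" (structure) +
 fixes B :: "nat => 'a set" and E :: "nat => 'a => 'a" and d :: "nat => real"
 assumes one_neq_zero: "\<one> \<noteq> \<zero>"
  and B_carrier: "B n \<subseteq> carrier A"
  and B_mult: "a \<in> B n ==> b \<in> B n ==> a \<otimes> b \<in> B n"
  and B_mono: "B n \<subseteq> B (Suc n)"
  and B_dense: "a \<in> carrier A ==> 0 < e ==> \<exists>n. \<exists>b\<in>B n. cnorm A (a \<ominus> b) < e"
  and B_0: "b \<in> B 0 ==> \<exists>c. b = c \<odot> \<one>" and one_B_0: "\<one> \<in> B 0"
  and B_coords: "\<exists>S. finite S \<and> S \<subseteq> carrier A \<and> (\<forall>\<phi>\<in>states A. \<forall>\<psi>\<in>states A. \<forall>b\<in>B n.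
   cmod (\<phi> b - \<psi> b) \<le> cnorm A b * (\<Sum>s\<in>S. cmod (\<phi> s - \<psi> s)))"
  and E_B: "a \<in> carrier A ==> E n a \<in> B n"
  and E_id: "b \<in> B n ==> E n b = b"
  and E_add: "a \<in> carrier A ==> b \<in> carrier A ==> E n (a \<oplus> b) = E n a \<oplus> E n b"
  and E_smult: "a \<in> carrier A ==> E n (c \<odot> a) = c \<odot> E n a"
  and E_star: "a \<in> carrier A ==> E n (star A a) = star A (E n a)"
  and E_norm: "a \<in> carrier A ==> cnorm A (E n a) \<le> cnorm A a"
  and d_pos: "0 < d n" and d_lim: "filterlim d at_top sequentially"
begin

abbreviation L where "L \<equiv> tower_lip A E d"
definition res where "res n a = cnorm A (a \<ominus> E n a)"

lemma E_closed [simp]: "a \<in> carrier A ==> E n a \<in> carrier A"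
 using E_B B_carrier by blast

lemma B_le: "m \<le> n ==> B m \<subseteq> B n"
 by (rule lift_Suc_mono_le[of B]) (use B_mono in auto)

lemma E_minus: "a \<in> carrier A ==> b \<in> carrier A ==> E n (a \<ominus> b) = E n a \<ominus> E n b"
 by (simp add: minus_smult E_add E_smult)

lemma B_iff: "b \<in> B n \<longleftrightarrow> b \<in> carrier A \<and> E n b = b"
 using E_B[of b n] E_id[of b n] B_carrier by auto

lemma res_nonneg [simp]: "a \<in> carrier A ==> 0 \<le> res n a"
 by (simp add: res_def)

lemma res_B: "b \<in> B m ==> m \<le> n ==> res n b = 0"
proof -
 assume "b \<in> B m" "m \<le> n"
 hence "b \<in> B n" using B_le by blast
 thus ?thesis unfolding res_def using B_iff[of b n] by (simp add: A.minus_eq A.r_neg)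
qed

lemma res_add:
 assumes a: "a \<in> carrier A" and b: "b \<in> carrier A"
 shows "res n (a \<oplus> b) \<le> res n a + res n b"
proof -
 have "(a \<oplus> b) \<ominus> (E n a \<oplus> E n b) = (a \<ominus> E n a) \<oplus> (b \<ominus> E n b)"
  using a b E_closed[OF a, of n] E_closed[OF b, of n] by algebra
 thus ?thesis unfolding res_def E_add[OF a b]
  using cnorm_triangle[of "a \<ominus> E n a" "b \<ominus> E n b"] a b by simp
qed

lemma res_smult:
 assumes a: "a \<in> carrier A"
 shows "res n (c \<odot> a) = cmod c * res n a"
 unfolding res_def E_smult[OF a] using a by (simp add: cnorm_smult flip: smult_minus_right)

lemma res_minus:
 assumes a: "a \<in> carrier A" and b: "b \<in> carrier A"
 shows "res n (a \<ominus> b) \<le> res n a + res n b"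
 using res_add[OF a, of "(-1) \<odot> b" n] res_smult[OF b, of n "-1"] b by (simp add: minus_smult[OF a b])

text \<open>The product of the approximants \<open>E n a\<close> and \<open>E n b\<close> lies in \<open>B n\<close>, and the residue is at most twice the
  distance to any element of \<open>B n\<close>.  This is the source of the constant \<open>2\<close> in the Leibniz inequality.\<close>

lemma res_mult:
 assumes a: "a \<in> carrier A" and b: "b \<in> carrier A"
 shows "res n (a \<otimes> b) \<le> 2 * (cnorm A a * res n b + res n a * cnorm A b)"
proof -
 let ?p = "E n a \<otimes> E n b"
 have p: "?p \<in> B n" using B_mult E_B a b by blast
 have pc: "?p \<in> carrier A" using a b by simp
 have 1: "cnorm A (a \<otimes> b \<ominus> ?p) \<le> cnorm A a * res n b + res n a * cnorm A b"
 proof -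
  have "cnorm A (a \<otimes> b \<ominus> ?p) \<le> cnorm A a * cnorm A (b \<ominus> E n b) + cnorm A (a \<ominus> E n a) * cnorm A (E n b)"
   by (rule cnorm_mult_dist) (use a b in auto)
  also have "\<dots> \<le> cnorm A a * res n b + res n a * cnorm A b"
   unfolding res_def by (intro add_left_mono mult_left_mono E_norm b) (use a in simp)
  finally show ?thesis .
 qed
 have "cnorm A (?p \<ominus> E n (a \<otimes> b)) = cnorm A (E n (a \<otimes> b \<ominus> ?p))"
  using E_minus[of "a \<otimes> b" ?p n] E_id[OF p] a b pc by (simp add: cnorm_minus_commute)
 also have "\<dots> \<le> cnorm A (a \<otimes> b \<ominus> ?p)" by (rule E_norm) (use a b in simp)
 finally show ?thesis
  using 1 cnorm_dist_triangle[of "a \<otimes> b" ?p "E n (a \<otimes> b)"] a b by (simp add: res_def)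
qed

lemma res_E0: "a \<in> carrier A ==> res n (a \<ominus> E 0 a) = res n a"
proof -
 assume a: "a \<in> carrier A"
 have e: "E n (E 0 a) = E 0 a" using E_id[of "E 0 a" n] B_le[of 0 n] E_B[OF a, of 0] by blast
 have "(a \<ominus> E 0 a) \<ominus> (E n a \<ominus> E 0 a) = a \<ominus> E n a"
  using a E_closed[OF a, of n] E_closed[OF a, of 0] by algebra
 thus ?thesis unfolding res_def using a by (simp add: E_minus e)
qed

lemma L_res: "L a = (SUP n. ennreal (d n * res n a))"
 by (simp add: tower_lip_def res_def)

lemma L_le_iff: "a \<in> carrier A ==> 0 \<le> c ==> L a \<le> ennreal c \<longleftrightarrow> (\<forall>n. d n * res n a \<le> c)"
 by (simp add: L_res SUP_le_iff)

lemma L_upper: "ennreal (d n * res n a) \<le> L a"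
 unfolding L_res by (rule SUP_upper) simp

lemma lip_ball_res: "a \<in> lip_ball A L ==> res n a \<le> 1 / d n"
proof -
 assume a: "a \<in> lip_ball A L"
 hence "L a \<le> ennreal 1" and ac: "a \<in> carrier A" by (auto simp: lip_ball_def self_adjoint_def)
 hence "d n * res n a \<le> 1" using L_le_iff[OF ac, of 1] by simp
 thus ?thesis using d_pos[of n] by (simp add: field_simps)
qed

lemma lip_ball_iff: "a \<in> lip_ball A L \<longleftrightarrow> a \<in> self_adjoint A \<and> (\<forall>n. d n * res n a \<le> 1)"
 using L_le_iff[of a 1] self_adjointD(1)[of a] by (auto simp: lip_ball_def)

lemma L_add: "a \<in> carrier A ==> b \<in> carrier A ==> L (a \<oplus> b) \<le> L a + L b"
proof -
 assume a: "a \<in> carrier A" and b: "b \<in> carrier A"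
 have "ennreal (d n * res n (a \<oplus> b)) \<le> L a + L b" for n
 proof -
  have "d n * res n (a \<oplus> b) \<le> d n * res n a + d n * res n b"
   using mult_left_mono[OF res_add[OF a b, of n], of "d n"] d_pos[of n] by (simp add: distrib_left)
  hence "ennreal (d n * res n (a \<oplus> b)) \<le> ennreal (d n * res n a + d n * res n b)" by (rule ennreal_leI)
  also have "\<dots> = ennreal (d n * res n a) + ennreal (d n * res n b)"
   using a b d_pos[of n] by (intro ennreal_plus) auto
  also have "\<dots> \<le> L a + L b" by (intro add_mono L_upper)
  finally show ?thesis .
 qed
 thus ?thesis unfolding L_res[of "a \<oplus> b"] by (intro SUP_least)
qed

lemma L_smult: "a \<in> carrier A ==> L (c \<odot> a) = ennreal (cmod c) * L a"
proof -
 assume a: "a \<in> carrier A"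
 have "ennreal (d n * res n (c \<odot> a)) = ennreal (cmod c) * ennreal (d n * res n a)" for n
 proof -
  have "d n * res n (c \<odot> a) = cmod c * (d n * res n a)" using res_smult[OF a] by simp
  thus ?thesis using a d_pos[of n] by (simp only: ennreal_mult[OF norm_ge_zero] mult_nonneg_nonneg[OF less_imp_le res_nonneg])
 qed
 thus ?thesis unfolding L_res by (simp only: SUP_mult_left_ennreal)
qed

lemma L_Leibniz_aux:
 assumes a: "a \<in> carrier A" and b: "b \<in> carrier A"
  and x: "\<And>n. res n x \<le> (1/2) * (res n (a \<otimes> b) + res n (b \<otimes> a))"
 shows "L x \<le> 2 * (ennreal (cnorm A a) * L b + ennreal (cnorm A b) * L a)"
proof -
 have "ennreal (d n * res n x) \<le> 2 * (ennreal (cnorm A a) * L b + ennreal (cnorm A b) * L a)" for n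
 proof -
  have dn: "0 \<le> d n" using d_pos[of n] by simp
  have "res n x \<le> 2 * (cnorm A a * res n b + cnorm A b * res n a)"
   using x[of n] res_mult[OF a b, of n] res_mult[OF b a, of n] by (simp add: mult.commute)
  hence "d n * res n x \<le> d n * (2 * (cnorm A a * res n b + cnorm A b * res n a))"
   by (rule mult_left_mono) (rule dn)
  also have "\<dots> = 2 * (cnorm A a * (d n * res n b) + cnorm A b * (d n * res n a))"
   by (simp add: algebra_simps)
  finally have "ennreal (d n * res n x) \<le> ennreal (2 * (cnorm A a * (d n * res n b) + cnorm A b * (d n * res n a)))"
   by (rule ennreal_leI)
  also have "\<dots> = 2 * (ennreal (cnorm A a) * ennreal (d n * res n b) + ennreal (cnorm A b) * ennreal (d n * res n a))"
   using a b dn by (simp add: ennreal_mult ennreal_plus mult_nonneg_nonneg del: ennreal_plus[symmetric])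
  also have "\<dots> \<le> 2 * (ennreal (cnorm A a) * L b + ennreal (cnorm A b) * L a)"
   by (intro mult_left_mono add_mono L_upper) auto
  finally show ?thesis .
 qed
 thus ?thesis unfolding L_res[of x] by (intro SUP_least)
qed

lemma jordan_lie_self_adjoint:
 assumes "a \<in> self_adjoint A" "b \<in> self_adjoint A"
 shows "jordan_prod A a b \<in> self_adjoint A" "lie_prod A a b \<in> self_adjoint A"
proof -
 have c: "a \<in> carrier A" "b \<in> carrier A" using assms self_adjointD by auto
 note s = self_adjointD(2)[OF assms(1)] self_adjointD(2)[OF assms(2)]
 show "jordan_prod A a b \<in> self_adjoint A"
  unfolding jordan_prod_def using c s A.a_comm[of "a \<otimes> b" "b \<otimes> a"]
  by (intro self_adjointI) (simp_all add: star_smult star_add star_mult)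
 have "(- (1 / (2 * \<i>))) \<odot> (b \<otimes> a \<ominus> a \<otimes> b) = (1 / (2 * \<i>)) \<odot> (a \<otimes> b \<ominus> b \<otimes> a)"
  using smult_assoc'[of "b \<otimes> a \<ominus> a \<otimes> b" "1/(2*\<i>)" "-1"] uminus_smult[of "b \<otimes> a \<ominus> a \<otimes> b"]
   minus_swap[of "a \<otimes> b" "b \<otimes> a"] c by simp
 thus "lie_prod A a b \<in> self_adjoint A"
  unfolding lie_prod_def using c s
  by (intro self_adjointI) (simp_all add: star_smult star_minus star_mult)
qed

lemma L_jordan_lie:
 assumes "a \<in> self_adjoint A" "b \<in> self_adjoint A"
 shows "L (jordan_prod A a b) \<le> 2 * (ennreal (cnorm A a) * L b + ennreal (cnorm A b) * L a)"
  "L (lie_prod A a b) \<le> 2 * (ennreal (cnorm A a) * L b + ennreal (cnorm A b) * L a)"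
proof -
 have c: "a \<in> carrier A" "b \<in> carrier A" using assms self_adjointD by auto
 show "L (jordan_prod A a b) \<le> 2 * (ennreal (cnorm A a) * L b + ennreal (cnorm A b) * L a)"
  by (rule L_Leibniz_aux[OF c]) (use c res_add[of "a \<otimes> b" "b \<otimes> a"] in \<open>simp add: jordan_prod_def res_smult\<close>)
 show "L (lie_prod A a b) \<le> 2 * (ennreal (cnorm A a) * L b + ennreal (cnorm A b) * L a)"
  by (rule L_Leibniz_aux[OF c]) (use c res_minus[of "a \<otimes> b" "b \<otimes> a"] in \<open>simp add: lie_prod_def res_smult norm_divide norm_mult\<close>)
qed

lemma B_lip:
 assumes b: "b \<in> B n"
 shows "L b < \<infinity>"
proof -
 have bc: "b \<in> carrier A" using b B_carrier by blast
 let ?c = "\<Sum>m<n. d m * res m b"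
 have c0: "0 \<le> d m * res m b" for m using d_pos[of m] bc by simp
 have "d m * res m b \<le> ?c" for m
 proof (cases "m < n")
  case True
  show ?thesis by (rule member_le_sum[of m "{..<n}" "\<lambda>m. d m * res m b"]) (use True c0 in auto)
 next
  case False
  thus ?thesis using res_B[OF b, of m] c0 by (simp add: sum_nonneg)
 qed
 hence "L b \<le> ennreal ?c" using L_le_iff[OF bc, of ?c] c0 by (simp add: sum_nonneg)
 thus ?thesis using le_less_trans by fastforce
qed

lemma lip_dense:
 assumes a: "a \<in> self_adjoint A" and e: "0 < e"
 shows "\<exists>b\<in>self_adjoint A. L b < \<infinity> \<and> cnorm A (a \<ominus> b) < e"
proof -
 have ac: "a \<in> carrier A" using a self_adjointD by blast
 obtain n b where b: "b \<in> B n" "cnorm A (a \<ominus> b) < e" using B_dense[OF ac e] by blast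
 have bc: "b \<in> carrier A" using b B_carrier by blast
 have "E n (re_part b) = re_part b"
  unfolding re_part_def using bc E_id[OF b(1)] by (simp add: E_smult E_add E_star)
 hence rB: "re_part b \<in> B n" using B_iff re_im_part(1)[OF bc] self_adjointD(1) by blast
 have "re_part (a \<ominus> b) = (1/2) \<odot> ((a \<oplus> star A a) \<ominus> (b \<oplus> star A b))"
 proof -
  have "(a \<ominus> b) \<oplus> (star A a \<ominus> star A b) = (a \<oplus> star A a) \<ominus> (b \<oplus> star A b)"
   using ac bc star_closed[OF ac] star_closed[OF bc] by algebra
  thus ?thesis unfolding re_part_def using ac bc by (simp add: star_minus)
 qed
 also have "\<dots> = (1/2) \<odot> (a \<oplus> star A a) \<ominus> re_part b"
  unfolding re_part_def using ac bc by (simp add: smult_minus_right)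
 also have "(1/2) \<odot> (a \<oplus> star A a) = a"
 proof -
  have "a \<oplus> star A a = (2::complex) \<odot> a" using self_adjointD(2)[OF a] smult_add_left[of a 1 1] ac by simp
  thus ?thesis using smult_assoc'[OF ac, of "1/2" 2] ac by simp
 qed
 finally have "cnorm A (a \<ominus> re_part b) < e" using re_im_part(4)[of "a \<ominus> b"] b(2) ac bc by simp
 thus ?thesis using B_lip[OF rB] re_im_part(1)[OF bc] by blast
qed

lemma cnorm_one_pos: "0 < cnorm A \<one>"
 using cnorm_nonneg[OF A.one_closed] cnorm_eq_0_iff[OF A.one_closed] one_neq_zero by (simp add: less_le)

lemma one_B: "\<one> \<in> B n" using one_B_0 B_le[of 0 n] by blast

lemma L_kernel: "{a \<in> self_adjoint A. L a = 0} = range (\<lambda>t::real. cor t \<odot> \<one>)"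
proof (intro equalityI subsetI)
 fix a assume "a \<in> {a \<in> self_adjoint A. L a = 0}"
 hence a: "a \<in> self_adjoint A" "L a = 0" by auto
 have ac: "a \<in> carrier A" using a self_adjointD by blast
 have "d 0 * res 0 a \<le> 0" using L_le_iff[OF ac, of 0] a by simp
 hence "res 0 a \<le> 0" using d_pos[of 0] by (simp add: mult_le_0_iff)
 hence "cnorm A (a \<ominus> E 0 a) = 0" using res_nonneg[OF ac, of 0] by (simp add: res_def)
 hence "a = E 0 a" using cnorm_minus_eq_0 ac by simp
 then obtain c where c: "a = c \<odot> \<one>" using B_0[OF E_B[OF ac]] by metis
 have "c \<odot> \<one> = cnj c \<odot> \<one>" using self_adjointD(2)[OF a(1)] unfolding c by (simp add: star_smult)
 hence "(c - cnj c) \<odot> \<one> = \<zero>" by (simp add: smult_minus_left A.minus_eq A.r_neg)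
 hence "cmod (c - cnj c) * cnorm A \<one> = 0" using cnorm_smult[of \<one> "c - cnj c"] by simp
 hence "c = cnj c" using cnorm_one_pos by simp
 hence "c = cor (Re c)" by (simp add: complex_eq_iff)
 from arg_cong[OF this, of "\<lambda>x. x \<odot> \<one>"] have "a = cor (Re c) \<odot> \<one>" unfolding c .
 thus "a \<in> range (\<lambda>t::real. cor t \<odot> \<one>)" by (rule range_eqI)
next
 fix a assume "a \<in> range (\<lambda>t::real. cor t \<odot> \<one>)"
 then obtain t where t: "a = cor t \<odot> \<one>" by blast
 have "a \<in> self_adjoint A" unfolding t by (intro self_adjointI) (simp_all add: star_smult)
 moreover have "L a = 0"
 proof -
  have "res n a = 0" for n using res_smult[of \<one> n "cor t"] res_B[OF one_B, of n n] unfolding t by simp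
  thus ?thesis by (simp add: L_res)
 qed
 ultimately show "a \<in> {a \<in> self_adjoint A. L a = 0}" by simp
qed

lemma res_diff:
 assumes a: "a \<in> carrier A" and b: "b \<in> carrier A"
 shows "\<bar>res n a - res n b\<bar> \<le> 2 * cnorm A (a \<ominus> b)"
proof -
 have le: "res n a \<le> res n b + 2 * cnorm A (a \<ominus> b)" if a: "a \<in> carrier A" and b: "b \<in> carrier A" for a b
 proof -
  have "res n (a \<ominus> b) \<le> cnorm A (a \<ominus> b) + cnorm A (E n (a \<ominus> b))"
   unfolding res_def by (rule cnorm_minus_le) (use a b in auto)
  also have "\<dots> \<le> 2 * cnorm A (a \<ominus> b)" using E_norm[of "a \<ominus> b" n] a b by simp
  finally have "res n (a \<ominus> b) \<le> 2 * cnorm A (a \<ominus> b)" .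
  moreover have "a = (a \<ominus> b) \<oplus> b" using a b by algebra
  ultimately show ?thesis using res_add[of "a \<ominus> b" b n] a b by simp
 qed
 show ?thesis using le[OF a b] le[OF b a] cnorm_minus_commute[OF a b] by simp
qed

lemma L_lower_semicontinuous: "lower_semicontinuous_lip A L"
 unfolding lower_semicontinuous_lip_def
proof (intro allI ballI impI, elim conjE)
 fix s a assume a: "a \<in> self_adjoint A" and s: "\<forall>n::nat. s n \<in> self_adjoint A"
  and lim: "(\<lambda>n. cnorm A (s n \<ominus> a)) \<longlonglongrightarrow> 0"
 have ac: "a \<in> carrier A" and sc: "\<And>k. s k \<in> carrier A" using a s self_adjointD by blast+
 show "L a \<le> liminf (\<lambda>n. L (s n))"
  unfolding L_res[of a]
 proof (rule SUP_least)
  fix n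
  have "(\<lambda>k. \<bar>res n (s k) - res n a\<bar>) \<longlonglongrightarrow> 0"
  proof (rule null_seq_le)
   show "\<bar>res n (s k) - res n a\<bar> \<le> 2 * cnorm A (s k \<ominus> a)" for k by (rule res_diff[OF sc ac])
   show "(\<lambda>k. 2 * cnorm A (s k \<ominus> a)) \<longlonglongrightarrow> 0" using tendsto_mult_left[OF lim, of 2] by simp
  qed simp
  hence "(\<lambda>k. res n (s k)) \<longlonglongrightarrow> res n a" by (simp add: LIM_zero_cancel tendsto_rabs_zero_iff)
  hence "(\<lambda>k. ennreal (d n * res n (s k))) \<longlonglongrightarrow> ennreal (d n * res n a)"
   by (intro tendsto_ennrealI tendsto_mult_left)
  hence "liminf (\<lambda>k. ennreal (d n * res n (s k))) = ennreal (d n * res n a)"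
   by (intro lim_imp_Liminf) simp_all
  moreover have "liminf (\<lambda>k. ennreal (d n * res n (s k))) \<le> liminf (\<lambda>k. L (s k))"
   by (rule Liminf_mono) (simp add: L_upper)
  ultimately show "ennreal (d n * res n a) \<le> liminf (\<lambda>k. L (s k))" by simp
 qed
qed

lemma self_adjoint_E:
 assumes "a \<in> self_adjoint A" shows "E n a \<in> self_adjoint A"
 using self_adjointD[OF assms] E_star[of a n] by (intro self_adjointI) auto

lemma self_adjoint_minus:
 assumes "a \<in> self_adjoint A" "b \<in> self_adjoint A" shows "a \<ominus> b \<in> self_adjoint A"
 using self_adjointD[OF assms(1)] self_adjointD[OF assms(2)] by (intro self_adjointI) (auto simp: star_minus)

lemma states_agree_on_B0:
 assumes "\<phi> \<in> states A" "\<psi> \<in> states A" "b \<in> B 0"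
 shows "\<phi> b = \<psi> b"
proof -
 obtain c where "b = c \<odot> \<one>" using B_0[OF assms(3)] by blast
 thus ?thesis using states_D(2,4)[OF assms(1)] states_D(2,4)[OF assms(2)] by simp
qed

text \<open>States do not see scalars, so an element of the ball may be replaced by the difference to its level
  \<open>0\<close> part, which has norm at most \<open>1 / d 0\<close>; its level \<open>n\<close> part is then bounded and approximates it up to
  \<open>1 / d n\<close>.\<close>

lemma states_diff_ball:
 assumes \<phi>: "\<phi> \<in> states A" and \<psi>: "\<psi> \<in> states A" and a: "a \<in> lip_ball A L"
 shows "cmod (\<phi> a - \<psi> a) \<le> cmod (\<phi> (E n (a \<ominus> E 0 a)) - \<psi> (E n (a \<ominus> E 0 a))) + 2 / d n"
proof -
 have asa: "a \<in> self_adjoint A" using a by (simp add: lip_ball_def)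
 have ac: "a \<in> carrier A" using asa self_adjointD by blast
 let ?a = "a \<ominus> E 0 a"
 have a0: "?a \<in> self_adjoint A" using self_adjoint_minus[OF asa self_adjoint_E[OF asa]] .
 have a0c: "?a \<in> carrier A" using a0 self_adjointD by blast
 have sa: "?a \<ominus> E n ?a \<in> self_adjoint A" using self_adjoint_minus[OF a0 self_adjoint_E[OF a0]] .
 have eq: "\<rho> a = \<rho> (E 0 a) + (\<rho> (E n ?a) + \<rho> (?a \<ominus> E n ?a))" if "\<rho> \<in> states A" for \<rho>
  using states_minus[OF that a0c E_closed[OF a0c]] states_minus[OF that ac E_closed[OF ac]] by simp
 have small: "cmod (\<rho> (?a \<ominus> E n ?a)) \<le> 1 / d n" if "\<rho> \<in> states A" for \<rho>
  using states_self_adjoint_bound(2)[OF that sa] res_E0[OF ac, of n] lip_ball_res[OF a, of n] by (simp add: res_def)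
 have "\<phi> a - \<psi> a = (\<phi> (E n ?a) - \<psi> (E n ?a)) + (\<phi> (?a \<ominus> E n ?a) - \<psi> (?a \<ominus> E n ?a))"
  using eq[OF \<phi>] eq[OF \<psi>] states_agree_on_B0[OF \<phi> \<psi> E_B[OF ac]] by simp
 hence "cmod (\<phi> a - \<psi> a) \<le> cmod (\<phi> (E n ?a) - \<psi> (E n ?a)) + cmod (\<phi> (?a \<ominus> E n ?a) - \<psi> (?a \<ominus> E n ?a))"
  using norm_triangle_ineq by metis
 also have "cmod (\<phi> (?a \<ominus> E n ?a) - \<psi> (?a \<ominus> E n ?a)) \<le> 1 / d n + 1 / d n"
  using norm_triangle_ineq4[of "\<phi> (?a \<ominus> E n ?a)" "\<psi> (?a \<ominus> E n ?a)"] small[OF \<phi>] small[OF \<psi>] by linarith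
 finally show ?thesis by simp
qed

lemma mk_dist_le:
 assumes \<phi>: "\<phi> \<in> states A" and \<psi>: "\<psi> \<in> states A" and agree: "\<And>b. b \<in> B n ==> \<phi> b = \<psi> b"
 shows "mk_dist A L \<phi> \<psi> \<le> ennreal (2 / d n)"
 unfolding mk_dist_def
proof (rule SUP_least)
 fix a assume a: "a \<in> lip_ball A L"
 hence "a \<in> carrier A" by (simp add: lip_ball_def self_adjoint_def)
 hence "E n (a \<ominus> E 0 a) \<in> B n" by (intro E_B) simp
 thus "ennreal (cmod (\<phi> a - \<psi> a)) \<le> ennreal (2 / d n)"
  using states_diff_ball[OF \<phi> \<psi> a, of n] agree by (intro ennreal_leI) simp
qed

definition mkd where "mkd \<phi> \<psi> = enn2real (mk_dist A L \<phi> \<psi>)"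

lemma mk_dist_finite: "\<phi> \<in> states A ==> \<psi> \<in> states A ==> mk_dist A L \<phi> \<psi> < \<infinity>"
 using mk_dist_le[of \<phi> \<psi> 0] states_agree_on_B0 by (metis ennreal_less_top infinity_ennreal_def order_le_less_trans)

lemma mkd_upper:
 assumes "\<phi> \<in> states A" "\<psi> \<in> states A" "a \<in> lip_ball A L"
 shows "cmod (\<phi> a - \<psi> a) \<le> mkd \<phi> \<psi>"
proof -
 have "ennreal (cmod (\<phi> a - \<psi> a)) \<le> mk_dist A L \<phi> \<psi>" unfolding mk_dist_def by (rule SUP_upper[OF assms(3)])
 hence "enn2real (ennreal (cmod (\<phi> a - \<psi> a))) \<le> mkd \<phi> \<psi>"
  unfolding mkd_def using mk_dist_finite[OF assms(1,2)] by (intro enn2real_mono) simp_all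
 thus ?thesis by simp
qed

lemma mkd_least:
 assumes "0 \<le> c" "\<And>a. a \<in> lip_ball A L ==> cmod (\<phi> a - \<psi> a) \<le> c"
 shows "mkd \<phi> \<psi> \<le> c"
proof -
 have "mk_dist A L \<phi> \<psi> \<le> ennreal c" unfolding mk_dist_def by (rule SUP_least) (intro ennreal_leI assms)
 thus ?thesis unfolding mkd_def using assms(1) by (rule enn2real_leI[rotated])
qed

lemma mkd_nonneg: "0 \<le> mkd \<phi> \<psi>" by (simp add: mkd_def)

lemma mkd_lip:
 assumes \<phi>: "\<phi> \<in> states A" and \<psi>: "\<psi> \<in> states A" and b: "b \<in> self_adjoint A" "L b < \<infinity>"
 shows "cmod (\<phi> b - \<psi> b) \<le> (enn2real (L b) + 1) * mkd \<phi> \<psi>"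
proof -
 let ?l = "enn2real (L b) + 1"
 have l: "0 < ?l" using enn2real_nonneg[of "L b"] by linarith
 have bc: "b \<in> carrier A" using b self_adjointD by blast
 let ?b = "cor (1/?l) \<odot> b"
 have "L ?b = ennreal (1/?l) * L b" using L_smult[OF bc] l by (simp add: norm_divide del: of_real_divide of_real_add)
 also have "\<dots> = ennreal (1/?l) * ennreal (enn2real (L b))" using b(2) by simp
 also have "\<dots> = ennreal (1/?l * enn2real (L b))" using l by (intro ennreal_mult[symmetric]) auto
 also have "\<dots> \<le> 1" using l by (simp add: field_simps)
 finally have "?b \<in> lip_ball A L" using b(1) bc self_adjointD(2)[OF b(1)]
  unfolding lip_ball_def by (auto intro!: self_adjointI simp: star_smult)
 from mkd_upper[OF \<phi> \<psi> this] have "cmod (cor (1/?l) * (\<phi> b - \<psi> b)) \<le> mkd \<phi> \<psi>"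
  using states_D(2)[OF \<phi> bc] states_D(2)[OF \<psi> bc] by (simp only: right_diff_distrib)
 moreover have inv: "0 < 1/?l" using l by simp
 ultimately have "(1/?l) * cmod (\<phi> b - \<psi> b) \<le> mkd \<phi> \<psi>"
  using abs_of_pos[OF inv] by (simp only: norm_mult norm_of_real)
 thus ?thesis using l by (simp add: field_simps)
qed

lemma mkd_controls_sa:
 assumes a: "a \<in> self_adjoint A" and e: "0 < e"
 shows "\<exists>r>0. \<forall>\<phi>\<in>states A. \<forall>\<psi>\<in>states A. mkd \<phi> \<psi> < r \<longrightarrow> cmod (\<phi> a - \<psi> a) < e"
proof -
 have e4: "0 < e/4" using e by simp
 obtain b where b: "b \<in> self_adjoint A" "L b < \<infinity>" "cnorm A (a \<ominus> b) < e/4" using lip_dense[OF a e4] by blast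
 have c: "a \<in> carrier A" "b \<in> carrier A" using a b self_adjointD by auto
 let ?l = "enn2real (L b) + 1"
 have l: "0 < ?l" using enn2real_nonneg[of "L b"] by linarith
 show ?thesis
 proof (intro exI[of _ "e / (2 * ?l)"] conjI ballI impI)
  show "0 < e / (2 * ?l)" using e l by simp
  fix \<phi> \<psi> assume \<phi>: "\<phi> \<in> states A" and \<psi>: "\<psi> \<in> states A" and m: "mkd \<phi> \<psi> < e / (2 * ?l)"
  have "?l * mkd \<phi> \<psi> < e / 2" using m l by (simp add: field_simps)
  hence 1: "cmod (\<phi> b - \<psi> b) < e/2" using mkd_lip[OF \<phi> \<psi> b(1,2)] by linarith
  have 2: "cmod (\<rho> (a \<ominus> b)) < e/4" if "\<rho> \<in> states A" for \<rho>
   using states_self_adjoint_bound(2)[OF that self_adjoint_minus[OF a b(1)]] b(3) by linarith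
  have "\<phi> a - \<psi> a = (\<phi> b - \<psi> b) + (\<phi> (a \<ominus> b) - \<psi> (a \<ominus> b))"
   using states_minus[OF \<phi> c] states_minus[OF \<psi> c] by simp
  hence "cmod (\<phi> a - \<psi> a) \<le> cmod (\<phi> b - \<psi> b) + (cmod (\<phi> (a \<ominus> b)) + cmod (\<psi> (a \<ominus> b)))"
   using norm_triangle_ineq[of "\<phi> b - \<psi> b" "\<phi> (a \<ominus> b) - \<psi> (a \<ominus> b)"] norm_triangle_ineq4[of "\<phi> (a \<ominus> b)" "\<psi> (a \<ominus> b)"] by simp
  thus "cmod (\<phi> a - \<psi> a) < e" using 1 2[OF \<phi>] 2[OF \<psi>] by linarith
 qed
qed

lemma mkd_controls:
 assumes a: "a \<in> carrier A" and e: "0 < e"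
 shows "\<exists>r>0. \<forall>\<phi>\<in>states A. \<forall>\<psi>\<in>states A. mkd \<phi> \<psi> < r \<longrightarrow> cmod (\<phi> a - \<psi> a) < e"
proof -
 note ri = re_im_part[OF a]
 have c: "re_part a \<in> carrier A" "im_part a \<in> carrier A" using ri self_adjointD by auto
 have e2: "0 < e/2" using e by simp
 obtain r1 where r1: "r1 > 0" "\<And>\<phi> \<psi>. \<phi>\<in>states A ==> \<psi>\<in>states A ==> mkd \<phi> \<psi> < r1 ==> cmod (\<phi> (re_part a) - \<psi> (re_part a)) < e/2"
  using mkd_controls_sa[OF ri(1) e2] by blast
 obtain r2 where r2: "r2 > 0" "\<And>\<phi> \<psi>. \<phi>\<in>states A ==> \<psi>\<in>states A ==> mkd \<phi> \<psi> < r2 ==> cmod (\<phi> (im_part a) - \<psi> (im_part a)) < e/2"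
  using mkd_controls_sa[OF ri(2) e2] by blast
 show ?thesis
 proof (intro exI[of _ "min r1 r2"] conjI ballI impI)
  show "0 < min r1 r2" using r1 r2 by simp
  fix \<phi> \<psi> assume \<phi>: "\<phi> \<in> states A" and \<psi>: "\<psi> \<in> states A" and m: "mkd \<phi> \<psi> < min r1 r2"
  have eq: "\<rho> a = \<rho> (re_part a) + \<i> * \<rho> (im_part a)" if "\<rho> \<in> states A" for \<rho>
   using states_D(1)[OF that c(1), of "\<i> \<odot> im_part a"] states_D(2)[OF that c(2), of \<i>] ri(3) c by simp
  have "\<phi> a - \<psi> a = (\<phi> (re_part a) - \<psi> (re_part a)) + \<i> * (\<phi> (im_part a) - \<psi> (im_part a))"
   unfolding eq[OF \<phi>] eq[OF \<psi>] by (simp add: algebra_simps)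
  hence "cmod (\<phi> a - \<psi> a) \<le> cmod (\<phi> (re_part a) - \<psi> (re_part a)) + cmod (\<phi> (im_part a) - \<psi> (im_part a))"
   by (metis mult_1 norm_ii norm_mult norm_triangle_ineq)
  thus "cmod (\<phi> a - \<psi> a) < e" using r1(2)[OF \<phi> \<psi>] r2(2)[OF \<phi> \<psi>] m by simp
 qed
qed

lemma Metric_space_mkd: "Metric_space (states A) mkd"
proof
 show "0 \<le> mkd \<phi> \<psi>" for \<phi> \<psi> by (rule mkd_nonneg)
 show "mkd \<phi> \<psi> = mkd \<psi> \<phi>" for \<phi> \<psi> by (simp add: mkd_def mk_dist_def norm_minus_commute)
next
 fix \<phi> \<psi> \<rho> assume s: "\<phi> \<in> states A" "\<psi> \<in> states A" "\<rho> \<in> states A"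
 show "mkd \<phi> \<rho> \<le> mkd \<phi> \<psi> + mkd \<psi> \<rho>"
 proof (rule mkd_least)
  fix a assume a: "a \<in> lip_ball A L"
  show "cmod (\<phi> a - \<rho> a) \<le> mkd \<phi> \<psi> + mkd \<psi> \<rho>"
   using mkd_upper[OF s(1,2) a] mkd_upper[OF s(2,3) a] norm_triangle_ineq[of "\<phi> a - \<psi> a" "\<psi> a - \<rho> a"] by simp
 qed (simp add: mkd_nonneg)
next
 fix \<phi> \<psi> assume s: "\<phi> \<in> states A" "\<psi> \<in> states A"
 show "(mkd \<phi> \<psi> = 0) = (\<phi> = \<psi>)"
 proof
  assume 0: "mkd \<phi> \<psi> = 0"
  show "\<phi> = \<psi>"
  proof (rule extensionalityI[OF states_D(5)[OF s(1)] states_D(5)[OF s(2)]])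
   fix a assume a: "a \<in> carrier A"
   have "cmod (\<phi> a - \<psi> a) \<le> 0"
   proof (rule field_le_epsilon)
    fix e :: real assume "0 < e"
    thus "cmod (\<phi> a - \<psi> a) \<le> 0 + e" using mkd_controls[OF a \<open>0 < e\<close>] 0 s by force
   qed
   thus "\<phi> a = \<psi> a" by simp
  qed
 next
  assume "\<phi> = \<psi>"
  thus "mkd \<phi> \<psi> = 0" using mkd_least[of 0 \<phi> \<psi>] mkd_nonneg[of \<phi> \<psi>] by simp
 qed
qed

lemma topspace_weak_star: "topspace (weak_star_topology A) = states A"
 unfolding weak_star_topology_def using states_D(5) by (auto simp: PiE_def Pi_def)

lemma continuous_map_eval:
 assumes "a \<in> carrier A"
 shows "continuous_map (weak_star_topology A) euclidean (\<lambda>\<phi>. \<phi> a)"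
 unfolding weak_star_topology_def
 by (intro continuous_map_from_subtopology continuous_map_product_projection assms)

text \<open>Weak* convergence gives convergence on the finitely many coordinates of a level uniformly over the
  ball; conversely elements of finite seminorm are dense and states are uniformly bounded.\<close>

lemma mk_metrizes: "mk_metrizes_weak_star A L"
proof -
 interpret M: Metric_space "states A" mkd by (rule Metric_space_mkd)
 have "M.mtopology = weak_star_topology A"
 proof (rule topology_eq[THEN iffD2], intro allI iffI)
  fix U assume U: "openin M.mtopology U"
  show "openin (weak_star_topology A) U"
  proof (subst openin_subopen, intro ballI)
   fix \<phi> assume \<phi>U: "\<phi> \<in> U"
   have \<phi>: "\<phi> \<in> states A" using U \<phi>U M.openin_mtopology by blast
   obtain e where e: "e > 0" "M.mball \<phi> e \<subseteq> U" using U \<phi>U M.openin_mtopology by blast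
   have "\<forall>\<^sub>F n in sequentially. 8 / e < d n" using d_lim filterlim_at_top_dense by blast
   then obtain n where "8 / e < d n" by (meson eventually_happens' sequentially_bot)
   hence n: "2 / d n < e / 2" using e(1) d_pos[of n] by (simp add: field_simps)
   obtain S where S: "finite S" "S \<subseteq> carrier A" "\<And>\<psi> b. \<psi> \<in> states A ==> b \<in> B n ==>
    cmod (\<phi> b - \<psi> b) \<le> cnorm A b * (\<Sum>s\<in>S. cmod (\<phi> s - \<psi> s))"
    using B_coords[of n] \<phi> by meson
   define h where "h \<psi> = (1 / d 0) * (\<Sum>s\<in>S. cmod (\<phi> s - \<psi> s))" for \<psi>
   have hc: "continuous_map (weak_star_topology A) euclideanreal h"
    unfolding h_def
    by (intro continuous_map_real_mult_left continuous_map_sum continuous_map_norm continuous_map_diff continuous_map_eval continuous_map_const[THEN iffD2] S(1))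
     (use S(2) in auto)
   define V where "V = {\<psi> \<in> topspace (weak_star_topology A). h \<psi> \<in> {..<e/2}}"
   have "openin (weak_star_topology A) V"
    unfolding V_def by (rule openin_continuous_map_preimage[OF hc]) simp
   moreover have "\<phi> \<in> V" using \<phi> e(1) by (simp add: V_def topspace_weak_star h_def)
   moreover have "V \<subseteq> U"
   proof
    fix \<psi> assume "\<psi> \<in> V"
    hence \<psi>: "\<psi> \<in> states A" and h: "h \<psi> < e/2" by (auto simp: V_def topspace_weak_star)
    have h0: "0 \<le> h \<psi>" using d_pos[of 0] by (simp add: h_def sum_nonneg)
    have "mkd \<phi> \<psi> \<le> h \<psi> + 2 / d n"
    proof (rule mkd_least)
     show "0 \<le> h \<psi> + 2 / d n" using h0 d_pos[of n] by simp
     fix a assume a: "a \<in> lip_ball A L"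
     have ac: "a \<in> carrier A" using a by (simp add: lip_ball_def self_adjoint_def)
     let ?b = "E n (a \<ominus> E 0 a)"
     have "cnorm A ?b \<le> 1 / d 0"
      using E_norm[of "a \<ominus> E 0 a" n] lip_ball_res[OF a, of 0] ac by (simp add: res_def)
     hence "cnorm A ?b * (\<Sum>s\<in>S. cmod (\<phi> s - \<psi> s)) \<le> h \<psi>"
      unfolding h_def by (rule mult_right_mono) (simp add: sum_nonneg)
     hence "cmod (\<phi> ?b - \<psi> ?b) \<le> h \<psi>" using S(3)[OF \<psi>, of ?b] E_B[of "a \<ominus> E 0 a" n] ac by simp
     thus "cmod (\<phi> a - \<psi> a) \<le> h \<psi> + 2 / d n" using states_diff_ball[OF \<phi> \<psi> a, of n] by linarith
    qed
    hence "mkd \<phi> \<psi> < e" using h n by linarith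
    thus "\<psi> \<in> U" using e(2) \<phi> \<psi> by auto
   qed
   ultimately show "\<exists>V. openin (weak_star_topology A) V \<and> \<phi> \<in> V \<and> V \<subseteq> U" by blast
  qed
 next
  fix U assume U: "openin (weak_star_topology A) U"
  have ev: "continuous_map M.mtopology euclidean (\<lambda>\<phi>. \<phi> a)" if a: "a \<in> carrier A" for a
   unfolding continuous_map_def
  proof (intro conjI allI impI)
   fix W :: "complex set" assume W: "openin euclidean W"
   show "openin M.mtopology {\<phi> \<in> topspace M.mtopology. \<phi> a \<in> W}"
    unfolding M.openin_mtopology
   proof (intro conjI allI impI)
    fix \<phi> assume "\<phi> \<in> {\<phi> \<in> topspace M.mtopology. \<phi> a \<in> W}"
    hence \<phi>: "\<phi> \<in> states A" "\<phi> a \<in> W" by auto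
    obtain e where e: "e > 0" "ball (\<phi> a) e \<subseteq> W" using W \<phi>(2) open_contains_ball by (metis open_openin)
    obtain r where r: "r > 0" "\<And>\<phi> \<psi>. \<phi>\<in>states A ==> \<psi>\<in>states A ==> mkd \<phi> \<psi> < r ==> cmod (\<phi> a - \<psi> a) < e"
     using mkd_controls[OF a e(1)] by blast
    have "M.mball \<phi> r \<subseteq> {\<phi> \<in> topspace M.mtopology. \<phi> a \<in> W}"
    proof
     fix \<psi> assume "\<psi> \<in> M.mball \<phi> r"
     hence \<psi>: "\<psi> \<in> states A" "mkd \<phi> \<psi> < r" by auto
     have "\<psi> a \<in> ball (\<phi> a) e" using r(2)[OF \<phi>(1) \<psi>] by (simp add: dist_norm)
     thus "\<psi> \<in> {\<phi> \<in> topspace M.mtopology. \<phi> a \<in> W}" using e(2) \<psi>(1) by auto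
    qed
    thus "\<exists>r>0. M.mball \<phi> r \<subseteq> {\<phi> \<in> topspace M.mtopology. \<phi> a \<in> W}" using r(1) by blast
   qed auto
  qed auto
  have "continuous_map M.mtopology (weak_star_topology A) (\<lambda>\<phi>. \<phi>)"
   unfolding weak_star_topology_def continuous_map_in_subtopology continuous_map_componentwise
   using ev states_D(5) by auto
  from openin_continuous_map_preimage[OF this U]
  have "openin M.mtopology {\<phi> \<in> topspace M.mtopology. \<phi> \<in> U}" .
  moreover have "{\<phi> \<in> topspace M.mtopology. \<phi> \<in> U} = U"
   using openin_subset[OF U] topspace_weak_star by auto
  ultimately show "openin M.mtopology U" by simp
 qed
 moreover have "(\<lambda>\<phi> \<psi>. enn2real (mk_dist A L \<phi> \<psi>)) = mkd" by (simp add: fun_eq_iff mkd_def)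
 ultimately show ?thesis
  unfolding mk_metrizes_weak_star_def Let_def using mk_dist_finite Metric_space_mkd by simp
qed

lemma lip_dom_iff: "a \<in> lip_dom A L \<longleftrightarrow> a \<in> self_adjoint A \<and> L a < \<infinity>"
 by (simp add: lip_dom_def)

lemma jordan_lie_dom: "jordan_lie_subalgebra A (lip_dom A L)"
proof -
 have fin: "2 * (ennreal (cnorm A a) * L b + ennreal (cnorm A b) * L a) < \<infinity>" if "L a < \<infinity>" "L b < \<infinity>" for a b
  using that by (simp add: ennreal_mult_less_top)
 show ?thesis
  unfolding jordan_lie_subalgebra_def
 proof (intro conjI ballI allI)
  show "lip_dom A L \<subseteq> self_adjoint A" by (auto simp: lip_dom_def)
  show "\<zero> \<in> lip_dom A L"
   using L_smult[of \<one> 0] by (auto simp: lip_dom_iff intro!: self_adjointI)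
 next
  fix a b assume "a \<in> lip_dom A L" "b \<in> lip_dom A L"
  hence a: "a \<in> self_adjoint A" "L a < \<infinity>" and b: "b \<in> self_adjoint A" "L b < \<infinity>" by (auto simp: lip_dom_iff)
  have c: "a \<in> carrier A" "b \<in> carrier A" using a b self_adjointD by auto
  have "L (a \<oplus> b) < \<infinity>" using order_le_less_trans[OF L_add[OF c]] a b by simp
  thus "a \<oplus> b \<in> lip_dom A L" using a b c self_adjointD(2)[OF a(1)] self_adjointD(2)[OF b(1)]
   by (auto simp: lip_dom_iff star_add intro!: self_adjointI)
  show "jordan_prod A a b \<in> lip_dom A L"
   using order_le_less_trans[OF L_jordan_lie(1)[OF a(1) b(1)] fin[OF a(2) b(2)]] jordan_lie_self_adjoint(1)[OF a(1) b(1)]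
   by (simp add: lip_dom_iff)
  show "lie_prod A a b \<in> lip_dom A L"
   using order_le_less_trans[OF L_jordan_lie(2)[OF a(1) b(1)] fin[OF a(2) b(2)]] jordan_lie_self_adjoint(2)[OF a(1) b(1)]
   by (simp add: lip_dom_iff)
 next
  fix t :: real and a assume "a \<in> lip_dom A L"
  hence a: "a \<in> self_adjoint A" "L a < \<infinity>" by (auto simp: lip_dom_iff)
  have c: "a \<in> carrier A" using a self_adjointD by auto
  show "cor t \<odot> a \<in> lip_dom A L"
   using a(2) c self_adjointD(2)[OF a(1)] by (auto simp: lip_dom_iff L_smult star_smult ennreal_mult_less_top intro!: self_adjointI)
 qed
qed

theorem qcms: "(A, L) \<in> qcms_class"
proof -
 have "unital_cstar A" using pos_cstar_imp_unital_cstar[OF _ one_neq_zero] pos_cstar_axioms by blast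
 show ?thesis
  unfolding qcms_class_def mem_Collect_eq case_prod_conv
 proof (intro conjI \<open>unital_cstar A\<close> jordan_lie_dom L_kernel mk_metrizes L_lower_semicontinuous)
  show "dense_in_self_adjoint A (lip_dom A L)"
   unfolding dense_in_self_adjoint_def
  proof (intro ballI allI impI)
   fix a and e :: real assume "a \<in> self_adjoint A" "0 < e"
   from lip_dense[OF this] show "\<exists>b\<in>lip_dom A L. cnorm A (a \<ominus> b) < e" by (auto simp: lip_dom_iff)
  qed
  show "seminorm_on A (lip_dom A L) L"
   unfolding seminorm_on_def by (auto simp: lip_dom_iff self_adjoint_def L_add L_smult)
  show "\<forall>a\<in>lip_dom A L. \<forall>b\<in>lip_dom A L. max (L (jordan_prod A a b)) (L (lie_prod A a b))
     \<le> 2 * (ennreal (cnorm A a) * L b + ennreal (cnorm A b) * L a)"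
   using L_jordan_lie by (simp add: lip_dom_iff)
 qed
qed

end

text \<open>An inductive sequence with a conditional expectation \<open>F n\<close> of each level onto the previous one.  The
  expectation makes every connecting map isometric.\<close>

locale ind_tower =
 fixes A :: "nat => 'a cstar" and \<alpha> :: "nat => 'a => 'a" and F :: "nat => 'a => 'a"
 assumes A: "pos_cstar (A n)" and A_nontrivial: "\<one>\<^bsub>A n\<^esub> \<noteq> \<zero>\<^bsub>A n\<^esub>"
  and \<alpha>_closed: "x \<in> carrier (A n) ==> \<alpha> n x \<in> carrier (A (Suc n))"
  and \<alpha>_add: "x \<in> carrier (A n) ==> y \<in> carrier (A n) ==> \<alpha> n (x \<oplus>\<^bsub>A n\<^esub> y) = \<alpha> n x \<oplus>\<^bsub>A (Suc n)\<^esub> \<alpha> n y"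
  and \<alpha>_mult: "x \<in> carrier (A n) ==> y \<in> carrier (A n) ==> \<alpha> n (x \<otimes>\<^bsub>A n\<^esub> y) = \<alpha> n x \<otimes>\<^bsub>A (Suc n)\<^esub> \<alpha> n y"
  and \<alpha>_smult: "x \<in> carrier (A n) ==> \<alpha> n (c \<odot>\<^bsub>A n\<^esub> x) = c \<odot>\<^bsub>A (Suc n)\<^esub> \<alpha> n x"
  and \<alpha>_star: "x \<in> carrier (A n) ==> \<alpha> n (star (A n) x) = star (A (Suc n)) (\<alpha> n x)"
  and \<alpha>_one: "\<alpha> n \<one>\<^bsub>A n\<^esub> = \<one>\<^bsub>A (Suc n)\<^esub>"
  and \<alpha>_norm: "x \<in> carrier (A n) ==> cnorm (A (Suc n)) (\<alpha> n x) \<le> cnorm (A n) x"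
  and F_closed: "x \<in> carrier (A (Suc n)) ==> F n x \<in> carrier (A n)"
  and F_add: "x \<in> carrier (A (Suc n)) ==> y \<in> carrier (A (Suc n)) ==> F n (x \<oplus>\<^bsub>A (Suc n)\<^esub> y) = F n x \<oplus>\<^bsub>A n\<^esub> F n y"
  and F_smult: "x \<in> carrier (A (Suc n)) ==> F n (c \<odot>\<^bsub>A (Suc n)\<^esub> x) = c \<odot>\<^bsub>A n\<^esub> F n x"
  and F_star: "x \<in> carrier (A (Suc n)) ==> F n (star (A (Suc n)) x) = star (A n) (F n x)"
  and F_norm: "x \<in> carrier (A (Suc n)) ==> cnorm (A n) (F n x) \<le> cnorm (A (Suc n)) x"
  and F_\<alpha>: "x \<in> carrier (A n) ==> F n (\<alpha> n x) = x"
  and F_bimod: "x \<in> carrier (A n) ==> y \<in> carrier (A n) ==> z \<in> carrier (A (Suc n)) ==>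
   F n (\<alpha> n x \<otimes>\<^bsub>A (Suc n)\<^esub> z \<otimes>\<^bsub>A (Suc n)\<^esub> \<alpha> n y) = x \<otimes>\<^bsub>A n\<^esub> F n z \<otimes>\<^bsub>A n\<^esub> y"
begin

sublocale lev: pos_cstar "A n" for n by (rule A)

abbreviation conn where "conn \<equiv> ind_conn \<alpha>"

primrec Fc :: "nat => nat => 'a => 'a" where
 "Fc n 0 x = x"
| "Fc n (Suc k) x = Fc n k (F (n + k) x)"

lemma conn_closed [simp]: "x \<in> carrier (A n) ==> conn n k x \<in> carrier (A (n + k))"
 by (induction k) (use \<alpha>_closed in auto)

lemma conn_hom:
 "x \<in> carrier (A n) ==> y \<in> carrier (A n) ==> conn n k (x \<oplus>\<^bsub>A n\<^esub> y) = conn n k x \<oplus>\<^bsub>A (n + k)\<^esub> conn n k y"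
 "x \<in> carrier (A n) ==> y \<in> carrier (A n) ==> conn n k (x \<otimes>\<^bsub>A n\<^esub> y) = conn n k x \<otimes>\<^bsub>A (n + k)\<^esub> conn n k y"
 "x \<in> carrier (A n) ==> conn n k (c \<odot>\<^bsub>A n\<^esub> x) = c \<odot>\<^bsub>A (n + k)\<^esub> conn n k x"
 "x \<in> carrier (A n) ==> conn n k (star (A n) x) = star (A (n + k)) (conn n k x)"
 "conn n k \<one>\<^bsub>A n\<^esub> = \<one>\<^bsub>A (n + k)\<^esub>"
 by (induction k) (simp_all add: \<alpha>_add \<alpha>_mult \<alpha>_smult \<alpha>_star \<alpha>_one)

lemma conn_minus:
 "x \<in> carrier (A n) ==> y \<in> carrier (A n) ==> conn n k (x \<ominus>\<^bsub>A n\<^esub> y) = conn n k x \<ominus>\<^bsub>A (n + k)\<^esub> conn n k y"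
 by (simp add: lev.minus_smult conn_hom)

lemma conn_norm_le: "x \<in> carrier (A n) ==> cnorm (A (n + k)) (conn n k x) \<le> cnorm (A n) x"
proof (induction k)
 case (Suc k)
 thus ?case using \<alpha>_norm[OF conn_closed[OF Suc.prems, of k]] by simp
qed simp

lemma conn_add: "conn n (k + l) x = conn (n + k) l (conn n k x)"
 by (induction l) (simp_all add: add.assoc)

lemma Fc_closed [simp]: "x \<in> carrier (A (n + k)) ==> Fc n k x \<in> carrier (A n)"
 by (induction k arbitrary: x) (use F_closed in auto)

lemma Fc_add:
 "x \<in> carrier (A (n + k)) ==> y \<in> carrier (A (n + k)) ==> Fc n k (x \<oplus>\<^bsub>A (n + k)\<^esub> y) = Fc n k x \<oplus>\<^bsub>A n\<^esub> Fc n k y"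
 by (induction k arbitrary: x y) (simp_all add: F_add F_closed)

lemma Fc_smult: "x \<in> carrier (A (n + k)) ==> Fc n k (c \<odot>\<^bsub>A (n + k)\<^esub> x) = c \<odot>\<^bsub>A n\<^esub> Fc n k x"
 by (induction k arbitrary: x) (simp_all add: F_smult F_closed)

lemma Fc_star: "x \<in> carrier (A (n + k)) ==> Fc n k (star (A (n + k)) x) = star (A n) (Fc n k x)"
 by (induction k arbitrary: x) (simp_all add: F_star F_closed)

lemma Fc_minus:
 "x \<in> carrier (A (n + k)) ==> y \<in> carrier (A (n + k)) ==> Fc n k (x \<ominus>\<^bsub>A (n + k)\<^esub> y) = Fc n k x \<ominus>\<^bsub>A n\<^esub> Fc n k y"
 by (simp add: lev.minus_smult Fc_add Fc_smult)

lemma Fc_norm: "x \<in> carrier (A (n + k)) ==> cnorm (A n) (Fc n k x) \<le> cnorm (A (n + k)) x"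
proof (induction k arbitrary: x)
 case (Suc k)
 have x: "x \<in> carrier (A (Suc (n + k)))" using Suc.prems by simp
 show ?case using Suc.IH[OF F_closed[OF x]] F_norm[OF x] by simp
qed simp

lemma Fc_conn: "x \<in> carrier (A n) ==> Fc n k (conn n k x) = x"
 by (induction k) (simp_all add: F_\<alpha>)

lemma Fc_bimod:
 "x \<in> carrier (A n) ==> y \<in> carrier (A n) ==> z \<in> carrier (A (n + k)) ==>
  Fc n k (conn n k x \<otimes>\<^bsub>A (n + k)\<^esub> z \<otimes>\<^bsub>A (n + k)\<^esub> conn n k y) = x \<otimes>\<^bsub>A n\<^esub> Fc n k z \<otimes>\<^bsub>A n\<^esub> y"
 by (induction k arbitrary: z) (simp_all add: F_bimod F_closed)

lemma Fc_add_index: "Fc n (k + l) x = Fc n k (Fc (n + k) l x)"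
 by (induction l arbitrary: x) (simp_all add: add.assoc)

lemma Fc_conn_add: "x \<in> carrier (A (n + k)) ==> Fc n (k + l) (conn (n + k) l x) = Fc n k x"
 by (simp add: Fc_add_index Fc_conn)

lemma conn_norm:
 assumes "x \<in> carrier (A n)" shows "cnorm (A (n + k)) (conn n k x) = cnorm (A n) x"
 using conn_norm_le[OF assms, of k] Fc_norm[OF conn_closed[OF assms], of k] Fc_conn[OF assms, of k] by simp

section \<open>The inductive limit\<close>

abbreviation T where "T \<equiv> ind_threads A \<alpha>"
definition N where "N = (\<lambda>X. THE r. \<forall>x\<in>X. (\<lambda>n. cnorm (A n) (x n)) \<longlonglongrightarrow> r)"

lemma threadI:
 assumes "\<And>n. x n \<in> carrier (A n)"
  and "\<And>e. 0 < e ==> \<exists>N. \<forall>n\<ge>N. \<forall>k. cdist (A (n + k)) (x (n + k)) (conn n k (x n)) \<le> e"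
 shows "x \<in> T"
 unfolding ind_threads_def
proof (intro CollectI conjI allI impI)
 fix e :: real assume "0 < e"
 hence "0 < e/2" by simp
 from assms(2)[OF this] obtain N where N: "\<forall>n\<ge>N. \<forall>k. cdist (A (n + k)) (x (n + k)) (conn n k (x n)) \<le> e/2" by blast
 have "cdist (A (n + k)) (x (n + k)) (conn n k (x n)) < e" if "n \<ge> N" for n k
  using N that \<open>0 < e\<close> by (smt (verit) field_sum_of_halves)
 thus "\<exists>N. \<forall>n\<ge>N. \<forall>k. cdist (A (n + k)) (x (n + k)) (conn n k (x n)) < e" by blast
qed (use assms(1) in simp)

lemma threadD:
 assumes "x \<in> T"
 shows "x n \<in> carrier (A n)"
  and "0 < e ==> \<exists>N. \<forall>n\<ge>N. \<forall>k. cdist (A (n + k)) (x (n + k)) (conn n k (x n)) < e"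
 using assms by (auto simp: ind_threads_def)

lemma thread_norm_diff:
 assumes x: "x \<in> T"
 shows "\<bar>cnorm (A (n + k)) (x (n + k)) - cnorm (A n) (x n)\<bar> \<le> cdist (A (n + k)) (x (n + k)) (conn n k (x n))"
proof -
 let ?a = "x (n + k)" and ?b = "conn n k (x n)"
 have c: "?a \<in> carrier (A (n+k))" "?b \<in> carrier (A (n+k))" using threadD(1)[OF x] by auto
 show ?thesis
  using lev.cnorm_le_dist[OF c] lev.cnorm_le_dist[OF c(2,1)] lev.cnorm_minus_commute[OF c]
   conn_norm[OF threadD(1)[OF x, of n], of k] by linarith
qed

lemma thread_norm_convergent:
 assumes x: "x \<in> T"
 shows "convergent (\<lambda>n. cnorm (A n) (x n))"
proof -
 have "Cauchy (\<lambda>n. cnorm (A n) (x n))"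
  unfolding Cauchy_altdef
 proof (intro allI impI)
  fix e :: real assume "0 < e"
  then obtain N where N: "\<forall>n\<ge>N. \<forall>k. cdist (A (n + k)) (x (n + k)) (conn n k (x n)) < e"
   using threadD(2)[OF x] by blast
  have "dist (cnorm (A m) (x m)) (cnorm (A n) (x n)) < e" if "m \<ge> N" "n > m" for m n
  proof -
   obtain k where k: "n = m + k" using \<open>n > m\<close> less_imp_add_positive by metis
   have "cdist (A (m + k)) (x (m + k)) (conn m k (x m)) < e" using N that(1) by blast
   thus ?thesis using thread_norm_diff[OF x, of m k] unfolding k dist_real_def by linarith
  qed
  thus "\<exists>M. \<forall>m\<ge>M. \<forall>n>m. dist (cnorm (A m) (x m)) (cnorm (A n) (x n)) < e" by blast
 qed
 thus ?thesis by (simp add: Cauchy_convergent_iff)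
qed

text \<open>Every operation on threads is continuous, with a modulus that does not depend on the level; this is
  the common form of the closure properties.\<close>

lemma thread_pointwise:
 assumes c: "\<And>n. z n \<in> carrier (A n)"
  and x: "x \<in> T" and y: "y \<in> T" and C: "0 \<le> C" "0 \<le> D"
  and le: "\<And>n k. cdist (A (n + k)) (z (n + k)) (conn n k (z n)) \<le>
   C * cdist (A (n + k)) (x (n + k)) (conn n k (x n)) +
   D * cdist (A (n + k)) (y (n + k)) (conn n k (y n))"
 shows "z \<in> T"
proof (rule threadI[OF c])
 fix e :: real assume e: "0 < e"
 define d where "d = e / (C + D + 1)"
 have d: "0 < d" "(C + D) * d \<le> e" using e C by (auto simp: d_def field_simps)
 obtain N1 where N1: "\<forall>n\<ge>N1. \<forall>k. cdist (A (n + k)) (x (n + k)) (conn n k (x n)) < d"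
  using threadD(2)[OF x d(1)] by blast
 obtain N2 where N2: "\<forall>n\<ge>N2. \<forall>k. cdist (A (n + k)) (y (n + k)) (conn n k (y n)) < d"
  using threadD(2)[OF y d(1)] by blast
 show "\<exists>N. \<forall>n\<ge>N. \<forall>k. cdist (A (n + k)) (z (n + k)) (conn n k (z n)) \<le> e"
 proof (intro exI[of _ "max N1 N2"] allI impI)
  fix n k assume n: "max N1 N2 \<le> n"
  have "C * cdist (A (n + k)) (x (n + k)) (conn n k (x n)) \<le> C * d"
   using N1 n C by (intro mult_left_mono) (auto intro: less_imp_le)
  moreover have "D * cdist (A (n + k)) (y (n + k)) (conn n k (y n)) \<le> D * d"
   using N2 n C by (intro mult_left_mono) (auto intro: less_imp_le)
  ultimately show "cdist (A (n + k)) (z (n + k)) (conn n k (z n)) \<le> e"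
   using le[of n k] d(2) by (simp add: distrib_right)
 qed
qed

lemma thread_bounded:
 assumes x: "x \<in> T" shows "\<exists>C\<ge>0. \<forall>n. cnorm (A n) (x n) \<le> C"
proof -
 have "Bseq (\<lambda>n. cnorm (A n) (x n))" using thread_norm_convergent[OF x] convergent_imp_Bseq by blast
 then obtain C where "C > 0" "\<forall>n. norm (cnorm (A n) (x n)) \<le> C" using BseqE by blast
 thus ?thesis by (intro exI[of _ C]) (auto intro: abs_le_D1)
qed

sublocale S: seq_algebra A T N
proof
 show tc: "x n \<in> carrier (A n)" if "x \<in> T" for x n using threadD(1)[OF that] .
 show "\<exists>C. \<forall>n. cnorm (A n) (x n) \<le> C" if "x \<in> T" for x using thread_bounded[OF that] by blast
 show one: "(\<lambda>n. \<one>\<^bsub>A n\<^esub>) \<in> T"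
  by (rule threadI) (auto simp: conn_hom(5) lev.minus_eq lev.A.r_neg intro: exI[of _ 0])
 show "(\<lambda>n. x n \<oplus>\<^bsub>A n\<^esub> y n) \<in> T" if x: "x \<in> T" and y: "y \<in> T" for x y
 proof (rule thread_pointwise[OF _ x y, of _ 1 1])
  fix n k
  interpret Ank: pos_cstar "A (n + k)" by (rule A)
  let ?a = "x (n + k)" and ?b = "y (n + k)" and ?c = "conn n k (x n)" and ?d = "conn n k (y n)"
  have c: "?a \<in> carrier (A (n + k))" "?b \<in> carrier (A (n + k))" "?c \<in> carrier (A (n + k))" "?d \<in> carrier (A (n + k))"
   using tc x y by auto
  have "(?a \<oplus>\<^bsub>A (n + k)\<^esub> ?b) \<ominus>\<^bsub>A (n + k)\<^esub> (?c \<oplus>\<^bsub>A (n + k)\<^esub> ?d) = (?a \<ominus>\<^bsub>A (n + k)\<^esub> ?c) \<oplus>\<^bsub>A (n + k)\<^esub> (?b \<ominus>\<^bsub>A (n + k)\<^esub> ?d)"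
   using c by algebra
  thus "cdist (A (n + k)) (?a \<oplus>\<^bsub>A (n + k)\<^esub> ?b) (conn n k (x n \<oplus>\<^bsub>A n\<^esub> y n))
   \<le> 1 * cdist (A (n + k)) ?a ?c + 1 * cdist (A (n + k)) ?b ?d"
   using lev.cnorm_triangle[of "?a \<ominus>\<^bsub>A (n + k)\<^esub> ?c" "n + k" "?b \<ominus>\<^bsub>A (n + k)\<^esub> ?d"] c conn_hom(1)[OF tc[OF x, of n] tc[OF y], of k] by simp
 qed (use tc x y in auto)
 show "(\<lambda>n. x n \<otimes>\<^bsub>A n\<^esub> y n) \<in> T" if x: "x \<in> T" and y: "y \<in> T" for x y
 proof -
  obtain C where C: "C \<ge> 0" "\<forall>n. cnorm (A n) (x n) \<le> C" using thread_bounded[OF x] by blast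
  obtain D where D: "D \<ge> 0" "\<forall>n. cnorm (A n) (y n) \<le> D" using thread_bounded[OF y] by blast
  show ?thesis
  proof (rule thread_pointwise[OF _ x y, of _ D C])
   fix n k
   let ?a = "x (n + k)" and ?b = "y (n + k)" and ?c = "conn n k (x n)" and ?d = "conn n k (y n)"
   have c: "?a \<in> carrier (A (n + k))" "?b \<in> carrier (A (n + k))" "?c \<in> carrier (A (n + k))" "?d \<in> carrier (A (n + k))"
    using tc x y by auto
   have "cdist (A (n + k)) (?a \<otimes>\<^bsub>A (n + k)\<^esub> ?b) (?c \<otimes>\<^bsub>A (n + k)\<^esub> ?d)
    \<le> cnorm (A (n + k)) ?a * cdist (A (n + k)) ?b ?d + cdist (A (n + k)) ?a ?c * cnorm (A (n + k)) ?d"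
    by (rule lev.cnorm_mult_dist[OF c])
   also have "\<dots> \<le> C * cdist (A (n + k)) ?b ?d + cdist (A (n + k)) ?a ?c * D"
   proof (rule add_mono[OF mult_right_mono mult_left_mono])
    show "cnorm (A (n + k)) ?a \<le> C" using C(2) by blast
    show "cnorm (A (n + k)) ?d \<le> D" unfolding conn_norm[OF tc[OF y, of n], of k] using D(2) by blast
   qed (use c in simp_all)
   finally show "cdist (A (n + k)) (?a \<otimes>\<^bsub>A (n + k)\<^esub> ?b) (conn n k (x n \<otimes>\<^bsub>A n\<^esub> y n))
    \<le> D * cdist (A (n + k)) ?a ?c + C * cdist (A (n + k)) ?b ?d"
    using conn_hom(2)[OF tc[OF x, of n] tc[OF y], of k] by (simp add: mult.commute[of _ D] add.commute[of "D * _"])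
  qed (use tc x y C D in auto)
 qed
 show "(\<lambda>n. c \<odot>\<^bsub>A n\<^esub> x n) \<in> T" if x: "x \<in> T" for x c
 proof (rule thread_pointwise[OF _ x x, of _ "cmod c" 0])
  fix n k
  show "cdist (A (n + k)) (c \<odot>\<^bsub>A (n + k)\<^esub> x (n + k)) (conn n k (c \<odot>\<^bsub>A n\<^esub> x n))
   \<le> cmod c * cdist (A (n + k)) (x (n + k)) (conn n k (x n)) + 0 * cdist (A (n + k)) (x (n + k)) (conn n k (x n))"
   using lev.smult_minus_right[OF tc[OF x, of "n + k"] conn_closed[OF tc[OF x, of n], of k], of c]
    lev.cnorm_smult[of "x (n + k) \<ominus>\<^bsub>A (n + k)\<^esub> conn n k (x n)" "n + k" c] tc[OF x] conn_hom(3)[OF tc[OF x, of n], of k c] by simp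
 qed (use tc x in auto)
 show "(\<lambda>n. star (A n) (x n)) \<in> T" if x: "x \<in> T" for x
 proof (rule thread_pointwise[OF _ x x, of _ 1 0])
  fix n k
  show "cdist (A (n + k)) (star (A (n + k)) (x (n + k))) (conn n k (star (A n) (x n)))
   \<le> 1 * cdist (A (n + k)) (x (n + k)) (conn n k (x n)) + 0 * cdist (A (n + k)) (x (n + k)) (conn n k (x n))"
   using lev.star_minus[OF tc[OF x, of "n + k"] conn_closed[OF tc[OF x, of n], of k]]
    lev.cnorm_star[of "x (n + k) \<ominus>\<^bsub>A (n + k)\<^esub> conn n k (x n)" "n + k"] tc[OF x] conn_hom(4)[OF tc[OF x, of n], of k] by simp
 qed (use tc x in auto)
 show "x \<in> T" if c: "\<And>n. x n \<in> carrier (A n)"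
  and appr: "\<And>e. 0 < e ==> \<exists>y\<in>T. \<forall>\<^sub>F n in sequentially. cdist (A n) (x n) (y n) \<le> e" for x
 proof (rule threadI[OF c])
  fix e :: real assume e: "0 < e"
  hence e3: "0 < e/3" by simp
  from appr[OF e3] obtain y where y: "y \<in> T" "\<forall>\<^sub>F n in sequentially. cdist (A n) (x n) (y n) \<le> e/3" by blast
  obtain N1 where N1: "\<And>n. n \<ge> N1 ==> cdist (A n) (x n) (y n) \<le> e/3" using y(2) unfolding eventually_sequentially by blast
  obtain N2 where N2: "\<forall>n\<ge>N2. \<forall>k. cdist (A (n + k)) (y (n + k)) (conn n k (y n)) < e/3"
   using threadD(2)[OF y(1) e3] by blast
  show "\<exists>N. \<forall>n\<ge>N. \<forall>k. cdist (A (n + k)) (x (n + k)) (conn n k (x n)) \<le> e"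
  proof (intro exI[of _ "max N1 N2"] allI impI)
   fix n k assume n: "max N1 N2 \<le> n"
   let ?a = "x (n + k)" and ?b = "y (n + k)" and ?c = "conn n k (x n)" and ?d = "conn n k (y n)"
   have cc: "?a \<in> carrier (A (n + k))" "?b \<in> carrier (A (n + k))" "?c \<in> carrier (A (n + k))" "?d \<in> carrier (A (n + k))"
    using c tc y(1) by auto
   have 1: "cdist (A (n + k)) ?a ?b \<le> e/3" using N1[of "n+k"] n by simp
   have 2: "cdist (A (n + k)) ?b ?d \<le> e/3" using N2[rule_format, of n k] n by simp
   have "?c \<ominus>\<^bsub>A (n + k)\<^esub> ?d = conn n k (x n \<ominus>\<^bsub>A n\<^esub> y n)" using conn_minus[OF c tc[OF y(1)]] by simp
   hence 3: "cdist (A (n + k)) ?d ?c \<le> e/3"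
    using N1[of n] n conn_norm[of "x n \<ominus>\<^bsub>A n\<^esub> y n" n k] c tc[OF y(1)] lev.cnorm_minus_commute[OF cc(4,3)] by simp
   show "cdist (A (n + k)) ?a ?c \<le> e"
    using 1 2 3 lev.cnorm_dist_triangle[OF cc(1,2,3)] lev.cnorm_dist_triangle[OF cc(2,4,3)] by linarith
  qed
 qed
 show "N (null_rel A T `` {x}) = seq_norm A x" if x: "x \<in> T" for x
 proof -
  obtain l where l: "(\<lambda>n. cnorm (A n) (x n)) \<longlonglongrightarrow> l" using thread_norm_convergent[OF x] convergent_def by blast
  have l0: "0 \<le> l" by (rule LIMSEQ_le_const[OF l]) (use tc[OF x] in auto)
  have all: "\<forall>y\<in>null_rel A T `` {x}. (\<lambda>n. cnorm (A n) (y n)) \<longlonglongrightarrow> l"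
  proof
   fix y assume "y \<in> null_rel A T `` {x}"
   hence y: "y \<in> T" "(\<lambda>n. cdist (A n) (x n) (y n)) \<longlonglongrightarrow> 0" by (auto simp: null_rel_def)
   have "(\<lambda>n. \<bar>cnorm (A n) (y n) - cnorm (A n) (x n)\<bar>) \<longlonglongrightarrow> 0"
   proof (rule null_seq_le[OF _ _ y(2)])
    fix n
    show "\<bar>cnorm (A n) (y n) - cnorm (A n) (x n)\<bar> \<le> cdist (A n) (x n) (y n)"
     using lev.cnorm_le_dist[OF tc[OF x, of n] tc[OF y(1)]] lev.cnorm_le_dist[OF tc[OF y(1), of n] tc[OF x]]
      lev.cnorm_minus_commute[OF tc[OF x, of n] tc[OF y(1)]] by linarith
   qed simp
   hence "(\<lambda>n. cnorm (A n) (y n) - cnorm (A n) (x n)) \<longlonglongrightarrow> 0" by (simp add: tendsto_rabs_zero_iff)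
   from tendsto_add[OF this l] show "(\<lambda>n. cnorm (A n) (y n)) \<longlonglongrightarrow> l" by simp
  qed
  have xx: "x \<in> null_rel A T `` {x}" using x tc[OF x] by (simp add: null_rel_def lev.minus_eq lev.A.r_neg)
  have Nl: "N (null_rel A T `` {x}) = l"
   unfolding N_def
  proof (rule the_equality)
   show "\<forall>y\<in>null_rel A T `` {x}. (\<lambda>n. cnorm (A n) (y n)) \<longlonglongrightarrow> l" by (rule all)
  next
   fix r assume "\<forall>y\<in>null_rel A T `` {x}. (\<lambda>n. cnorm (A n) (y n)) \<longlonglongrightarrow> r"
   hence "(\<lambda>n. cnorm (A n) (x n)) \<longlonglongrightarrow> r" using xx by blast
   thus "r = l" using l LIMSEQ_unique by blast
  qed
  have "seq_norm A x = l"
  proof (rule antisym)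
   show "seq_norm A x \<le> l"
   proof (rule field_le_epsilon)
    fix e :: real assume e: "0 < e"
    have ev: "\<forall>\<^sub>F n in sequentially. cnorm (A n) (x n) < l + e" using order_tendstoD(2)[OF l, of "l + e"] e by simp
    show "seq_norm A x \<le> l + e" unfolding seq_norm_def
    proof (rule cInf_lower)
     show "l + e \<in> {c. 0 \<le> c \<and> (\<forall>\<^sub>F n in sequentially. cnorm (A n) (x n) \<le> c)}"
      using l0 e ev by (auto elim: eventually_mono)
     show "bdd_below {c. 0 \<le> c \<and> (\<forall>\<^sub>F n in sequentially. cnorm (A n) (x n) \<le> c)}" by (rule bdd_belowI[of _ 0]) simp
    qed
   qed
   show "l \<le> seq_norm A x" unfolding seq_norm_def
   proof (rule cInf_greatest)
    obtain C where "0 \<le> C" "\<forall>n. cnorm (A n) (x n) \<le> C" using thread_bounded[OF x] by blast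
    hence "C \<in> {c. 0 \<le> c \<and> (\<forall>\<^sub>F n in sequentially. cnorm (A n) (x n) \<le> c)}" by simp
    thus "{c. 0 \<le> c \<and> (\<forall>\<^sub>F n in sequentially. cnorm (A n) (x n) \<le> c)} \<noteq> {}" by blast
    fix c assume "c \<in> {c. 0 \<le> c \<and> (\<forall>\<^sub>F n in sequentially. cnorm (A n) (x n) \<le> c)}"
    hence "\<forall>\<^sub>F n in sequentially. cnorm (A n) (x n) \<le> c" by simp
    from tendsto_upperbound[OF l this] show "l \<le> c" by simp
   qed
  qed
  thus ?thesis using Nl by simp
 qed
qed

lemma ind_rel_eq: "ind_rel A \<alpha> = null_rel A T"
 by (simp add: ind_rel_def null_rel_def)

lemma ind_lim_eq: "ind_lim A \<alpha> = S.Q"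
 by (simp add: ind_lim_def seq_quot_def ind_rel_eq N_def Let_def)

end

context ind_tower
begin

abbreviation QQ where "QQ \<equiv> S.Q"
abbreviation cl where "cl \<equiv> S.cls"

sublocale Q: pos_cstar QQ by (rule S.pos_cstar_Q)

lemma minus_self [simp]: "x \<in> carrier (A n) ==> x \<ominus>\<^bsub>A n\<^esub> x = \<zero>\<^bsub>A n\<^esub>"
 unfolding a_minus_def by (rule lev.A.r_neg)

lemma Q_minus_self [simp]: "x \<in> carrier QQ ==> x \<ominus>\<^bsub>QQ\<^esub> x = \<zero>\<^bsub>QQ\<^esub>"
 unfolding a_minus_def by (rule Q.A.r_neg)

definition const_thread :: "nat => 'a => nat => 'a" where
 "const_thread n a = (\<lambda>m. if n \<le> m then conn n (m - n) a else \<zero>\<^bsub>A m\<^esub>)"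

definition can :: "nat => 'a => (nat => 'a) set" where
 "can n a = cl (const_thread n a)"

lemma can_eq: "can n = ind_can A \<alpha> n"
 by (simp add: fun_eq_iff can_def ind_can_def S.cls_def ind_rel_eq const_thread_def)

lemma const_thread_add [simp]: "const_thread n a (n + k) = conn n k a"
 by (simp add: const_thread_def)

lemma const_thread_T [simp]:
 assumes a: "a \<in> carrier (A n)" shows "const_thread n a \<in> T"
proof (rule threadI)
 fix m
 show "const_thread n a m \<in> carrier (A m)"
  using conn_closed[OF a, of "m - n"] by (cases "n \<le> m") (simp_all add: const_thread_def)
next
 fix e :: real assume e: "0 < e"
 show "\<exists>N. \<forall>m\<ge>N. \<forall>k. cdist (A (m + k)) (const_thread n a (m + k)) (conn m k (const_thread n a m)) \<le> e"
 proof (intro exI[of _ n] allI impI)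
  fix m k assume "n \<le> m"
  then obtain l where l: "m = n + l" using le_Suc_ex by blast
  have "const_thread n a (m + k) = conn n (l + k) a" using const_thread_add[of n a "l + k"] by (simp add: l add.assoc)
  also have "\<dots> = conn m k (const_thread n a m)" by (simp add: l conn_add)
  finally have eq: "const_thread n a (m + k) = conn m k (const_thread n a m)" .
  have "conn m k (const_thread n a m) \<in> carrier (A (m + k))" using conn_closed[OF conn_closed[OF a, of l], of k] by (simp add: l)
  thus "cdist (A (m + k)) (const_thread n a (m + k)) (conn m k (const_thread n a m)) \<le> e"
   unfolding eq using e by simp
 qed
qed

lemma can_closed [simp]: "a \<in> carrier (A n) ==> can n a \<in> carrier QQ"
 by (simp add: can_def)

lemma cl_eq_eventually:
 assumes "x \<in> T" "y \<in> T" "\<And>k. x (n + k) = y (n + k)"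
 shows "cl x = cl y"
proof -
 have "\<forall>\<^sub>F m in sequentially. cdist (A m) (x m) (y m) = 0"
  unfolding eventually_sequentially
 proof (intro exI[of _ n] allI impI)
  fix m assume "n \<le> m"
  then obtain k where "m = n + k" using le_Suc_ex by blast
  hence "x m = y m" using assms(3) by simp
  thus "cdist (A m) (x m) (y m) = 0" using threadD(1)[OF assms(2), of m] by simp
 qed
 hence "(\<lambda>m. cdist (A m) (x m) (y m)) \<longlonglongrightarrow> 0" by (rule tendsto_eventually)
 thus ?thesis using S.cls_eq_iff[OF assms(1,2)] by blast
qed

lemma can_hom:
 assumes "a \<in> carrier (A n)" "b \<in> carrier (A n)"
 shows "can n (a \<oplus>\<^bsub>A n\<^esub> b) = can n a \<oplus>\<^bsub>QQ\<^esub> can n b"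
  "can n (a \<otimes>\<^bsub>A n\<^esub> b) = can n a \<otimes>\<^bsub>QQ\<^esub> can n b"
  "can n (c \<odot>\<^bsub>A n\<^esub> a) = c \<odot>\<^bsub>QQ\<^esub> can n a"
  "can n (star (A n) a) = star QQ (can n a)"
 unfolding can_def
 by (simp_all only: S.Q_simps(4-7) const_thread_T assms)
  (rule cl_eq_eventually[where n = n]; use assms in \<open>simp add: conn_hom\<close>)+

lemma can_one: "can n \<one>\<^bsub>A n\<^esub> = \<one>\<^bsub>QQ\<^esub>"
 unfolding can_def S.Q_simps(2) by (rule cl_eq_eventually[where n = n]) (simp_all add: conn_hom)

lemma can_minus:
 "a \<in> carrier (A n) ==> b \<in> carrier (A n) ==> can n (a \<ominus>\<^bsub>A n\<^esub> b) = can n a \<ominus>\<^bsub>QQ\<^esub> can n b"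
 by (simp add: lev.minus_smult Q.minus_smult can_hom)

lemma can_norm: assumes a: "a \<in> carrier (A n)" shows "cnorm QQ (can n a) = cnorm (A n) a"
proof -
 have "(\<lambda>m. cnorm (A m) (const_thread n a m)) \<longlonglongrightarrow> cnorm (A n) a"
 proof (rule tendsto_eventually, unfold eventually_sequentially, intro exI[of _ n] allI impI)
  fix m assume "n \<le> m"
  then obtain k where "m = n + k" using le_Suc_ex by blast
  thus "cnorm (A m) (const_thread n a m) = cnorm (A n) a" using conn_norm[OF a, of k] by simp
 qed
 hence "seq_norm A (const_thread n a) = cnorm (A n) a" by (rule S.seq_norm_unique[OF const_thread_T[OF a]])
 thus ?thesis unfolding can_def S.Q_simps(8)[OF const_thread_T[OF a]] .
qed

lemma can_inj: "a \<in> carrier (A n) ==> b \<in> carrier (A n) ==> can n a = can n b ==> a = b"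
 using can_norm[of "a \<ominus>\<^bsub>A n\<^esub> b" n] can_minus[of a n b] lev.cnorm_minus_eq_0[of a n b]
 by simp

lemma can_conn: assumes a: "a \<in> carrier (A n)" shows "can (n + k) (conn n k a) = can n a"
 unfolding can_def
proof (rule cl_eq_eventually[where n = "n + k"])
 fix l
 have "const_thread n a (n + k + l) = conn n (k + l) a"
  using const_thread_add[of n a "k + l"] by (simp add: add.assoc)
 thus "const_thread (n + k) (conn n k a) (n + k + l) = const_thread n a (n + k + l)"
  unfolding const_thread_add[of "n + k"] conn_add by (rule sym)
qed (use a in simp_all)

lemma can_approx:
 assumes x: "x \<in> T" and e: "0 < e"
 shows "\<exists>n. cdist QQ (cl x) (can n (x n)) < e"
proof -
 have e2: "0 < e/2" using e by simp
 obtain n where n: "\<And>m k. m \<ge> n ==> cdist (A (m + k)) (x (m + k)) (conn m k (x m)) < e/2"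
  using threadD(2)[OF x e2] by blast
 have xn: "x n \<in> carrier (A n)" using threadD(1)[OF x] .
 have "seq_norm A (\<lambda>m. x m \<ominus>\<^bsub>A m\<^esub> const_thread n (x n) m) \<le> e/2"
 proof (rule S.seq_norm_le, use e in simp, unfold eventually_sequentially, intro exI[of _ n] allI impI)
  fix m assume "n \<le> m"
  then obtain k where "m = n + k" using le_Suc_ex by blast
  thus "cdist (A m) (x m) (const_thread n (x n) m) \<le> e/2" using n[of n k] by simp
 qed
 hence "cdist QQ (cl x) (can n (x n)) \<le> e/2"
  unfolding can_def S.Q_minus[OF x const_thread_T[OF xn]] S.Q_simps(8)[OF S.T_minus[OF x const_thread_T[OF xn]]] .
 thus ?thesis using e by (intro exI[of _ n]) simp
qed

section \<open>Conditional expectations on the limit\<close>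

text \<open>The expectations of the members of a thread onto a fixed level \<open>n\<close> form a Cauchy sequence.  Its limit is
  the expectation of the class of the thread.\<close>

definition lim_at :: "nat => (nat => 'a) => 'a => bool" where
 "lim_at n x y \<longleftrightarrow> y \<in> carrier (A n) \<and> (\<lambda>k. cdist (A n) (Fc n k (x (n + k))) y) \<longlonglongrightarrow> 0"

lemma lim_at_exists:
 assumes x: "x \<in> T" shows "\<exists>y. lim_at n x y"
proof -
 let ?s = "\<lambda>k. Fc n k (x (n + k))"
 have xc: "x m \<in> carrier (A m)" for m using threadD(1)[OF x] .
 have sc: "?s k \<in> carrier (A n)" for k using xc by simp
 have step: "cdist (A n) (?s (k + l)) (?s k) \<le> cdist (A (n + k + l)) (x (n + k + l)) (conn (n + k) l (x (n + k)))" for k l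
 proof -
  have "?s (k + l) \<ominus>\<^bsub>A n\<^esub> ?s k = Fc n (k + l) (x (n + (k + l)) \<ominus>\<^bsub>A (n + (k + l))\<^esub> conn (n + k) l (x (n + k)))"
   using Fc_minus[of "x (n + (k + l))" n "k + l" "conn (n + k) l (x (n + k))"] xc[of "n + (k + l)"]
    conn_closed[OF xc[of "n + k"], of l] Fc_conn_add[OF xc[of "n + k"], of l] by (simp add: add.assoc)
  thus ?thesis
   using Fc_norm[of "x (n + (k + l)) \<ominus>\<^bsub>A (n + (k + l))\<^esub> conn (n + k) l (x (n + k))" n "k + l"] xc[of "n + (k + l)"]
    conn_closed[OF xc[of "n + k"], of l] by (simp add: add.assoc)
 qed
 have "\<exists>y\<in>carrier (A n). (\<lambda>k. cdist (A n) (?s k) y) \<longlonglongrightarrow> 0"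
 proof (rule lev.complete[OF sc])
  fix e :: real assume e: "0 < e"
  then obtain M where M: "\<And>m k. m \<ge> M ==> cdist (A (m + k)) (x (m + k)) (conn m k (x m)) < e"
   using threadD(2)[OF x] by blast
  have ord: "cdist (A n) (?s q) (?s p) < e" if pq: "M \<le> p" "p \<le> q" for p q
  proof -
   obtain l where "q = p + l" using pq(2) le_Suc_ex by blast
   thus ?thesis using step[of p l] M[of "n + p" l] pq(1) by simp
  qed
  have "cdist (A n) (?s p) (?s q) < e" if "M \<le> p" "M \<le> q" for p q
   using ord[of p q] ord[of q p] that lev.cnorm_minus_commute[OF sc sc, of p q] by (cases "p \<le> q") auto
  thus "\<exists>N. \<forall>p\<ge>N. \<forall>q\<ge>N. cdist (A n) (?s p) (?s q) < e" by blast
 qed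
 thus ?thesis by (auto simp: lim_at_def)
qed

lemma lim_at_unique: "x \<in> T ==> lim_at n x y ==> lim_at n x z ==> y = z"
 using lev.limit_unique[of "\<lambda>k. Fc n k (x (n + k))" n y z] threadD(1) by (simp add: lim_at_def)

lemma lim_at_cong:
 assumes x: "x \<in> T" and x': "x' \<in> T" and eq: "cl x = cl x'" and l: "lim_at n x y"
 shows "lim_at n x' y"
proof -
 have y: "y \<in> carrier (A n)" and l0: "(\<lambda>k. cdist (A n) (Fc n k (x (n + k))) y) \<longlonglongrightarrow> 0" using l by (auto simp: lim_at_def)
 have xc: "x m \<in> carrier (A m)" "x' m \<in> carrier (A m)" for m using threadD(1)[OF x] threadD(1)[OF x'] by auto
 have "(\<lambda>m. cdist (A m) (x m) (x' m)) \<longlonglongrightarrow> 0" using eq S.cls_eq_iff[OF x x'] by blast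
 hence n0: "(\<lambda>k. cdist (A (n + k)) (x (n + k)) (x' (n + k))) \<longlonglongrightarrow> 0"
  using LIMSEQ_ignore_initial_segment[of _ 0 n] by (simp add: add.commute)
 have "(\<lambda>k. cdist (A n) (Fc n k (x' (n + k))) y) \<longlonglongrightarrow> 0"
 proof (rule null_seq_le)
  fix k
  have "cdist (A n) (Fc n k (x' (n + k))) y \<le> cdist (A n) (Fc n k (x' (n + k))) (Fc n k (x (n + k))) + cdist (A n) (Fc n k (x (n + k))) y"
   by (rule lev.cnorm_dist_triangle) (use xc y in auto)
  also have "cdist (A n) (Fc n k (x' (n + k))) (Fc n k (x (n + k))) \<le> cdist (A (n + k)) (x (n + k)) (x' (n + k))"
   using Fc_norm[of "x' (n + k) \<ominus>\<^bsub>A (n + k)\<^esub> x (n + k)" n k] Fc_minus[of "x' (n + k)" n k "x (n + k)"]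
    lev.cnorm_minus_commute[OF xc(1) xc(2), of "n + k"] xc by simp
  finally show "cdist (A n) (Fc n k (x' (n + k))) y \<le> cdist (A (n + k)) (x (n + k)) (x' (n + k)) + cdist (A n) (Fc n k (x (n + k))) y"
   by simp
  show "0 \<le> cdist (A n) (Fc n k (x' (n + k))) y" using xc y by simp
 next
  show "(\<lambda>k. cdist (A (n + k)) (x (n + k)) (x' (n + k)) + cdist (A n) (Fc n k (x (n + k))) y) \<longlonglongrightarrow> 0"
   using tendsto_add[OF n0 l0] by simp
 qed
 thus ?thesis using y by (simp add: lim_at_def)
qed

definition Ex :: "nat => (nat => 'a) set => (nat => 'a) set" where
 "Ex n = (\<lambda>X\<in>carrier QQ. can n (SOME y. \<exists>x\<in>T. X = cl x \<and> lim_at n x y))"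

lemma Ex_cl:
 assumes x: "x \<in> T" and l: "lim_at n x y"
 shows "Ex n (cl x) = can n y"
proof -
 have "(SOME y. \<exists>x'\<in>T. cl x = cl x' \<and> lim_at n x' y) = y"
 proof (rule some_equality)
  show "\<exists>x'\<in>T. cl x = cl x' \<and> lim_at n x' y" using x l by blast
  fix z assume "\<exists>x'\<in>T. cl x = cl x' \<and> lim_at n x' z"
  then obtain x' where x': "x' \<in> T" "cl x = cl x'" "lim_at n x' z" by blast
  have "lim_at n x z" using lim_at_cong[OF x'(1) x _ x'(3)] x'(2) by simp
  thus "z = y" using lim_at_unique[OF x] l by blast
 qed
 thus ?thesis using x by (simp add: Ex_def)
qed

lemma Ex_repr:
 assumes "X \<in> carrier QQ"
 obtains x y where "x \<in> T" "X = cl x" "lim_at n x y" "y \<in> carrier (A n)" "Ex n X = can n y"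
 using assms S.carrier_Q lim_at_exists Ex_cl lim_at_def by metis

lemma lim_at_const:
 assumes a: "a \<in> carrier (A n)" shows "lim_at n (const_thread n a) a"
 using a by (simp add: lim_at_def Fc_conn)

lemma Ex_can: "a \<in> carrier (A n) ==> Ex n (can n a) = can n a"
 using Ex_cl[OF const_thread_T lim_at_const] by (simp add: can_def)

lemma lim_at_add:
 assumes x: "x \<in> T" and x': "x' \<in> T" and l: "lim_at n x y" "lim_at n x' y'"
 shows "lim_at n (\<lambda>m. x m \<oplus>\<^bsub>A m\<^esub> x' m) (y \<oplus>\<^bsub>A n\<^esub> y')"
proof -
 have y: "y \<in> carrier (A n)" "y' \<in> carrier (A n)" and l0: "(\<lambda>k. cdist (A n) (Fc n k (x (n + k))) y) \<longlonglongrightarrow> 0"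
  "(\<lambda>k. cdist (A n) (Fc n k (x' (n + k))) y') \<longlonglongrightarrow> 0" using l by (auto simp: lim_at_def)
 have xc: "x m \<in> carrier (A m)" "x' m \<in> carrier (A m)" for m using threadD(1)[OF x] threadD(1)[OF x'] by auto
 have "(\<lambda>k. cdist (A n) (Fc n k (x (n + k) \<oplus>\<^bsub>A (n + k)\<^esub> x' (n + k))) (y \<oplus>\<^bsub>A n\<^esub> y')) \<longlonglongrightarrow> 0"
 proof (rule null_seq_le)
  fix k
  have c: "Fc n k (x (n + k)) \<in> carrier (A n)" "Fc n k (x' (n + k)) \<in> carrier (A n)" using xc by auto
  have "Fc n k (x (n + k) \<oplus>\<^bsub>A (n + k)\<^esub> x' (n + k)) \<ominus>\<^bsub>A n\<^esub> (y \<oplus>\<^bsub>A n\<^esub> y') =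
   (Fc n k (x (n + k)) \<ominus>\<^bsub>A n\<^esub> y) \<oplus>\<^bsub>A n\<^esub> (Fc n k (x' (n + k)) \<ominus>\<^bsub>A n\<^esub> y')"
   unfolding Fc_add[OF xc(1) xc(2)] using c y by algebra
  thus "cdist (A n) (Fc n k (x (n + k) \<oplus>\<^bsub>A (n + k)\<^esub> x' (n + k))) (y \<oplus>\<^bsub>A n\<^esub> y') \<le>
   cdist (A n) (Fc n k (x (n + k))) y + cdist (A n) (Fc n k (x' (n + k))) y'"
   using lev.cnorm_triangle[of "Fc n k (x (n + k)) \<ominus>\<^bsub>A n\<^esub> y" n "Fc n k (x' (n + k)) \<ominus>\<^bsub>A n\<^esub> y'"] c y by simp
  show "0 \<le> cdist (A n) (Fc n k (x (n + k) \<oplus>\<^bsub>A (n + k)\<^esub> x' (n + k))) (y \<oplus>\<^bsub>A n\<^esub> y')" using xc y by simp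
 next
  show "(\<lambda>k. cdist (A n) (Fc n k (x (n + k))) y + cdist (A n) (Fc n k (x' (n + k))) y') \<longlonglongrightarrow> 0"
   using tendsto_add[OF l0] by simp
 qed
 thus ?thesis using y by (simp add: lim_at_def)
qed

lemma lim_at_smult:
 assumes x: "x \<in> T" and l: "lim_at n x y"
 shows "lim_at n (\<lambda>m. c \<odot>\<^bsub>A m\<^esub> x m) (c \<odot>\<^bsub>A n\<^esub> y)"
proof -
 have y: "y \<in> carrier (A n)" and l0: "(\<lambda>k. cdist (A n) (Fc n k (x (n + k))) y) \<longlonglongrightarrow> 0" using l by (auto simp: lim_at_def)
 have xc: "x m \<in> carrier (A m)" for m using threadD(1)[OF x] .
 have "cdist (A n) (Fc n k (c \<odot>\<^bsub>A (n + k)\<^esub> x (n + k))) (c \<odot>\<^bsub>A n\<^esub> y) = cmod c * cdist (A n) (Fc n k (x (n + k))) y" for k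
  using lev.smult_minus_right[of "Fc n k (x (n + k))" n y c] lev.cnorm_smult[of "Fc n k (x (n + k)) \<ominus>\<^bsub>A n\<^esub> y" n c] xc y
  by (simp add: Fc_smult)
 thus ?thesis using y tendsto_mult_left[OF l0, of "cmod c"] by (simp add: lim_at_def)
qed

lemma lim_at_star:
 assumes x: "x \<in> T" and l: "lim_at n x y"
 shows "lim_at n (\<lambda>m. star (A m) (x m)) (star (A n) y)"
proof -
 have y: "y \<in> carrier (A n)" and l0: "(\<lambda>k. cdist (A n) (Fc n k (x (n + k))) y) \<longlonglongrightarrow> 0" using l by (auto simp: lim_at_def)
 have xc: "x m \<in> carrier (A m)" for m using threadD(1)[OF x] .
 have "cdist (A n) (Fc n k (star (A (n + k)) (x (n + k)))) (star (A n) y) = cdist (A n) (Fc n k (x (n + k))) y" for k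
  using lev.star_minus[OF Fc_closed[OF xc] y, of k] lev.cnorm_star[of "Fc n k (x (n + k)) \<ominus>\<^bsub>A n\<^esub> y" n] xc y
  by (simp add: Fc_star)
 thus ?thesis using y l0 by (simp add: lim_at_def)
qed

lemma lim_at_bimod:
 assumes x: "x \<in> T" and l: "lim_at n x y" and b: "b \<in> carrier (A n)" and c: "c \<in> carrier (A n)"
 shows "lim_at n (\<lambda>m. const_thread n b m \<otimes>\<^bsub>A m\<^esub> x m \<otimes>\<^bsub>A m\<^esub> const_thread n c m) (b \<otimes>\<^bsub>A n\<^esub> y \<otimes>\<^bsub>A n\<^esub> c)"
proof -
 have y: "y \<in> carrier (A n)" and l0: "(\<lambda>k. cdist (A n) (Fc n k (x (n + k))) y) \<longlonglongrightarrow> 0" using l by (auto simp: lim_at_def)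
 have xc: "x m \<in> carrier (A m)" for m using threadD(1)[OF x] .
 have "(\<lambda>k. cdist (A n) (b \<otimes>\<^bsub>A n\<^esub> Fc n k (x (n + k)) \<otimes>\<^bsub>A n\<^esub> c) (b \<otimes>\<^bsub>A n\<^esub> y \<otimes>\<^bsub>A n\<^esub> c)) \<longlonglongrightarrow> 0"
 proof (rule null_seq_le)
  fix k
  have f: "Fc n k (x (n + k)) \<in> carrier (A n)" using xc by auto
  have "b \<otimes>\<^bsub>A n\<^esub> Fc n k (x (n + k)) \<otimes>\<^bsub>A n\<^esub> c \<ominus>\<^bsub>A n\<^esub> b \<otimes>\<^bsub>A n\<^esub> y \<otimes>\<^bsub>A n\<^esub> c = b \<otimes>\<^bsub>A n\<^esub> (Fc n k (x (n + k)) \<ominus>\<^bsub>A n\<^esub> y) \<otimes>\<^bsub>A n\<^esub> c"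
   using f y b c by algebra
  also have "cnorm (A n) \<dots> \<le> cnorm (A n) b * cdist (A n) (Fc n k (x (n + k))) y * cnorm (A n) c"
   using lev.cnorm_mult[of "b \<otimes>\<^bsub>A n\<^esub> (Fc n k (x (n + k)) \<ominus>\<^bsub>A n\<^esub> y)" n c]
    mult_right_mono[OF lev.cnorm_mult[of b n "Fc n k (x (n + k)) \<ominus>\<^bsub>A n\<^esub> y"], of "cnorm (A n) c"] f y b c by simp
  finally show "cdist (A n) (b \<otimes>\<^bsub>A n\<^esub> Fc n k (x (n + k)) \<otimes>\<^bsub>A n\<^esub> c) (b \<otimes>\<^bsub>A n\<^esub> y \<otimes>\<^bsub>A n\<^esub> c) \<le> cnorm (A n) b * cdist (A n) (Fc n k (x (n + k))) y * cnorm (A n) c" .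
  show "0 \<le> cdist (A n) (b \<otimes>\<^bsub>A n\<^esub> Fc n k (x (n + k)) \<otimes>\<^bsub>A n\<^esub> c) (b \<otimes>\<^bsub>A n\<^esub> y \<otimes>\<^bsub>A n\<^esub> c)" using f y b c by simp
 next
  show "(\<lambda>k. cnorm (A n) b * cdist (A n) (Fc n k (x (n + k))) y * cnorm (A n) c) \<longlonglongrightarrow> 0"
   using tendsto_mult_right[OF tendsto_mult_left[OF l0, of "cnorm (A n) b"], of "cnorm (A n) c"] by simp
 qed
 thus ?thesis using y b c xc by (simp add: lim_at_def Fc_bimod)
qed

lemma lim_at_norm:
 assumes x: "x \<in> T" and l: "lim_at n x y"
 shows "cnorm (A n) y \<le> seq_norm A x"
proof (rule field_le_epsilon)
 fix e :: real assume e: "0 < e"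
 have y: "y \<in> carrier (A n)" and l0: "(\<lambda>k. cdist (A n) (Fc n k (x (n + k))) y) \<longlonglongrightarrow> 0" using l by (auto simp: lim_at_def)
 have xc: "x m \<in> carrier (A m)" for m using threadD(1)[OF x] .
 have e2: "0 < e/2" using e by simp
 have 1: "\<forall>\<^sub>F k in sequentially. cdist (A n) (Fc n k (x (n + k))) y < e/2" using order_tendstoD(2)[OF l0 e2] .
 obtain M where M: "\<And>m. m \<ge> M ==> cnorm (A m) (x m) \<le> seq_norm A x + e/2"
  using S.seq_norm_eps[OF x e2] unfolding eventually_sequentially by blast
 obtain M' where M': "\<And>k. k \<ge> M' ==> cdist (A n) (Fc n k (x (n + k))) y < e/2" using 1 unfolding eventually_sequentially by blast
 let ?k = "max M M'"
 have "cnorm (A n) y \<le> cdist (A n) y (Fc n ?k (x (n + ?k))) + cnorm (A n) (Fc n ?k (x (n + ?k)))"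
  by (rule lev.cnorm_le_dist) (use y xc in auto)
 also have "\<dots> \<le> e/2 + (seq_norm A x + e/2)"
  using M'[of ?k, OF max.cobounded2] M[of "n + ?k", OF trans_le_add2[OF max.cobounded1]] Fc_norm[OF xc[of "n + ?k"]] lev.cnorm_minus_commute[OF y Fc_closed[OF xc], of ?k] by linarith
 finally show "cnorm (A n) y \<le> seq_norm A x + e" by simp
qed

lemma lim_at_tower:
 assumes x: "x \<in> T" and l: "lim_at (n + j) x y"
 shows "lim_at n x (Fc n j y)"
proof -
 have y: "y \<in> carrier (A (n + j))" and l0: "(\<lambda>k. cdist (A (n + j)) (Fc (n + j) k (x (n + j + k))) y) \<longlonglongrightarrow> 0" using l by (auto simp: lim_at_def)
 have xc: "x m \<in> carrier (A m)" for m using threadD(1)[OF x] .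
 have "(\<lambda>k. cdist (A n) (Fc n (k + j) (x (n + (k + j)))) (Fc n j y)) \<longlonglongrightarrow> 0"
 proof (rule null_seq_le[OF _ _ l0])
  fix k
  have f: "Fc (n + j) k (x (n + j + k)) \<in> carrier (A (n + j))" using xc by simp
  have "Fc n (k + j) (x (n + (k + j))) = Fc n j (Fc (n + j) k (x (n + j + k)))"
   using Fc_add_index[of n j k] by (simp add: add.commute add.left_commute)
  hence "Fc n (k + j) (x (n + (k + j))) \<ominus>\<^bsub>A n\<^esub> Fc n j y = Fc n j (Fc (n + j) k (x (n + j + k)) \<ominus>\<^bsub>A (n + j)\<^esub> y)"
   using Fc_minus[OF f y] by simp
  thus "cdist (A n) (Fc n (k + j) (x (n + (k + j)))) (Fc n j y) \<le> cdist (A (n + j)) (Fc (n + j) k (x (n + j + k))) y"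
   using Fc_norm[of "Fc (n + j) k (x (n + j + k)) \<ominus>\<^bsub>A (n + j)\<^esub> y" n j] f y by simp
  show "0 \<le> cdist (A n) (Fc n (k + j) (x (n + (k + j)))) (Fc n j y)" using Fc_closed[OF xc[of "n + (k + j)"]] y by simp
 qed
 hence "(\<lambda>k. cdist (A n) (Fc n k (x (n + k))) (Fc n j y)) \<longlonglongrightarrow> 0" by (rule LIMSEQ_offset)
 thus ?thesis using y by (simp add: lim_at_def)
qed

lemma Ex_closed [simp]: "X \<in> carrier QQ ==> Ex n X \<in> carrier QQ"
 by (elim Ex_repr[of X n]) simp

lemma Ex_in: "X \<in> carrier QQ ==> Ex n X \<in> can n ` carrier (A n)"
 by (elim Ex_repr[of X n]) simp

lemma Ex_add: assumes X: "X \<in> carrier QQ" "Y \<in> carrier QQ" shows "Ex n (X \<oplus>\<^bsub>QQ\<^esub> Y) = Ex n X \<oplus>\<^bsub>QQ\<^esub> Ex n Y"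
proof -
 obtain x y where x: "x \<in> T" "X = cl x" "lim_at n x y" "y \<in> carrier (A n)" "Ex n X = can n y" using Ex_repr[OF X(1), of n] .
 obtain x' y' where x': "x' \<in> T" "Y = cl x'" "lim_at n x' y'" "y' \<in> carrier (A n)" "Ex n Y = can n y'" using Ex_repr[OF X(2), of n] .
 have "Ex n (cl (\<lambda>m. x m \<oplus>\<^bsub>A m\<^esub> x' m)) = can n (y \<oplus>\<^bsub>A n\<^esub> y')"
  by (rule Ex_cl[OF S.T_add[OF x(1) x'(1)] lim_at_add[OF x(1) x'(1) x(3) x'(3)]])
 thus ?thesis unfolding x(5) x'(5) unfolding x(2) x'(2) S.Q_simps(5)[OF x(1) x'(1)] can_hom(1)[OF x(4) x'(4)] .
qed

lemma Ex_smult: assumes X: "X \<in> carrier QQ" shows "Ex n (c \<odot>\<^bsub>QQ\<^esub> X) = c \<odot>\<^bsub>QQ\<^esub> Ex n X"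
proof -
 obtain x y where x: "x \<in> T" "X = cl x" "lim_at n x y" "y \<in> carrier (A n)" "Ex n X = can n y" using Ex_repr[OF X(1), of n] .
 have "Ex n (cl (\<lambda>m. c \<odot>\<^bsub>A m\<^esub> x m)) = can n (c \<odot>\<^bsub>A n\<^esub> y)"
  by (rule Ex_cl[OF S.T_smult[OF x(1)] lim_at_smult[OF x(1) x(3)]])
 thus ?thesis unfolding x(5) unfolding x(2) S.Q_simps(6)[OF x(1)] can_hom(3)[OF x(4) x(4)] .
qed

lemma Ex_star: assumes X: "X \<in> carrier QQ" shows "Ex n (star QQ X) = star QQ (Ex n X)"
proof -
 obtain x y where x: "x \<in> T" "X = cl x" "lim_at n x y" "y \<in> carrier (A n)" "Ex n X = can n y" using Ex_repr[OF X(1), of n] .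
 have "Ex n (cl (\<lambda>m. star (A m) (x m))) = can n (star (A n) y)"
  by (rule Ex_cl[OF S.T_star[OF x(1)] lim_at_star[OF x(1) x(3)]])
 thus ?thesis unfolding x(5) unfolding x(2) S.Q_simps(7)[OF x(1)] can_hom(4)[OF x(4) x(4)] .
qed

lemma Ex_minus: "X \<in> carrier QQ ==> Y \<in> carrier QQ ==> Ex n (X \<ominus>\<^bsub>QQ\<^esub> Y) = Ex n X \<ominus>\<^bsub>QQ\<^esub> Ex n Y"
 by (simp add: Q.minus_smult Ex_add Ex_smult)

lemma Ex_bimod:
 assumes X: "X \<in> carrier QQ" and b: "b \<in> carrier (A n)" and c: "c \<in> carrier (A n)"
 shows "Ex n (can n b \<otimes>\<^bsub>QQ\<^esub> X \<otimes>\<^bsub>QQ\<^esub> can n c) = can n b \<otimes>\<^bsub>QQ\<^esub> Ex n X \<otimes>\<^bsub>QQ\<^esub> can n c"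
proof -
 obtain x y where x: "x \<in> T" "X = cl x" "lim_at n x y" "y \<in> carrier (A n)" "Ex n X = can n y" using Ex_repr[OF X(1), of n] .
 note t = const_thread_T[OF b] const_thread_T[OF c]
 have "Ex n (cl (\<lambda>m. const_thread n b m \<otimes>\<^bsub>A m\<^esub> x m \<otimes>\<^bsub>A m\<^esub> const_thread n c m)) = can n (b \<otimes>\<^bsub>A n\<^esub> y \<otimes>\<^bsub>A n\<^esub> c)"
  by (rule Ex_cl[OF S.T_mult[OF S.T_mult[OF t(1) x(1)] t(2)] lim_at_bimod[OF x(1) x(3) b c]])
 also have "can n (b \<otimes>\<^bsub>A n\<^esub> y \<otimes>\<^bsub>A n\<^esub> c) = can n b \<otimes>\<^bsub>QQ\<^esub> can n y \<otimes>\<^bsub>QQ\<^esub> can n c"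
  using b c x(4) by (simp add: can_hom)
 finally show ?thesis
  unfolding x(5) unfolding x(2) unfolding can_def[of n b] can_def[of n c] S.Q_simps(4)[OF t(1) x(1)]
   S.Q_simps(4)[OF S.T_mult[OF t(1) x(1)] t(2)] .
qed

lemma Ex_norm: assumes X: "X \<in> carrier QQ" shows "cnorm QQ (Ex n X) \<le> cnorm QQ X"
proof -
 obtain x y where x: "x \<in> T" "X = cl x" "lim_at n x y" "y \<in> carrier (A n)" "Ex n X = can n y" using Ex_repr[OF X(1), of n] .
 show ?thesis unfolding x(5) can_norm[OF x(4)] unfolding x(2) S.Q_simps(8)[OF x(1)] by (rule lim_at_norm[OF x(1,3)])
qed

lemma Ex_tower_can:
 assumes a: "a \<in> carrier (A (n + j))" shows "Ex n (can (n + j) a) = can n (Fc n j a)"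
 unfolding can_def[of "n + j"]
 by (rule Ex_cl[OF const_thread_T[OF a] lim_at_tower[OF const_thread_T[OF a] lim_at_const[OF a]]])

lemma Ex_tower: assumes X: "X \<in> carrier QQ" shows "Ex n (Ex (n + j) X) = Ex n X"
proof -
 obtain x y where x: "x \<in> T" "X = cl x" "lim_at (n + j) x y" "y \<in> carrier (A (n + j))" "Ex (n + j) X = can (n + j) y" using Ex_repr[OF X(1), of "n + j"] .
 show ?thesis unfolding x(5) Ex_tower_can[OF x(4)] unfolding x(2) by (rule Ex_cl[OF x(1) lim_at_tower[OF x(1,3)], symmetric])
qed

text \<open>The expectation of \<open>X\<^sup>* X\<close> satisfies the norm condition of \<open>sqrt_exists\<close>, because \<open>Ex n\<close> is unital and
  contractive.\<close>

lemma Ex_positive: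
 assumes X: "X \<in> carrier QQ" shows "\<exists>b\<in>self_adjoint QQ. Ex n (star QQ X \<otimes>\<^bsub>QQ\<^esub> X) = b \<otimes>\<^bsub>QQ\<^esub> b"
proof (rule Q.sqrt_exists[where r = "(cnorm QQ X)\<^sup>2"])
 let ?h = "star QQ X \<otimes>\<^bsub>QQ\<^esub> X"
 have h: "?h \<in> carrier QQ" using X by simp
 have "star QQ (Ex n ?h) = Ex n (star QQ ?h)" by (rule Ex_star[OF h, symmetric])
 also have "star QQ ?h = ?h" using X by (simp add: Q.star_mult)
 finally show "Ex n ?h \<in> self_adjoint QQ" using h by (intro Q.self_adjointI) auto
 let ?r = "cor ((cnorm QQ X)\<^sup>2) \<odot>\<^bsub>QQ\<^esub> \<one>\<^bsub>QQ\<^esub>"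
 have "Ex n ?r = ?r" using Ex_can[of "\<one>\<^bsub>A n\<^esub>" n] by (simp add: Ex_smult can_one)
 hence "?r \<ominus>\<^bsub>QQ\<^esub> Ex n ?h = Ex n (?r \<ominus>\<^bsub>QQ\<^esub> ?h)" using h by (simp add: Ex_minus)
 thus "cdist QQ ?r (Ex n ?h) \<le> (cnorm QQ X)\<^sup>2"
  using Ex_norm[of "?r \<ominus>\<^bsub>QQ\<^esub> ?h" n] Q.square_positive[OF X order_refl] h by simp
qed

lemma Ex_conditional_expectation: "conditional_expectation QQ (can n ` carrier (A n)) (Ex n)"
 unfolding conditional_expectation_def
proof (intro conjI ballI allI)
 show "Ex n \<in> carrier QQ \<rightarrow>\<^sub>E can n ` carrier (A n)"
  using Ex_in by (auto simp: PiE_def Ex_def)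
 show "\<exists>b\<in>carrier QQ. Ex n (star QQ a \<otimes>\<^bsub>QQ\<^esub> a) = star QQ b \<otimes>\<^bsub>QQ\<^esub> b" if "a \<in> carrier QQ" for a
  using Ex_positive[OF that, of n] Q.self_adjointD by metis
qed (use Ex_can Ex_bimod in \<open>auto simp: Ex_add Ex_smult Ex_norm\<close>)

end

section \<open>Uniqueness of the trace and of the expectations\<close>

text \<open>Level \<open>0\<close> consists of the scalars, so the expectation onto it is a trace.  \<open>trace_unique\<close> speaks about
  compatible sequences of tracial functionals on the levels, which are the restrictions of tracial
  states of the limit.\<close>

locale traced_tower = ind_tower A \<alpha> F for A :: "nat => 'a cstar" and \<alpha> F +
 assumes dim0: "x \<in> carrier (A 0) ==> \<exists>c. x = c \<odot>\<^bsub>A 0\<^esub> \<one>\<^bsub>A 0\<^esub>"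
  and trace_sym: "x \<in> carrier (A n) ==> y \<in> carrier (A n) ==> Fc 0 n (x \<otimes>\<^bsub>A n\<^esub> y) = Fc 0 n (y \<otimes>\<^bsub>A n\<^esub> x)"
  and faithful: "x \<in> carrier (A n) ==> Fc 0 n (star (A n) x \<otimes>\<^bsub>A n\<^esub> x) = \<zero>\<^bsub>A 0\<^esub> ==> x = \<zero>\<^bsub>A n\<^esub>"
  and trace_unique: "\<And>t n x.
   (\<And>n x y. x \<in> carrier (A n) ==> y \<in> carrier (A n) ==> t n (x \<oplus>\<^bsub>A n\<^esub> y) = t n x + t n y) ==>
   (\<And>n x c. x \<in> carrier (A n) ==> t n (c \<odot>\<^bsub>A n\<^esub> x) = c * t n x) ==>
   (\<And>n x y. x \<in> carrier (A n) ==> y \<in> carrier (A n) ==> t n (x \<otimes>\<^bsub>A n\<^esub> y) = t n (y \<otimes>\<^bsub>A n\<^esub> x)) ==>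
   (\<And>n x. x \<in> carrier (A n) ==> 0 \<le> t n (star (A n) x \<otimes>\<^bsub>A n\<^esub> x)) ==>
   (\<And>n. t n \<one>\<^bsub>A n\<^esub> = 1) ==>
   (\<And>n x. x \<in> carrier (A n) ==> t (Suc n) (\<alpha> n x) = t n x) ==>
   x \<in> carrier (A n) ==> Fc 0 n x = t n x \<odot>\<^bsub>A 0\<^esub> \<one>\<^bsub>A 0\<^esub>"
  and coords: "\<exists>S. finite S \<and> S \<subseteq> carrier (A n) \<and> (\<forall>\<phi>.
   (\<forall>x\<in>carrier (A n). \<forall>y\<in>carrier (A n). \<phi> (x \<oplus>\<^bsub>A n\<^esub> y) = \<phi> x + \<phi> y) \<longrightarrow>
   (\<forall>x\<in>carrier (A n). \<forall>c. \<phi> (c \<odot>\<^bsub>A n\<^esub> x) = c * \<phi> x) \<longrightarrow>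
   (\<forall>x\<in>carrier (A n). cmod (\<phi> x) \<le> cnorm (A n) x * (\<Sum>s\<in>S. cmod (\<phi> s))))"
begin

lemma Q_nontrivial: "\<one>\<^bsub>QQ\<^esub> \<noteq> \<zero>\<^bsub>QQ\<^esub>"
 using unital_cstar.one_not_zero[OF S.unital_cstar_Q[OF A_nontrivial]] .

lemma Q_one_norm_pos: "0 < cnorm QQ \<one>\<^bsub>QQ\<^esub>"
 using Q.cnorm_nonneg[OF Q.A.one_closed] Q.cnorm_eq_0_iff[OF Q.A.one_closed] Q_nontrivial by (simp add: less_le)

lemma scalar_inj: "c \<odot>\<^bsub>QQ\<^esub> \<one>\<^bsub>QQ\<^esub> = c' \<odot>\<^bsub>QQ\<^esub> \<one>\<^bsub>QQ\<^esub> ==> c = c'"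
proof -
 assume "c \<odot>\<^bsub>QQ\<^esub> \<one>\<^bsub>QQ\<^esub> = c' \<odot>\<^bsub>QQ\<^esub> \<one>\<^bsub>QQ\<^esub>"
 hence "(c - c') \<odot>\<^bsub>QQ\<^esub> \<one>\<^bsub>QQ\<^esub> = \<zero>\<^bsub>QQ\<^esub>" by (simp add: Q.smult_minus_left)
 hence "cmod (c - c') * cnorm QQ \<one>\<^bsub>QQ\<^esub> = 0" using Q.cnorm_smult[OF Q.A.one_closed, of "c - c'"] by simp
 thus ?thesis using Q_one_norm_pos by simp
qed

lemma scalar_B0: "b \<in> can 0 ` carrier (A 0) ==> \<exists>c. b = c \<odot>\<^bsub>QQ\<^esub> \<one>\<^bsub>QQ\<^esub>"
proof -
 assume "b \<in> can 0 ` carrier (A 0)"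
 then obtain x where x: "x \<in> carrier (A 0)" "b = can 0 x" by blast
 obtain c where c: "x = c \<odot>\<^bsub>A 0\<^esub> \<one>\<^bsub>A 0\<^esub>" using dim0[OF x(1)] by blast
 have "can 0 x = c \<odot>\<^bsub>QQ\<^esub> \<one>\<^bsub>QQ\<^esub>" unfolding c using can_hom(3)[OF lev.A.one_closed lev.A.one_closed, of 0 c] can_one by simp
 thus ?thesis using x(2) by blast
qed

definition sig :: "(nat => 'a) set => complex" where
 "sig = (\<lambda>X\<in>carrier QQ. THE c. Ex 0 X = c \<odot>\<^bsub>QQ\<^esub> \<one>\<^bsub>QQ\<^esub>)"

lemma sig_eqI: "X \<in> carrier QQ ==> Ex 0 X = c \<odot>\<^bsub>QQ\<^esub> \<one>\<^bsub>QQ\<^esub> ==> sig X = c"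
 unfolding sig_def by (simp, rule the_equality) (auto intro: scalar_inj)

lemma Ex_0: "X \<in> carrier QQ ==> Ex 0 X = sig X \<odot>\<^bsub>QQ\<^esub> \<one>\<^bsub>QQ\<^esub>"
 using scalar_B0[OF Ex_in[of X 0]] sig_eqI by metis

lemma sig_Ex: assumes X: "X \<in> carrier QQ" shows "sig (Ex n X) = sig X"
 by (rule sig_eqI) (use X Ex_tower[OF X, of 0 n] Ex_0[OF X] in simp_all)

lemma sig_mult_commute:
 assumes X: "X \<in> carrier QQ" "Y \<in> carrier QQ" shows "sig (X \<otimes>\<^bsub>QQ\<^esub> Y) = sig (Y \<otimes>\<^bsub>QQ\<^esub> X)"
proof (rule sig_eqI)
 obtain x where x: "x \<in> T" "X = cl x" using X(1) S.carrier_Q by blast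
 obtain y where y: "y \<in> T" "Y = cl y" using X(2) S.carrier_Q by blast
 have xc: "x m \<in> carrier (A m)" "y m \<in> carrier (A m)" for m using threadD(1)[OF x(1)] threadD(1)[OF y(1)] by auto
 note t = S.T_mult[OF x(1) y(1)] S.T_mult[OF y(1) x(1)]
 obtain z where z: "lim_at 0 (\<lambda>n. y n \<otimes>\<^bsub>A n\<^esub> x n) z" using lim_at_exists[OF t(2)] by blast
 have z': "lim_at 0 (\<lambda>n. x n \<otimes>\<^bsub>A n\<^esub> y n) z" using z trace_sym[OF xc(1) xc(2)] by (simp add: lim_at_def)
 have "Ex 0 (X \<otimes>\<^bsub>QQ\<^esub> Y) = Ex 0 (Y \<otimes>\<^bsub>QQ\<^esub> X)"
  unfolding x(2) y(2) S.Q_simps(4)[OF x(1) y(1)] S.Q_simps(4)[OF y(1) x(1)] Ex_cl[OF t(1) z'] Ex_cl[OF t(2) z] ..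
 thus "Ex 0 (X \<otimes>\<^bsub>QQ\<^esub> Y) = sig (Y \<otimes>\<^bsub>QQ\<^esub> X) \<odot>\<^bsub>QQ\<^esub> \<one>\<^bsub>QQ\<^esub>" using Ex_0[of "Y \<otimes>\<^bsub>QQ\<^esub> X"] X by simp
qed (use X in simp)

lemma sig_positive: assumes X: "X \<in> carrier QQ" shows "0 \<le> sig (star QQ X \<otimes>\<^bsub>QQ\<^esub> X)"
proof -
 let ?h = "star QQ X \<otimes>\<^bsub>QQ\<^esub> X" and ?r = "(cnorm QQ X)\<^sup>2"
 have h: "?h \<in> carrier QQ" using X by simp
 have "star QQ ?h = ?h" using X by (simp add: Q.star_mult)
 hence "star QQ (Ex 0 ?h) = Ex 0 ?h" using Ex_star[OF h, of 0] by simp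
 hence "cnj (sig ?h) \<odot>\<^bsub>QQ\<^esub> \<one>\<^bsub>QQ\<^esub> = sig ?h \<odot>\<^bsub>QQ\<^esub> \<one>\<^bsub>QQ\<^esub>" unfolding Ex_0[OF h] by (simp add: Q.star_smult)
 hence real: "cnj (sig ?h) = sig ?h" by (rule scalar_inj)
 have R: "cor ?r \<odot>\<^bsub>QQ\<^esub> \<one>\<^bsub>QQ\<^esub> = Ex 0 (cor ?r \<odot>\<^bsub>QQ\<^esub> \<one>\<^bsub>QQ\<^esub>)"
  using Ex_can[of "\<one>\<^bsub>A 0\<^esub>" 0] by (simp add: Ex_smult can_one)
 have "cnorm QQ ((cor ?r - sig ?h) \<odot>\<^bsub>QQ\<^esub> \<one>\<^bsub>QQ\<^esub>) = cnorm QQ (Ex 0 (cor ?r \<odot>\<^bsub>QQ\<^esub> \<one>\<^bsub>QQ\<^esub> \<ominus>\<^bsub>QQ\<^esub> ?h))"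
  using Ex_minus[OF _ h, of "cor ?r \<odot>\<^bsub>QQ\<^esub> \<one>\<^bsub>QQ\<^esub>" 0] R Ex_0[OF h] by (simp add: Q.smult_minus_left)
 also have "\<dots> \<le> cdist QQ (cor ?r \<odot>\<^bsub>QQ\<^esub> \<one>\<^bsub>QQ\<^esub>) ?h" by (rule Ex_norm) (use h in simp)
 also have "\<dots> \<le> ?r" by (rule Q.square_positive[OF X order_refl])
 finally have le: "cmod (cor ?r - sig ?h) * cnorm QQ \<one>\<^bsub>QQ\<^esub> \<le> ?r" by (simp add: Q.cnorm_smult)
 have "cnorm QQ \<one>\<^bsub>QQ\<^esub> = 1"
 proof -
  have "cnorm QQ \<one>\<^bsub>QQ\<^esub> = (cnorm QQ \<one>\<^bsub>QQ\<^esub>)\<^sup>2" using Q.cstar_identity[OF Q.A.one_closed] by simp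
  thus ?thesis using Q_one_norm_pos by (simp add: power2_eq_square)
 qed
 hence "cmod (cor ?r - sig ?h) \<le> ?r" using le by simp
 hence "\<bar>Re (cor ?r - sig ?h)\<bar> \<le> ?r" using abs_Re_le_cmod order_trans by blast
 hence "0 \<le> Re (sig ?h)" by simp
 moreover have "Im (sig ?h) = 0" using real by (simp add: complex_eq_iff)
 ultimately show ?thesis by (simp add: less_eq_complex_def)
qed

lemma tracial_state_sig: "tracial_state QQ sig"
 unfolding tracial_state_def states_def linear_functional_def
proof (intro conjI CollectI ballI allI)
 show "sig \<in> extensional (carrier QQ)" by (simp add: sig_def)
 show "sig (a \<oplus>\<^bsub>QQ\<^esub> b) = sig a + sig b" if "a \<in> carrier QQ" "b \<in> carrier QQ" for a b
  by (rule sig_eqI) (use that in \<open>simp_all add: Ex_add Ex_0 Q.smult_add_left\<close>)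
 show "sig (c \<odot>\<^bsub>QQ\<^esub> a) = c * sig a" if "a \<in> carrier QQ" for a c
  by (rule sig_eqI) (use that in \<open>simp_all add: Ex_smult Ex_0 Q.smult_assoc'\<close>)
 show "sig \<one>\<^bsub>QQ\<^esub> = 1"
  by (rule sig_eqI) (use Ex_can[of "\<one>\<^bsub>A 0\<^esub>" 0] in \<open>simp_all add: can_one\<close>)
qed (use sig_positive sig_mult_commute in blast)+

lemma sig_can: assumes "x \<in> carrier (A n)" "Fc 0 n x = c \<odot>\<^bsub>A 0\<^esub> \<one>\<^bsub>A 0\<^esub>" shows "sig (can n x) = c"
proof (rule sig_eqI)
 have "Ex 0 (can n x) = can 0 (Fc 0 n x)" using Ex_tower_can[of x 0 n] assms(1) by simp
 also have "\<dots> = c \<odot>\<^bsub>QQ\<^esub> \<one>\<^bsub>QQ\<^esub>" unfolding assms(2) using can_hom(3)[OF lev.A.one_closed lev.A.one_closed, of 0 c] can_one by simp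
 finally show "Ex 0 (can n x) = c \<odot>\<^bsub>QQ\<^esub> \<one>\<^bsub>QQ\<^esub>" .
qed (use assms in simp)

lemma can_dense:
 assumes X: "X \<in> carrier QQ" and e: "0 < e"
 shows "\<exists>n. \<exists>b\<in>can n ` carrier (A n). cdist QQ X b < e"
proof -
 obtain x where x: "x \<in> T" "X = cl x" using X S.carrier_Q by blast
 show ?thesis using can_approx[OF x(1) e] threadD(1)[OF x(1)] unfolding x(2) by blast
qed

lemma tracial_state_unique: assumes t: "tracial_state QQ \<tau>" shows "\<tau> = sig"
proof -
 have ts: "\<tau> \<in> states QQ" using t by (simp add: tracial_state_def)
 have ss: "sig \<in> states QQ" using tracial_state_sig by (simp add: tracial_state_def)
 have eq: "\<tau> (can n x) = sig (can n x)" if x: "x \<in> carrier (A n)" for n x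
 proof (rule sig_can[OF x, symmetric], rule trace_unique[of "\<lambda>n x. \<tau> (can n x)", OF _ _ _ _ _ _ x])
  fix n x y assume xy: "x \<in> carrier (A n)" "y \<in> carrier (A n)"
  show "\<tau> (can n (x \<oplus>\<^bsub>A n\<^esub> y)) = \<tau> (can n x) + \<tau> (can n y)"
   using Q.states_D(1)[OF ts, of "can n x" "can n y"] xy by (simp add: can_hom)
  show "\<tau> (can n (x \<otimes>\<^bsub>A n\<^esub> y)) = \<tau> (can n (y \<otimes>\<^bsub>A n\<^esub> x))"
   using t xy by (simp add: can_hom tracial_state_def)
 next
  fix n x c assume x: "x \<in> carrier (A n)"
  show "\<tau> (can n (c \<odot>\<^bsub>A n\<^esub> x)) = c * \<tau> (can n x)"
   using Q.states_D(2)[OF ts, of "can n x" c] x by (simp add: can_hom(3)[OF x x])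
  show "0 \<le> \<tau> (can n (star (A n) x \<otimes>\<^bsub>A n\<^esub> x))"
   using Q.states_D(3)[OF ts, of "can n x"] x by (simp add: can_hom(2) can_hom(4)[OF x x])
  show "\<tau> (can (Suc n) (\<alpha> n x)) = \<tau> (can n x)" using can_conn[OF x, of 1] by simp
 next
  fix n show "\<tau> (can n \<one>\<^bsub>A n\<^esub>) = 1" using Q.states_D(4)[OF ts] by (simp add: can_one)
 qed
 show ?thesis
 proof (rule extensionalityI[OF Q.states_D(5)[OF ts] Q.states_D(5)[OF ss]])
  fix X assume X: "X \<in> carrier QQ"
  have "cmod (\<tau> X - sig X) \<le> 0"
  proof (rule field_le_epsilon)
   fix e :: real assume e: "0 < e"
   hence "0 < e/4" by simp
   from can_dense[OF X this] obtain n x where x: "x \<in> carrier (A n)" "cdist QQ X (can n x) < e/4" by blast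
   let ?d = "X \<ominus>\<^bsub>QQ\<^esub> can n x"
   have d: "?d \<in> carrier QQ" using X x by simp
   have "\<tau> X - sig X = \<tau> ?d - sig ?d"
    using Q.states_minus[OF ts X can_closed[OF x(1)]] Q.states_minus[OF ss X can_closed[OF x(1)]] eq[OF x(1)] by simp
   hence "cmod (\<tau> X - sig X) \<le> cmod (\<tau> ?d) + cmod (sig ?d)" by (simp add: norm_triangle_ineq4)
   also have "\<dots> \<le> e" using Q.states_bound[OF ts d] Q.states_bound[OF ss d] x(2) by linarith
   finally show "cmod (\<tau> X - sig X) \<le> 0 + e" by simp
  qed
  thus "\<tau> X = sig X" by simp
 qed
qed

lemma the_trace: "(THE \<sigma>. tracial_state QQ \<sigma>) = sig"
 using tracial_state_sig tracial_state_unique by (rule the_equality)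

text \<open>If \<open>D\<close> is the difference of two such expectations at some element, then \<open>D\<close> lies in level \<open>n\<close>, and the
  bimodule property makes \<open>b D\<close> have trace zero for every \<open>b\<close> in that level.  With \<open>b = D\<^sup>*\<close>, faithfulness
  gives \<open>D = 0\<close>.\<close>

lemma expectation_unique:
 assumes E: "conditional_expectation QQ (can n ` carrier (A n)) E"
  and pres: "\<forall>a\<in>carrier QQ. sig (E a) = sig a"
 shows "E = Ex n"
proof -
 have ss: "sig \<in> states QQ" using tracial_state_sig by (simp add: tracial_state_def)
 have E1: "E \<in> carrier QQ \<rightarrow>\<^sub>E can n ` carrier (A n)" using E by (simp add: conditional_expectation_def)
 have E2: "\<forall>b\<in>can n ` carrier (A n). \<forall>c\<in>can n ` carrier (A n). \<forall>a\<in>carrier QQ. E (b \<otimes>\<^bsub>QQ\<^esub> a \<otimes>\<^bsub>QQ\<^esub> c) = b \<otimes>\<^bsub>QQ\<^esub> E a \<otimes>\<^bsub>QQ\<^esub> c"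
  using E by (simp add: conditional_expectation_def)
 show ?thesis
 proof (rule extensionalityI[of _ "carrier QQ"])
  show "E \<in> extensional (carrier QQ)" using E1 by (simp add: PiE_def)
  show "Ex n \<in> extensional (carrier QQ)" by (simp add: Ex_def)
  fix X assume X: "X \<in> carrier QQ"
  obtain y1 where y1: "y1 \<in> carrier (A n)" "E X = can n y1" using E1 X by blast
  obtain y2 where y2: "y2 \<in> carrier (A n)" "Ex n X = can n y2" using Ex_in[OF X, of n] by blast
  define y where "y = y1 \<ominus>\<^bsub>A n\<^esub> y2"
  have y: "y \<in> carrier (A n)" using y1 y2 by (simp add: y_def)
  have yd: "can n y = E X \<ominus>\<^bsub>QQ\<^esub> Ex n X" unfolding y_def y1 y2 using y1 y2 by (simp add: can_minus)
  let ?s = "can n (star (A n) y)"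
  have s: "?s \<in> carrier QQ" using y by simp
  have oneB: "\<one>\<^bsub>QQ\<^esub> \<in> can n ` carrier (A n)" using can_one[of n] by (metis imageI lev.A.one_closed)
  have e1: "E (?s \<otimes>\<^bsub>QQ\<^esub> X) = ?s \<otimes>\<^bsub>QQ\<^esub> E X"
   using E2[rule_format, of ?s "\<one>\<^bsub>QQ\<^esub>" X] oneB X y s y1 by simp
  have e2: "Ex n (?s \<otimes>\<^bsub>QQ\<^esub> X) = ?s \<otimes>\<^bsub>QQ\<^esub> Ex n X"
   using Ex_bimod[OF X, of "star (A n) y" n "\<one>\<^bsub>A n\<^esub>"] X y s by (simp add: can_one)
  have "?s \<otimes>\<^bsub>QQ\<^esub> can n y = ?s \<otimes>\<^bsub>QQ\<^esub> E X \<ominus>\<^bsub>QQ\<^esub> ?s \<otimes>\<^bsub>QQ\<^esub> Ex n X"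
  proof -
   have c: "E X \<in> carrier QQ" "Ex n X \<in> carrier QQ" using y1 X by auto
   show ?thesis unfolding yd using s c by algebra
  qed
  hence "sig (?s \<otimes>\<^bsub>QQ\<^esub> can n y) = sig (?s \<otimes>\<^bsub>QQ\<^esub> E X) - sig (?s \<otimes>\<^bsub>QQ\<^esub> Ex n X)"
   using Q.states_minus[OF ss, of "?s \<otimes>\<^bsub>QQ\<^esub> E X" "?s \<otimes>\<^bsub>QQ\<^esub> Ex n X"] s y1 X by simp
  also have "\<dots> = 0" unfolding e1[symmetric] e2[symmetric] using pres sig_Ex X s by simp
  finally have "sig (can n (star (A n) y \<otimes>\<^bsub>A n\<^esub> y)) = 0" using y by (simp add: can_hom(2))
  hence "Ex 0 (can n (star (A n) y \<otimes>\<^bsub>A n\<^esub> y)) = \<zero>\<^bsub>QQ\<^esub>" using Ex_0[of "can n (star (A n) y \<otimes>\<^bsub>A n\<^esub> y)"] y by simp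
  hence "can 0 (Fc 0 n (star (A n) y \<otimes>\<^bsub>A n\<^esub> y)) = can 0 \<zero>\<^bsub>A 0\<^esub>"
   using Ex_tower_can[of "star (A n) y \<otimes>\<^bsub>A n\<^esub> y" 0 n] y can_hom(3)[of "\<zero>\<^bsub>A 0\<^esub>" 0 "\<zero>\<^bsub>A 0\<^esub>" 0] by simp
  hence "Fc 0 n (star (A n) y \<otimes>\<^bsub>A n\<^esub> y) = \<zero>\<^bsub>A 0\<^esub>" using can_inj[of "Fc 0 n (star (A n) y \<otimes>\<^bsub>A n\<^esub> y)" 0 "\<zero>\<^bsub>A 0\<^esub>"] y Fc_closed[of _ 0 n] by simp
  hence "y = \<zero>\<^bsub>A n\<^esub>" using faithful y by blast
  hence "cdist (A n) y1 y2 = 0" using lev.cnorm_zero y_def by simp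
  hence "y1 = y2" using lev.cnorm_minus_eq_0 y1 y2 by blast
  thus "E X = Ex n X" using y1 y2 by simp
 qed
qed

lemma the_expectation:
 "(THE E. conditional_expectation QQ (can n ` carrier (A n)) E \<and> (\<forall>a\<in>carrier QQ. sig (E a) = sig a)) = Ex n"
proof (rule the_equality)
 show "conditional_expectation QQ (can n ` carrier (A n)) (Ex n) \<and> (\<forall>a\<in>carrier QQ. sig (Ex n a) = sig a)"
  using Ex_conditional_expectation sig_Ex by blast
qed (use expectation_unique in blast)

lemma af_towerI:
 assumes d: "\<And>n. 0 < d n" "filterlim d at_top sequentially"
 shows "af_tower QQ (\<lambda>n. can n ` carrier (A n)) Ex d"
proof
 show "\<one>\<^bsub>QQ\<^esub> \<noteq> \<zero>\<^bsub>QQ\<^esub>" by (rule Q_nontrivial)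
 show "can n ` carrier (A n) \<subseteq> carrier QQ" for n by auto
 show "a \<otimes>\<^bsub>QQ\<^esub> b \<in> can n ` carrier (A n)" if "a \<in> can n ` carrier (A n)" "b \<in> can n ` carrier (A n)" for a b n
  using that by (auto simp flip: can_hom(2))
 show "can n ` carrier (A n) \<subseteq> can (Suc n) ` carrier (A (Suc n))" for n
 proof
  fix b assume "b \<in> can n ` carrier (A n)"
  then obtain x where x: "x \<in> carrier (A n)" "b = can n x" by blast
  have "b = can (Suc n) (\<alpha> n x)" using can_conn[OF x(1), of 1] x(2) by simp
  thus "b \<in> can (Suc n) ` carrier (A (Suc n))" using \<alpha>_closed[OF x(1)] by blast
 qed
 show "\<exists>n. \<exists>b\<in>can n ` carrier (A n). cdist QQ a b < e" if "a \<in> carrier QQ" "0 < e" for a e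
  using can_dense[OF that] .
 show "\<exists>c. b = c \<odot>\<^bsub>QQ\<^esub> \<one>\<^bsub>QQ\<^esub>" if "b \<in> can 0 ` carrier (A 0)" for b by (rule scalar_B0[OF that])
 show "\<one>\<^bsub>QQ\<^esub> \<in> can 0 ` carrier (A 0)" using can_one[of 0] by (metis imageI lev.A.one_closed)
 show "\<exists>S. finite S \<and> S \<subseteq> carrier QQ \<and> (\<forall>\<phi>\<in>states QQ. \<forall>\<psi>\<in>states QQ. \<forall>b\<in>can n ` carrier (A n).
   cmod (\<phi> b - \<psi> b) \<le> cnorm QQ b * (\<Sum>s\<in>S. cmod (\<phi> s - \<psi> s)))" for n
 proof -
  obtain S where S0: "finite S \<and> S \<subseteq> carrier (A n) \<and> (\<forall>\<phi>.
   (\<forall>x\<in>carrier (A n). \<forall>y\<in>carrier (A n). \<phi> (x \<oplus>\<^bsub>A n\<^esub> y) = \<phi> x + \<phi> y) \<longrightarrow>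
   (\<forall>x\<in>carrier (A n). \<forall>c. \<phi> (c \<odot>\<^bsub>A n\<^esub> x) = c * \<phi> x) \<longrightarrow>
   (\<forall>x\<in>carrier (A n). cmod (\<phi> x) \<le> cnorm (A n) x * (\<Sum>s\<in>S. cmod (\<phi> s))))"
   using coords[of n] by (rule exE)
  have S: "finite S" "S \<subseteq> carrier (A n)" using S0 by auto
  have inj: "inj_on (can n) S" using can_inj S(2) by (meson inj_onI subsetD)
  show ?thesis
  proof (intro exI[of _ "can n ` S"] conjI ballI)
   show "finite (can n ` S)" "can n ` S \<subseteq> carrier QQ" using S by auto
   fix \<phi> \<psi> b assume \<phi>: "\<phi> \<in> states QQ" and \<psi>: "\<psi> \<in> states QQ" and "b \<in> can n ` carrier (A n)"
   then obtain x where x: "x \<in> carrier (A n)" "b = can n x" by blast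
   have "cmod (\<phi> (can n x) - \<psi> (can n x)) \<le> cnorm (A n) x * (\<Sum>s\<in>S. cmod (\<phi> (can n s) - \<psi> (can n s)))"
   proof (rule S0[THEN conjunct2, THEN conjunct2, THEN spec[of _ "\<lambda>x. \<phi> (can n x) - \<psi> (can n x)"], THEN mp, THEN mp, THEN bspec, OF _ _ x(1)]; intro ballI allI)
    fix x y assume xy: "x \<in> carrier (A n)" "y \<in> carrier (A n)"
    show "\<phi> (can n (x \<oplus>\<^bsub>A n\<^esub> y)) - \<psi> (can n (x \<oplus>\<^bsub>A n\<^esub> y)) = \<phi> (can n x) - \<psi> (can n x) + (\<phi> (can n y) - \<psi> (can n y))"
     using Q.states_D(1)[OF \<phi>, of "can n x" "can n y"] Q.states_D(1)[OF \<psi>, of "can n x" "can n y"] xy by (simp add: can_hom(1))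
   next
    fix x c assume x: "x \<in> carrier (A n)"
    show "\<phi> (can n (c \<odot>\<^bsub>A n\<^esub> x)) - \<psi> (can n (c \<odot>\<^bsub>A n\<^esub> x)) = c * (\<phi> (can n x) - \<psi> (can n x))"
     using Q.states_D(2)[OF \<phi>, of "can n x" c] Q.states_D(2)[OF \<psi>, of "can n x" c] x
     by (simp add: can_hom(3)[OF x x] right_diff_distrib)
   qed
   thus "cmod (\<phi> b - \<psi> b) \<le> cnorm QQ b * (\<Sum>s\<in>can n ` S. cmod (\<phi> s - \<psi> s))"
    unfolding x(2) can_norm[OF x(1)] sum.reindex[OF inj] by simp
  qed
 qed
 show "Ex n a \<in> can n ` carrier (A n)" if "a \<in> carrier QQ" for a n by (rule Ex_in[OF that])
 show "Ex n b = b" if "b \<in> can n ` carrier (A n)" for b n using that Ex_can by auto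
 show "Ex n (a \<oplus>\<^bsub>QQ\<^esub> b) = Ex n a \<oplus>\<^bsub>QQ\<^esub> Ex n b" if "a \<in> carrier QQ" "b \<in> carrier QQ" for a b n by (rule Ex_add[OF that])
 show "Ex n (c \<odot>\<^bsub>QQ\<^esub> a) = c \<odot>\<^bsub>QQ\<^esub> Ex n a" if "a \<in> carrier QQ" for a c n by (rule Ex_smult[OF that])
 show "Ex n (star QQ a) = star QQ (Ex n a)" if "a \<in> carrier QQ" for a n by (rule Ex_star[OF that])
 show "cnorm QQ (Ex n a) \<le> cnorm QQ a" if "a \<in> carrier QQ" for a n by (rule Ex_norm[OF that])
 show "0 < d n" for n by (rule d(1))
 show "filterlim d at_top sequentially" by (rule d(2))
qed

end

section \<open>Block matrices\<close>

definition incl :: "nat => nat => nat => complex mat" where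
 "incl N p d = mat N d (\<lambda>(i,j). if i = p + j then 1 else 0)"

lemma incl_carrier [simp]: "incl N p d \<in> carrier_mat N d"
 by (simp add: incl_def)

lemma incl_dim [simp]: "dim_row (incl N p d) = N" "dim_col (incl N p d) = d"
 by (simp_all add: incl_def)

lemma incl_adjoint_mult:
 assumes X: "X \<in> carrier_mat N M" and le: "p + d \<le> N"
 shows "mat_adjoint (incl N p d) * X = mat d M (\<lambda>(i,j). X $$ (p + i, j))"
proof (rule eq_matI)
 fix i j assume "i < dim_row (mat d M (\<lambda>(i,j). X $$ (p + i, j)))" "j < dim_col (mat d M (\<lambda>(i,j). X $$ (p + i, j)))"
 hence ij: "i < d" "j < M" by auto
 have "(mat_adjoint (incl N p d) * X) $$ (i,j) = (\<Sum>l\<in>{0..<N}. mat_adjoint (incl N p d) $$ (i,l) * X $$ (l,j))"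
  using X ij by (simp add: incl_def scalar_prod_def)
 also have "\<dots> = (\<Sum>l\<in>{0..<N}. if l = p + i then X $$ (l,j) else 0)"
  using ij by (intro sum.cong) (auto simp: incl_def)
 also have "\<dots> = X $$ (p + i, j)" using ij le by (simp add: sum.delta)
 finally show "(mat_adjoint (incl N p d) * X) $$ (i,j) = mat d M (\<lambda>(i,j). X $$ (p + i, j)) $$ (i,j)" using ij by simp
qed (use X in \<open>simp_all add: incl_def\<close>)

lemma mult_incl:
 assumes X: "X \<in> carrier_mat M N" and le: "p + d \<le> N"
 shows "X * incl N p d = mat M d (\<lambda>(i,j). X $$ (i, p + j))"
proof (rule eq_matI)
 fix i j assume "i < dim_row (mat M d (\<lambda>(i,j). X $$ (i, p + j)))" "j < dim_col (mat M d (\<lambda>(i,j). X $$ (i, p + j)))"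
 hence ij: "i < M" "j < d" by auto
 have "(X * incl N p d) $$ (i,j) = (\<Sum>l\<in>{0..<N}. X $$ (i,l) * incl N p d $$ (l,j))"
  using X ij by (simp add: incl_def scalar_prod_def)
 also have "\<dots> = (\<Sum>l\<in>{0..<N}. if l = p + j then X $$ (i,l) else 0)"
  using ij by (intro sum.cong) (auto simp: incl_def)
 also have "\<dots> = X $$ (i, p + j)" using ij le by (simp add: sum.delta)
 finally show "(X * incl N p d) $$ (i,j) = mat M d (\<lambda>(i,j). X $$ (i, p + j)) $$ (i,j)" using ij by simp
qed (use X in \<open>simp_all add: incl_def\<close>)

lemma incl_isometry: "p + d \<le> N ==> mat_adjoint (incl N p d) * incl N p d = 1\<^sub>m d"
 by (subst incl_adjoint_mult[OF incl_carrier]) (auto simp: incl_def intro!: eq_matI)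

lemma incl_norm: assumes "p + d \<le> N" shows "mat_op_norm (incl N p d) \<le> 1"
proof -
 have "(mat_op_norm (incl N p d))\<^sup>2 \<le> 1\<^sup>2"
  using mat_op_norm_cstar[OF incl_carrier, of N p d] mat_op_norm_one[of d] incl_isometry[OF assms] by simp
 thus ?thesis by (rule power2_le_imp_le) simp
qed

definition cmp :: "nat => nat => complex mat => complex mat" where
 "cmp p d X = mat d d (\<lambda>(i,j). X $$ (p + i, p + j))"

lemma cmp_carrier [simp]: "cmp p d X \<in> sqm d"
 by (simp add: cmp_def)

lemma cmp_eq:
 assumes X: "X \<in> sqm N" and le: "p + d \<le> N"
 shows "cmp p d X = mat_adjoint (incl N p d) * X * incl N p d"
proof -
 have "mat_adjoint (incl N p d) * X \<in> carrier_mat d N" using X by (metis incl_carrier mat_adjoint_carrier mult_carrier_mat)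
 from mult_incl[OF this le] show ?thesis
  unfolding incl_adjoint_mult[OF X le] cmp_def using le by (auto intro!: eq_matI)
qed

text \<open>Compressions by contractions do not increase the norm; \<open>cmp\<close> is the compression to a block of coordinates.\<close>

lemma sandwich_norm:
 assumes V: "V \<in> carrier_mat N d" and W: "W \<in> carrier_mat N e" and X: "X \<in> sqm N"
  and "mat_op_norm V \<le> 1" "mat_op_norm W \<le> 1"
 shows "mat_op_norm (mat_adjoint V * X * W) \<le> mat_op_norm X"
proof -
 have VX: "mat_adjoint V * X \<in> carrier_mat d N" using V X by (metis mat_adjoint_carrier mult_carrier_mat)
 have "mat_op_norm (mat_adjoint V * X * W) \<le> mat_op_norm (mat_adjoint V * X) * mat_op_norm W"
  by (rule mat_op_norm_mult[OF VX W])
 also have "\<dots> \<le> mat_op_norm (mat_adjoint V * X) * 1"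
  by (rule mult_left_mono[OF assms(5) mat_op_norm_nonneg])
 also have "mat_op_norm (mat_adjoint V * X) \<le> mat_op_norm (mat_adjoint V) * mat_op_norm X"
  by (rule mat_op_norm_mult[OF mat_adjoint_carrier[OF V] X])
 also have "\<dots> \<le> 1 * mat_op_norm X"
  unfolding mat_op_norm_adjoint[OF V] by (rule mult_right_mono[OF assms(4) mat_op_norm_nonneg])
 finally show ?thesis by simp
qed

lemma cmp_norm:
 assumes X: "X \<in> sqm N" and le: "p + d \<le> N"
 shows "mat_op_norm (cmp p d X) \<le> mat_op_norm X"
 unfolding cmp_eq[OF assms] by (rule sandwich_norm[OF incl_carrier incl_carrier X incl_norm[OF le] incl_norm[OF le]])

lemma cmp_add: "X \<in> sqm N ==> Y \<in> sqm N ==> p + d \<le> N ==> cmp p d (X + Y) = cmp p d X + cmp p d Y"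
 by (rule eq_matI) (auto simp: cmp_def)

lemma cmp_smult: "X \<in> sqm N ==> p + d \<le> N ==> cmp p d (c \<cdot>\<^sub>m X) = c \<cdot>\<^sub>m cmp p d X"
 by (rule eq_matI) (auto simp: cmp_def)

lemma cmp_adjoint: "X \<in> sqm N ==> p + d \<le> N ==> cmp p d (mat_adjoint X) = mat_adjoint (cmp p d X)"
 by (rule eq_matI) (auto simp: cmp_def)

definition blk :: "nat => complex mat => complex mat => complex mat" where
 "blk r a b = diag_block_mat (replicate r a @ [b])"

lemma blk_0: "blk 0 a b = b"
 by (simp only: blk_def replicate.simps append_Nil diag_block_mat_singleton)

lemma blk_Suc: "blk (Suc r) a b = four_block_mat a (0\<^sub>m (dim_row a) (dim_col (blk r a b))) (0\<^sub>m (dim_row (blk r a b)) (dim_col a)) (blk r a b)"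
 by (simp add: blk_def Let_def)

lemma blk_carrier [simp]: "a \<in> sqm p ==> b \<in> sqm s ==> blk r a b \<in> sqm (r * p + s)"
proof (induction r)
 case (Suc r)
 hence "blk (Suc r) a b \<in> sqm (p + (r * p + s))"
  unfolding blk_Suc by (intro four_block_carrier_mat) auto
 thus ?case by (simp add: add.assoc)
qed (simp add: blk_0)

lemma blk_entry:
 assumes a: "a \<in> sqm p" and b: "b \<in> sqm s"
 shows "k < r ==> i < p ==> l < r * p + s ==>
   blk r a b $$ (k * p + i, l) = (if k * p \<le> l \<and> l < k * p + p then a $$ (i, l - k * p) else 0)"
  and "i < s ==> l < r * p + s ==> blk r a b $$ (r * p + i, l) = (if r * p \<le> l then b $$ (i, l - r * p) else 0)"
proof (induction r arbitrary: k l)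
 case 0
 { case 1 thus ?case by simp }
 { case 2 thus ?case by (simp add: blk_0) }
next
 case (Suc r)
 have c: "blk r a b \<in> sqm (r * p + s)" using blk_carrier[OF a b] .
 have e: "blk (Suc r) a b $$ (x, y) = (if x < p then if y < p then a $$ (x, y) else 0 else if y < p then 0 else blk r a b $$ (x - p, y - p))"
  if "x < p + (r * p + s)" "y < p + (r * p + s)" for x y
  unfolding blk_Suc using that a c by (subst index_mat_four_block) auto
 { case 1
  show ?case
  proof (cases k)
   case 0
   thus ?thesis using 1 e[of i l] by auto
  next
   case (Suc k')
   have lt: "k * p + i < p + (r * p + s)"
   proof -
    have "k' * p + p \<le> r * p" using 1 Suc by (metis Suc_less_eq Suc_leI add.commute mult_Suc mult_le_mono1)
    thus ?thesis using 1 Suc by simp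
   qed
   have "k' < r" using 1 Suc by simp
   hence "l - p < r * p + s ==> blk r a b $$ (k' * p + i, l - p) = (if k' * p \<le> l - p \<and> l - p < k' * p + p then a $$ (i, l - p - k' * p) else 0)"
    using Suc.IH(1) 1 by blast
   moreover have "k * p + i - p = k' * p + i" using Suc by simp
   ultimately show ?thesis using e[OF lt, of l] 1 Suc by (auto simp: diff_diff_add)
  qed }
 { case 2
  have "l - p < r * p + s ==> blk r a b $$ (r * p + i, l - p) = (if r * p \<le> l - p then b $$ (i, l - p - r * p) else 0)"
   using Suc.IH(2) 2 by blast
  thus ?case using e[of "Suc r * p + i" l] 2 by (auto simp: diff_diff_add add.assoc) }
qed

lemma idx_lt: "k < r ==> i < p ==> k * p + i < r * (p::nat) + s"
proof -
 assume "k < r" "i < p"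
 hence "Suc k * p \<le> r * p" by (intro mult_le_mono1) simp
 thus ?thesis using \<open>i < p\<close> by simp
qed

lemma div_eq_iff_range: "0 < p ==> (j div p = k) = (k * p \<le> j \<and> j < k * p + (p::nat))"
proof
 assume p: "0 < p" and k: "j div p = k"
 have "k * p + j mod p = j" using div_mult_mod_eq[of j p] k by simp
 moreover have "j mod p < p" using p by simp
 ultimately show "k * p \<le> j \<and> j < k * p + p" by linarith
qed (auto intro!: div_nat_eqI simp: mult.commute)

locale blocks =
 fixes r p s N :: nat
 assumes N: "N = r * p + s"
begin

abbreviation V where "V k \<equiv> incl N (k * p) p"
abbreviation W where "W \<equiv> incl N (r * p) s"

lemma V_le: "k < r ==> k * p + p \<le> N"
proof -
 assume "k < r"
 hence "Suc k * p \<le> r * p" by (intro mult_le_mono1) simp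
 thus ?thesis by (simp add: N)
qed

lemma W_le: "r * p + s \<le> N" by (simp add: N)

lemma blk_N [simp]: "a \<in> sqm p ==> b \<in> sqm s ==> blk r a b \<in> sqm N"
 by (simp add: N)

lemma row_V:
 assumes a: "a \<in> sqm p" and b: "b \<in> sqm s" and k: "k < r"
 shows "mat_adjoint (V k) * blk r a b = a * mat_adjoint (V k)"
proof -
 have l: "mat_adjoint (V k) * blk r a b = mat p N (\<lambda>(i,j). blk r a b $$ (k * p + i, j))"
  by (rule incl_adjoint_mult[OF blk_N[OF a b] V_le[OF k]])
 have "mat_adjoint (a * mat_adjoint (V k)) = V k * mat_adjoint a"
  using a mat_adjoint_mult[of a p p "mat_adjoint (V k)" N] by simp
 have r: "a * mat_adjoint (V k) = mat p N (\<lambda>(i,j). if k * p \<le> j \<and> j < k * p + p then a $$ (i, j - k * p) else 0)"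
 proof (rule eq_matI)
  fix i j assume "i < dim_row (mat p N (\<lambda>(i,j). if k * p \<le> j \<and> j < k * p + p then a $$ (i, j - k * p) else 0))"
   "j < dim_col (mat p N (\<lambda>(i,j). if k * p \<le> j \<and> j < k * p + p then a $$ (i, j - k * p) else 0))"
  hence ij: "i < p" "j < N" by auto
  have "(a * mat_adjoint (V k)) $$ (i,j) = (\<Sum>l\<in>{0..<p}. a $$ (i,l) * mat_adjoint (V k) $$ (l,j))"
   using a ij by (simp add: incl_def scalar_prod_def)
  also have "\<dots> = (\<Sum>l\<in>{0..<p}. if l = j - k * p then (if k * p \<le> j then a $$ (i,l) else 0) else 0)"
   using ij by (intro sum.cong) (auto simp: incl_def)
  also have "\<dots> = (if k * p \<le> j \<and> j < k * p + p then a $$ (i, j - k * p) else 0)"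
   by (auto simp: sum.delta)
  finally show "(a * mat_adjoint (V k)) $$ (i,j) = mat p N (\<lambda>(i,j). if k * p \<le> j \<and> j < k * p + p then a $$ (i, j - k * p) else 0) $$ (i,j)"
   using ij by simp
 qed (use a in \<open>simp_all add: incl_def\<close>)
 show ?thesis unfolding l r using blk_entry(1)[OF a b k] by (intro eq_matI) (auto simp: N)
qed

lemma row_W:
 assumes a: "a \<in> sqm p" and b: "b \<in> sqm s"
 shows "mat_adjoint W * blk r a b = b * mat_adjoint W"
proof -
 have l: "mat_adjoint W * blk r a b = mat s N (\<lambda>(i,j). blk r a b $$ (r * p + i, j))"
  by (rule incl_adjoint_mult[OF blk_N[OF a b] W_le])
 have r: "b * mat_adjoint W = mat s N (\<lambda>(i,j). if r * p \<le> j then b $$ (i, j - r * p) else 0)"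
 proof (rule eq_matI)
  fix i j assume "i < dim_row (mat s N (\<lambda>(i,j). if r * p \<le> j then b $$ (i, j - r * p) else 0))"
   "j < dim_col (mat s N (\<lambda>(i,j). if r * p \<le> j then b $$ (i, j - r * p) else 0))"
  hence ij: "i < s" "j < N" by auto
  have "(b * mat_adjoint W) $$ (i,j) = (\<Sum>l\<in>{0..<s}. b $$ (i,l) * mat_adjoint W $$ (l,j))"
   using b ij by (simp add: incl_def scalar_prod_def)
  also have "\<dots> = (\<Sum>l\<in>{0..<s}. if l = j - r * p then (if r * p \<le> j then b $$ (i,l) else 0) else 0)"
   using ij by (intro sum.cong) (auto simp: incl_def)
  also have "\<dots> = (if r * p \<le> j then b $$ (i, j - r * p) else 0)"
   using ij by (auto simp: sum.delta N)
  finally show "(b * mat_adjoint W) $$ (i,j) = mat s N (\<lambda>(i,j). if r * p \<le> j then b $$ (i, j - r * p) else 0) $$ (i,j)"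
   using ij by simp
 qed (use b in \<open>simp_all add: incl_def\<close>)
 show ?thesis unfolding l r using blk_entry(2)[OF a b] by (intro eq_matI) (auto simp: N)
qed

lemma row_cases:
 assumes "i < N"
 obtains k i' where "k < r" "i' < p" "i = k * p + i'" | i' where "i' < s" "i = r * p + i'"
proof (cases "i < r * p")
 case True
 hence "p > 0" by (cases p) auto
 have "i div p < r" using True by (simp add: less_mult_imp_div_less)
 moreover have "i mod p < p" using \<open>p > 0\<close> by simp
 moreover have "i = i div p * p + i mod p" by simp
 ultimately show ?thesis using that(1) by blast
next
 case False
 thus ?thesis using that(2)[of "i - r * p"] assms by (simp add: N)
qed

lemma rows_eqI:
 assumes X: "X \<in> carrier_mat N M" and Y: "Y \<in> carrier_mat N M"
  and V: "\<And>k. k < r ==> mat_adjoint (V k) * X = mat_adjoint (V k) * Y"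
  and W: "mat_adjoint W * X = mat_adjoint W * Y"
 shows "X = Y"
proof (rule eq_matI)
 fix i j assume "i < dim_row Y" "j < dim_col Y"
 hence ij: "i < N" "j < M" using Y by auto
 show "X $$ (i,j) = Y $$ (i,j)"
  using ij(1)
 proof (cases rule: row_cases)
  case (1 k i')
  have "mat p M (\<lambda>(i,j). X $$ (k * p + i, j)) = mat p M (\<lambda>(i,j). Y $$ (k * p + i, j))"
   using V[OF 1(1)] unfolding incl_adjoint_mult[OF X V_le[OF 1(1)]] incl_adjoint_mult[OF Y V_le[OF 1(1)]] .
  from arg_cong[OF this, of "\<lambda>Z. Z $$ (i',j)"] show ?thesis using 1 ij by simp
 next
  case (2 i')
  have "mat s M (\<lambda>(i,j). X $$ (r * p + i, j)) = mat s M (\<lambda>(i,j). Y $$ (r * p + i, j))"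
   using W unfolding incl_adjoint_mult[OF X W_le] incl_adjoint_mult[OF Y W_le] .
  from arg_cong[OF this, of "\<lambda>Z. Z $$ (i',j)"] show ?thesis using 2 ij by simp
 qed
qed (use X Y in auto)

lemma Vc: "mat_adjoint (V k) \<in> carrier_mat p N" "mat_adjoint W \<in> carrier_mat s N"
 using mat_adjoint_carrier[OF incl_carrier] by blast+

lemma blk_mult:
 assumes "a \<in> sqm p" "b \<in> sqm s" "a' \<in> sqm p" "b' \<in> sqm s"
 shows "blk r (a * a') (b * b') = blk r a b * blk r a' b'"
proof (rule rows_eqI)
 have c: "a * a' \<in> sqm p" "b * b' \<in> sqm s" using assms by auto
 show "blk r (a * a') (b * b') \<in> sqm N" using c by simp
 show "blk r a b * blk r a' b' \<in> sqm N" using assms by (intro mult_carrier_mat[of _ N N]) auto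
 show "mat_adjoint (V k) * blk r (a * a') (b * b') = mat_adjoint (V k) * (blk r a b * blk r a' b')" if "k < r" for k
 proof -
  have "mat_adjoint (V k) * (blk r a b * blk r a' b') = (mat_adjoint (V k) * blk r a b) * blk r a' b'"
   by (rule assoc_mult_mat[symmetric, OF Vc(1) blk_N blk_N]) (use assms in auto)
  also have "\<dots> = a * (mat_adjoint (V k) * blk r a' b')"
   unfolding row_V[OF assms(1,2) that] by (rule assoc_mult_mat[OF assms(1) Vc(1) blk_N]) (use assms in auto)
  also have "\<dots> = (a * a') * mat_adjoint (V k)"
   unfolding row_V[OF assms(3,4) that] by (rule assoc_mult_mat[symmetric, OF assms(1,3) Vc(1)])
  finally show ?thesis unfolding row_V[OF c that] by simp
 qed
 have "mat_adjoint W * (blk r a b * blk r a' b') = (mat_adjoint W * blk r a b) * blk r a' b'"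
  by (rule assoc_mult_mat[symmetric, OF Vc(2) blk_N blk_N]) (use assms in auto)
 also have "\<dots> = b * (mat_adjoint W * blk r a' b')"
  unfolding row_W[OF assms(1,2)] by (rule assoc_mult_mat[OF assms(2) Vc(2) blk_N]) (use assms in auto)
 also have "\<dots> = (b * b') * mat_adjoint W"
  unfolding row_W[OF assms(3,4)] by (rule assoc_mult_mat[symmetric, OF assms(2,4) Vc(2)])
 finally show "mat_adjoint W * blk r (a * a') (b * b') = mat_adjoint W * (blk r a b * blk r a' b')" unfolding row_W[OF c] by simp
qed

lemma blk_entry_cases:
 assumes a: "a \<in> sqm p" and b: "b \<in> sqm s" and "i < N" "j < N"
 shows "blk r a b $$ (i,j) = (if i < r * p then (if j < r * p \<and> i div p = j div p then a $$ (i mod p, j mod p) else 0)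
  else if j < r * p then 0 else b $$ (i - r * p, j - r * p))"
 using assms(3)
proof (cases rule: row_cases)
 case (1 k i')
 have p0: "0 < p" using 1 by simp
 have lt: "i < r * p" using idx_lt[OF 1(1,2), of 0] 1(3) by simp
 have d: "i div p = k" "i mod p = i'" using 1 by auto
 have jr: "j < r * p" if "j div p = k"
 proof -
  have rg: "k * p \<le> j \<and> j < k * p + p" using that div_eq_iff_range[OF p0] by blast
  hence "j - k * p < p" by linarith
  from idx_lt[OF 1(1) this, of 0] rg show ?thesis by simp
 qed
 have jm: "j - k * p = j mod p" if "j div p = k" using that by (simp add: minus_div_mult_eq_mod[symmetric])
 have "blk r a b $$ (i,j) = (if j div p = k then a $$ (i', j - k * p) else 0)"
  using blk_entry(1)[OF a b 1(1,2), of j] assms(4) 1(3) unfolding div_eq_iff_range[OF p0] N by simp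
 thus ?thesis using lt d jr jm by auto
next
 case (2 i')
 thus ?thesis using blk_entry(2)[OF a b 2(1), of j r] assms(4) unfolding N by simp
qed

lemma blk_dim: "a \<in> sqm p ==> b \<in> sqm s ==> dim_row (blk r a b) = N \<and> dim_col (blk r a b) = N"
 using blk_N by blast

lemma div_lt: "i < r * p ==> i mod p < p"
 by (cases p) auto

lemma blk_add:
 assumes "a \<in> sqm p" "b \<in> sqm s" "a' \<in> sqm p" "b' \<in> sqm s"
 shows "blk r (a + a') (b + b') = blk r a b + blk r a' b'"
proof (rule eq_matI)
 have c: "a + a' \<in> sqm p" "b + b' \<in> sqm s" using assms by auto
 note B = blk_N[OF assms(1,2)] blk_N[OF assms(3,4)] blk_N[OF c]
 fix i j assume "i < dim_row (blk r a b + blk r a' b')" "j < dim_col (blk r a b + blk r a' b')"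
 hence ij: "i < N" "j < N" using B by auto
 have "(blk r a b + blk r a' b') $$ (i,j) = blk r a b $$ (i,j) + blk r a' b' $$ (i,j)" using B ij by simp
 thus "blk r (a + a') (b + b') $$ (i,j) = (blk r a b + blk r a' b') $$ (i,j)"
  unfolding blk_entry_cases[OF assms(1,2) ij] blk_entry_cases[OF assms(3,4) ij] blk_entry_cases[OF c ij]
  using assms div_lt[of i] div_lt[of j] ij[unfolded N] by simp
qed (use assms in \<open>simp_all add: blk_dim\<close>)

lemma blk_smult:
 assumes "a \<in> sqm p" "b \<in> sqm s"
 shows "blk r (c \<cdot>\<^sub>m a) (c \<cdot>\<^sub>m b) = c \<cdot>\<^sub>m blk r a b"
proof (rule eq_matI)
 have c: "c \<cdot>\<^sub>m a \<in> sqm p" "c \<cdot>\<^sub>m b \<in> sqm s" using assms by auto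
 note B = blk_N[OF assms(1,2)] blk_N[OF c]
 fix i j assume "i < dim_row (c \<cdot>\<^sub>m blk r a b)" "j < dim_col (c \<cdot>\<^sub>m blk r a b)"
 hence ij: "i < N" "j < N" using B by auto
 have "(c \<cdot>\<^sub>m blk r a b) $$ (i,j) = c * blk r a b $$ (i,j)" using B ij by simp
 thus "blk r (c \<cdot>\<^sub>m a) (c \<cdot>\<^sub>m b) $$ (i,j) = (c \<cdot>\<^sub>m blk r a b) $$ (i,j)"
  unfolding blk_entry_cases[OF assms(1,2) ij] blk_entry_cases[OF c ij]
  using assms div_lt[of i] div_lt[of j] ij[unfolded N] by simp
qed (use assms in \<open>simp_all add: blk_dim\<close>)

lemma blk_one: "blk r (1\<^sub>m p) (1\<^sub>m s) = 1\<^sub>m N"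
proof (rule eq_matI)
 fix i j assume "i < dim_row (1\<^sub>m N :: complex mat)" "j < dim_col (1\<^sub>m N :: complex mat)"
 hence ij: "i < N" "j < N" by auto
 have "i div p = j div p \<and> i mod p = j mod p \<longleftrightarrow> i = j"
  by (metis div_mult_mod_eq)
 thus "blk r (1\<^sub>m p) (1\<^sub>m s) $$ (i,j) = (1\<^sub>m N :: complex mat) $$ (i,j)"
  unfolding blk_entry_cases[OF one_carrier_mat one_carrier_mat ij]
  using ij div_lt[of i] div_lt[of j] ij[unfolded N] by auto
qed (simp_all add: blk_dim)

lemma blk_adjoint:
 assumes "a \<in> sqm p" "b \<in> sqm s"
 shows "blk r (mat_adjoint a) (mat_adjoint b) = mat_adjoint (blk r a b)"
proof (rule eq_matI)
 have c: "mat_adjoint a \<in> sqm p" "mat_adjoint b \<in> sqm s" using assms by auto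
 note B = blk_N[OF assms(1,2)] blk_N[OF c]
 fix i j assume "i < dim_row (mat_adjoint (blk r a b))" "j < dim_col (mat_adjoint (blk r a b))"
 hence ij: "i < N" "j < N" using B by auto
 have "mat_adjoint (blk r a b) $$ (i,j) = cnj (blk r a b $$ (j,i))" using B ij by simp
 thus "blk r (mat_adjoint a) (mat_adjoint b) $$ (i,j) = mat_adjoint (blk r a b) $$ (i,j)"
  unfolding blk_entry_cases[OF assms(1,2) ij(2,1)] blk_entry_cases[OF c ij]
  using assms div_lt[of i] div_lt[of j] ij[unfolded N] by auto
qed (use assms in \<open>simp_all add: blk_dim\<close>)

lemma col_V:
 assumes a: "a \<in> sqm p" and b: "b \<in> sqm s" and k: "k < r"
 shows "blk r a b * V k = V k * a"
proof -
 have a': "mat_adjoint a \<in> sqm p" and b': "mat_adjoint b \<in> sqm s" using a b by auto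
 have "mat_adjoint (mat_adjoint (V k) * blk r (mat_adjoint a) (mat_adjoint b)) = mat_adjoint (mat_adjoint a * mat_adjoint (V k))"
  using row_V[OF a' b' k] by simp
 hence "mat_adjoint (blk r (mat_adjoint a) (mat_adjoint b)) * V k = V k * a"
  unfolding mat_adjoint_mult[OF Vc(1) blk_N[OF a' b']] mat_adjoint_mult[OF a' Vc(1)] by simp
 thus ?thesis unfolding blk_adjoint[OF a b] by simp
qed

lemma col_W:
 assumes a: "a \<in> sqm p" and b: "b \<in> sqm s"
 shows "blk r a b * W = W * b"
proof -
 have a': "mat_adjoint a \<in> sqm p" and b': "mat_adjoint b \<in> sqm s" using a b by auto
 have "mat_adjoint (mat_adjoint W * blk r (mat_adjoint a) (mat_adjoint b)) = mat_adjoint (mat_adjoint b * mat_adjoint W)"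
  using row_W[OF a' b'] by simp
 hence "mat_adjoint (blk r (mat_adjoint a) (mat_adjoint b)) * W = W * b"
  unfolding mat_adjoint_mult[OF Vc(2) blk_N[OF a' b']] mat_adjoint_mult[OF b' Vc(2)] by simp
 thus ?thesis unfolding blk_adjoint[OF a b] by simp
qed

text \<open>The matrix \<open>t - a\<^sup>* a\<close> differs from \<open>t\<close> by \<open>a\<^sup>* a\<close>, whose norm is at most \<open>t\<close>, so \<open>sqrt_exists\<close> applies.  This
  turns norm bounds for block matrices into algebraic identities between the blocks.\<close>

lemma mat_sqrt_compl:
 assumes a: "a \<in> sqm d" and le: "(mat_op_norm a)\<^sup>2 \<le> t"
 shows "\<exists>c\<in>sqm d. mat_adjoint a * a + mat_adjoint c * c = cor t \<cdot>\<^sub>m 1\<^sub>m d"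
proof -
 interpret M: pos_cstar "mat_cstar d" by (rule pos_cstar_mat)
 have h: "mat_adjoint a * a \<in> sqm d" using a by (intro mult_carrier_mat[of _ d d]) auto
 let ?t = "cor t \<cdot>\<^sub>m 1\<^sub>m d"
 let ?h = "?t \<ominus>\<^bsub>mat_cstar d\<^esub> mat_adjoint a * a"
 have hh: "?h = ?t - mat_adjoint a * a"
  using M.minus_smult[of ?t "mat_adjoint a * a"] h by (simp add: mat_minus_eq[of ?t d d])
 have hc: "?h \<in> sqm d" unfolding hh using h by (rule minus_carrier_mat)
 have sa: "?h \<in> self_adjoint (mat_cstar d)"
 proof (rule M.self_adjointI)
  have "mat_adjoint (mat_adjoint a * a) = mat_adjoint a * a" using a mat_adjoint_mult[of "mat_adjoint a" d d a d] by simp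
  thus "star (mat_cstar d) ?h = ?h" using M.star_minus[of ?t "mat_adjoint a * a"] h by (simp add: mat_adjoint_smult)
 qed (use hc in simp)
 have e: "?t \<ominus>\<^bsub>mat_cstar d\<^esub> ?h = mat_adjoint a * a"
  using M.minus_smult[of ?t ?h] hc h a unfolding hh by (auto simp: mat_minus_eq[of ?t d d] intro!: eq_matI)
 have "cdist (mat_cstar d) (cor t \<odot>\<^bsub>mat_cstar d\<^esub> \<one>\<^bsub>mat_cstar d\<^esub>) ?h \<le> t"
  using e le mat_op_norm_cstar[OF a] by simp
 from M.sqrt_exists[OF sa this] obtain c where c: "c \<in> self_adjoint (mat_cstar d)" "?h = c * c" by auto
 have cc: "c \<in> sqm d" "mat_adjoint c = c" using M.self_adjointD[OF c(1)] by auto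
 have "mat_adjoint a * a + c * c = ?t" unfolding c(2)[symmetric] hh using h by (intro eq_matI) auto
 thus ?thesis using cc by (intro bexI[of _ c]) auto
qed

text \<open>If \<open>t - a\<^sup>* a\<close> and \<open>t - b\<^sup>* b\<close> are of the form \<open>c\<^sup>* c\<close>, then so is \<open>t\<close> minus the square of the block matrix.\<close>

lemma blk_norm:
 assumes a: "a \<in> sqm p" and b: "b \<in> sqm s"
 shows "mat_op_norm (blk r a b) \<le> max (mat_op_norm a) (mat_op_norm b)"
proof -
 let ?m = "max (mat_op_norm a) (mat_op_norm b)"
 let ?t = "?m\<^sup>2"
 have le: "(mat_op_norm a)\<^sup>2 \<le> ?t" "(mat_op_norm b)\<^sup>2 \<le> ?t" by (auto intro!: power_mono simp: mat_op_norm_nonneg)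
 obtain c where c: "c \<in> sqm p" "mat_adjoint a * a + mat_adjoint c * c = cor ?t \<cdot>\<^sub>m 1\<^sub>m p"
  using mat_sqrt_compl[OF a le(1)] by blast
 obtain d where d: "d \<in> sqm s" "mat_adjoint b * b + mat_adjoint d * d = cor ?t \<cdot>\<^sub>m 1\<^sub>m s"
  using mat_sqrt_compl[OF b le(2)] by blast
 have cr: "mat_adjoint a \<in> sqm p" "mat_adjoint b \<in> sqm s" "mat_adjoint c \<in> sqm p" "mat_adjoint d \<in> sqm s"
  using a b c d by auto
 have cp: "mat_adjoint a * a \<in> sqm p" "mat_adjoint b * b \<in> sqm s" "mat_adjoint c * c \<in> sqm p" "mat_adjoint d * d \<in> sqm s"
  by (rule mult_carrier_mat, rule cr, rule a b c(1) d(1))+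
 have "mat_adjoint (blk r a b) * blk r a b + mat_adjoint (blk r c d) * blk r c d = cor ?t \<cdot>\<^sub>m 1\<^sub>m N"
  unfolding blk_adjoint[OF a b, symmetric] blk_adjoint[OF c(1) d(1), symmetric] blk_mult[OF cr(1,2) a b, symmetric]
   blk_mult[OF cr(3,4) c(1) d(1), symmetric] blk_add[OF cp, symmetric] c(2) d(2) blk_smult[OF one_carrier_mat one_carrier_mat] blk_one ..
 from mat_op_norm_sq_le_of_sum[OF blk_N[OF a b] blk_N[OF c(1) d(1)] _ this]
 have "(mat_op_norm (blk r a b))\<^sup>2 \<le> ?m\<^sup>2" by simp
 thus ?thesis by (rule power2_le_imp_le) (simp add: mat_op_norm_nonneg le_max_iff_disj)
qed

lemma cmp_blk:
 assumes a: "a \<in> sqm p" and b: "b \<in> sqm s"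
 shows "k < r ==> cmp (k * p) p (blk r a b) = a" "cmp (r * p) s (blk r a b) = b"
proof -
 show "cmp (k * p) p (blk r a b) = a" if "k < r"
  unfolding cmp_eq[OF blk_N[OF a b] V_le[OF that]] row_V[OF a b that] assoc_mult_mat[OF a Vc(1) incl_carrier] incl_isometry[OF V_le[OF that]]
  using a by simp
 show "cmp (r * p) s (blk r a b) = b"
  unfolding cmp_eq[OF blk_N[OF a b] W_le] row_W[OF a b] assoc_mult_mat[OF b Vc(2) incl_carrier] incl_isometry[OF W_le]
  using b by simp
qed

lemma cmp_bimod:
 assumes a: "a \<in> sqm p" and b: "b \<in> sqm s" and a': "a' \<in> sqm p" and b': "b' \<in> sqm s"
  and X: "X \<in> sqm N"
 shows "k < r ==> cmp (k * p) p (blk r a b * X * blk r a' b') = a * cmp (k * p) p X * a'"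
  "cmp (r * p) s (blk r a b * X * blk r a' b') = b * cmp (r * p) s X * b'"
proof -
 note B = blk_N[OF a b] and B' = blk_N[OF a' b']
 have BX: "blk r a b * X \<in> sqm N" by (rule mult_carrier_mat[OF B X])
 have BXB: "blk r a b * X * blk r a' b' \<in> sqm N" by (rule mult_carrier_mat[OF BX B'])
 have gen: "mat_adjoint U * (blk r a b * X * blk r a' b') * U = u * (mat_adjoint U * X * U) * u'"
  if U: "U \<in> carrier_mat N d" and u: "u \<in> sqm d" and u': "u' \<in> sqm d"
   and l: "mat_adjoint U * blk r a b = u * mat_adjoint U" and rr: "blk r a' b' * U = U * u'" for U d u u'
 proof -
  note U' = mat_adjoint_carrier[OF U]
  have UX: "mat_adjoint U * X \<in> carrier_mat d N" by (rule mult_carrier_mat[OF U' X])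
  have uUX: "u * (mat_adjoint U * X) \<in> carrier_mat d N" by (rule mult_carrier_mat[OF u UX])
  have UXU: "mat_adjoint U * X * U \<in> sqm d" by (rule mult_carrier_mat[OF UX U])
  have "mat_adjoint U * (blk r a b * X * blk r a' b') = mat_adjoint U * (blk r a b * X) * blk r a' b'"
   by (rule assoc_mult_mat[OF U' BX B', symmetric])
  also have "mat_adjoint U * (blk r a b * X) = u * (mat_adjoint U * X)"
   unfolding assoc_mult_mat[OF U' B X, symmetric] l by (rule assoc_mult_mat[OF u U' X])
  finally have "mat_adjoint U * (blk r a b * X * blk r a' b') * U = u * (mat_adjoint U * X) * (U * u')"
   using assoc_mult_mat[OF uUX B' U] rr by simp
  also have "\<dots> = u * (mat_adjoint U * X) * U * u'" by (rule assoc_mult_mat[OF uUX U u', symmetric])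
  also have "u * (mat_adjoint U * X) * U = u * (mat_adjoint U * X * U)" by (rule assoc_mult_mat[OF u UX U])
  finally show ?thesis .
 qed
 show "cmp (k * p) p (blk r a b * X * blk r a' b') = a * cmp (k * p) p X * a'" if k: "k < r"
  unfolding cmp_eq[OF BXB V_le[OF k]] cmp_eq[OF X V_le[OF k]]
  by (rule gen[OF incl_carrier a a' row_V[OF a b k] col_V[OF a' b' k]])
 show "cmp (r * p) s (blk r a b * X * blk r a' b') = b * cmp (r * p) s X * b'"
  unfolding cmp_eq[OF BXB W_le] cmp_eq[OF X W_le]
  by (rule gen[OF incl_carrier b b' row_W[OF a b] col_W[OF a' b']])
qed

end

section \<open>Averages of diagonal blocks\<close>

definition avg :: "nat => nat => complex mat => complex mat" where
 "avg r p X = mat p p (\<lambda>(i,j). \<Sum>k<r. X $$ (k * p + i, k * p + j))"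

lemma avg_carrier [simp]: "avg r p X \<in> sqm p"
 by (simp add: avg_def)

lemma avg_0: "avg 0 p X = 0\<^sub>m p p"
 by (rule eq_matI) (auto simp: avg_def)

lemma avg_Suc: "avg (Suc r) p X = avg r p X + cmp (r * p) p X"
 by (rule eq_matI) (auto simp: avg_def cmp_def)

lemma avg_norm:
 assumes X: "X \<in> sqm N" and le: "r * p \<le> N"
 shows "mat_op_norm (avg r p X) \<le> real r * mat_op_norm X"
 using le
proof (induction r)
 case 0
 thus ?case using mat_op_norm_eq_0[of "0\<^sub>m p p" p p] by (simp add: avg_0)
next
 case (Suc r)
 have "mat_op_norm (avg (Suc r) p X) \<le> mat_op_norm (avg r p X) + mat_op_norm (cmp (r * p) p X)"
  unfolding avg_Suc by (rule mat_op_norm_triangle[OF avg_carrier cmp_carrier])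
 also have "\<dots> \<le> real r * mat_op_norm X + mat_op_norm X"
  using Suc cmp_norm[OF X, of "r * p" p] by (intro add_mono) (auto simp: add.commute)
 finally show ?case by (simp add: distrib_right)
qed

lemma avg_blk:
 assumes N: "N = r * p + s" and a: "a \<in> sqm p" and b: "b \<in> sqm s" and "l \<le> r"
 shows "avg l p (blk r a b) = of_nat l \<cdot>\<^sub>m a"
 using \<open>l \<le> r\<close>
proof (induction l)
 case 0
 thus ?case using a by (intro eq_matI) (auto simp: avg_0)
next
 case (Suc l)
 interpret blocks r p s N by (rule blocks.intro) (rule N)
 show ?case unfolding avg_Suc using Suc cmp_blk(1)[OF a b, of l] a by (intro eq_matI) (auto simp: distrib_right)
qed

lemma avg_bimod:
 assumes N: "N = r * p + s" and a: "a \<in> sqm p" and b: "b \<in> sqm s" and a': "a' \<in> sqm p" and b': "b' \<in> sqm s"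
  and X: "X \<in> sqm N" and "l \<le> r"
 shows "avg l p (blk r a b * X * blk r a' b') = a * avg l p X * a'"
 using \<open>l \<le> r\<close>
proof (induction l)
 case 0
 thus ?case using a a' by (simp add: avg_0)
next
 case (Suc l)
 interpret blocks r p s N by (rule blocks.intro) (rule N)
 have c: "a * avg l p X \<in> sqm p" "a * cmp (l * p) p X \<in> sqm p"
  by (rule mult_carrier_mat[OF a avg_carrier] mult_carrier_mat[OF a cmp_carrier])+
 have "a * (avg l p X + cmp (l * p) p X) * a' = a * avg l p X * a' + a * cmp (l * p) p X * a'"
  unfolding mult_add_distrib_mat[OF a avg_carrier cmp_carrier] by (rule add_mult_distrib_mat[OF c a'])
 thus ?case unfolding avg_Suc using Suc cmp_bimod(1)[OF a b a' b' X, of l] by simp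
qed

lemma avg_add:
 assumes "X \<in> sqm N" "Y \<in> sqm N" "N = r * p + s"
 shows "avg r p (X + Y) = avg r p X + avg r p Y"
proof (rule eq_matI)
 fix i j assume "i < dim_row (avg r p X + avg r p Y)" "j < dim_col (avg r p X + avg r p Y)"
 hence ij: "i < p" "j < p" by (simp_all add: avg_def)
 have "(\<Sum>k<r. (X + Y) $$ (k * p + i, k * p + j)) = (\<Sum>k<r. X $$ (k * p + i, k * p + j) + Y $$ (k * p + i, k * p + j))"
 proof (rule sum.cong[OF refl])
  fix k assume "k \<in> {..<r}"
  hence "k * p + i < N" "k * p + j < N" using idx_lt[of k r _ p s] ij assms(3) by auto
  thus "(X + Y) $$ (k * p + i, k * p + j) = X $$ (k * p + i, k * p + j) + Y $$ (k * p + i, k * p + j)" using assms(1,2) by simp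
 qed
 thus "avg r p (X + Y) $$ (i,j) = (avg r p X + avg r p Y) $$ (i,j)" using ij by (simp add: avg_def sum.distrib)
qed (simp_all add: avg_def)

lemma avg_smult:
 assumes "X \<in> sqm N" "N = r * p + s"
 shows "avg r p (c \<cdot>\<^sub>m X) = c \<cdot>\<^sub>m avg r p X"
proof (rule eq_matI)
 fix i j assume "i < dim_row (c \<cdot>\<^sub>m avg r p X)" "j < dim_col (c \<cdot>\<^sub>m avg r p X)"
 hence ij: "i < p" "j < p" by (simp_all add: avg_def)
 have "(\<Sum>k<r. (c \<cdot>\<^sub>m X) $$ (k * p + i, k * p + j)) = (\<Sum>k<r. c * X $$ (k * p + i, k * p + j))"
 proof (rule sum.cong[OF refl])
  fix k assume "k \<in> {..<r}"
  hence "k * p + i < N" "k * p + j < N" using idx_lt[of k r _ p s] ij assms(2) by auto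
  thus "(c \<cdot>\<^sub>m X) $$ (k * p + i, k * p + j) = c * X $$ (k * p + i, k * p + j)" using assms(1) by simp
 qed
 thus "avg r p (c \<cdot>\<^sub>m X) $$ (i,j) = (c \<cdot>\<^sub>m avg r p X) $$ (i,j)" using ij by (simp add: avg_def sum_distrib_left)
qed (simp_all add: avg_def)

lemma avg_adjoint:
 assumes "X \<in> sqm N" "N = r * p + s"
 shows "avg r p (mat_adjoint X) = mat_adjoint (avg r p X)"
proof (rule eq_matI)
 fix i j assume "i < dim_row (mat_adjoint (avg r p X))" "j < dim_col (mat_adjoint (avg r p X))"
 hence ij: "i < p" "j < p" by (simp_all add: avg_def)
 have "(\<Sum>k<r. mat_adjoint X $$ (k * p + i, k * p + j)) = (\<Sum>k<r. cnj (X $$ (k * p + j, k * p + i)))"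
 proof (rule sum.cong[OF refl])
  fix k assume "k \<in> {..<r}"
  hence "k * p + i < N" "k * p + j < N" using idx_lt[of k r _ p s] ij assms(2) by auto
  thus "mat_adjoint X $$ (k * p + i, k * p + j) = cnj (X $$ (k * p + j, k * p + i))" using assms(1) by simp
 qed
 thus "avg r p (mat_adjoint X) $$ (i,j) = mat_adjoint (avg r p X) $$ (i,j)" using ij by (simp add: avg_def)
qed (simp_all add: avg_def)

definition tr :: "complex mat => complex" where
 "tr X = (\<Sum>i<dim_row X. X $$ (i,i))"

lemma tr_add: "X \<in> sqm d ==> Y \<in> sqm d ==> tr (X + Y) = tr X + tr Y"
 by (simp add: tr_def sum.distrib)

lemma tr_smult: "X \<in> sqm d ==> tr (c \<cdot>\<^sub>m X) = c * tr X"
 by (simp add: tr_def sum_distrib_left)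

lemma tr_one: "tr (1\<^sub>m d) = of_nat d"
 by (simp add: tr_def)

lemma tr_mult_commute:
 assumes X: "X \<in> sqm d" and Y: "Y \<in> sqm d"
 shows "tr (X * Y) = tr (Y * X)"
proof -
 have e: "tr (X * Y) = (\<Sum>i<d. \<Sum>l<d. X $$ (i,l) * Y $$ (l,i))" if X: "X \<in> sqm d" and Y: "Y \<in> sqm d" for X Y
  unfolding tr_def using X Y by (auto simp: scalar_prod_def atLeast0LessThan intro!: sum.cong)
 show ?thesis unfolding e[OF X Y] e[OF Y X] by (subst sum.swap) (simp add: mult.commute)
qed

lemma tr_adjoint_self:
 assumes X: "X \<in> sqm d"
 shows "tr (mat_adjoint X * X) = cor (\<Sum>i<d. \<Sum>l<d. (cmod (X $$ (l,i)))\<^sup>2)"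
proof -
 have "(mat_adjoint X * X) $$ (i,i) = (\<Sum>l<d. cor ((cmod (X $$ (l,i)))\<^sup>2))" if "i < d" for i
 proof -
  have "(mat_adjoint X * X) $$ (i,i) = (\<Sum>l<d. cnj (X $$ (l,i)) * X $$ (l,i))"
   using X that by (simp add: scalar_prod_def atLeast0LessThan)
  also have "\<dots> = (\<Sum>l<d. cor ((cmod (X $$ (l,i)))\<^sup>2))"
   by (rule sum.cong[OF refl], subst complex_norm_square, rule mult.commute)
  finally show ?thesis .
 qed
 thus ?thesis unfolding tr_def using X by simp
qed

lemma tr_avg:
 assumes X: "X \<in> sqm N" and N: "N = r * p + s"
 shows "tr X = tr (avg r p X) + tr (cmp (r * p) s X)"
proof -
 have "tr X = (\<Sum>i<r * p. X $$ (i,i)) + (\<Sum>i\<in>{r * p..<r * p + s}. X $$ (i,i))"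
  unfolding tr_def using X N sum.atLeastLessThan_concat[of 0 "r * p" "r * p + s" "\<lambda>i. X $$ (i,i)"] by (simp add: lessThan_atLeast0)
 also have "(\<Sum>i<r * p. X $$ (i,i)) = (\<Sum>k<r. \<Sum>i\<in>{k * p..<k * p + p}. X $$ (i,i))"
  by (rule sum.nat_group[symmetric])
 also have "\<dots> = (\<Sum>k<r. \<Sum>i<p. X $$ (k * p + i, k * p + i))"
 proof (rule sum.cong[OF refl])
  fix k
  show "(\<Sum>i\<in>{k * p..<k * p + p}. X $$ (i,i)) = (\<Sum>i<p. X $$ (k * p + i, k * p + i))"
   using sum.shift_bounds_nat_ivl[of "\<lambda>i. X $$ (i,i)" 0 "k * p" p] by (simp add: add.commute lessThan_atLeast0)
 qed
 also have "\<dots> = (\<Sum>i<p. \<Sum>k<r. X $$ (k * p + i, k * p + i))" by (rule sum.swap)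
 also have "\<dots> = tr (avg r p X)" by (simp add: tr_def avg_def)
 also have "(\<Sum>i\<in>{r * p..<r * p + s}. X $$ (i,i)) = (\<Sum>i<s. X $$ (r * p + i, r * p + i))"
  using sum.shift_bounds_nat_ivl[of "\<lambda>i. X $$ (i,i)" 0 "r * p" s] by (simp add: add.commute lessThan_atLeast0)
 also have "\<dots> = tr (cmp (r * p) s X)" by (simp add: tr_def cmp_def)
 finally show ?thesis .
qed

section \<open>Matrix units\<close>

definition munit :: "nat => nat => nat => complex mat" where
 "munit d i j = mat d d (\<lambda>(k,l). if k = i \<and> l = j then 1 else 0)"

lemma munit_carrier [simp]: "munit d i j \<in> sqm d"
 by (simp add: munit_def)

lemma munit_dim [simp]: "dim_row (munit d i j) = d" "dim_col (munit d i j) = d"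
 by (simp_all add: munit_def)

lemma munit_index [simp]: "k < d ==> l < d ==> munit d i j $$ (k,l) = (if k = i \<and> l = j then 1 else 0)"
 by (simp add: munit_def)

lemma munit_mult:
 assumes "j < d" shows "munit d i j * munit d j' l = (if j = j' then munit d i l else 0\<^sub>m d d)"
proof (rule eq_matI)
 fix k m assume "k < dim_row (if j = j' then munit d i l else 0\<^sub>m d d)" "m < dim_col (if j = j' then munit d i l else 0\<^sub>m d d)"
 hence km: "k < d" "m < d" by (auto split: if_splits)
 have "(munit d i j * munit d j' l) $$ (k,m) = (\<Sum>x\<in>{0..<d}. munit d i j $$ (k,x) * munit d j' l $$ (x,m))"
  using km by (simp add: scalar_prod_def)
 also have "\<dots> = (\<Sum>x\<in>{0..<d}. if x = j then (if k = i \<and> j = j' \<and> m = l then 1 else 0) else 0)"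
  using km by (intro sum.cong) auto
 also have "\<dots> = (if k = i \<and> j = j' \<and> m = l then 1 else 0)" using assms by (simp add: sum.delta)
 finally show "(munit d i j * munit d j' l) $$ (k,m) = (if j = j' then munit d i l else 0\<^sub>m d d) $$ (k,m)" using km by auto
qed auto

lemma munit_adjoint: "mat_adjoint (munit d i j) = munit d j i"
 by (rule eq_matI) auto

lemma tr_munit: "i < d ==> tr (munit d i j) = (if i = j then 1 else 0)"
 by (simp add: tr_def if_distrib sum.delta cong: if_cong)

lemma linear_munit:
 fixes \<phi> :: "complex mat => complex"
 assumes add: "\<And>x y. x \<in> sqm d ==> y \<in> sqm d ==> \<phi> (x + y) = \<phi> x + \<phi> y"
  and smult: "\<And>x c. x \<in> sqm d ==> \<phi> (c \<cdot>\<^sub>m x) = c * \<phi> x"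
  and X: "X \<in> sqm d"
 shows "\<phi> X = (\<Sum>(i,j)\<in>{..<d} \<times> {..<d}. X $$ (i,j) * \<phi> (munit d i j))"
proof -
 define P where "P S = mat d d (\<lambda>ij. if ij \<in> S then X $$ ij else 0)" for S
 have Pc: "P S \<in> sqm d" for S by (simp add: P_def)
 have "\<phi> (P S) = (\<Sum>(i,j)\<in>S. X $$ (i,j) * \<phi> (munit d i j))" if "finite S" for S
  using that
 proof (induction S)
  case empty
  have "P {} = 0 \<cdot>\<^sub>m P {}" by (rule eq_matI) (simp_all add: P_def)
  thus ?case using smult[OF Pc, of 0 "{}"] by simp
 next
  case (insert x S)
  obtain i j where x: "x = (i,j)" by (cases x)
  have "P (insert x S) = P S + X $$ (i,j) \<cdot>\<^sub>m munit d i j"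
   using insert(2) unfolding x by (intro eq_matI) (auto simp: P_def)
  hence "\<phi> (P (insert x S)) = \<phi> (P S) + X $$ (i,j) * \<phi> (munit d i j)"
   using add[OF Pc smult_carrier_mat[OF munit_carrier]] smult[OF munit_carrier] by simp
  thus ?case using insert x by simp
 qed
 from this[of "{..<d} \<times> {..<d}"] have "\<phi> (P ({..<d} \<times> {..<d})) = (\<Sum>(i,j)\<in>{..<d} \<times> {..<d}. X $$ (i,j) * \<phi> (munit d i j))" by simp
 moreover have "P ({..<d} \<times> {..<d}) = X" using X by (intro eq_matI) (auto simp: P_def)
 ultimately show ?thesis by simp
qed

lemma linear_munit_bound:
 fixes \<phi> :: "complex mat => complex"
 assumes add: "\<And>x y. x \<in> sqm d ==> y \<in> sqm d ==> \<phi> (x + y) = \<phi> x + \<phi> y"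
  and smult: "\<And>x c. x \<in> sqm d ==> \<phi> (c \<cdot>\<^sub>m x) = c * \<phi> x"
  and X: "X \<in> sqm d"
 shows "cmod (\<phi> X) \<le> mat_op_norm X * (\<Sum>(i,j)\<in>{..<d} \<times> {..<d}. cmod (\<phi> (munit d i j)))"
proof -
 have "cmod (\<phi> X) \<le> (\<Sum>(i,j)\<in>{..<d} \<times> {..<d}. cmod (X $$ (i,j)) * cmod (\<phi> (munit d i j)))"
 proof -
  have e: "\<phi> X = (\<Sum>(i,j)\<in>{..<d} \<times> {..<d}. X $$ (i,j) * \<phi> (munit d i j))"
   by (rule linear_munit[OF add smult X])
  show ?thesis unfolding arg_cong[OF e, of cmod]
   by (rule order_trans[OF norm_sum]) (simp add: case_prod_unfold norm_mult)
 qed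
 also have "\<dots> \<le> (\<Sum>(i,j)\<in>{..<d} \<times> {..<d}. mat_op_norm X * cmod (\<phi> (munit d i j)))"
  by (rule sum_mono) (auto intro!: mult_right_mono cmod_entry_le_mat_op_norm[OF X])
 finally show ?thesis by (simp add: sum_distrib_left case_prod_unfold)
qed

text \<open>A trace vanishes on the off-diagonal matrix units, and takes the same value on all diagonal ones.\<close>

lemma tracial_functional:
 fixes \<phi> :: "complex mat => complex"
 assumes add: "\<And>x y. x \<in> sqm d ==> y \<in> sqm d ==> \<phi> (x + y) = \<phi> x + \<phi> y"
  and smult: "\<And>x c. x \<in> sqm d ==> \<phi> (c \<cdot>\<^sub>m x) = c * \<phi> x"
  and comm: "\<And>x y. x \<in> sqm d ==> y \<in> sqm d ==> \<phi> (x * y) = \<phi> (y * x)"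
  and X: "X \<in> sqm d"
 shows "\<phi> X = \<phi> (munit d 0 0) * tr X"
proof -
 define c where "c = \<phi> (munit d 0 0)"
 have zero: "\<phi> (0\<^sub>m d d) = 0" using smult[of "0\<^sub>m d d" 0] by simp
 have u: "\<phi> (munit d i j) = (if i = j then c else 0)" if "i < d" "j < d" for i j
 proof -
  have "\<phi> (munit d i j) = \<phi> (munit d i 0 * munit d 0 j)" using munit_mult[of 0 d i 0 j] that by simp
  also have "\<dots> = \<phi> (munit d 0 j * munit d i 0)" by (rule comm) simp_all
  also have "\<dots> = (if i = j then c else 0)" using munit_mult[of j d 0 i 0] that zero by (auto simp: c_def)
  finally show ?thesis .
 qed
 have "\<phi> X = (\<Sum>(i,j)\<in>{..<d} \<times> {..<d}. X $$ (i,j) * \<phi> (munit d i j))"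
  by (rule linear_munit[OF add smult X])
 also have "\<dots> = (\<Sum>i<d. \<Sum>j<d. X $$ (i,j) * \<phi> (munit d i j))"
  by (rule sum.cartesian_product[symmetric])
 also have "\<dots> = (\<Sum>i<d. \<Sum>j<d. if j = i then X $$ (i,i) * c else 0)"
  by (intro sum.cong refl) (simp add: u)
 also have "\<dots> = (\<Sum>i<d. X $$ (i,i) * c)" by (rule sum.cong) (simp_all add: sum.delta)
 finally show ?thesis using X unfolding c_def[symmetric] by (simp add: tr_def sum_distrib_left mult.commute)
qed

lemma munit_inj: "inj_on (\<lambda>(i,j). munit d i j) ({..<d} \<times> {..<d})"
proof (rule inj_onI, clarsimp)
 fix i j i' j' assume *: "i < d" "j < d" "i' < d" "j' < d" "munit d i j = munit d i' j'"
 have "munit d i j $$ (i,j) = 1" using *(1,2) by simp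
 hence one: "munit d i' j' $$ (i,j) = 1" unfolding *(5) .
 show "i = i' \<and> j = j'"
 proof (rule ccontr)
  assume "\<not> (i = i' \<and> j = j')"
  hence "munit d i' j' $$ (i,j) = 0" using munit_index[OF *(1,2), of i' j'] by auto
  thus False using one by simp
 qed
qed

section \<open>Dimension of a sum of two matrix algebras\<close>

lemma cstar_dim_mat_sum: "cstar_dim (cstar_sum (mat_cstar d) (mat_cstar e)) = d * d + e * e"
proof -
 let ?W = "cstar_sum (mat_cstar d) (mat_cstar e)"
 interpret W: pos_cstar ?W by (rule pos_cstar_sum[OF pos_cstar_mat pos_cstar_mat])
 interpret VS: vec_space "TYPE(complex)" "d * d + e * e" .
 define f where "f v = (mat d d (\<lambda>(i,j). v $ (i * d + j)), mat e e (\<lambda>(i,j). v $ (d * d + (i * e + j))))" for v :: "complex Matrix.vec"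
 have ix: "i < n ==> j < n ==> i * n + j < n * n" for i j n :: nat using idx_lt[of i n j n 0] by simp
 have ix2: "i < d ==> j < d ==> i * d + j < d * d + e * e" for i j using ix[of i d j] by simp
 have vsW: "vectorspace (class_ring :: complex ring) ?W"
  by (intro vectorspace.intro W.module_axioms class_field)
 have hom: "f \<in> module_hom class_ring VS.V ?W"
  unfolding module_hom_def
  by (auto simp: f_def module_vec_simps ix ix2 class_ring_simps intro!: eq_matI)
 interpret LM: linear_map "class_ring :: complex ring" VS.V ?W f
  by (intro linear_map.intro VS.vectorspace_axioms vsW mod_hom.intro mod_hom_axioms.intro hom VS.module_axioms W.module_axioms)
 have inj: "inj_on f (carrier VS.V)"
 proof (rule inj_onI)
  fix v w :: "complex Matrix.vec" assume vw: "v \<in> carrier VS.V" "w \<in> carrier VS.V" "f v = f w"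
  hence c: "v \<in> carrier_vec (d * d + e * e)" "w \<in> carrier_vec (d * d + e * e)" by (auto simp: module_vec_simps)
  have fst: "mat d d (\<lambda>(i,j). v $ (i * d + j)) = mat d d (\<lambda>(i,j). w $ (i * d + j))"
   and snd: "mat e e (\<lambda>(i,j). v $ (d * d + (i * e + j))) = mat e e (\<lambda>(i,j). w $ (d * d + (i * e + j)))"
   using vw(3) by (simp_all add: f_def)
  show "v = w"
  proof (rule eq_vecI)
   fix k assume "k < dim_vec w"
   hence k: "k < d * d + e * e" using c by simp
   show "v $ k = w $ k"
   proof (cases "k < d * d")
    case True
    hence "d > 0" by (cases d) auto
    hence "k div d < d" "k mod d < d" using True by (auto simp: less_mult_imp_div_less)
    thus ?thesis using arg_cong[OF fst, of "\<lambda>M. M $$ (k div d, k mod d)"] by simp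
   next
    case False
    let ?k = "k - d * d"
    have k': "?k < e * e" "k = d * d + ?k" using k False by auto
    hence "e > 0" by (cases e) auto
    hence "?k div e < e" "?k mod e < e" using k'(1) by (auto simp: less_mult_imp_div_less)
    hence "v $ (d * d + ?k) = w $ (d * d + ?k)" using arg_cong[OF snd, of "\<lambda>M. M $$ (?k div e, ?k mod e)"] by simp
    thus ?thesis using k'(2) by simp
   qed
  qed (use c in simp)
 qed
 have surj: "f ` carrier VS.V = carrier ?W"
 proof (intro equalityI subsetI)
  fix x assume "x \<in> carrier ?W"
  then obtain a b where x: "x = (a,b)" "a \<in> sqm d" "b \<in> sqm e" by auto
  define v where "v = Matrix.vec (d * d + e * e) (\<lambda>k. if k < d * d then a $$ (k div d, k mod d) else b $$ ((k - d * d) div e, (k - d * d) mod e))"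
  have "mat d d (\<lambda>(i,j). v $ (i * d + j)) = a"
  proof (rule eq_matI)
   fix i j assume "i < dim_row a" "j < dim_col a"
   hence ij: "i < d" "j < d" using x by auto
   hence "(i * d + j) div d = i" "(i * d + j) mod d = j" by auto
   thus "mat d d (\<lambda>(i,j). v $ (i * d + j)) $$ (i,j) = a $$ (i,j)"
    using ij ix[OF ij] ix2[OF ij] by (simp add: v_def)
  qed (use x in auto)
  moreover have "mat e e (\<lambda>(i,j). v $ (d * d + (i * e + j))) = b"
  proof (rule eq_matI)
   fix i j assume "i < dim_row b" "j < dim_col b"
   hence ij: "i < e" "j < e" using x by auto
   hence "(i * e + j) div e = i" "(i * e + j) mod e = j" by auto
   thus "mat e e (\<lambda>(i,j). v $ (d * d + (i * e + j))) $$ (i,j) = b $$ (i,j)"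
    using ij ix[OF ij] by (simp add: v_def)
  qed (use x in auto)
  ultimately have "f v = (a,b)" unfolding f_def by simp
  moreover have "v \<in> carrier VS.V" by (simp add: v_def module_vec_simps)
  ultimately show "x \<in> f ` carrier VS.V" using x by (metis imageI)
 qed (auto simp: f_def)
 have "VS.dim = vectorspace.dim class_ring ?W"
  by (rule LM.dim_eq[OF VS.fin_dim inj surj])
 thus ?thesis unfolding cstar_dim_def VS.dim_is_n by simp
qed

section \<open>The tower of a continued fraction\<close>

text \<open>Digits \<open>r\<close>, denominators \<open>q\<close> and tails \<open>f\<close> of a continued fraction: \<open>f n\<close> is the fractional part of the
  complete quotient number \<open>n\<close>, and \<open>f_rel\<close> says that its inverse is the next complete quotient.\<close>

locale cf_data =
 fixes r q :: "nat => nat" and f :: "nat => real"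
 assumes q0: "q 0 = 1" and q1: "q (Suc 0) = r (Suc 0)"
  and qSS: "q (Suc (Suc n)) = r (Suc (Suc n)) * q (Suc n) + q n"
  and r_pos: "0 < r (Suc n)" and f_pos: "0 < f n"
  and f_rel: "f n * (real (r (Suc n)) + f (Suc n)) = 1"
begin

definition qp :: "nat => nat" where "qp n = (if n = 0 then 0 else q (n - 1))"

lemma qp_Suc [simp]: "qp (Suc n) = q n" and qp_0 [simp]: "qp 0 = 0"
 by (simp_all add: qp_def)

lemma q_Suc: "q (Suc n) = r (Suc n) * q n + qp n"
 by (cases n) (simp_all add: q0 q1 qSS)

lemma q_pos: "0 < q n"
 by (induction n) (simp_all add: q0 q_Suc r_pos)

lemma q_ge: "n \<le> q n"
proof (induction n rule: less_induct)
 case (less n)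
 consider "n = 0" | "n = 1" | m where "n = Suc (Suc m)" by (metis One_nat_def not0_implies_Suc)
 thus ?case
 proof cases
  case 3
  have "q (Suc m) \<le> r n * q (Suc m)" using r_pos[of "Suc m"] 3 by simp
  hence "q (Suc m) + q m \<le> q n" unfolding 3 qSS by simp
  thus ?thesis using less[of "Suc m"] q_pos[of m] 3 by simp
 qed (use q_pos[of 1] in auto)
qed

definition AA :: "nat => (complex mat \<times> complex mat) cstar" where
 "AA n = cstar_sum (mat_cstar (q n)) (mat_cstar (qp n))"

definition al :: "nat => complex mat \<times> complex mat => complex mat \<times> complex mat" where
 "al n = (\<lambda>(a,b). (blk (r (Suc n)) a b, a))"

definition g :: "nat => real" where "g n = 1 - real (r (Suc n)) * f n"

text \<open>The expectation of level \<open>n + 1\<close> onto level \<open>n\<close>.  The first summand of level \<open>n\<close> occurs \<open>r\<close> times in the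
  first summand of level \<open>n + 1\<close> and once in the second, and each copy carries a fraction \<open>f n\<close>,
  respectively \<open>g n\<close>, of the trace.\<close>

definition FF :: "nat => complex mat \<times> complex mat => complex mat \<times> complex mat" where
 "FF n = (\<lambda>(X,Y). (cor (f n) \<cdot>\<^sub>m avg (r (Suc n)) (q n) X + cor (g n) \<cdot>\<^sub>m Y,
  cmp (r (Suc n) * q n) (qp n) X))"

lemma g_eq: "g n = f n * f (Suc n)"
 using f_rel[of n] by (simp add: g_def algebra_simps)

lemma g_pos: "0 < g n"
 unfolding g_eq using f_pos by simp

lemma fg: "real (r (Suc n)) * f n + g n = 1"
 by (simp add: g_def)

lemma AA_carrier: "x \<in> carrier (AA n) \<longleftrightarrow> fst x \<in> sqm (q n) \<and> snd x \<in> sqm (qp n)"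
 by (auto simp: AA_def mem_Times_iff)

lemma AA_ops:
 "(a,b) \<oplus>\<^bsub>AA n\<^esub> (a',b') = (a + a', b + b')" "(a,b) \<otimes>\<^bsub>AA n\<^esub> (a',b') = (a * a', b * b')"
 "c \<odot>\<^bsub>AA n\<^esub> (a,b) = (c \<cdot>\<^sub>m a, c \<cdot>\<^sub>m b)" "star (AA n) (a,b) = (mat_adjoint a, mat_adjoint b)"
 "\<one>\<^bsub>AA n\<^esub> = (1\<^sub>m (q n), 1\<^sub>m (qp n))" "\<zero>\<^bsub>AA n\<^esub> = (0\<^sub>m (q n) (q n), 0\<^sub>m (qp n) (qp n))"
 "cnorm (AA n) (a,b) = max (mat_op_norm a) (mat_op_norm b)"
 by (simp_all add: AA_def)

lemma AA_E:
 assumes "x \<in> carrier (AA n)"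
 obtains a b where "x = (a,b)" "a \<in> sqm (q n)" "b \<in> sqm (qp n)"
 using assms AA_carrier by (cases x) auto

lemma blocks_n: "blocks (r (Suc n)) (q n) (qp n) (q (Suc n))"
 by (rule blocks.intro) (rule q_Suc)

lemma pos_cstar_AA: "pos_cstar (AA n)"
 unfolding AA_def by (rule pos_cstar_sum[OF pos_cstar_mat pos_cstar_mat])

lemma rq_le: "r (Suc n) * q n + qp n \<le> q (Suc n)" "r (Suc n) * q n \<le> q (Suc n)"
 by (simp_all add: q_Suc)

lemma combo_bimod:
 assumes "a \<in> sqm d" "a' \<in> sqm d" "U \<in> sqm d" "Y \<in> sqm d"
 shows "c \<cdot>\<^sub>m (a * U * a') + c' \<cdot>\<^sub>m (a * Y * a') = a * (c \<cdot>\<^sub>m U + c' \<cdot>\<^sub>m Y) * (a' :: complex mat)"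
proof -
 have c: "c \<cdot>\<^sub>m U \<in> sqm d" "c' \<cdot>\<^sub>m Y \<in> sqm d" "a * U \<in> sqm d" "a * Y \<in> sqm d"
  using assms by auto
 have c2: "c \<cdot>\<^sub>m (a * U) \<in> sqm d" "c' \<cdot>\<^sub>m (a * Y) \<in> sqm d" using c by auto
 show ?thesis
  unfolding mult_add_distrib_mat[OF assms(1) c(1,2)] mult_smult_distrib[OF assms(1,3)] mult_smult_distrib[OF assms(1,4)]
   add_mult_distrib_mat[OF c2 assms(2)] mult_smult_assoc_mat[OF c(3) assms(2)] mult_smult_assoc_mat[OF c(4) assms(2)] ..
qed

sublocale ind_tower AA al FF
proof (rule ind_tower.intro)
 fix n
 interpret B: blocks "r (Suc n)" "q n" "qp n" "q (Suc n)" by (rule blocks_n)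
 show "pos_cstar (AA n)" by (rule pos_cstar_AA)
 show "\<one>\<^bsub>AA n\<^esub> \<noteq> \<zero>\<^bsub>AA n\<^esub>"
 proof
  assume "\<one>\<^bsub>AA n\<^esub> = \<zero>\<^bsub>AA n\<^esub>"
  hence "1\<^sub>m (q n) = (0\<^sub>m (q n) (q n) :: complex mat)" by (simp add: AA_ops)
  from arg_cong[OF this, of "\<lambda>M. M $$ (0,0)"] show False using q_pos[of n] by simp
 qed
 show "al n \<one>\<^bsub>AA n\<^esub> = \<one>\<^bsub>AA (Suc n)\<^esub>" by (simp add: AA_ops al_def B.blk_one)
 { fix x assume "x \<in> carrier (AA n)"
  then obtain a b where x: "x = (a,b)" "a \<in> sqm (q n)" "b \<in> sqm (qp n)" by (rule AA_E)
  show "al n x \<in> carrier (AA (Suc n))" using x by (simp add: AA_carrier al_def)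
  show "al n (c \<odot>\<^bsub>AA n\<^esub> x) = c \<odot>\<^bsub>AA (Suc n)\<^esub> al n x" for c using x by (simp add: AA_ops al_def B.blk_smult)
  show "al n (star (AA n) x) = star (AA (Suc n)) (al n x)" using x by (simp add: AA_ops al_def B.blk_adjoint)
  show "cnorm (AA (Suc n)) (al n x) \<le> cnorm (AA n) x" using x B.blk_norm[OF x(2,3)] by (simp add: AA_ops al_def)
  show "FF n (al n x) = x"
  proof -
   have "cor (f n) \<cdot>\<^sub>m (of_nat (r (Suc n)) \<cdot>\<^sub>m a) + cor (g n) \<cdot>\<^sub>m a = a"
   proof -
    have "cor (f n) * (of_nat (r (Suc n)) * z) + cor (g n) * z = z" for z
    proof -
     have "cor (f n) * (of_nat (r (Suc n)) * z) + cor (g n) * z = cor (real (r (Suc n)) * f n + g n) * z"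
      by (simp add: algebra_simps)
     thus ?thesis unfolding fg by simp
    qed
    thus ?thesis using x by (intro eq_matI) auto
   qed
   thus ?thesis
    using x avg_blk[OF q_Suc x(2,3) order_refl] B.cmp_blk(2)[OF x(2,3)] by (simp add: FF_def al_def)
  qed
  fix y assume "y \<in> carrier (AA n)"
  then obtain a' b' where y: "y = (a',b')" "a' \<in> sqm (q n)" "b' \<in> sqm (qp n)" by (rule AA_E)
  show "al n (x \<oplus>\<^bsub>AA n\<^esub> y) = al n x \<oplus>\<^bsub>AA (Suc n)\<^esub> al n y" using x y by (simp add: AA_ops al_def B.blk_add)
  show "al n (x \<otimes>\<^bsub>AA n\<^esub> y) = al n x \<otimes>\<^bsub>AA (Suc n)\<^esub> al n y" using x y by (simp add: AA_ops al_def B.blk_mult)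
  fix z assume "z \<in> carrier (AA (Suc n))"
  then obtain X Y where z: "z = (X,Y)" "X \<in> sqm (q (Suc n))" "Y \<in> sqm (qp (Suc n))" by (rule AA_E)
  have Y: "Y \<in> sqm (q n)" using z by simp
  show "FF n (al n x \<otimes>\<^bsub>AA (Suc n)\<^esub> z \<otimes>\<^bsub>AA (Suc n)\<^esub> al n y) = x \<otimes>\<^bsub>AA n\<^esub> FF n z \<otimes>\<^bsub>AA n\<^esub> y"
   using combo_bimod[OF x(2) y(2) avg_carrier Y, of "cor (f n)" "r (Suc n)" X "cor (g n)"]
    avg_bimod[OF q_Suc x(2,3) y(2,3) z(2) order_refl] B.cmp_bimod(2)[OF x(2,3) y(2,3) z(2)]
   by (simp add: x(1) y(1) z(1) AA_ops al_def FF_def) }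
 { fix x assume "x \<in> carrier (AA (Suc n))"
  then obtain X Y where x: "x = (X,Y)" "X \<in> sqm (q (Suc n))" "Y \<in> sqm (qp (Suc n))" by (rule AA_E)
  have Y: "Y \<in> sqm (q n)" using x by simp
  show "FF n x \<in> carrier (AA n)" using x Y by (simp add: AA_carrier FF_def)
  show "FF n (c \<odot>\<^bsub>AA (Suc n)\<^esub> x) = c \<odot>\<^bsub>AA n\<^esub> FF n x" for c
  proof -
   have "cor (f n) \<cdot>\<^sub>m (c \<cdot>\<^sub>m avg (r (Suc n)) (q n) X) + cor (g n) \<cdot>\<^sub>m (c \<cdot>\<^sub>m Y) = c \<cdot>\<^sub>m (cor (f n) \<cdot>\<^sub>m avg (r (Suc n)) (q n) X + cor (g n) \<cdot>\<^sub>m Y)"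
    using Y carrier_matD[OF avg_carrier[of "r (Suc n)" "q n" X]] by (intro eq_matI) (auto simp: algebra_simps)
   thus ?thesis by (simp add: x(1) AA_ops FF_def avg_smult[OF x(2) q_Suc] cmp_smult[OF x(2) rq_le(1)])
  qed
  show "FF n (star (AA (Suc n)) x) = star (AA n) (FF n x)"
   using Y by (simp add: x(1) AA_ops FF_def avg_adjoint[OF x(2) q_Suc] cmp_adjoint[OF x(2) rq_le(1)]
     mat_adjoint_add[of _ "q n" "q n"] mat_adjoint_smult)
  show "cnorm (AA n) (FF n x) \<le> cnorm (AA (Suc n)) x"
  proof -
   let ?m = "max (mat_op_norm X) (mat_op_norm Y)"
   have "mat_op_norm (cor (f n) \<cdot>\<^sub>m avg (r (Suc n)) (q n) X + cor (g n) \<cdot>\<^sub>m Y)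
    \<le> f n * mat_op_norm (avg (r (Suc n)) (q n) X) + g n * mat_op_norm Y"
    using mat_op_norm_triangle[OF smult_carrier_mat[OF avg_carrier] smult_carrier_mat[OF Y]]
     mat_op_norm_smult[OF avg_carrier] mat_op_norm_smult[OF Y] f_pos[of n] g_pos[of n] by (metis abs_of_pos norm_of_real)
   also have "\<dots> \<le> f n * (real (r (Suc n)) * ?m) + g n * ?m"
    using order_trans[OF avg_norm[OF x(2) rq_le(2)] mult_left_mono[of "mat_op_norm X" ?m "real (r (Suc n))"]] f_pos[of n] g_pos[of n]
    by (intro add_mono mult_left_mono) auto
   also have "\<dots> = (real (r (Suc n)) * f n + g n) * ?m" by (simp add: algebra_simps)
   also have "\<dots> = ?m" unfolding fg by simp
   finally show ?thesis using cmp_norm[OF x(2) rq_le(1)] by (simp add: x(1) AA_ops FF_def)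
  qed
  fix y assume "y \<in> carrier (AA (Suc n))"
  then obtain X' Y' where y: "y = (X',Y')" "X' \<in> sqm (q (Suc n))" "Y' \<in> sqm (qp (Suc n))" by (rule AA_E)
  have Y': "Y' \<in> sqm (q n)" using y by simp
  have "cor (f n) \<cdot>\<^sub>m (avg (r (Suc n)) (q n) X + avg (r (Suc n)) (q n) X') + cor (g n) \<cdot>\<^sub>m (Y + Y') =
   (cor (f n) \<cdot>\<^sub>m avg (r (Suc n)) (q n) X + cor (g n) \<cdot>\<^sub>m Y) + (cor (f n) \<cdot>\<^sub>m avg (r (Suc n)) (q n) X' + cor (g n) \<cdot>\<^sub>m Y')"
   using Y Y' carrier_matD[OF avg_carrier[of "r (Suc n)" "q n" X]] carrier_matD[OF avg_carrier[of "r (Suc n)" "q n" X']] by (intro eq_matI) (auto simp: algebra_simps)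
  thus "FF n (x \<oplus>\<^bsub>AA (Suc n)\<^esub> y) = FF n x \<oplus>\<^bsub>AA n\<^esub> FF n y"
   by (simp add: x(1) y(1) AA_ops FF_def avg_add[OF x(2) y(2) q_Suc] cmp_add[OF x(2) y(2) rq_le(1)]) }
qed

text \<open>The trace of level \<open>n\<close> has weight \<open>w n\<close> on the first and \<open>w (n + 1)\<close> on the second summand.\<close>

primrec w :: "nat => real" where
 "w 0 = 1"
| "w (Suc n) = f n * w n"

lemma w_pos: "0 < w n"
 by (induction n) (use f_pos in auto)

lemma w_rel: "w n = real (r (Suc n)) * w (Suc n) + w (Suc (Suc n))"
proof -
 have "real (r (Suc n)) * w (Suc n) + w (Suc (Suc n)) = (f n * (real (r (Suc n)) + f (Suc n))) * w n" by (simp add: algebra_simps)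
 thus ?thesis unfolding f_rel by simp
qed

definition tau :: "nat => complex mat \<times> complex mat => complex" where
 "tau n x = cor (w n) * tr (fst x) + cor (w (Suc n)) * tr (snd x)"

lemma tau_FF: assumes "x \<in> carrier (AA (Suc n))" shows "tau n (FF n x) = tau (Suc n) x"
proof -
 obtain X Y where x: "x = (X,Y)" "X \<in> sqm (q (Suc n))" "Y \<in> sqm (qp (Suc n))"
  using assms by (rule AA_E)
 have Y: "Y \<in> sqm (q n)" using x by simp
 let ?t = "tr (avg (r (Suc n)) (q n) X)" and ?s = "tr (cmp (r (Suc n) * q n) (qp n) X)"
 have "tau n (FF n x) = cor (w n) * (cor (f n) * ?t + cor (g n) * tr Y) + cor (w (Suc n)) * ?s"
  using tr_add[OF smult_carrier_mat[OF avg_carrier] smult_carrier_mat[OF Y]] tr_smult[OF avg_carrier] tr_smult[OF Y]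
  by (simp add: tau_def x(1) FF_def)
 also have "\<dots> = cor (w (Suc n)) * (?t + ?s) + cor (w (Suc (Suc n))) * tr Y"
  by (simp add: g_eq algebra_simps)
 also have "?t + ?s = tr X" by (rule tr_avg[OF x(2) q_Suc, symmetric])
 finally show ?thesis by (simp add: tau_def x(1))
qed

lemma Fc_tau: "x \<in> carrier (AA n) ==> Fc 0 n x = tau n x \<odot>\<^bsub>AA 0\<^esub> \<one>\<^bsub>AA 0\<^esub>"
proof (induction n arbitrary: x)
 case 0
 then obtain a b where x: "x = (a,b)" "a \<in> sqm (q 0)" "b \<in> sqm (qp 0)" by (rule AA_E)
 have t: "tau 0 x = a $$ (0,0)" using x by (simp add: tau_def tr_def q0)
 show ?case unfolding t using x by (auto simp: AA_ops q0 intro!: eq_matI)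
next
 case (Suc n)
 show ?case using Suc.IH[OF F_closed[OF Suc.prems]] tau_FF[OF Suc.prems] by simp
qed

lemma tau_mult_commute:
 assumes "x \<in> carrier (AA n)" "y \<in> carrier (AA n)" shows "tau n (x \<otimes>\<^bsub>AA n\<^esub> y) = tau n (y \<otimes>\<^bsub>AA n\<^esub> x)"
 using assms by (elim AA_E) (simp add: tau_def AA_ops tr_mult_commute[of _ "q n"] tr_mult_commute[of _ "qp n"])

lemma sum_sq_zero:
 assumes X: "X \<in> sqm d" and z: "(\<Sum>i<d. \<Sum>l<d. (cmod (X $$ (l,i)))\<^sup>2) = 0"
 shows "X = 0\<^sub>m d d"
proof (rule eq_matI)
 fix l i assume "l < dim_row (0\<^sub>m d d :: complex mat)" "i < dim_col (0\<^sub>m d d :: complex mat)"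
 hence li: "l < d" "i < d" by auto
 have "\<forall>i\<in>{..<d}. (\<Sum>l<d. (cmod (X $$ (l,i)))\<^sup>2) = 0" using z by (subst (asm) sum_nonneg_eq_0_iff) (auto intro: sum_nonneg)
 hence "(\<Sum>l<d. (cmod (X $$ (l,i)))\<^sup>2) = 0" using li by simp
 hence "\<forall>l\<in>{..<d}. (cmod (X $$ (l,i)))\<^sup>2 = 0" by (subst (asm) sum_nonneg_eq_0_iff) auto
 thus "X $$ (l,i) = 0\<^sub>m d d $$ (l,i)" using li by simp
qed (use X in auto)

lemma tau_faithful:
 assumes x: "x \<in> carrier (AA n)" and z: "tau n (star (AA n) x \<otimes>\<^bsub>AA n\<^esub> x) = 0"
 shows "x = \<zero>\<^bsub>AA n\<^esub>"
proof -
 obtain a b where ab: "x = (a,b)" "a \<in> sqm (q n)" "b \<in> sqm (qp n)" using x by (rule AA_E)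
 let ?s = "\<Sum>i<q n. \<Sum>l<q n. (cmod (a $$ (l,i)))\<^sup>2" and ?t = "\<Sum>i<qp n. \<Sum>l<qp n. (cmod (b $$ (l,i)))\<^sup>2"
 have "cor (w n * ?s + w (Suc n) * ?t) = 0"
  using z unfolding tau_def ab(1) AA_ops fst_conv snd_conv tr_adjoint_self[OF ab(2)] tr_adjoint_self[OF ab(3)] by (simp only: of_real_add of_real_mult)
 hence sum0: "w n * ?s + w (Suc n) * ?t = 0" by (simp only: of_real_eq_0_iff)
 have nn: "0 \<le> ?s" "0 \<le> ?t" by (auto intro!: sum_nonneg)
 have "0 \<le> w n * ?s" "0 \<le> w (Suc n) * ?t" using nn w_pos[of n] w_pos[of "Suc n"] by (meson less_imp_le mult_nonneg_nonneg)+
 hence "w n * ?s = 0" "w (Suc n) * ?t = 0" using sum0 by linarith+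
 hence "?s = 0" "?t = 0" using w_pos[of n] w_pos[of "Suc n"] by (metis less_irrefl mult_eq_0_iff)+
 thus ?thesis using sum_sq_zero[OF ab(2)] sum_sq_zero[OF ab(3)] ab(1) by (simp add: AA_ops)
qed

end

context cf_data
begin

text \<open>The solutions of the recurrence with \<open>z 0 = 0\<close> are the multiples of \<open>(-1) ^ n * q n\<close>, which grow too
  fast for the bound unless they vanish.\<close>

lemma recurrence_zero:
 fixes z :: "nat => real"
 assumes z0: "z 0 = 0" and rec: "\<And>n. z n = real (r (Suc n)) * z (Suc n) + z (Suc (Suc n))"
  and bound: "\<And>n. \<bar>z n\<bar> * real (q n) \<le> 2"
 shows "z n = 0"
proof -
 have form: "z (Suc n) = (- 1) ^ n * real (q n) * z 1 \<and> z (Suc (Suc n)) = (- 1) ^ Suc n * real (q (Suc n)) * z 1" for n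
 proof (induction n)
  case 0
  show ?case using rec[of 0] z0 by (simp add: q0 q1)
 next
  case (Suc n)
  have "z (Suc (Suc (Suc n))) = z (Suc n) - real (r (Suc (Suc n))) * z (Suc (Suc n))" using rec[of "Suc n"] by simp
  also have "\<dots> = (- 1) ^ n * real (q n) * z 1 - real (r (Suc (Suc n))) * ((- 1) ^ Suc n * real (q (Suc n)) * z 1)"
   using Suc by simp
  also have "\<dots> = (- 1) ^ Suc (Suc n) * real (q (Suc (Suc n))) * z 1" by (simp add: qSS algebra_simps)
  finally show ?case using Suc by blast
 qed
 have "\<bar>z 1\<bar> * real n \<le> 2" for n
 proof -
  have "\<bar>z (Suc n)\<bar> = real (q n) * \<bar>z 1\<bar>" using form[of n] by (simp add: abs_mult power_abs)
  moreover have "1 \<le> real (q n)" using q_pos[of n] by simp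
  ultimately have "\<bar>z 1\<bar> \<le> \<bar>z (Suc n)\<bar>" using mult_right_mono[of 1 "real (q n)" "\<bar>z 1\<bar>"] by simp
  moreover have "real n \<le> real (q (Suc n))" using q_ge[of "Suc n"] by simp
  ultimately have "\<bar>z 1\<bar> * real n \<le> \<bar>z (Suc n)\<bar> * real (q (Suc n))" by (intro mult_mono) auto
  thus ?thesis using bound[of "Suc n"] by linarith
 qed
 note all_n = this
 have "z 1 = 0"
 proof (rule ccontr)
  assume "z 1 \<noteq> 0"
  then obtain n where "2 < real n * \<bar>z 1\<bar>" using reals_Archimedean3[of "\<bar>z 1\<bar>"] by fastforce
  thus False using all_n[of n] by (simp add: mult.commute)
 qed
 hence "z (Suc m) = 0" for m using form[of m] by simp
 thus ?thesis using z0 by (cases n) simp_all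
qed

text \<open>A trace on level \<open>n\<close> is determined by its values on the minimal projections of the two summands.
  Compatibility forces these values to satisfy the recurrence of \<open>w\<close>, and normalization bounds them by
  \<open>1 / q n\<close>, so their difference to \<open>w\<close> is zero by \<open>recurrence_zero\<close>.\<close>

lemma trace_unique_levels:
 fixes t :: "nat => complex mat \<times> complex mat => complex"
 assumes add: "\<And>n x y. x \<in> carrier (AA n) ==> y \<in> carrier (AA n) ==> t n (x \<oplus>\<^bsub>AA n\<^esub> y) = t n x + t n y"
  and smult: "\<And>n x c. x \<in> carrier (AA n) ==> t n (c \<odot>\<^bsub>AA n\<^esub> x) = c * t n x"
  and comm: "\<And>n x y. x \<in> carrier (AA n) ==> y \<in> carrier (AA n) ==> t n (x \<otimes>\<^bsub>AA n\<^esub> y) = t n (y \<otimes>\<^bsub>AA n\<^esub> x)"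
  and pos: "\<And>n x. x \<in> carrier (AA n) ==> 0 \<le> t n (star (AA n) x \<otimes>\<^bsub>AA n\<^esub> x)"
  and one: "\<And>n. t n \<one>\<^bsub>AA n\<^esub> = 1"
  and compat: "\<And>n x. x \<in> carrier (AA n) ==> t (Suc n) (al n x) = t n x"
  and x: "x \<in> carrier (AA n)"
 shows "t n x = tau n x"
proof -
 define U where "U n = (munit (q n) 0 0, 0\<^sub>m (qp n) (qp n) :: complex mat)" for n
 define V where "V n = (0\<^sub>m (q n) (q n) :: complex mat, munit (qp n) 0 0)" for n
 have UV: "U n \<in> carrier (AA n)" "V n \<in> carrier (AA n)" for n by (simp_all add: U_def V_def AA_carrier)
 have form: "t n (a,b) = t n (U n) * tr a + t n (V n) * tr b"
  if a: "a \<in> sqm (q n)" and b: "b \<in> sqm (qp n)" for n a b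
 proof -
  have "t n (a, 0\<^sub>m (qp n) (qp n)) = t n (U n) * tr a"
   unfolding U_def
  proof (rule tracial_functional[of "q n" "\<lambda>a. t n (a, 0\<^sub>m (qp n) (qp n))", OF _ _ _ a])
   fix x y :: "complex mat" assume xy: "x \<in> sqm (q n)" "y \<in> sqm (q n)"
   show "t n (x + y, 0\<^sub>m (qp n) (qp n)) = t n (x, 0\<^sub>m (qp n) (qp n)) + t n (y, 0\<^sub>m (qp n) (qp n))"
    using add[of "(x, 0\<^sub>m (qp n) (qp n))" n "(y, 0\<^sub>m (qp n) (qp n))"] xy by (simp add: AA_carrier AA_ops)
   show "t n (x * y, 0\<^sub>m (qp n) (qp n)) = t n (y * x, 0\<^sub>m (qp n) (qp n))"
    using comm[of "(x, 0\<^sub>m (qp n) (qp n))" n "(y, 0\<^sub>m (qp n) (qp n))"] xy by (simp add: AA_carrier AA_ops)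
  next
   fix x :: "complex mat" and c assume x: "x \<in> sqm (q n)"
   show "t n (c \<cdot>\<^sub>m x, 0\<^sub>m (qp n) (qp n)) = c * t n (x, 0\<^sub>m (qp n) (qp n))"
    using smult[of "(x, 0\<^sub>m (qp n) (qp n))" n c] x by (simp add: AA_carrier AA_ops)
  qed
  moreover have "t n (0\<^sub>m (q n) (q n), b) = t n (V n) * tr b"
   unfolding V_def
  proof (rule tracial_functional[of "qp n" "\<lambda>b. t n (0\<^sub>m (q n) (q n), b)", OF _ _ _ b])
   fix x y :: "complex mat" assume xy: "x \<in> sqm (qp n)" "y \<in> sqm (qp n)"
   show "t n (0\<^sub>m (q n) (q n), x + y) = t n (0\<^sub>m (q n) (q n), x) + t n (0\<^sub>m (q n) (q n), y)"
    using add[of "(0\<^sub>m (q n) (q n), x)" n "(0\<^sub>m (q n) (q n), y)"] xy by (simp add: AA_carrier AA_ops)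
   show "t n (0\<^sub>m (q n) (q n), x * y) = t n (0\<^sub>m (q n) (q n), y * x)"
    using comm[of "(0\<^sub>m (q n) (q n), x)" n "(0\<^sub>m (q n) (q n), y)"] xy by (simp add: AA_carrier AA_ops)
  next
   fix x :: "complex mat" and c assume x: "x \<in> sqm (qp n)"
   show "t n (0\<^sub>m (q n) (q n), c \<cdot>\<^sub>m x) = c * t n (0\<^sub>m (q n) (q n), x)"
    using smult[of "(0\<^sub>m (q n) (q n), x)" n c] x by (simp add: AA_carrier AA_ops)
  qed
  moreover have "t n (a,b) = t n (a, 0\<^sub>m (qp n) (qp n)) + t n (0\<^sub>m (q n) (q n), b)"
   using add[of "(a, 0\<^sub>m (qp n) (qp n))" n "(0\<^sub>m (q n) (q n), b)"] a b by (simp add: AA_carrier AA_ops)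
  ultimately show ?thesis by simp
 qed
 have Upos: "0 \<le> t n (U n)" for n
 proof -
  have "star (AA n) (U n) \<otimes>\<^bsub>AA n\<^esub> U n = U n"
   using munit_mult[of 0 "q n" 0 0 0] q_pos[of n] by (auto simp: U_def AA_ops munit_adjoint intro!: eq_matI)
  thus ?thesis using pos[OF UV(1), of n] by simp
 qed
 have Vpos: "0 \<le> t n (V n)" for n
 proof (cases "qp n = 0")
  case True
  have "V n = \<zero>\<^bsub>AA n\<^esub>" using True by (auto simp: V_def AA_ops intro!: eq_matI)
  hence "V n = 0 \<odot>\<^bsub>AA n\<^esub> V n" using lev.smult_zero_left[OF UV(2)] by simp
  thus ?thesis using smult[OF UV(2), of n 0] by simp
 next
  case False
  have "star (AA n) (V n) \<otimes>\<^bsub>AA n\<^esub> V n = V n"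
   using munit_mult[of 0 "qp n" 0 0 0] False by (auto simp: V_def AA_ops munit_adjoint intro!: eq_matI)
  thus ?thesis using pos[OF UV(2), of n] by simp
 qed
 have trU: "tr (munit (q n) 0 0) = 1" for n using tr_munit[of 0 "q n" 0] q_pos[of n] by simp
 have tr0: "tr (0\<^sub>m d d) = 0" for d by (simp add: tr_def)
 have tr_blk: "tr (blk (r (Suc n)) a b) = of_nat (r (Suc n)) * tr a + tr b"
  if a: "a \<in> sqm (q n)" and b: "b \<in> sqm (qp n)" for n a b
 proof -
  interpret B: blocks "r (Suc n)" "q n" "qp n" "q (Suc n)" by (rule blocks_n)
  show ?thesis
   using tr_avg[OF B.blk_N[OF a b] q_Suc] unfolding avg_blk[OF q_Suc a b order_refl] B.cmp_blk(2)[OF a b] tr_smult[OF a] .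
 qed
 have tal: "t (Suc n) (al n (a,b)) = t (Suc n) (U (Suc n)) * (of_nat (r (Suc n)) * tr a + tr b) + t (Suc n) (V (Suc n)) * tr a"
  if a: "a \<in> sqm (q n)" and b: "b \<in> sqm (qp n)" for n a b
 proof -
  interpret B: blocks "r (Suc n)" "q n" "qp n" "q (Suc n)" by (rule blocks_n)
  have a': "a \<in> sqm (qp (Suc n))" using a by simp
  show ?thesis unfolding al_def case_prod_conv using form[OF B.blk_N[OF a b] a'] tr_blk[OF a b] by simp
 qed
 have relU: "t n (U n) = of_nat (r (Suc n)) * t (Suc n) (U (Suc n)) + t (Suc n) (V (Suc n))" for n
  using compat[OF UV(1), of n] tal[of "munit (q n) 0 0" n "0\<^sub>m (qp n) (qp n)"] trU[of n] tr0 by (simp add: U_def mult.commute)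
 have relV: "t (Suc n) (V (Suc n)) = t (Suc (Suc n)) (U (Suc (Suc n)))" for n
  using compat[OF UV(2), of "Suc n"] tal[of "0\<^sub>m (q (Suc n)) (q (Suc n))" "Suc n" "munit (qp (Suc n)) 0 0"] trU[of n] tr0 by (simp add: V_def)
 define u where "u n = Re (t n (U n))" for n
 have tu: "t n (U n) = cor (u n)" for n using Upos[of n] by (simp add: u_def complex_eq_iff less_eq_complex_def)
 have u0: "0 \<le> u n" for n using Upos[of n] by (simp add: u_def less_eq_complex_def)
 have norm: "u n * real (q n) \<le> 1" for n
 proof -
  have "cor (u n * real (q n)) + t n (V n) * of_nat (qp n) = 1"
   using form[OF one_carrier_mat one_carrier_mat, of n] one[of n] by (simp add: AA_ops tr_one tu)
  hence "Re (cor (u n * real (q n)) + t n (V n) * of_nat (qp n)) = Re 1" by (rule arg_cong)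
  hence "u n * real (q n) + Re (t n (V n)) * real (qp n) = 1" by simp
  moreover have "0 \<le> Re (t n (V n)) * real (qp n)" using Vpos[of n] by (simp add: less_eq_complex_def)
  ultimately show ?thesis by linarith
 qed
 have urec: "u n = real (r (Suc n)) * u (Suc n) + u (Suc (Suc n))" for n
 proof -
  have "cor (u n) = cor (real (r (Suc n)) * u (Suc n) + u (Suc (Suc n)))"
   using relU[of n] relV[of n] by (simp add: tu)
  thus ?thesis by (simp only: of_real_eq_iff)
 qed
 have unorm0: "u 0 = 1"
 proof -
  have "t 0 (U 0) * tr (1\<^sub>m (q 0)) + t 0 (V 0) * tr (1\<^sub>m (qp 0)) = 1"
   using form[OF one_carrier_mat one_carrier_mat, of 0] one[of 0] by (simp add: AA_ops)
  thus ?thesis by (simp add: tu tr_one q0)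
 qed
 have wq: "w n * real (q n) \<le> 1" for n
 proof -
  have "w n * real (q n) + w (Suc n) * real (qp n) = 1"
  proof (induction n)
   case (Suc n)
   have "w (Suc n) * real (q (Suc n)) + w (Suc (Suc n)) * real (qp (Suc n))
    = (real (r (Suc n)) * w (Suc n) + w (Suc (Suc n))) * real (q n) + w (Suc n) * real (qp n)"
    by (simp add: q_Suc algebra_simps del: w.simps)
   thus ?case unfolding w_rel[of n, symmetric] using Suc by simp
  qed (simp add: q0)
  moreover have "0 \<le> w (Suc n) * real (qp n)" using w_pos[of "Suc n"] by simp
  ultimately show ?thesis by linarith
 qed
 have uw: "u n - w n = 0" for n
 proof (rule recurrence_zero[of "\<lambda>n. u n - w n"])
  fix n
  show "u n - w n = real (r (Suc n)) * (u (Suc n) - w (Suc n)) + (u (Suc (Suc n)) - w (Suc (Suc n)))"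
   using urec[of n] w_rel[of n] unfolding right_diff_distrib by linarith
  have "\<bar>u n - w n\<bar> \<le> u n + w n" using u0[of n] w_pos[of n] by linarith
  hence "\<bar>u n - w n\<bar> * real (q n) \<le> (u n + w n) * real (q n)" by (rule mult_right_mono) simp
  thus "\<bar>u n - w n\<bar> * real (q n) \<le> 2" using norm[of n] wq[of n] by (simp add: distrib_right)
 qed (simp add: unorm0)
 have tU: "t n (U n) = cor (w n)" for n using tu[of n] uw[of n] by (simp del: w.simps)
 obtain a b where ab: "x = (a,b)" "a \<in> sqm (q n)" "b \<in> sqm (qp n)" using x by (rule AA_E)
 show ?thesis
 proof (cases n)
  case 0
  hence "tr b = 0" using ab(3) by (simp add: tr_def)
  thus ?thesis unfolding ab(1) form[OF ab(2,3)] tU by (simp add: tau_def)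
 next
  case (Suc m)
  hence "t n (V n) = cor (w (Suc n))" using relV[of m] tU[of "Suc n"] by (simp del: w.simps)
  thus ?thesis unfolding ab(1) form[OF ab(2,3)] tU by (simp add: tau_def del: w.simps)
 qed
qed

lemma level_coords: "\<exists>S. finite S \<and> S \<subseteq> carrier (AA n) \<and> (\<forall>\<phi>.
   (\<forall>x\<in>carrier (AA n). \<forall>y\<in>carrier (AA n). \<phi> (x \<oplus>\<^bsub>AA n\<^esub> y) = \<phi> x + \<phi> y) \<longrightarrow>
   (\<forall>x\<in>carrier (AA n). \<forall>c. \<phi> (c \<odot>\<^bsub>AA n\<^esub> x) = c * \<phi> x) \<longrightarrow>
   (\<forall>x\<in>carrier (AA n). cmod (\<phi> x) \<le> cnorm (AA n) x * (\<Sum>s\<in>S. cmod (\<phi> s))))"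
proof -
 let ?Z1 = "0\<^sub>m (q n) (q n) :: complex mat" and ?Z2 = "0\<^sub>m (qp n) (qp n) :: complex mat"
 let ?I = "\<lambda>d. {..<d} \<times> {..<d::nat}"
 define S1 where "S1 = (\<lambda>(i,j). (munit (q n) i j, ?Z2)) ` ?I (q n)"
 define S2 where "S2 = (\<lambda>(i,j). (?Z1, munit (qp n) i j)) ` ?I (qp n)"
 have i1: "inj_on (\<lambda>(i,j). (munit (q n) i j, ?Z2)) (?I (q n))"
  using munit_inj[of "q n"] by (auto simp: inj_on_def)
 have i2: "inj_on (\<lambda>(i,j). (?Z1, munit (qp n) i j)) (?I (qp n))"
  using munit_inj[of "qp n"] by (auto simp: inj_on_def)
 have disj: "S1 \<inter> S2 = {}"
 proof (rule ccontr)
  assume "S1 \<inter> S2 \<noteq> {}"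
  then obtain i j where ij: "i < q n" "j < q n" "munit (q n) i j = ?Z1" by (auto simp: S1_def S2_def)
  have "munit (q n) i j $$ (i,j) = 1" using ij(1,2) by simp
  thus False unfolding ij(3) using ij(1,2) by simp
 qed
 have fin: "finite S1" "finite S2" by (auto simp: S1_def S2_def)
 show ?thesis
 proof (intro exI[of _ "S1 \<union> S2"] conjI allI impI ballI)
  show "finite (S1 \<union> S2)" using fin by simp
  show "S1 \<union> S2 \<subseteq> carrier (AA n)" by (auto simp: S1_def S2_def AA_carrier)
  fix \<phi> :: "complex mat \<times> complex mat => complex" and x
  assume add: "\<forall>x\<in>carrier (AA n). \<forall>y\<in>carrier (AA n). \<phi> (x \<oplus>\<^bsub>AA n\<^esub> y) = \<phi> x + \<phi> y"
   and sm: "\<forall>x\<in>carrier (AA n). \<forall>c. \<phi> (c \<odot>\<^bsub>AA n\<^esub> x) = c * \<phi> x" and "x \<in> carrier (AA n)"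
  then obtain a b where ab: "x = (a,b)" "a \<in> sqm (q n)" "b \<in> sqm (qp n)" by (elim AA_E)
  have "cmod (\<phi> (a, ?Z2)) \<le> mat_op_norm a * (\<Sum>(i,j)\<in>?I (q n). cmod (\<phi> (munit (q n) i j, ?Z2)))"
  proof (rule linear_munit_bound[of "q n" "\<lambda>a. \<phi> (a, ?Z2)", OF _ _ ab(2)])
   fix x y :: "complex mat" and c assume x: "x \<in> sqm (q n)"
   show "\<phi> (c \<cdot>\<^sub>m x, ?Z2) = c * \<phi> (x, ?Z2)"
    using sm[rule_format, of "(x, ?Z2)" c] x by (simp add: AA_carrier AA_ops)
   assume y: "y \<in> sqm (q n)"
   show "\<phi> (x + y, ?Z2) = \<phi> (x, ?Z2) + \<phi> (y, ?Z2)"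
    using add[rule_format, of "(x, ?Z2)" "(y, ?Z2)"] x y by (simp add: AA_carrier AA_ops)
  qed
  also have "(\<Sum>(i,j)\<in>?I (q n). cmod (\<phi> (munit (q n) i j, ?Z2))) = (\<Sum>s\<in>S1. cmod (\<phi> s))"
   unfolding S1_def sum.reindex[OF i1] by (rule sum.cong) auto
  finally have 1: "cmod (\<phi> (a, ?Z2)) \<le> mat_op_norm a * (\<Sum>s\<in>S1. cmod (\<phi> s))" .
  have "cmod (\<phi> (?Z1, b)) \<le> mat_op_norm b * (\<Sum>(i,j)\<in>?I (qp n). cmod (\<phi> (?Z1, munit (qp n) i j)))"
  proof (rule linear_munit_bound[of "qp n" "\<lambda>b. \<phi> (?Z1, b)", OF _ _ ab(3)])
   fix x y :: "complex mat" and c assume x: "x \<in> sqm (qp n)"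
   show "\<phi> (?Z1, c \<cdot>\<^sub>m x) = c * \<phi> (?Z1, x)"
    using sm[rule_format, of "(?Z1, x)" c] x by (simp add: AA_carrier AA_ops)
   assume y: "y \<in> sqm (qp n)"
   show "\<phi> (?Z1, x + y) = \<phi> (?Z1, x) + \<phi> (?Z1, y)"
    using add[rule_format, of "(?Z1, x)" "(?Z1, y)"] x y by (simp add: AA_carrier AA_ops)
  qed
  also have "(\<Sum>(i,j)\<in>?I (qp n). cmod (\<phi> (?Z1, munit (qp n) i j))) = (\<Sum>s\<in>S2. cmod (\<phi> s))"
   unfolding S2_def sum.reindex[OF i2] by (rule sum.cong) auto
  finally have 2: "cmod (\<phi> (?Z1, b)) \<le> mat_op_norm b * (\<Sum>s\<in>S2. cmod (\<phi> s))" .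
  have n: "mat_op_norm a \<le> cnorm (AA n) x" "mat_op_norm b \<le> cnorm (AA n) x" by (simp_all add: ab(1) AA_ops)
  have "\<phi> x = \<phi> (a, ?Z2) + \<phi> (?Z1, b)"
   using add[rule_format, of "(a, ?Z2)" "(?Z1, b)"] ab by (simp add: AA_carrier AA_ops)
  hence "cmod (\<phi> x) \<le> cmod (\<phi> (a, ?Z2)) + cmod (\<phi> (?Z1, b))" using norm_triangle_ineq by metis
  also have "\<dots> \<le> cnorm (AA n) x * (\<Sum>s\<in>S1. cmod (\<phi> s)) + cnorm (AA n) x * (\<Sum>s\<in>S2. cmod (\<phi> s))"
   using 1 2 mult_right_mono[OF n(1), of "\<Sum>s\<in>S1. cmod (\<phi> s)"] mult_right_mono[OF n(2), of "\<Sum>s\<in>S2. cmod (\<phi> s)"]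
   by (simp add: sum_nonneg)
  also have "\<dots> = cnorm (AA n) x * (\<Sum>s\<in>S1 \<union> S2. cmod (\<phi> s))"
   unfolding sum.union_disjoint[OF fin disj] by (simp add: distrib_left)
  finally show "cmod (\<phi> x) \<le> cnorm (AA n) x * (\<Sum>s\<in>S1 \<union> S2. cmod (\<phi> s))" .
 qed
qed

sublocale traced_tower AA al FF
proof (rule traced_tower.intro[OF ind_tower_axioms traced_tower_axioms.intro])
 show "\<exists>c. x = c \<odot>\<^bsub>AA 0\<^esub> \<one>\<^bsub>AA 0\<^esub>" if "x \<in> carrier (AA 0)" for x
  using Fc_tau[OF that] by auto
 show "Fc 0 n (x \<otimes>\<^bsub>AA n\<^esub> y) = Fc 0 n (y \<otimes>\<^bsub>AA n\<^esub> x)" if "x \<in> carrier (AA n)" "y \<in> carrier (AA n)" for x y n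
  using Fc_tau[of "x \<otimes>\<^bsub>AA n\<^esub> y" n] Fc_tau[of "y \<otimes>\<^bsub>AA n\<^esub> x" n] tau_mult_commute[OF that] that by simp
 show "x = \<zero>\<^bsub>AA n\<^esub>" if x: "x \<in> carrier (AA n)" and z: "Fc 0 n (star (AA n) x \<otimes>\<^bsub>AA n\<^esub> x) = \<zero>\<^bsub>AA 0\<^esub>" for x n
 proof (rule tau_faithful[OF x])
  have "tau n (star (AA n) x \<otimes>\<^bsub>AA n\<^esub> x) \<odot>\<^bsub>AA 0\<^esub> \<one>\<^bsub>AA 0\<^esub> = \<zero>\<^bsub>AA 0\<^esub>"
   using Fc_tau[of "star (AA n) x \<otimes>\<^bsub>AA n\<^esub> x" n] x z by simp
  hence "cmod (tau n (star (AA n) x \<otimes>\<^bsub>AA n\<^esub> x)) * cnorm (AA 0) \<one>\<^bsub>AA 0\<^esub> = 0"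
   using lev.cnorm_smult[OF lev.A.one_closed, of 0 "tau n (star (AA n) x \<otimes>\<^bsub>AA n\<^esub> x)"] by simp
  thus "tau n (star (AA n) x \<otimes>\<^bsub>AA n\<^esub> x) = 0"
   using lev.cnorm_eq_0_iff[OF lev.A.one_closed, of 0] A_nontrivial[of 0] by simp
 qed
 show "Fc 0 n x = t n x \<odot>\<^bsub>AA 0\<^esub> \<one>\<^bsub>AA 0\<^esub>"
  if "\<And>n x y. x \<in> carrier (AA n) ==> y \<in> carrier (AA n) ==> t n (x \<oplus>\<^bsub>AA n\<^esub> y) = t n x + t n y"
   "\<And>n x c. x \<in> carrier (AA n) ==> t n (c \<odot>\<^bsub>AA n\<^esub> x) = c * t n x"
   "\<And>n x y. x \<in> carrier (AA n) ==> y \<in> carrier (AA n) ==> t n (x \<otimes>\<^bsub>AA n\<^esub> y) = t n (y \<otimes>\<^bsub>AA n\<^esub> x)"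
   "\<And>n x. x \<in> carrier (AA n) ==> 0 \<le> t n (star (AA n) x \<otimes>\<^bsub>AA n\<^esub> x)"
   "\<And>n. t n \<one>\<^bsub>AA n\<^esub> = 1"
   "\<And>n x. x \<in> carrier (AA n) ==> t (Suc n) (al n x) = t n x"
   and x: "x \<in> carrier (AA n)" for t n x
 proof -
  have "t n x = tau n x" by (rule trace_unique_levels[where t = t]) (fact that)+
  thus ?thesis using Fc_tau[OF x] by simp
 qed
qed (rule level_coords)

lemma dim_AA: "real (q n) \<le> real (cstar_dim (AA n))"
proof -
 have "q n \<le> cstar_dim (AA n)"
  unfolding AA_def cstar_dim_mat_sum using le_square[of "q n"] by (rule trans_le_add1)
 thus ?thesis by simp
qed

lemma dim_weights:
 assumes "0 < k"
 shows "0 < real (cstar_dim (AA n)) powr k"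
  "filterlim (\<lambda>n. real (cstar_dim (AA n)) powr k) at_top sequentially"
proof -
 show "0 < real (cstar_dim (AA n)) powr k" using dim_AA[of n] q_pos[of n] by simp
 have "filterlim (\<lambda>n. real n powr k) at_top sequentially"
  using filterlim_compose[OF real_powr_at_top[OF assms] filterlim_real_sequentially] .
 moreover have "real n powr k \<le> real (cstar_dim (AA n)) powr k" for n
  using dim_AA[of n] q_ge[of n] assms by (intro powr_mono2) auto
 ultimately show "filterlim (\<lambda>n. real (cstar_dim (AA n)) powr k) at_top sequentially"
  by (rule filterlim_at_top_mono[OF _ always_eventually[OF allI]])
qed

abbreviation dd where "dd k n \<equiv> real (cstar_dim (AA n)) powr k"

theorem af_tower_AA: "0 < k ==> af_tower QQ (\<lambda>n. can n ` carrier (AA n)) Ex (dd k)"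
 by (rule af_towerI) (rule dim_weights, assumption)+

end

section \<open>Limits along bounded sequences of states\<close>

text \<open>
 A positive linear extension of the limit to all bounded sequences is a cluster point of the
 evaluations \<open>x \<mapsto> x m\<close>, which range in a product of compact sets.  Every closed condition satisfied
 by almost all evaluations passes to the cluster point, and linearity, positivity and agreement
 with the limit are such conditions.
\<close>

lemma generalized_limit:
 obtains L :: "(nat => complex) => complex" where
  "\<And>x y. bounded (range x) ==> bounded (range y) ==> L (\<lambda>n. x n + y n) = L x + L y"
  "\<And>c x. bounded (range x) ==> L (\<lambda>n. c * x n) = c * L x"
  "\<And>x. bounded (range x) ==> \<forall>\<^sub>F n in sequentially. 0 \<le> x n ==> 0 \<le> L x"
  "\<And>x c. bounded (range x) ==> x \<longlonglongrightarrow> c ==> L x = c"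
proof -
 let ?B = "\<lambda>x :: nat => complex. bounded (range x)"
 define e :: "nat => (nat => complex) => complex" where "e m x = (if ?B x then x m else 0)" for m x
 define S where "S x = (if ?B x then closure (range x) else {0})" for x
 have "compactin (product_topology (\<lambda>_. euclidean) UNIV) (PiE UNIV S)"
  unfolding compactin_PiE by (simp add: S_def)
 hence cpt: "compact (PiE UNIV S)" unfolding euclidean_product_topology by simp
 define F where "F = filtermap e sequentially"
 have eS: "e m \<in> PiE UNIV S" for m
  using closure_subset by (fastforce simp: S_def e_def)
 have "\<forall>\<^sub>F M in F. M \<in> PiE UNIV S" unfolding F_def by (simp add: eventually_filtermap eS)
 moreover have "F \<noteq> bot" by (simp add: F_def filtermap_bot_iff)
 ultimately obtain L where L: "inf (nhds L) F \<noteq> bot"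
  using compact_filter[THEN iffD1, OF cpt, rule_format, of F] by blast
 have closed: "L \<in> C" if C: "closed C" and ev: "\<forall>\<^sub>F m in sequentially. e m \<in> C" for C
 proof (rule ccontr)
  assume "L \<notin> C"
  hence "\<forall>\<^sub>F y in nhds L. y \<in> - C" using C by (intro eventually_nhds_in_open) auto
  moreover have "\<forall>\<^sub>F y in F. y \<in> C" using ev by (simp add: F_def eventually_filtermap)
  ultimately have "\<forall>\<^sub>F y in inf (nhds L) F. False" unfolding eventually_inf by fastforce
  thus False using L by (simp add: eventually_False)
 qed
 have cont: "continuous_on UNIV (\<lambda>M :: (nat => complex) => complex. M x)" for x
  by (rule continuous_on_product_coordinates)
 show thesis
 proof (rule that)
  fix x y assume x: "?B x" and y: "?B y"
  have "bounded (range (\<lambda>n. x n + y n))" using bounded_plus_comp[OF x y] .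
  hence "e m (\<lambda>n. x n + y n) = e m x + e m y" for m using x y by (simp add: e_def)
  moreover have "closed {M :: (nat => complex) => complex. M (\<lambda>n. x n + y n) = M x + M y}"
   by (intro closed_Collect_eq continuous_on_add cont)
  ultimately show "L (\<lambda>n. x n + y n) = L x + L y" using closed by fastforce
 next
  fix c x assume x: "?B x"
  have "bounded (range (\<lambda>n. c * x n))"
   using bounded_scaling[of "range x"] bounded_linear_image[OF x bounded_linear_mult_right[of c]] by (simp add: image_image)
  hence "e m (\<lambda>n. c * x n) = c * e m x" for m using x by (simp add: e_def)
  moreover have "closed {M :: (nat => complex) => complex. M (\<lambda>n. c * x n) = c * M x}"
   by (intro closed_Collect_eq continuous_on_mult continuous_on_const cont)
  ultimately show "L (\<lambda>n. c * x n) = c * L x" using closed by fastforce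
 next
  fix x assume x: "?B x" and ev: "\<forall>\<^sub>F n in sequentially. 0 \<le> x n"
  have "closed {M :: (nat => complex) => complex. 0 \<le> Re (M x) \<and> Im (M x) = 0}"
   by (intro closed_Collect_conj closed_Collect_eq closed_Collect_le continuous_on_Re continuous_on_Im continuous_on_const cont)
  moreover have "\<forall>\<^sub>F m in sequentially. e m \<in> {M. 0 \<le> Re (M x) \<and> Im (M x) = 0}"
   using ev by eventually_elim (simp add: e_def x less_eq_complex_def)
  ultimately have "L \<in> {M. 0 \<le> Re (M x) \<and> Im (M x) = 0}" by (rule closed)
  thus "0 \<le> L x" by (simp add: less_eq_complex_def)
 next
  fix x c assume x: "?B x" and lim: "x \<longlonglongrightarrow> c"
  have "dist (L x) c \<le> r" if "0 < r" for r
  proof -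
   have "closed {M :: (nat => complex) => complex. dist (M x) c \<le> r}"
    by (intro closed_Collect_le continuous_on_dist continuous_on_const cont)
   moreover have "\<forall>\<^sub>F m in sequentially. e m \<in> {M. dist (M x) c \<le> r}"
    using tendstoD[OF lim that] by eventually_elim (simp add: e_def x)
   ultimately have "L \<in> {M. dist (M x) c \<le> r}" by (rule closed)
   thus ?thesis by simp
  qed
  hence "dist (L x) c \<le> 0" using field_le_epsilon[of "dist (L x) c" 0] by simp
  thus "L x = c" by simp
 qed
qed

section \<open>Bounded sequences modulo null sequences\<close>

definition bounded_seqs :: "(nat => 'a cstar) => (nat => 'a) set" where
 "bounded_seqs D = {x. (\<forall>n. x n \<in> carrier (D n)) \<and> (\<exists>C. \<forall>n. cnorm (D n) (x n) \<le> C)}"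

definition limsup_norm :: "(nat => 'a cstar) => (nat => 'a) set => real" where
 "limsup_norm D X = seq_norm D (SOME x. x \<in> X)"

abbreviation bounded_quot :: "(nat => 'a cstar) => (nat => 'a) set cstar" where
 "bounded_quot D \<equiv> seq_quot D (bounded_seqs D) (limsup_norm D)"

lemma seq_norm_mono_null:
 fixes D :: "nat => 'a cstar"
 assumes D: "\<And>n. pos_cstar (D n)" and x: "x \<in> bounded_seqs D" and y: "y \<in> bounded_seqs D"
  and null: "(\<lambda>n. cdist (D n) (x n) (y n)) \<longlonglongrightarrow> 0"
 shows "seq_norm D x \<le> seq_norm D y"
proof (rule field_le_epsilon)
 fix e :: real assume e: "0 < e"
 let ?S = "\<lambda>x. {c. 0 \<le> c \<and> (\<forall>\<^sub>F n in sequentially. cnorm (D n) (x n) \<le> c)}"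
 obtain C where C: "\<And>n. cnorm (D n) (y n) \<le> C" using y by (auto simp: bounded_seqs_def)
 have "max 0 C \<in> ?S y" using C by (auto intro!: always_eventually simp: le_max_iff_disj)
 hence "?S y \<noteq> {}" by blast
 moreover have "Inf (?S y) < seq_norm D y + e / 2" using e by (simp add: seq_norm_def)
 ultimately obtain c where c: "c \<in> ?S y" "c < seq_norm D y + e / 2" using cInf_lessD[of "?S y"] by blast
 have "\<forall>\<^sub>F n in sequentially. cdist (D n) (x n) (y n) < e / 2"
  using order_tendstoD(2)[OF null half_gt_zero[OF e]] .
 moreover have "\<forall>\<^sub>F n in sequentially. cnorm (D n) (y n) \<le> c" using c by simp
 ultimately have "\<forall>\<^sub>F n in sequentially. cnorm (D n) (x n) \<le> c + e / 2"
 proof eventually_elim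
  case (elim n)
  interpret pos_cstar "D n" by (rule D)
  have "x n \<in> carrier (D n)" "y n \<in> carrier (D n)" using x y by (auto simp: bounded_seqs_def)
  from cnorm_le_dist[OF this] show ?case using elim by linarith
 qed
 hence "c + e / 2 \<in> ?S x" using c e by simp
 hence "seq_norm D x \<le> c + e / 2" unfolding seq_norm_def by (rule cInf_lower) (auto intro!: bdd_belowI[of _ 0])
 thus "seq_norm D x \<le> seq_norm D y + e" using c(2) by linarith
qed

locale bounded_seq_algebra =
 fixes D :: "nat => 'a cstar"
 assumes D: "pos_cstar (D n)" and D_nontrivial: "\<one>\<^bsub>D n\<^esub> \<noteq> \<zero>\<^bsub>D n\<^esub>"
begin

sublocale lev: pos_cstar "D n" for n by (rule D)

lemma bounded_seqsI: "(\<And>n. x n \<in> carrier (D n)) ==> (\<And>n. cnorm (D n) (x n) \<le> C) ==> x \<in> bounded_seqs D"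
 by (auto simp: bounded_seqs_def)

lemma bounded_seqsE:
 assumes "x \<in> bounded_seqs D"
 obtains C where "\<And>n. x n \<in> carrier (D n)" "\<And>n. cnorm (D n) (x n) \<le> C" "0 \<le> C"
proof -
 obtain C where C: "\<And>n. x n \<in> carrier (D n)" "\<And>n. cnorm (D n) (x n) \<le> C"
  using assms by (auto simp: bounded_seqs_def)
 have "0 \<le> C" using lev.cnorm_nonneg[OF C(1)[of 0]] C(2)[of 0] by linarith
 thus thesis using that C by blast
qed

sublocale seq_algebra D "bounded_seqs D" "limsup_norm D"
proof (rule seq_algebra.intro)
 show "pos_cstar (D n)" for n by (rule D)
 show "x n \<in> carrier (D n)" if "x \<in> bounded_seqs D" for x n using that by (auto simp: bounded_seqs_def)
 show "\<exists>C. \<forall>n. cnorm (D n) (x n) \<le> C" if "x \<in> bounded_seqs D" for x using that by (auto simp: bounded_seqs_def)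
 show "(\<lambda>n. \<one>\<^bsub>D n\<^esub>) \<in> bounded_seqs D"
  by (rule bounded_seqsI[of _ 1]) (auto intro: lev.cnorm_one_le)
 show "(\<lambda>n. x n \<oplus>\<^bsub>D n\<^esub> y n) \<in> bounded_seqs D" if xy: "x \<in> bounded_seqs D" "y \<in> bounded_seqs D" for x y
 proof -
  obtain C C' where "\<And>n. x n \<in> carrier (D n)" "\<And>n. cnorm (D n) (x n) \<le> C" "\<And>n. y n \<in> carrier (D n)" "\<And>n. cnorm (D n) (y n) \<le> C'"
   using xy by (elim bounded_seqsE) blast
  thus ?thesis
   by (intro bounded_seqsI[of _ "C + C'"]) (auto intro: order_trans[OF lev.cnorm_triangle add_mono])
 qed
 show "(\<lambda>n. x n \<otimes>\<^bsub>D n\<^esub> y n) \<in> bounded_seqs D" if xy: "x \<in> bounded_seqs D" "y \<in> bounded_seqs D" for x y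
 proof -
  obtain C C' where "\<And>n. x n \<in> carrier (D n)" "\<And>n. cnorm (D n) (x n) \<le> C" "\<And>n. y n \<in> carrier (D n)" "\<And>n. cnorm (D n) (y n) \<le> C'" "0 \<le> C" "0 \<le> C'"
   using xy by (elim bounded_seqsE) blast
  thus ?thesis
   by (intro bounded_seqsI[of _ "C * C'"]) (auto intro!: order_trans[OF lev.cnorm_mult mult_mono] simp: lev.cnorm_nonneg)
 qed
 show "(\<lambda>n. c \<odot>\<^bsub>D n\<^esub> x n) \<in> bounded_seqs D" if x: "x \<in> bounded_seqs D" for x c
 proof -
  obtain C where "\<And>n. x n \<in> carrier (D n)" "\<And>n. cnorm (D n) (x n) \<le> C" "0 \<le> C" using x by (rule bounded_seqsE) blast
  thus ?thesis by (intro bounded_seqsI[of _ "cmod c * C"]) (auto simp: lev.cnorm_smult intro: mult_left_mono)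
 qed
 show "(\<lambda>n. star (D n) (x n)) \<in> bounded_seqs D" if x: "x \<in> bounded_seqs D" for x
 proof -
  obtain C where "\<And>n. x n \<in> carrier (D n)" "\<And>n. cnorm (D n) (x n) \<le> C" "0 \<le> C" using x by (rule bounded_seqsE) blast
  thus ?thesis by (intro bounded_seqsI[of _ C]) auto
 qed
 show "x \<in> bounded_seqs D" if x: "\<And>n. x n \<in> carrier (D n)"
  and ap: "\<And>e. 0 < e ==> \<exists>y\<in>bounded_seqs D. \<forall>\<^sub>F n in sequentially. cdist (D n) (x n) (y n) \<le> e" for x
 proof -
  obtain y where y: "y \<in> bounded_seqs D" and "\<forall>\<^sub>F n in sequentially. cdist (D n) (x n) (y n) \<le> 1" using ap[of 1] by auto
  then obtain K where K: "\<And>n. n \<ge> K ==> cdist (D n) (x n) (y n) \<le> 1" by (auto simp: eventually_sequentially)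
  obtain C where C: "\<And>n. y n \<in> carrier (D n)" "\<And>n. cnorm (D n) (y n) \<le> C" "0 \<le> C" using y by (rule bounded_seqsE) blast
  have pos: "0 \<le> (\<Sum>i<K. cnorm (D i) (x i))" by (intro sum_nonneg lev.cnorm_nonneg x)
  show ?thesis
  proof (rule bounded_seqsI[OF x, of "1 + C + (\<Sum>i<K. cnorm (D i) (x i))"])
   fix n
   show "cnorm (D n) (x n) \<le> 1 + C + (\<Sum>i<K. cnorm (D i) (x i))"
   proof (cases "n < K")
    case True
    hence "cnorm (D n) (x n) \<le> (\<Sum>i<K. cnorm (D i) (x i))"
     by (intro member_le_sum) (auto intro: lev.cnorm_nonneg x)
    thus ?thesis using C(3) by linarith
   next
    case False
    thus ?thesis using lev.cnorm_le_dist[OF x[of n] C(1)] K[of n] C(2)[of n] pos by linarith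
   qed
  qed
 qed
 show "limsup_norm D (null_rel D (bounded_seqs D) `` {x}) = seq_norm D x" if x: "x \<in> bounded_seqs D" for x
 proof -
  let ?X = "null_rel D (bounded_seqs D) `` {x}"
  have "x \<in> ?X" using x by (auto simp: null_rel_def bounded_seqs_def lev.A.r_neg[unfolded a_minus_def[symmetric]] lev.A.minus_eq lev.A.r_neg)
  hence "(SOME y. y \<in> ?X) \<in> ?X" by (rule someI[of "\<lambda>y. y \<in> ?X"])
  hence y: "(SOME y. y \<in> ?X) \<in> bounded_seqs D" "(\<lambda>n. cdist (D n) (x n) ((SOME y. y \<in> ?X) n)) \<longlonglongrightarrow> 0"
   by (auto simp: null_rel_def)
  have "(\<lambda>n. cdist (D n) ((SOME y. y \<in> ?X) n) (x n)) \<longlonglongrightarrow> 0"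
   using y x by (subst lev.cnorm_minus_commute) (auto simp: bounded_seqs_def)
  thus ?thesis
   unfolding limsup_norm_def using seq_norm_mono_null[OF D] x y by (intro antisym) auto
 qed
qed

abbreviation DQ where "DQ \<equiv> bounded_quot D"

sublocale DQ: pos_cstar DQ by (rule pos_cstar_Q)

lemma unital_DQ: "unital_cstar DQ"
 by (rule unital_cstar_Q[OF D_nontrivial])

text \<open>
 States of the levels have a limit along the generalized limit above.  It is well defined on
 classes because states are uniformly bounded, and positive because positivity is checked in the
 levels.
\<close>

lemma limit_state:
 assumes \<zeta>: "\<And>m. K \<le> m ==> \<zeta> m \<in> states (D m)"
 shows "\<exists>\<phi>\<in>states DQ. \<forall>x\<in>bounded_seqs D. \<forall>c. (\<forall>m\<ge>K. \<zeta> m (x m) = c) \<longrightarrow> \<phi> (cls x) = c"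
proof (rule generalized_limit)
 fix L :: "(nat => complex) => complex" assume L:
  "\<And>x y. bounded (range x) ==> bounded (range y) ==> L (\<lambda>n. x n + y n) = L x + L y"
  "\<And>c x. bounded (range x) ==> L (\<lambda>n. c * x n) = c * L x"
  "\<And>x. bounded (range x) ==> \<forall>\<^sub>F n in sequentially. 0 \<le> x n ==> 0 \<le> L x"
  "\<And>x c. bounded (range x) ==> x \<longlonglongrightarrow> c ==> L x = c"
 define \<xi> where "\<xi> m = (if K \<le> m then \<zeta> m else (\<lambda>_. 0))" for m
 have z: "K \<le> m ==> \<xi> m \<in> states (D m)" "\<not> K \<le> m ==> \<xi> m = (\<lambda>_. 0)" for m
  using \<zeta> by (auto simp: \<xi>_def)
 have z_bound: "cmod (\<xi> m a) \<le> 2 * cnorm (D m) a" if "a \<in> carrier (D m)" for m a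
  using lev.states_bound[OF z(1) that] z(2)[of m] lev.cnorm_nonneg[OF that] by (cases "K \<le> m") auto
 have z_minus: "\<xi> m (a \<ominus>\<^bsub>D m\<^esub> b) = \<xi> m a - \<xi> m b" if "a \<in> carrier (D m)" "b \<in> carrier (D m)" for m a b
  using lev.states_minus[OF z(1) that] z(2)[of m] by (cases "K \<le> m") auto
 have z_add: "\<xi> m (a \<oplus>\<^bsub>D m\<^esub> b) = \<xi> m a + \<xi> m b" if "a \<in> carrier (D m)" "b \<in> carrier (D m)" for m a b
  using lev.states_D(1)[OF z(1) that] z(2)[of m] by (cases "K \<le> m") auto
 have z_smult: "\<xi> m (c \<odot>\<^bsub>D m\<^esub> a) = c * \<xi> m a" if "a \<in> carrier (D m)" for m a c
  using lev.states_D(2)[OF z(1) that] z(2)[of m] by (cases "K \<le> m") auto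
 have z_pos: "0 \<le> \<xi> m (star (D m) a \<otimes>\<^bsub>D m\<^esub> a)" if "a \<in> carrier (D m)" for m a
  using lev.states_D(3)[OF z(1) that] z(2)[of m] by (cases "K \<le> m") auto
 have bdd: "bounded (range (\<lambda>m. \<xi> m (x m)))" if x: "x \<in> bounded_seqs D" for x
 proof -
  obtain C where C: "\<And>n. x n \<in> carrier (D n)" "\<And>n. cnorm (D n) (x n) \<le> C" "0 \<le> C" using x by (rule bounded_seqsE) blast
  have "cmod (\<xi> m (x m)) \<le> 2 * C" for m using z_bound[OF C(1), of m] C(2)[of m] by linarith
  thus ?thesis by (auto intro: boundedI)
 qed
 have wd: "L (\<lambda>m. \<xi> m (x m)) = L (\<lambda>m. \<xi> m (y m))" if x: "x \<in> bounded_seqs D" and y: "y \<in> bounded_seqs D" and eq: "cls x = cls y" for x y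
 proof -
  have null: "(\<lambda>m. cdist (D m) (x m) (y m)) \<longlonglongrightarrow> 0" using eq cls_eq_iff[OF x y] by simp
  define y' where "y' = (\<lambda>m. x m \<ominus>\<^bsub>D m\<^esub> y m)"
  have z: "y' \<in> bounded_seqs D" unfolding y'_def by (rule T_minus[OF x y])
  have null': "(\<lambda>m. 2 * cnorm (D m) (y' m)) \<longlonglongrightarrow> 0"
   unfolding y'_def by (rule tendsto_mult_right_zero[OF null])
  have "(\<lambda>m. cmod (\<xi> m (y' m))) \<longlonglongrightarrow> 0"
   by (rule null_seq_le[OF _ _ null']) (rule norm_ge_zero, rule z_bound[OF T_carrier[OF z]])
  hence "L (\<lambda>m. \<xi> m (y' m)) = 0" by (rule L(4)[OF bdd[OF z] tendsto_norm_zero_cancel])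
  moreover have "\<xi> m (x m) = \<xi> m (y' m) + \<xi> m (y m)" for m
   using z_minus[of "x m" m "y m"] x y by (simp add: y'_def)
  ultimately show ?thesis using L(1)[OF bdd[OF z] bdd[OF y]] by simp
 qed
 define \<phi> where "\<phi> = (\<lambda>X\<in>carrier DQ. L (\<lambda>m. \<xi> m ((SOME x. x \<in> bounded_seqs D \<and> X = cls x) m)))"
 have \<phi>: "\<phi> (cls x) = L (\<lambda>m. \<xi> m (x m))" if x: "x \<in> bounded_seqs D" for x
 proof -
  let ?y = "SOME y. y \<in> bounded_seqs D \<and> cls x = cls y"
  have "?y \<in> bounded_seqs D \<and> cls x = cls ?y" by (rule someI[of _ x]) (use x in simp)
  thus ?thesis using wd[OF x, of ?y] x by (simp add: \<phi>_def)
 qed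
 have const: "\<phi> (cls x) = c" if x: "x \<in> bounded_seqs D" and ev: "\<forall>\<^sub>F m in sequentially. \<xi> m (x m) = c" for x c
  unfolding \<phi>[OF x] by (rule L(4)[OF bdd[OF x]]) (rule tendsto_eventually[OF ev])
 have "\<phi> \<in> states DQ"
  unfolding states_def linear_functional_def
 proof (intro CollectI conjI ballI allI)
  show "\<phi> \<in> extensional (carrier DQ)" by (simp add: \<phi>_def)
  show "\<phi> \<one>\<^bsub>DQ\<^esub> = 1" unfolding Q_simps(2) by (rule const) (use lev.states_D(4)[OF z(1)] in \<open>auto simp: eventually_sequentially intro!: exI[of _ K]\<close>)
 next
  fix X Y assume "X \<in> carrier DQ" "Y \<in> carrier DQ"
  then obtain x y where x: "x \<in> bounded_seqs D" "X = cls x" and y: "y \<in> bounded_seqs D" "Y = cls y" by (metis carrier_Q)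
  show "\<phi> (X \<oplus>\<^bsub>DQ\<^esub> Y) = \<phi> X + \<phi> Y"
   unfolding x(2) y(2) Q_simps(5)[OF x(1) y(1)] \<phi>[OF x(1)] \<phi>[OF y(1)] \<phi>[OF T_add[OF x(1) y(1)]]
   using L(1)[OF bdd[OF x(1)] bdd[OF y(1)]] z_add[OF T_carrier[OF x(1)] T_carrier[OF y(1)]] by simp
 next
  fix c X assume "X \<in> carrier DQ"
  then obtain x where x: "x \<in> bounded_seqs D" "X = cls x" by (metis carrier_Q)
  show "\<phi> (c \<odot>\<^bsub>DQ\<^esub> X) = c * \<phi> X"
   unfolding x(2) Q_simps(6)[OF x(1)] \<phi>[OF x(1)] \<phi>[OF T_smult[OF x(1)]]
   using L(2)[OF bdd[OF x(1)]] z_smult[OF T_carrier[OF x(1)]] by simp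
 next
  fix X assume "X \<in> carrier DQ"
  then obtain x where x: "x \<in> bounded_seqs D" "X = cls x" by (metis carrier_Q)
  have s: "(\<lambda>m. star (D m) (x m) \<otimes>\<^bsub>D m\<^esub> x m) \<in> bounded_seqs D" using x by simp
  show "0 \<le> \<phi> (star DQ X \<otimes>\<^bsub>DQ\<^esub> X)"
   unfolding x(2) Q_simps(7)[OF x(1)] Q_simps(4)[OF T_star[OF x(1)] x(1)] \<phi>[OF s]
   by (rule L(3)[OF bdd[OF s]]) (use z_pos[OF T_carrier[OF x(1)]] in simp)
 qed
 moreover have "\<phi> (cls x) = c" if "x \<in> bounded_seqs D" "\<forall>m\<ge>K. \<zeta> m (x m) = c" for x c
  by (rule const[OF that(1)]) (use that(2) in \<open>auto simp: eventually_sequentially \<xi>_def\<close>)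
 ultimately show ?thesis by blast
qed

end

text \<open>
 A contractive unital *-linear map pulls states back to states: positivity of \<open>h = x\<^sup>* x\<close> is the norm
 condition \<open>\<parallel>r 1 - h\<parallel> \<le> r\<close>, which such a map respects.
\<close>

lemma pullback_state:
 fixes A :: "'a cstar" and B :: "'b cstar"
 assumes A: "pos_cstar A" and B: "pos_cstar B"
  and closed: "\<And>x. x \<in> carrier B ==> S x \<in> carrier A"
  and add: "\<And>x y. x \<in> carrier B ==> y \<in> carrier B ==> S (x \<oplus>\<^bsub>B\<^esub> y) = S x \<oplus>\<^bsub>A\<^esub> S y"
  and smult: "\<And>x c. x \<in> carrier B ==> S (c \<odot>\<^bsub>B\<^esub> x) = c \<odot>\<^bsub>A\<^esub> S x"
  and star: "\<And>x. x \<in> carrier B ==> S (star B x) = star A (S x)"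
  and one: "S \<one>\<^bsub>B\<^esub> = \<one>\<^bsub>A\<^esub>"
  and norm: "\<And>x. x \<in> carrier B ==> cnorm A (S x) \<le> cnorm B x"
  and \<psi>: "\<psi> \<in> states A"
 shows "restrict (\<psi> \<circ> S) (carrier B) \<in> states B"
proof -
 interpret A: pos_cstar A by (rule A)
 interpret B: pos_cstar B by (rule B)
 show ?thesis
  unfolding states_def linear_functional_def
 proof (intro CollectI conjI ballI allI)
  fix x assume x: "x \<in> carrier B"
  let ?h = "star B x \<otimes>\<^bsub>B\<^esub> x" and ?r = "(cnorm B x)\<^sup>2"
  have h: "?h \<in> carrier B" "star B ?h = ?h" using x by (simp_all add: B.star_mult B.star_star B.star_closed)
  have rh: "cor ?r \<odot>\<^bsub>B\<^esub> \<one>\<^bsub>B\<^esub> \<ominus>\<^bsub>B\<^esub> ?h \<in> carrier B" using h by simp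
  have "S (cor ?r \<odot>\<^bsub>B\<^esub> \<one>\<^bsub>B\<^esub> \<ominus>\<^bsub>B\<^esub> ?h) = cor ?r \<odot>\<^bsub>A\<^esub> \<one>\<^bsub>A\<^esub> \<ominus>\<^bsub>A\<^esub> S ?h"
   using h closed[OF h(1)] by (simp only: B.minus_smult[OF B.sclosed[OF B.A.one_closed]] A.minus_smult[OF A.sclosed[OF A.A.one_closed]] add smult B.sclosed B.A.one_closed one)
  hence "cdist A (cor ?r \<odot>\<^bsub>A\<^esub> \<one>\<^bsub>A\<^esub>) (S ?h) \<le> ?r"
   using norm[OF rh] B.square_positive[OF x order_refl] by simp
  moreover have "S ?h \<in> self_adjoint A" using closed[OF h(1)] star[OF h(1)] h(2) by (simp add: self_adjoint_def)
  ultimately have "0 \<le> \<psi> (S ?h)" by (intro A.states_positive[OF \<psi>])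
  thus "0 \<le> restrict (\<psi> \<circ> S) (carrier B) ?h" using h by simp
 qed (use A.states_D[OF \<psi>] closed add smult one in auto)
qed

section \<open>Embedding an inductive limit into bounded sequences\<close>

text \<open>
 Threads of a tower are bounded sequences.  Unital *-morphisms \<open>e m\<close> of the levels into the levels
 of another sequence of algebras therefore induce a morphism on the limit.  It is injective as
 soon as \<open>e\<close> preserves the norm after one step of the tower.
\<close>

locale tower_embedding = ind_tower A \<alpha> F + Dl: bounded_seq_algebra D
 for A :: "nat => 'a cstar" and \<alpha> F and D :: "nat => 'b cstar" +
 fixes e :: "nat => 'a => 'b"
 assumes e_closed: "x \<in> carrier (A n) ==> e n x \<in> carrier (D n)"
  and e_add: "x \<in> carrier (A n) ==> y \<in> carrier (A n) ==> e n (x \<oplus>\<^bsub>A n\<^esub> y) = e n x \<oplus>\<^bsub>D n\<^esub> e n y"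
  and e_mult: "x \<in> carrier (A n) ==> y \<in> carrier (A n) ==> e n (x \<otimes>\<^bsub>A n\<^esub> y) = e n x \<otimes>\<^bsub>D n\<^esub> e n y"
  and e_smult: "x \<in> carrier (A n) ==> e n (c \<odot>\<^bsub>A n\<^esub> x) = c \<odot>\<^bsub>D n\<^esub> e n x"
  and e_star: "x \<in> carrier (A n) ==> e n (star (A n) x) = star (D n) (e n x)"
  and e_one: "e n \<one>\<^bsub>A n\<^esub> = \<one>\<^bsub>D n\<^esub>"
  and e_norm: "x \<in> carrier (A n) ==> cnorm (D n) (e n x) \<le> cnorm (A n) x"
  and e_below: "x \<in> carrier (A n) ==> cnorm (A n) x \<le> cnorm (D (Suc n)) (e (Suc n) (\<alpha> n x))"
begin

abbreviation DQ where "DQ \<equiv> bounded_quot D"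

definition emb :: "(nat => 'a) set => (nat => 'b) set" where
 "emb X = Dl.cls (\<lambda>m. e m ((SOME x. x \<in> T \<and> X = cl x) m))"

lemma e_minus: "x \<in> carrier (A n) ==> y \<in> carrier (A n) ==> e n (x \<ominus>\<^bsub>A n\<^esub> y) = e n x \<ominus>\<^bsub>D n\<^esub> e n y"
 by (simp add: lev.minus_smult Dl.lev.minus_smult e_closed e_add e_smult)

lemma e_thread: assumes x: "x \<in> T" shows "(\<lambda>m. e m (x m)) \<in> bounded_seqs D"
proof -
 obtain C where C: "\<And>n. cnorm (A n) (x n) \<le> C" using thread_bounded[OF x] by blast
 show ?thesis
  by (rule Dl.bounded_seqsI[of _ C]) (auto intro: e_closed threadD(1)[OF x] order_trans[OF e_norm C])
qed

lemma emb_cl: assumes x: "x \<in> T" shows "emb (cl x) = Dl.cls (\<lambda>m. e m (x m))"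
proof -
 let ?y = "SOME y. y \<in> T \<and> cl x = cl y"
 have "?y \<in> T \<and> cl x = cl ?y" by (rule someI[of _ x]) (use x in simp)
 hence y: "?y \<in> T" and null: "(\<lambda>m. cdist (A m) (?y m) (x m)) \<longlonglongrightarrow> 0"
  using S.cls_eq_iff[of ?y x] x by auto
 have "(\<lambda>m. cdist (D m) (e m (?y m)) (e m (x m))) \<longlonglongrightarrow> 0"
 proof (rule null_seq_le[OF _ _ null])
  fix m
  have c: "?y m \<in> carrier (A m)" "x m \<in> carrier (A m)" using threadD(1) x y by auto
  show "0 \<le> cdist (D m) (e m (?y m)) (e m (x m))" using c by (intro Dl.lev.cnorm_nonneg Dl.lev.A.minus_closed e_closed)
  show "cdist (D m) (e m (?y m)) (e m (x m)) \<le> cdist (A m) (?y m) (x m)"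
   unfolding e_minus[OF c, symmetric] by (rule e_norm) (use c in simp)
 qed
 thus ?thesis unfolding emb_def using Dl.cls_eq_iff[OF e_thread[OF y] e_thread[OF x]] by simp
qed

lemma emb_closed: "X \<in> carrier QQ ==> emb X \<in> carrier DQ"
 by (elim S.carrier_QE) (simp add: emb_cl e_thread)

lemma emb_norm: assumes "X \<in> carrier QQ" shows "cnorm DQ (emb X) \<le> cnorm QQ X"
proof -
 obtain x where x: "x \<in> T" "X = cl x" using assms by (rule S.carrier_QE)
 have "seq_norm D (\<lambda>m. e m (x m)) \<le> seq_norm A x"
 proof (rule field_le_epsilon)
  fix r :: real assume r: "0 < r"
  have "\<forall>\<^sub>F m in sequentially. cnorm (D m) (e m (x m)) \<le> seq_norm A x + r"
   using S.seq_norm_eps[OF x(1) r]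
  proof eventually_elim
   case (elim m)
   thus ?case using e_norm[OF threadD(1)[OF x(1)], of m] by linarith
  qed
  thus "seq_norm D (\<lambda>m. e m (x m)) \<le> seq_norm A x + r"
   by (intro Dl.seq_norm_le) (use S.seq_norm_nonneg[OF x(1)] r in auto)
 qed
 thus ?thesis unfolding x(2) emb_cl[OF x(1)] S.Q_simps(8)[OF x(1)] Dl.Q_simps(8)[OF e_thread[OF x(1)]] .
qed

lemma emb_hom:
 assumes "X \<in> carrier QQ"
 shows "Y \<in> carrier QQ ==> emb (X \<oplus>\<^bsub>QQ\<^esub> Y) = emb X \<oplus>\<^bsub>DQ\<^esub> emb Y"
  "Y \<in> carrier QQ ==> emb (X \<otimes>\<^bsub>QQ\<^esub> Y) = emb X \<otimes>\<^bsub>DQ\<^esub> emb Y"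
  "emb (c \<odot>\<^bsub>QQ\<^esub> X) = c \<odot>\<^bsub>DQ\<^esub> emb X"
  "emb (star QQ X) = star DQ (emb X)"
proof -
 obtain x where x: "x \<in> T" "X = cl x" using assms by (rule S.carrier_QE)
 have xc: "x m \<in> carrier (A m)" for m by (rule threadD(1)[OF x(1)])
 show "emb (c \<odot>\<^bsub>QQ\<^esub> X) = c \<odot>\<^bsub>DQ\<^esub> emb X"
  unfolding x(2) S.Q_simps(6)[OF x(1)] emb_cl[OF x(1)] emb_cl[OF S.T_smult[OF x(1)]] Dl.Q_simps(6)[OF e_thread[OF x(1)]] e_smult[OF xc] ..
 show "emb (star QQ X) = star DQ (emb X)"
  unfolding x(2) S.Q_simps(7)[OF x(1)] emb_cl[OF x(1)] emb_cl[OF S.T_star[OF x(1)]] Dl.Q_simps(7)[OF e_thread[OF x(1)]] e_star[OF xc] ..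
 assume "Y \<in> carrier QQ"
 then obtain y where y: "y \<in> T" "Y = cl y" by (rule S.carrier_QE)
 have yc: "y m \<in> carrier (A m)" for m by (rule threadD(1)[OF y(1)])
 show "emb (X \<oplus>\<^bsub>QQ\<^esub> Y) = emb X \<oplus>\<^bsub>DQ\<^esub> emb Y"
  unfolding x(2) y(2) S.Q_simps(5)[OF x(1) y(1)] emb_cl[OF x(1)] emb_cl[OF y(1)] emb_cl[OF S.T_add[OF x(1) y(1)]]
   Dl.Q_simps(5)[OF e_thread[OF x(1)] e_thread[OF y(1)]] e_add[OF xc yc] ..
 show "emb (X \<otimes>\<^bsub>QQ\<^esub> Y) = emb X \<otimes>\<^bsub>DQ\<^esub> emb Y"
  unfolding x(2) y(2) S.Q_simps(4)[OF x(1) y(1)] emb_cl[OF x(1)] emb_cl[OF y(1)] emb_cl[OF S.T_mult[OF x(1) y(1)]]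
   Dl.Q_simps(4)[OF e_thread[OF x(1)] e_thread[OF y(1)]] e_mult[OF xc yc] ..
qed

lemma emb_one: "emb \<one>\<^bsub>QQ\<^esub> = \<one>\<^bsub>DQ\<^esub>"
 unfolding S.Q_simps(2) emb_cl[OF S.T_one] Dl.Q_simps(2) e_one ..

lemma emb_minus: "X \<in> carrier QQ ==> Y \<in> carrier QQ ==> emb (X \<ominus>\<^bsub>QQ\<^esub> Y) = emb X \<ominus>\<^bsub>DQ\<^esub> emb Y"
 by (simp add: Q.minus_smult Dl.DQ.minus_smult emb_closed emb_hom)

lemma emb_inj: "inj_on emb (carrier QQ)"
proof (rule inj_onI)
 fix X Y assume "X \<in> carrier QQ" "Y \<in> carrier QQ" and eq: "emb X = emb Y"
 then obtain x y where x: "x \<in> T" "X = cl x" and y: "y \<in> T" "Y = cl y" by (metis S.carrier_Q)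
 define z where "z = (\<lambda>m. x m \<ominus>\<^bsub>A m\<^esub> y m)"
 have zT: "z \<in> T" unfolding z_def by (rule S.T_minus[OF x(1) y(1)])
 have zc: "z m \<in> carrier (A m)" for m by (rule threadD(1)[OF zT])
 have null: "(\<lambda>m. cnorm (D m) (e m (z m))) \<longlonglongrightarrow> 0"
  using eq unfolding x(2) y(2) emb_cl[OF x(1)] emb_cl[OF y(1)] Dl.cls_eq_iff[OF e_thread[OF x(1)] e_thread[OF y(1)]]
  by (simp add: z_def e_minus[OF threadD(1)[OF x(1)] threadD(1)[OF y(1)]])
 have "(\<lambda>m. cnorm (A m) (z m)) \<longlonglongrightarrow> 0"
 proof (rule LIMSEQ_I)
  fix r :: real assume r: "0 < r"
  obtain N1 where N1: "\<And>n k. N1 \<le> n ==> cdist (A (n + k)) (z (n + k)) (conn n k (z n)) < r / 2"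
   using threadD(2)[OF zT half_gt_zero[OF r]] by blast
  obtain N2 where N2: "\<And>m. N2 \<le> m ==> cnorm (D m) (e m (z m)) < r / 2"
   using order_tendstoD(2)[OF null half_gt_zero[OF r]] by (auto simp: eventually_sequentially)
  have "norm (cnorm (A n) (z n) - 0) < r" if n: "max N1 N2 \<le> n" for n
  proof -
   have a: "\<alpha> n (z n) \<in> carrier (A (Suc n))" by (rule \<alpha>_closed[OF zc])
   have "cnorm (A n) (z n) \<le> cnorm (D (Suc n)) (e (Suc n) (\<alpha> n (z n)))" by (rule e_below[OF zc])
   also have "\<dots> \<le> cdist (D (Suc n)) (e (Suc n) (\<alpha> n (z n))) (e (Suc n) (z (Suc n))) + cnorm (D (Suc n)) (e (Suc n) (z (Suc n)))"
    by (rule Dl.lev.cnorm_le_dist[OF e_closed[OF a] e_closed[OF zc]])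
   also have "e (Suc n) (\<alpha> n (z n)) \<ominus>\<^bsub>D (Suc n)\<^esub> e (Suc n) (z (Suc n)) = e (Suc n) (\<alpha> n (z n) \<ominus>\<^bsub>A (Suc n)\<^esub> z (Suc n))"
    by (rule e_minus[OF a zc, symmetric])
   also have "cnorm (D (Suc n)) \<dots> \<le> cdist (A (Suc n)) (\<alpha> n (z n)) (z (Suc n))"
    by (rule e_norm) (use a zc in simp)
   also have "\<dots> = cdist (A (Suc n)) (z (Suc n)) (\<alpha> n (z n))" by (rule lev.cnorm_minus_commute[OF a zc])
   also have "\<dots> < r / 2" using N1[of n 1] n by simp
   also have "cnorm (D (Suc n)) (e (Suc n) (z (Suc n))) < r / 2" by (rule N2) (use n in simp)
   finally have "cnorm (A n) (z n) < r" by simp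
   thus ?thesis using lev.cnorm_nonneg[OF zc] by simp
  qed
  thus "\<exists>no. \<forall>n\<ge>no. norm (cnorm (A n) (z n) - 0) < r" by blast
 qed
 thus "X = Y" unfolding x(2) y(2) S.cls_eq_iff[OF x(1) y(1)] z_def .
qed

lemma emb_mono: "unital_star_mono QQ DQ emb"
 unfolding unital_star_mono_def unital_star_hom_def
 by (intro conjI ring_hom_memI ballI allI) (simp_all add: emb_inj emb_closed emb_hom emb_one)

lemma emb_pullback_state: "\<phi> \<in> states DQ ==> restrict (\<phi> \<circ> emb) (carrier QQ) \<in> states QQ"
 by (rule pullback_state[OF Dl.pos_cstar_Q S.pos_cstar_Q])
  (simp_all add: emb_closed emb_hom emb_one emb_norm)

end

section \<open>The algebra of a bridge\<close>

text \<open>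
 The second summand is the zero algebra: only the type asks for a pair of matrices.
\<close>

definition DD :: "(nat => nat) => nat => (complex mat \<times> complex mat) cstar" where
 "DD Nm m = cstar_sum (mat_cstar (Nm m)) (mat_cstar 0)"

abbreviation Z0 :: "complex mat" where "Z0 \<equiv> 0\<^sub>m 0 0"

lemma mat_0_unique: "X \<in> carrier_mat 0 0 ==> X = Z0"
 by (rule eq_matI) auto

lemma mat_0_iff: "X \<in> carrier_mat 0 0 \<longleftrightarrow> X = Z0"
 using mat_0_unique zero_carrier_mat by blast

lemma mat_op_norm_Z0: "mat_op_norm Z0 = 0"
proof -
 interpret pos_cstar "mat_cstar 0" by (rule pos_cstar_mat)
 show ?thesis using cnorm_zero by simp
qed

lemma incl_comp: assumes "s \<le> p" "p \<le> N" shows "incl N 0 p * incl p 0 s = incl N 0 s"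
 using assms by (subst mult_incl[of _ N p 0 s]) (auto simp: incl_def intro!: eq_matI)

lemma incl_id: "incl s 0 s = 1\<^sub>m s"
 by (auto simp: incl_def intro!: eq_matI)

locale corner =
 fixes Nm :: "nat => nat" and s n :: nat
 assumes Nm_pos: "0 < Nm m" and s_le: "Suc n \<le> m ==> s \<le> Nm m"
begin

lemma DD_carrier: "x \<in> carrier (DD Nm m) \<longleftrightarrow> fst x \<in> sqm (Nm m) \<and> snd x = Z0"
 by (cases x) (simp add: DD_def mat_0_iff del: carrier_matI)

lemma DD_ops:
 "(a, b) \<oplus>\<^bsub>DD Nm m\<^esub> (a', b') = (a + a', b + b')" "(a, b) \<otimes>\<^bsub>DD Nm m\<^esub> (a', b') = (a * a', b * b')"
 "c \<odot>\<^bsub>DD Nm m\<^esub> (a, b) = (c \<cdot>\<^sub>m a, c \<cdot>\<^sub>m b)" "star (DD Nm m) (a, b) = (mat_adjoint a, mat_adjoint b)"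
 "\<one>\<^bsub>DD Nm m\<^esub> = (1\<^sub>m (Nm m), 1\<^sub>m 0)" "\<zero>\<^bsub>DD Nm m\<^esub> = (0\<^sub>m (Nm m) (Nm m), Z0)"
 "cnorm (DD Nm m) (a, b) = max (mat_op_norm a) (mat_op_norm b)"
 by (simp_all add: DD_def)

lemma one_Z0: "1\<^sub>m 0 = Z0" by (rule mat_0_unique) simp

lemma Z0_ops: "Z0 + Z0 = Z0" "Z0 * Z0 = Z0" "c \<cdot>\<^sub>m Z0 = Z0" "mat_adjoint Z0 = Z0"
 by (rule mat_0_unique; simp)+

lemma DD_norm: "cnorm (DD Nm m) (a, Z0) = mat_op_norm a"
 by (simp add: DD_ops mat_op_norm_Z0 mat_op_norm_nonneg max_absorb1)

sublocale bounded_seq_algebra "DD Nm"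
proof (rule bounded_seq_algebra.intro)
 fix m
 show "pos_cstar (DD Nm m)" unfolding DD_def by (rule pos_cstar_sum[OF pos_cstar_mat pos_cstar_mat])
 show "\<one>\<^bsub>DD Nm m\<^esub> \<noteq> \<zero>\<^bsub>DD Nm m\<^esub>"
 proof
  assume "\<one>\<^bsub>DD Nm m\<^esub> = \<zero>\<^bsub>DD Nm m\<^esub>"
  hence "1\<^sub>m (Nm m) = (0\<^sub>m (Nm m) (Nm m) :: complex mat)" by (simp add: DD_ops)
  from arg_cong[OF this, of "\<lambda>M. M $$ (0,0)"] show False using Nm_pos[of m] by simp
 qed
qed

lemma cls_cong_eventually:
 assumes x: "x \<in> bounded_seqs (DD Nm)" and y: "y \<in> bounded_seqs (DD Nm)" and eq: "\<And>m. K \<le> m ==> x m = y m"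
 shows "cls x = cls y"
proof -
 have "\<forall>\<^sub>F m in sequentially. cdist (DD Nm m) (x m) (y m) = 0"
  unfolding eventually_sequentially
 proof (intro exI[of _ K] allI impI)
  fix m assume "K \<le> m"
  thus "cdist (DD Nm m) (x m) (y m) = 0"
   using eq T_carrier[OF y, of m] lev.A.r_neg[OF T_carrier[OF y], of m] by (simp add: lev.A.minus_eq)
 qed
 thus ?thesis unfolding cls_eq_iff[OF x y] by (rule tendsto_eventually)
qed

abbreviation W :: "nat => complex mat" where "W m \<equiv> incl (Nm m) 0 s"

definition cut_seq :: "complex mat => nat => complex mat \<times> complex mat" where
 "cut_seq Y m = (if Suc n \<le> m then (W m * Y * mat_adjoint (W m), Z0) else \<zero>\<^bsub>DD Nm m\<^esub>)"

text \<open>The image of a corner matrix.  Levels up to \<open>n\<close> are irrelevant for the class and are set to zero.\<close>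

definition cut :: "complex mat => (nat => complex mat \<times> complex mat) set" where
 "cut Y = cls (cut_seq Y)"

abbreviation om where "om \<equiv> cut (1\<^sub>m s)"

lemma W_adj [simp]: "mat_adjoint (W m) \<in> carrier_mat s (Nm m)"
 by (rule mat_adjoint_carrier) simp

lemma W_isometry: "Suc n \<le> m ==> mat_adjoint (W m) * W m = 1\<^sub>m s"
 using incl_isometry[of 0 s "Nm m"] s_le[of m] by simp

lemma WYW [simp]: "Y \<in> sqm s ==> W m * Y * mat_adjoint (W m) \<in> sqm (Nm m)"
 using mult_carrier_mat[OF mult_carrier_mat[OF incl_carrier] W_adj] by blast

lemma cut_seq_bounded:
 assumes Y: "Y \<in> sqm s" shows "cut_seq Y \<in> bounded_seqs (DD Nm)"
proof (rule bounded_seqsI[of _ "mat_op_norm Y"])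
 fix m
 show "cut_seq Y m \<in> carrier (DD Nm m)" using Y by (simp add: cut_seq_def DD_carrier DD_ops)
 show "cnorm (DD Nm m) (cut_seq Y m) \<le> mat_op_norm Y"
 proof (cases "Suc n \<le> m")
  case True
  have W1: "mat_op_norm (W m) \<le> 1" using incl_norm[of 0 s "Nm m"] s_le[OF True] by simp
  have WY: "W m * Y \<in> carrier_mat (Nm m) s" using mult_carrier_mat[OF incl_carrier Y] .
  have "mat_op_norm (W m * Y * mat_adjoint (W m)) \<le> mat_op_norm (W m * Y) * mat_op_norm (mat_adjoint (W m))"
   by (rule mat_op_norm_mult[OF WY W_adj])
  also have "\<dots> \<le> mat_op_norm (W m * Y)"
   using W1 mat_op_norm_adjoint[OF incl_carrier[of "Nm m" 0 s]] mult_left_le[of "mat_op_norm (W m)" "mat_op_norm (W m * Y)"] by (simp add: mat_op_norm_nonneg)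
  also have "\<dots> \<le> mat_op_norm (W m) * mat_op_norm Y" by (rule mat_op_norm_mult[OF incl_carrier Y])
  also have "\<dots> \<le> mat_op_norm Y" using mult_right_mono[OF W1 mat_op_norm_nonneg[of Y]] by simp
  finally show ?thesis using True by (simp add: cut_seq_def DD_norm)
 qed (simp add: cut_seq_def mat_op_norm_nonneg)
qed

lemma cut_closed: "Y \<in> sqm s ==> cut Y \<in> carrier DQ"
 unfolding cut_def by (rule cls_carrier[OF cut_seq_bounded])

lemma om_closed [simp]: "om \<in> carrier DQ" by (rule cut_closed) simp

lemma mult_om:
 assumes x: "x \<in> bounded_seqs (DD Nm)" and Y: "Y \<in> sqm s"
  and eq: "\<And>m. Suc n \<le> m ==> fst (x m) * W m = W m * Y"
 shows "cls x \<otimes>\<^bsub>DQ\<^esub> om = cut Y"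
 unfolding cut_def Q_simps(4)[OF x cut_seq_bounded[OF one_carrier_mat]]
proof (rule cls_cong_eventually[OF T_mult[OF x cut_seq_bounded[OF one_carrier_mat]] cut_seq_bounded[OF Y]])
 fix m assume m: "Suc n \<le> m"
 obtain X where X: "x m = (X, Z0)" "X \<in> sqm (Nm m)" using T_carrier[OF x, of m] unfolding DD_carrier by (cases "x m") auto
 have "X * (W m * 1\<^sub>m s * mat_adjoint (W m)) = X * W m * mat_adjoint (W m)"
  unfolding right_mult_one_mat[OF incl_carrier] using assoc_mult_mat[OF X(2) incl_carrier W_adj] by simp
 also have "X * W m = W m * Y" using eq[OF m] X by simp
 finally show "x m \<otimes>\<^bsub>DD Nm m\<^esub> cut_seq (1\<^sub>m s) m = cut_seq Y m"
  using m by (simp add: cut_seq_def X(1) DD_ops Z0_ops)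
qed

lemma om_mult:
 assumes x: "x \<in> bounded_seqs (DD Nm)" and Y: "Y \<in> sqm s"
  and eq: "\<And>m. Suc n \<le> m ==> mat_adjoint (W m) * fst (x m) = Y * mat_adjoint (W m)"
 shows "om \<otimes>\<^bsub>DQ\<^esub> cls x = cut Y"
 unfolding cut_def Q_simps(4)[OF cut_seq_bounded[OF one_carrier_mat] x]
proof (rule cls_cong_eventually[OF T_mult[OF cut_seq_bounded[OF one_carrier_mat] x] cut_seq_bounded[OF Y]])
 fix m assume m: "Suc n \<le> m"
 obtain X where X: "x m = (X, Z0)" "X \<in> sqm (Nm m)" using T_carrier[OF x, of m] unfolding DD_carrier by (cases "x m") auto
 have "W m * 1\<^sub>m s * mat_adjoint (W m) * X = W m * (mat_adjoint (W m) * X)"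
  unfolding right_mult_one_mat[OF incl_carrier] by (rule assoc_mult_mat[OF incl_carrier W_adj X(2)])
 also have "mat_adjoint (W m) * X = Y * mat_adjoint (W m)" using eq[OF m] X by simp
 also have "W m * (Y * mat_adjoint (W m)) = W m * Y * mat_adjoint (W m)"
  by (rule assoc_mult_mat[OF incl_carrier Y W_adj, symmetric])
 finally show "cut_seq (1\<^sub>m s) m \<otimes>\<^bsub>DD Nm m\<^esub> x m = cut_seq Y m"
  using m by (simp add: cut_seq_def X(1) DD_ops Z0_ops)
qed

lemma cut_W:
 assumes Y: "Y \<in> sqm s" and m: "Suc n \<le> m"
 shows "fst (cut_seq Y m) * W m = W m * Y"
proof -
 have WY: "W m * Y \<in> carrier_mat (Nm m) s" using mult_carrier_mat[OF incl_carrier Y] .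
 have "W m * Y * mat_adjoint (W m) * W m = W m * Y"
  unfolding assoc_mult_mat[OF WY W_adj incl_carrier] W_isometry[OF m] by (rule right_mult_one_mat[OF WY])
 thus ?thesis using m by (simp add: cut_seq_def)
qed

lemma om_idem: "om \<otimes>\<^bsub>DQ\<^esub> om = om"
 using mult_om[OF cut_seq_bounded[OF one_carrier_mat] one_carrier_mat cut_W[OF one_carrier_mat]] unfolding cut_def[symmetric] .

lemma om_star: "star DQ om = om"
 unfolding cut_def Q_simps(7)[OF cut_seq_bounded[OF one_carrier_mat]]
proof (rule arg_cong[of _ _ cls], rule ext)
 fix m
 have "mat_adjoint (W m * mat_adjoint (W m)) = W m * mat_adjoint (W m)"
  using mat_adjoint_mult[OF incl_carrier[of "Nm m" 0 s] W_adj[of m]] by (simp add: mat_adjoint_adjoint)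
 thus "star (DD Nm m) (cut_seq (1\<^sub>m s) m) = cut_seq (1\<^sub>m s) m"
  using right_mult_one_mat[OF incl_carrier, of "Nm m" 0 s] lev.star_zero[of m] by (simp add: cut_seq_def DD_ops Z0_ops)
qed

lemma om_norm: "cnorm DQ om \<le> 1"
proof -
 have "(cnorm DQ om)\<^sup>2 = cnorm DQ om" using DQ.cstar_identity[OF om_closed] by (simp add: om_star om_idem)
 thus ?thesis by (auto simp: power2_eq_square)
qed

lemma cmp_state:
 assumes \<eta>: "\<eta> \<in> states (mat_cstar s)" and m: "Suc n \<le> m"
 shows "restrict (\<eta> \<circ> (\<lambda>X. cmp 0 s (fst X))) (carrier (DD Nm m)) \<in> states (DD Nm m)"
proof (rule pullback_state[OF pos_cstar_mat D _ _ _ _ _ _ \<eta>])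
 have le: "0 + s \<le> Nm m" using s_le[OF m] by simp
 fix x assume x: "x \<in> carrier (DD Nm m)"
 then obtain X where X: "x = (X, Z0)" "X \<in> sqm (Nm m)" unfolding DD_carrier by (cases x) auto
 show "cmp 0 s (fst x) \<in> carrier (mat_cstar s)" by simp
 show "cmp 0 s (fst (c \<odot>\<^bsub>DD Nm m\<^esub> x)) = c \<odot>\<^bsub>mat_cstar s\<^esub> cmp 0 s (fst x)" for c
  using cmp_smult[OF X(2) le] by (simp add: X(1) DD_ops)
 show "cmp 0 s (fst (star (DD Nm m) x)) = star (mat_cstar s) (cmp 0 s (fst x))"
  using cmp_adjoint[OF X(2) le] by (simp add: X(1) DD_ops)
 show "cnorm (mat_cstar s) (cmp 0 s (fst x)) \<le> cnorm (DD Nm m) x"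
  using cmp_norm[OF X(2) le] by (simp add: X(1) DD_norm)
 fix y assume y: "y \<in> carrier (DD Nm m)"
 then obtain Y where Y: "y = (Y, Z0)" "Y \<in> sqm (Nm m)" unfolding DD_carrier by (cases y) auto
 show "cmp 0 s (fst (x \<oplus>\<^bsub>DD Nm m\<^esub> y)) = cmp 0 s (fst x) \<oplus>\<^bsub>mat_cstar s\<^esub> cmp 0 s (fst y)"
  using cmp_add[OF X(2) Y(2) le] by (simp add: X(1) Y(1) DD_ops)
next
 show "cmp 0 s (fst \<one>\<^bsub>DD Nm m\<^esub>) = \<one>\<^bsub>mat_cstar s\<^esub>"
  using s_le[OF m] by (auto simp: DD_ops cmp_def intro!: eq_matI)
qed

text \<open>
 A state of the corner algebra gives a state of the bridge algebra that sees only the corner, and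
 hence takes the value one at the projection \<open>om\<close>.
\<close>

lemma corner_state:
 assumes \<eta>: "\<eta> \<in> states (mat_cstar s)"
 shows "\<exists>\<phi>\<in>one_level_states DQ om. \<forall>x\<in>bounded_seqs (DD Nm). \<forall>Y.
  (\<forall>m\<ge>Suc n. cmp 0 s (fst (x m)) = Y) \<longrightarrow> \<phi> (cls x) = \<eta> Y"
proof -
 let ?\<zeta> = "\<lambda>m. restrict (\<eta> \<circ> (\<lambda>X. cmp 0 s (fst X))) (carrier (DD Nm m))"
 obtain \<phi> where \<phi>: "\<phi> \<in> states DQ"
  and val: "\<And>x c. x \<in> bounded_seqs (DD Nm) ==> (\<forall>m\<ge>Suc n. ?\<zeta> m (x m) = c) ==> \<phi> (cls x) = c"
  using limit_state[of "Suc n" ?\<zeta>, OF cmp_state[OF \<eta>]] by blast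
 have val': "\<phi> (cls x) = \<eta> Y" if "x \<in> bounded_seqs (DD Nm)" "\<forall>m\<ge>Suc n. cmp 0 s (fst (x m)) = Y" for x Y
  by (rule val[OF that(1)]) (use that T_carrier[OF that(1)] in simp)
 interpret M: pos_cstar "mat_cstar s" by (rule pos_cstar_mat)
 have "\<phi> om = \<eta> (1\<^sub>m s)"
  unfolding cut_def
 proof (rule val'[OF cut_seq_bounded[OF one_carrier_mat]], intro allI impI)
  fix m assume m: "Suc n \<le> m"
  have c: "fst (cut_seq (1\<^sub>m s) m) \<in> sqm (Nm m)"
   using T_carrier[OF cut_seq_bounded[OF one_carrier_mat], of m] by (simp add: DD_carrier)
  show "cmp 0 s (fst (cut_seq (1\<^sub>m s) m)) = 1\<^sub>m s"
   using s_le[OF m] W_isometry[OF m] cut_W[OF one_carrier_mat m] assoc_mult_mat[OF W_adj c incl_carrier]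
    right_mult_one_mat[OF incl_carrier, of "Nm m" 0 s]
   by (simp add: cmp_eq[OF c])
 qed
 also have "\<dots> = 1" using M.states_D(4)[OF \<eta>] by simp
 finally have "\<phi> (\<one>\<^bsub>DQ\<^esub> \<ominus>\<^bsub>DQ\<^esub> om) = 0"
  using DQ.states_minus[OF \<phi> DQ.A.one_closed om_closed] DQ.states_D(4)[OF \<phi>] by simp
 hence "\<phi> \<in> one_level_states DQ om" using \<phi> by (simp add: one_level_states_def om_star om_idem)
 thus ?thesis using val' by blast
qed

end

context cf_data
begin

lemma q_mono: "m \<le> m' ==> q m \<le> q m'"
proof (rule lift_Suc_mono_le[of q])
 fix m
 have "q m \<le> r (Suc m) * q m" using r_pos[of m] by simp
 thus "q m \<le> q (Suc m)" unfolding q_Suc by linarith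
qed

lemma al_carrier: "x \<in> carrier (AA m) ==> fst (al m x) \<in> sqm (q (Suc m))"
 using \<alpha>_closed[of x m] unfolding AA_carrier by blast

text \<open>The summands of level \<open>m\<close> sit as diagonal blocks in the first summand of level \<open>m + 1\<close>.\<close>

definition sl :: "nat => complex mat => complex mat \<times> complex mat" where
 "sl m Y = (cmp 0 (q m) Y, cmp (r (Suc m) * q m) (qp m) Y)"

lemma sl_al: assumes x: "x \<in> carrier (AA m)" shows "sl m (fst (al m x)) = x"
proof -
 interpret B: blocks "r (Suc m)" "q m" "qp m" "q (Suc m)" by (rule blocks_n)
 obtain a b where ab: "x = (a,b)" "a \<in> sqm (q m)" "b \<in> sqm (qp m)" using x by (rule AA_E)
 show ?thesis using B.cmp_blk(1)[OF ab(2,3) r_pos] B.cmp_blk(2)[OF ab(2,3)] by (simp add: sl_def ab(1) al_def)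
qed

lemma sl_le: "0 + q m \<le> q (Suc m)" "r (Suc m) * q m + qp m \<le> q (Suc m)"
 using q_mono[of m "Suc m"] by (simp_all add: q_Suc)

lemma sl_carrier: "sl m Y \<in> carrier (AA m)"
 by (simp add: sl_def AA_carrier)

lemma sl_norm:
 assumes "Y \<in> sqm (q (Suc m))"
 shows "cnorm (AA m) (sl m Y) \<le> mat_op_norm Y"
 using cmp_norm[OF assms sl_le(1)] cmp_norm[OF assms sl_le(2)] by (simp add: sl_def AA_ops)

lemma al_norm_fst: "x \<in> carrier (AA m) ==> cnorm (AA m) x \<le> mat_op_norm (fst (al m x))"
 using sl_norm[OF al_carrier] sl_al by metis

lemma sl_state:
 assumes \<psi>: "\<psi> \<in> states QQ"
 shows "restrict (\<psi> \<circ> (\<lambda>Y. can m (sl m Y))) (carrier (mat_cstar (q (Suc m)))) \<in> states (mat_cstar (q (Suc m)))"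
proof (rule pullback_state[OF S.pos_cstar_Q pos_cstar_mat _ _ _ _ _ _ \<psi>])
 fix Y assume "Y \<in> carrier (mat_cstar (q (Suc m)))"
 hence Y: "Y \<in> sqm (q (Suc m))" by simp
 show "can m (sl m Y) \<in> carrier QQ" by (rule can_closed[OF sl_carrier])
 show "can m (sl m (c \<odot>\<^bsub>mat_cstar (q (Suc m))\<^esub> Y)) = c \<odot>\<^bsub>QQ\<^esub> can m (sl m Y)" for c
  unfolding can_hom(3)[OF sl_carrier sl_carrier[of m Y], symmetric]
  using cmp_smult[OF Y sl_le(1)] cmp_smult[OF Y sl_le(2)] by (simp add: sl_def AA_ops)
 show "can m (sl m (star (mat_cstar (q (Suc m))) Y)) = star QQ (can m (sl m Y))"
  unfolding can_hom(4)[OF sl_carrier sl_carrier[of m Y], symmetric]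
  using cmp_adjoint[OF Y sl_le(1)] cmp_adjoint[OF Y sl_le(2)] by (simp add: sl_def AA_ops)
 show "cnorm QQ (can m (sl m Y)) \<le> cnorm (mat_cstar (q (Suc m))) Y"
  unfolding can_norm[OF sl_carrier] using sl_norm[OF Y] by simp
 fix Z assume "Z \<in> carrier (mat_cstar (q (Suc m)))"
 hence Z: "Z \<in> sqm (q (Suc m))" by simp
 show "can m (sl m (Y \<oplus>\<^bsub>mat_cstar (q (Suc m))\<^esub> Z)) = can m (sl m Y) \<oplus>\<^bsub>QQ\<^esub> can m (sl m Z)"
  unfolding can_hom(1)[OF sl_carrier sl_carrier, symmetric]
  using cmp_add[OF Y Z sl_le(1)] cmp_add[OF Y Z sl_le(2)] by (simp add: sl_def AA_ops)
next
 have "sl m (1\<^sub>m (q (Suc m))) = \<one>\<^bsub>AA m\<^esub>"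
  using sl_le[of m] by (auto simp: sl_def AA_ops cmp_def intro!: eq_matI)
 thus "can m (sl m \<one>\<^bsub>mat_cstar (q (Suc m))\<^esub>) = \<one>\<^bsub>QQ\<^esub>" using can_one[of m] by simp
qed

end

text \<open>
 One side of a bridge: the algebra of a continued fraction, mapped into matrices of size
 \<open>Nm m\<close> by repeating the first summand of level \<open>m\<close>.
\<close>

locale bridge_side = cf_data r q f + C: corner Nm s n
 for r q :: "nat => nat" and f :: "nat => real" and Nm :: "nat => nat" and s n :: nat +
 fixes M :: "nat => nat"
 assumes Nm: "Nm m = M m * q m" and s: "s = q (Suc n)"
begin

definition e :: "nat => complex mat \<times> complex mat => complex mat \<times> complex mat" where
 "e m x = (blk (M m) (fst x) Z0, Z0)"

lemma M_pos: "0 < M m"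
 using C.Nm_pos[of m] unfolding Nm by simp

lemma blocks_M: "blocks (M m) (q m) 0 (Nm m)"
 by (rule blocks.intro) (simp add: Nm)

lemma M_le: "0 + q m \<le> Nm m"
 using M_pos[of m] by (simp add: Nm)

sublocale E: tower_embedding AA al FF "DD Nm" e
proof (rule tower_embedding.intro[OF ind_tower_axioms C.bounded_seq_algebra_axioms tower_embedding_axioms.intro])
 fix m
 interpret B: blocks "M m" "q m" 0 "Nm m" by (rule blocks_M)
 have z: "Z0 \<in> carrier_mat 0 0" by simp
 show "e m \<one>\<^bsub>AA m\<^esub> = \<one>\<^bsub>DD Nm m\<^esub>" using B.blk_one by (simp add: e_def AA_ops C.DD_ops C.one_Z0)
 fix x assume x: "x \<in> carrier (AA m)"
 then obtain a b where ab: "x = (a,b)" "a \<in> sqm (q m)" "b \<in> sqm (qp m)" by (rule AA_E)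
 show "e m x \<in> carrier (DD Nm m)" using B.blk_N[OF ab(2) z] by (simp add: e_def C.DD_carrier ab(1))
 show "e m (c \<odot>\<^bsub>AA m\<^esub> x) = c \<odot>\<^bsub>DD Nm m\<^esub> e m x" for c
  using B.blk_smult[OF ab(2) z] by (simp add: e_def ab(1) AA_ops C.DD_ops C.Z0_ops)
 show "e m (star (AA m) x) = star (DD Nm m) (e m x)"
  using B.blk_adjoint[OF ab(2) z] by (simp add: e_def ab(1) AA_ops C.DD_ops C.Z0_ops)
 show "cnorm (DD Nm m) (e m x) \<le> cnorm (AA m) x"
  using B.blk_norm[OF ab(2) z] mat_op_norm_nonneg[of a] by (simp add: e_def ab(1) AA_ops C.DD_norm mat_op_norm_Z0)
 show "cnorm (AA m) x \<le> cnorm (DD Nm (Suc m)) (e (Suc m) (al m x))"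
 proof -
  interpret B': blocks "M (Suc m)" "q (Suc m)" 0 "Nm (Suc m)" by (rule blocks_M)
  have Y: "fst (al m x) \<in> sqm (q (Suc m))" by (rule al_carrier[OF x])
  have "mat_op_norm (fst (al m x)) \<le> mat_op_norm (blk (M (Suc m)) (fst (al m x)) Z0)"
   using cmp_norm[OF B'.blk_N[OF Y z] M_le] B'.cmp_blk(1)[OF Y z M_pos] by simp
  thus ?thesis using al_norm_fst[OF x] by (simp add: e_def C.DD_norm)
 qed
 fix y assume "y \<in> carrier (AA m)"
 then obtain a' b' where y: "y = (a',b')" "a' \<in> sqm (q m)" "b' \<in> sqm (qp m)" by (rule AA_E)
 show "e m (x \<oplus>\<^bsub>AA m\<^esub> y) = e m x \<oplus>\<^bsub>DD Nm m\<^esub> e m y"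
  using B.blk_add[OF ab(2) z y(2) z] by (simp add: e_def ab(1) y(1) AA_ops C.DD_ops C.Z0_ops)
 show "e m (x \<otimes>\<^bsub>AA m\<^esub> y) = e m x \<otimes>\<^bsub>DD Nm m\<^esub> e m y"
  using B.blk_mult[OF ab(2) z y(2) z] by (simp add: e_def ab(1) y(1) AA_ops C.DD_ops C.Z0_ops)
qed

text \<open>
 An element \<open>x\<close> of level \<open>n\<close> enters every later level with the matrix \<open>fst (al n x)\<close> of size
 \<open>s\<close> in the upper left corner, and is block diagonal there.
\<close>

lemma lead_conn:
 assumes x: "x \<in> carrier (AA n)"
 shows "fst (conn n (Suc j) x) * incl (q (n + Suc j)) 0 s = incl (q (n + Suc j)) 0 s * fst (al n x)"
proof (induction j)
 case 0
 have "fst (al n x) \<in> sqm s" using al_carrier[OF x] by (simp add: s)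
 thus ?case by (simp add: s[symmetric] incl_id)
next
 case (Suc j)
 define m where "m = n + Suc j"
 let ?Y = "fst (al n x)" and ?I = "incl (q m) 0 s" and ?V = "incl (q (Suc m)) 0 (q m)"
 interpret B: blocks "r (Suc m)" "q m" "qp m" "q (Suc m)" by (rule blocks_n)
 obtain X b where X: "conn n (Suc j) x = (X,b)" "X \<in> sqm (q m)" "b \<in> sqm (qp m)"
  using conn_closed[OF x, of "Suc j"] unfolding m_def by (rule AA_E)
 have Y: "?Y \<in> sqm s" using al_carrier[OF x] by (simp add: s)
 have IH: "X * ?I = ?I * ?Y" using Suc X(1) by (simp add: m_def)
 have V0: "blk (r (Suc m)) X b * ?V = ?V * X" using B.col_V[OF X(2,3) r_pos] by simp
 have comp: "incl (q (Suc m)) 0 s = ?V * ?I"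
  using incl_comp[of s "q m" "q (Suc m)"] q_mono[of "Suc n" m] q_mono[of m "Suc m"] by (simp add: s m_def)
 have "blk (r (Suc m)) X b * (?V * ?I) = blk (r (Suc m)) X b * ?V * ?I"
  by (rule assoc_mult_mat[OF B.blk_N[OF X(2,3)] incl_carrier incl_carrier, symmetric])
 also have "\<dots> = ?V * (X * ?I)" unfolding V0 by (rule assoc_mult_mat[OF incl_carrier X(2) incl_carrier])
 also have "\<dots> = ?V * ?I * ?Y" unfolding IH by (rule assoc_mult_mat[OF incl_carrier incl_carrier Y, symmetric])
 finally have "blk (r (Suc m)) X b * incl (q (Suc m)) 0 s = incl (q (Suc m)) 0 s * ?Y" unfolding comp .
 moreover have "fst (conn n (Suc (Suc j)) x) = blk (r (Suc m)) X b"
  unfolding ind_conn.simps(2)[of al n "Suc j"] X(1) m_def[symmetric] by (simp add: al_def)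
 moreover have "n + Suc (Suc j) = Suc m" by (simp add: m_def)
 ultimately show ?case by (simp only:)
qed

lemma e_W:
 assumes x: "x \<in> carrier (AA n)" and m: "Suc n \<le> m"
 shows "fst (e m (const_thread n x m)) * C.W m = C.W m * fst (al n x)"
proof -
 obtain j where j: "m = n + Suc j" using m less_iff_Suc_add[of n m] by auto
 interpret B: blocks "M m" "q m" 0 "Nm m" by (rule blocks_M)
 have z: "Z0 \<in> carrier_mat 0 0" by simp
 let ?X = "fst (conn n (Suc j) x)" and ?Y = "fst (al n x)" and ?I = "incl (q m) 0 s" and ?V = "incl (Nm m) 0 (q m)"
 have X: "?X \<in> sqm (q m)" using conn_closed[OF x, of "Suc j"] unfolding AA_carrier j by blast
 have Y: "?Y \<in> sqm s" using al_carrier[OF x] by (simp add: s)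
 have V0: "blk (M m) ?X Z0 * ?V = ?V * ?X" using B.col_V[OF X z M_pos] by simp
 have comp: "C.W m = ?V * ?I" using incl_comp[of s "q m" "Nm m"] q_mono[OF m] M_le[of m] by (simp add: s)
 have "blk (M m) ?X Z0 * (?V * ?I) = blk (M m) ?X Z0 * ?V * ?I"
  by (rule assoc_mult_mat[OF B.blk_N[OF X z] incl_carrier incl_carrier, symmetric])
 also have "\<dots> = ?V * (?X * ?I)" unfolding V0 by (rule assoc_mult_mat[OF incl_carrier X incl_carrier])
 also have "\<dots> = ?V * ?I * ?Y" unfolding lead_conn[OF x, of j, folded j] by (rule assoc_mult_mat[OF incl_carrier incl_carrier Y, symmetric])
 finally have "blk (M m) ?X Z0 * C.W m = C.W m * ?Y" unfolding comp .
 moreover have "const_thread n x m = conn n (Suc j) x" unfolding j by (rule const_thread_add)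
 ultimately show ?thesis by (simp only: e_def fst_conv)
qed

lemma e_carrier: "x \<in> carrier (AA n) ==> fst (e m (const_thread n x m)) \<in> sqm (Nm m)"
 using E.e_closed[OF threadD(1)[OF const_thread_T], of x n m] unfolding C.DD_carrier by blast

lemma e_W_adjoint:
 assumes x: "x \<in> carrier (AA n)" and m: "Suc n \<le> m"
 shows "mat_adjoint (C.W m) * fst (e m (const_thread n x m)) = fst (al n x) * mat_adjoint (C.W m)"
proof -
 let ?G = "fst (e m (const_thread n x m))" and ?Y = "fst (al n x)"
 obtain j where j: "m = n + j" using m le_iff_add[of n m] by auto
 have x': "star (AA n) x \<in> carrier (AA n)" using x by (simp add: lev.star_closed)
 have G: "?G \<in> sqm (Nm m)" by (rule e_carrier[OF x])
 have Y: "?Y \<in> sqm s" using al_carrier[OF x] by (simp add: s)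
 have fst_star: "fst (star (DD Nm i) u) = mat_adjoint (fst u)" for u i by (cases u) (simp add: C.DD_ops)
 have fst_star': "fst (star (AA i) u) = mat_adjoint (fst u)" for u i by (cases u) (simp add: AA_ops)
 have "fst (e m (const_thread n (star (AA n) x) m)) = mat_adjoint ?G"
  unfolding j const_thread_add conn_hom(4)[OF x] E.e_star[OF conn_closed[OF x]] fst_star ..
 moreover have "fst (al n (star (AA n) x)) = mat_adjoint ?Y" unfolding \<alpha>_star[OF x] fst_star' ..
 ultimately have "mat_adjoint ?G * C.W m = C.W m * mat_adjoint ?Y" using e_W[OF x' m] by simp
 hence "mat_adjoint (mat_adjoint ?G * C.W m) = mat_adjoint (C.W m * mat_adjoint ?Y)" by simp
 thus ?thesis
  unfolding mat_adjoint_mult[OF mat_adjoint_carrier[OF G] incl_carrier] mat_adjoint_mult[OF incl_carrier mat_adjoint_carrier[OF Y]]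
   mat_adjoint_adjoint .
qed

lemma emb_can: "x \<in> carrier (AA n) ==> E.emb (can n x) = C.cls (\<lambda>m. e m (const_thread n x m))"
 unfolding can_def by (rule E.emb_cl[OF const_thread_T])

lemma emb_can_om:
 assumes x: "x \<in> carrier (AA n)"
 shows "E.emb (can n x) \<otimes>\<^bsub>bounded_quot (DD Nm)\<^esub> C.om = C.cut (fst (al n x))"
  "C.om \<otimes>\<^bsub>bounded_quot (DD Nm)\<^esub> E.emb (can n x) = C.cut (fst (al n x))"
proof -
 have Y: "fst (al n x) \<in> sqm s" using al_carrier[OF x] by (simp add: s)
 show "E.emb (can n x) \<otimes>\<^bsub>bounded_quot (DD Nm)\<^esub> C.om = C.cut (fst (al n x))"
  unfolding emb_can[OF x] by (rule C.mult_om[OF E.e_thread[OF const_thread_T[OF x]] Y e_W[OF x]])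
 show "C.om \<otimes>\<^bsub>bounded_quot (DD Nm)\<^esub> E.emb (can n x) = C.cut (fst (al n x))"
  unfolding emb_can[OF x] by (rule C.om_mult[OF E.e_thread[OF const_thread_T[OF x]] Y e_W_adjoint[OF x]])
qed

text \<open>The state of the corner is \<open>\<psi>\<close> applied to the two diagonal blocks that form an element of level \<open>n\<close>.\<close>

lemma one_level_extension:
 assumes \<psi>: "\<psi> \<in> states QQ"
 shows "\<exists>\<phi>\<in>one_level_states (bounded_quot (DD Nm)) C.om. \<forall>b\<in>can n ` carrier (AA n). \<phi> (E.emb b) = \<psi> b"
proof -
 let ?\<eta> = "restrict (\<psi> \<circ> (\<lambda>Y. can n (sl n Y))) (carrier (mat_cstar s))"
 have "?\<eta> \<in> states (mat_cstar s)" unfolding s by (rule sl_state[OF \<psi>])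
 from C.corner_state[OF this] obtain \<phi> where \<phi>: "\<phi> \<in> one_level_states (bounded_quot (DD Nm)) C.om"
  and val: "\<And>x Y. x \<in> bounded_seqs (DD Nm) ==> \<forall>m\<ge>Suc n. cmp 0 s (fst (x m)) = Y ==> \<phi> (C.cls x) = ?\<eta> Y" by blast
 have "\<phi> (E.emb (can n x)) = \<psi> (can n x)" if x: "x \<in> carrier (AA n)" for x
 proof -
  have Y: "fst (al n x) \<in> sqm s" using al_carrier[OF x] by (simp add: s)
  have "\<phi> (E.emb (can n x)) = ?\<eta> (fst (al n x))"
   unfolding emb_can[OF x]
  proof (rule val[OF E.e_thread[OF const_thread_T[OF x]]], intro allI impI)
   fix m assume m: "Suc n \<le> m"
   have "cmp 0 s (fst (e m (const_thread n x m))) = mat_adjoint (C.W m) * fst (e m (const_thread n x m)) * C.W m"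
    using cmp_eq[OF e_carrier[OF x]] C.s_le[OF m] by simp
   also have "\<dots> = fst (al n x) * (mat_adjoint (C.W m) * C.W m)"
    unfolding e_W_adjoint[OF x m] by (rule assoc_mult_mat[OF Y C.W_adj incl_carrier])
   also have "\<dots> = fst (al n x)" unfolding C.W_isometry[OF m] by (rule right_mult_one_mat[OF Y])
   finally show "cmp 0 s (fst (e m (const_thread n x m))) = fst (al n x)" .
  qed
  also have "\<dots> = \<psi> (can n x)" using Y sl_al[OF x] by simp
  finally show ?thesis .
 qed
 with \<phi> show ?thesis by blast
qed

lemma one_level_nonempty: "one_level_states (bounded_quot (DD Nm)) C.om \<noteq> {}"
 using one_level_extension[of sig] tracial_state_sig unfolding tracial_state_def by blast

text \<open>A state and its one-level companion agree on level \<open>n\<close>, so they are at distance at most \<open>2 / dd k n\<close>.  The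
  other half of the Hausdorff distance vanishes since pullbacks are states.\<close>

lemma side_height:
 assumes k: "0 < k"
 shows "hausdorff_dist (mk_dist QQ (tower_lip QQ Ex (dd k))) (states QQ)
  (pullback_states QQ E.emb (one_level_states (bounded_quot (DD Nm)) C.om)) \<le> ennreal (2 / dd k n)"
proof -
 interpret T: af_tower QQ "\<lambda>n. can n ` carrier (AA n)" Ex "dd k" by (rule af_tower_AA[OF k])
 let ?P = "pullback_states QQ E.emb (one_level_states (bounded_quot (DD Nm)) C.om)"
 have P: "\<phi> \<in> states QQ" if "\<phi> \<in> ?P" for \<phi>
  using that E.emb_pullback_state unfolding pullback_states_def one_level_states_def by blast
 show ?thesis
  unfolding hausdorff_dist_def
 proof (intro max.boundedI SUP_least)
  fix \<psi> assume \<psi>: "\<psi> \<in> states QQ"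
  obtain \<phi> where \<phi>: "\<phi> \<in> one_level_states (bounded_quot (DD Nm)) C.om" "\<And>b. b \<in> can n ` carrier (AA n) ==> \<phi> (E.emb b) = \<psi> b"
   using one_level_extension[OF \<psi>] by blast
  let ?\<phi> = "restrict (\<phi> \<circ> E.emb) (carrier QQ)"
  have in_P: "?\<phi> \<in> ?P" unfolding pullback_states_def using \<phi>(1) by blast
  have "mk_dist QQ T.L \<psi> ?\<phi> \<le> ennreal (2 / dd k n)"
  proof (rule T.mk_dist_le[OF \<psi> P[OF in_P]])
   fix b assume b: "b \<in> can n ` carrier (AA n)"
   hence "b \<in> carrier QQ" using T.B_carrier by blast
   thus "\<psi> b = ?\<phi> b" using \<phi>(2)[OF b] by simp
  qed
  thus "(INF \<phi>\<in>?P. mk_dist QQ T.L \<psi> \<phi>) \<le> ennreal (2 / dd k n)" by (rule INF_lower2[OF in_P])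
 next
  fix \<phi> assume "\<phi> \<in> ?P"
  hence \<phi>: "\<phi> \<in> states QQ" by (rule P)
  show "(INF \<psi>\<in>states QQ. mk_dist QQ T.L \<psi> \<phi>) \<le> ennreal (2 / dd k n)"
   by (rule INF_lower2[OF \<phi>]) (rule T.mk_dist_le[OF \<phi> \<phi> refl])
 qed
qed

end

section \<open>The reach of the bridge\<close>

lemma (in pos_cstar) add_minus_add:
 assumes "c \<in> carrier A" "u \<in> carrier A" "v \<in> carrier A"
 shows "(c \<oplus> u) \<ominus> (c \<oplus> v) = u \<ominus> v"
proof -
 have "(c \<oplus> u) \<ominus> (c \<oplus> v) = c \<oplus> u \<oplus> (\<ominus> c \<oplus> \<ominus> v)" using assms by (simp add: A.minus_eq A.minus_add)
 also have "\<dots> = (c \<oplus> \<ominus> c) \<oplus> (u \<oplus> \<ominus> v)" using assms by (simp add: A.a_ac)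
 also have "\<dots> = u \<ominus> v" using assms by (simp add: A.r_neg A.minus_eq)
 finally show ?thesis .
qed

context cf_data
begin

lemma res_can:
 assumes y: "y \<in> carrier (AA (m + j))"
 shows "cdist QQ (can (m + j) y) (Ex m (can (m + j) y)) = cdist (AA (m + j)) y (conn m j (Fc m j y))"
proof -
 have F: "Fc m j y \<in> carrier (AA m)" by (rule Fc_closed[OF y])
 have c: "conn m j (Fc m j y) \<in> carrier (AA (m + j))" by (rule conn_closed[OF F])
 show ?thesis
  unfolding Ex_tower_can[OF y] can_conn[OF F, of j, symmetric] can_minus[OF y c, symmetric]
  by (rule can_norm) (use y c in simp)
qed

lemma dd_0: "dd k 0 = 1"
 by (simp add: AA_def cstar_dim_mat_sum q0)

lemma dd_pos: "0 < dd k m"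
 using dim_AA[of m] q_pos[of m] by simp

end

text \<open>
 Two continued fractions with the same digits up to \<open>n + 1\<close> have the same towers up to level \<open>n + 1\<close>.
 Their expectations between these levels differ, because the weights \<open>f\<close> depend on all digits.
\<close>

locale bridge_pair = A: bridge_side r q f Nm s n q' + B: bridge_side r' q' f' Nm s n q
 for r q f r' q' f' Nm s n +
 assumes agree: "j \<le> n ==> r (Suc j) = r' (Suc j)"
begin

lemma q_agree: "j \<le> Suc n ==> q j = q' j \<and> A.qp j = B.qp j"
proof (induction j)
 case (Suc j)
 thus ?case using A.q_Suc[of j] B.q_Suc[of j] agree[of j] by simp
qed (simp add: A.q0 B.q0)

lemma AA_agree: "j \<le> Suc n ==> A.AA j = B.AA j"
 unfolding A.AA_def B.AA_def using q_agree by simp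

lemma al_agree: "j \<le> n ==> A.al j = B.al j"
 unfolding A.al_def B.al_def using agree by simp

lemma conn_agree: "m + j \<le> Suc n ==> A.conn m j x = B.conn m j x"
 by (induction j) (simp_all add: al_agree)

lemma dd_agree: "j \<le> Suc n ==> A.dd k j = B.dd k j"
 by (simp add: AA_agree)

lemma FF_diff:
 assumes j: "j \<le> n" and x: "x \<in> carrier (A.AA (Suc j))"
 shows "cdist (A.AA j) (A.FF j x) (B.FF j x) \<le> 2 * real (r (Suc j)) * \<bar>f j - f' j\<bar> * cnorm (A.AA (Suc j)) x"
proof -
 obtain X Y where xy: "x = (X,Y)" "X \<in> sqm (q (Suc j))" "Y \<in> sqm (A.qp (Suc j))"
  using x by (rule A.AA_E)
 have Y: "Y \<in> sqm (q j)" using xy(3) by simp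
 let ?V = "avg (r (Suc j)) (q j) X" and ?c = "cmp (r (Suc j) * q j) (A.qp j) X" and ?d = "f j - f' j" and ?R = "real (r (Suc j))"
 let ?N = "cnorm (A.AA (Suc j)) x"
 have V: "?V \<in> sqm (q j)" by simp
 have FB: "B.FF j x = (cor (f' j) \<cdot>\<^sub>m ?V + cor (B.g j) \<cdot>\<^sub>m Y, ?c)"
  using q_agree[of j] j agree[OF j] by (simp add: B.FF_def xy(1))
 have FA: "A.FF j x = (cor (f j) \<cdot>\<^sub>m ?V + cor (A.g j) \<cdot>\<^sub>m Y, ?c)"
  by (simp add: A.FF_def xy(1))
 have c1: "A.FF j x \<in> carrier (A.AA j)" by (rule A.F_closed[OF x])
 have c2: "B.FF j x \<in> carrier (A.AA j)"
  using B.F_closed[of x j] x AA_agree[of j] AA_agree[of "Suc j"] j by simp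
 have gg: "A.g j - B.g j = - (?R * ?d)" using agree[OF j] by (simp add: A.g_def B.g_def algebra_simps)
 have "cor (f j) \<cdot>\<^sub>m ?V + cor (A.g j) \<cdot>\<^sub>m Y + (-1) \<cdot>\<^sub>m (cor (f' j) \<cdot>\<^sub>m ?V + cor (B.g j) \<cdot>\<^sub>m Y)
   = cor ?d \<cdot>\<^sub>m ?V + cor (A.g j - B.g j) \<cdot>\<^sub>m Y"
  using carrier_matD[OF V] carrier_matD[OF Y] by (intro eq_matI) (auto simp: algebra_simps)
 moreover have "?c + (-1) \<cdot>\<^sub>m ?c = 0\<^sub>m (A.qp j) (A.qp j)" by (intro eq_matI) (auto simp: cmp_def)
 ultimately have diff: "A.FF j x \<ominus>\<^bsub>A.AA j\<^esub> B.FF j x = (cor ?d \<cdot>\<^sub>m ?V + cor (- (?R * ?d)) \<cdot>\<^sub>m Y, 0\<^sub>m (A.qp j) (A.qp j))"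
  unfolding A.lev.minus_smult[OF c1 c2] unfolding FA FB A.AA_ops gg by simp
 have nX: "mat_op_norm X \<le> ?N" "mat_op_norm Y \<le> ?N" by (simp_all add: xy(1) A.AA_ops)
 have "mat_op_norm (cor ?d \<cdot>\<^sub>m ?V + cor (- (?R * ?d)) \<cdot>\<^sub>m Y)
   \<le> mat_op_norm (cor ?d \<cdot>\<^sub>m ?V) + mat_op_norm (cor (- (?R * ?d)) \<cdot>\<^sub>m Y)"
  by (rule mat_op_norm_triangle[OF smult_carrier_mat[OF V] smult_carrier_mat[OF Y]])
 also have "\<dots> = \<bar>?d\<bar> * mat_op_norm ?V + ?R * \<bar>?d\<bar> * mat_op_norm Y"
  unfolding mat_op_norm_smult[OF V] mat_op_norm_smult[OF Y] norm_of_real by (simp add: abs_mult)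
 also have "\<dots> \<le> \<bar>?d\<bar> * (?R * ?N) + ?R * \<bar>?d\<bar> * ?N"
 proof (intro add_mono mult_left_mono)
  have "mat_op_norm ?V \<le> ?R * mat_op_norm X" by (rule avg_norm[OF xy(2) A.rq_le(2)])
  also have "\<dots> \<le> ?R * ?N" by (rule mult_left_mono[OF nX(1)]) simp
  finally show "mat_op_norm ?V \<le> ?R * ?N" .
 qed (use nX in auto)
 finally have bd: "mat_op_norm (cor ?d \<cdot>\<^sub>m ?V + cor (- (?R * ?d)) \<cdot>\<^sub>m Y) \<le> 2 * ?R * \<bar>?d\<bar> * ?N"
  by (simp add: algebra_simps)
 have z: "mat_op_norm (0\<^sub>m (A.qp j) (A.qp j) :: complex mat) = 0"
 proof -
  interpret Z: pos_cstar "mat_cstar (A.qp j)" by (rule pos_cstar_mat)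
  show ?thesis using Z.cnorm_zero by simp
 qed
 have "0 \<le> ?N" by (rule A.lev.cnorm_nonneg[OF x])
 hence nn: "0 \<le> 2 * ?R * \<bar>?d\<bar> * ?N" by simp
 show ?thesis unfolding diff A.AA_ops z using bd nn by (rule max.boundedI)
qed

text \<open>Replacing the expectations one level at a time costs at most \<open>\<delta>\<close> per level, since all of them are
  contractions.\<close>

lemma Fc_diff:
 assumes \<delta>: "\<And>j. j < n ==> 2 * real (r (Suc j)) * \<bar>f j - f' j\<bar> \<le> \<delta>"
 shows "m + j \<le> n ==> x \<in> carrier (A.AA (m + j)) ==>
  cdist (A.AA m) (A.Fc m j x) (B.Fc m j x) \<le> real j * \<delta> * cnorm (A.AA (m + j)) x"
proof (induction j arbitrary: x)
 case 0
 thus ?case by simp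
next
 case (Suc j)
 have x: "x \<in> carrier (A.AA (Suc (m + j)))" using Suc.prems(2) by simp
 hence xB: "x \<in> carrier (B.AA (Suc (m + j)))" using AA_agree[of "Suc (m + j)"] Suc.prems(1) by simp
 have d: "2 * real (r (Suc (m + j))) * \<bar>f (m + j) - f' (m + j)\<bar> \<le> \<delta>" by (rule \<delta>) (use Suc.prems in simp)
 have \<delta>0: "0 \<le> \<delta>" by (rule order_trans[OF _ d]) simp
 let ?u = "A.FF (m + j) x" and ?v = "B.FF (m + j) x" and ?N = "cnorm (A.AA (Suc (m + j))) x"
 have u: "?u \<in> carrier (A.AA (m + j))" by (rule A.F_closed[OF x])
 have vB: "?v \<in> carrier (B.AA (m + j))" by (rule B.F_closed[OF xB])
 have v: "?v \<in> carrier (A.AA (m + j))" using vB AA_agree[of "m + j"] Suc.prems(1) by simp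
 have Bv: "B.Fc m j ?v \<in> carrier (A.AA m)" using B.Fc_closed[OF vB] AA_agree[of m] Suc.prems(1) by simp
 have N0: "0 \<le> ?N" by (rule A.lev.cnorm_nonneg[OF x])
 have nv: "cnorm (A.AA (m + j)) ?v \<le> ?N"
  using B.F_norm[OF xB] AA_agree[of "m + j"] AA_agree[of "Suc (m + j)"] Suc.prems(1) by simp
 have "cdist (A.AA m) (A.Fc m j ?u) (B.Fc m j ?v)
   \<le> cdist (A.AA m) (A.Fc m j ?u) (A.Fc m j ?v) + cdist (A.AA m) (A.Fc m j ?v) (B.Fc m j ?v)"
  by (rule A.lev.cnorm_dist_triangle[OF A.Fc_closed[OF u] A.Fc_closed[OF v] Bv])
 also have "cdist (A.AA m) (A.Fc m j ?u) (A.Fc m j ?v) \<le> cdist (A.AA (m + j)) ?u ?v"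
  unfolding A.Fc_minus[OF u v, symmetric] by (rule A.Fc_norm) (use u v in simp)
 also have "\<dots> \<le> 2 * real (r (Suc (m + j))) * \<bar>f (m + j) - f' (m + j)\<bar> * ?N"
  by (rule FF_diff[OF _ x]) (use Suc.prems in simp)
 also have "\<dots> \<le> \<delta> * ?N" by (rule mult_right_mono[OF d N0])
 also have "cdist (A.AA m) (A.Fc m j ?v) (B.Fc m j ?v) \<le> real j * \<delta> * cnorm (A.AA (m + j)) ?v"
  by (rule Suc.IH[OF _ v]) (use Suc.prems in simp)
 also have "\<dots> \<le> real j * \<delta> * ?N" by (rule mult_left_mono[OF nv]) (use \<delta>0 in simp)
 finally show ?case by (simp add: algebra_simps)
qed

text \<open>
 The level \<open>n\<close> part \<open>x\<close> of a Lipschitz element is also an element of the other algebra.  There its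
 distances to the lower levels have grown by at most the error \<open>n * \<delta>\<close> between the expectations,
 so shrinking its trace zero part by the factor \<open>1 / (1 + \<eta>)\<close> makes it Lipschitz again.
\<close>

lemma reach_half:
 assumes k: "0 < k"
  and \<delta>: "\<And>j. j < n ==> 2 * real (r (Suc j)) * \<bar>f j - f' j\<bar> \<le> \<delta>" and \<delta>0: "0 \<le> \<delta>"
  and \<eta>: "\<And>m. m < n ==> A.dd k m * (real n * \<delta>) \<le> \<eta>" and \<eta>0: "0 \<le> \<eta>"
  and a: "a \<in> lip_ball A.QQ (tower_lip A.QQ A.Ex (A.dd k))"
 shows "\<exists>b\<in>lip_ball B.QQ (tower_lip B.QQ B.Ex (B.dd k)).
  cnorm (bounded_quot (DD Nm)) (A.E.emb a \<otimes>\<^bsub>bounded_quot (DD Nm)\<^esub> A.C.om \<ominus>\<^bsub>bounded_quot (DD Nm)\<^esub>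
   A.C.om \<otimes>\<^bsub>bounded_quot (DD Nm)\<^esub> B.E.emb b) \<le> 1 / A.dd k n + \<eta>"
proof -
 interpret TA: af_tower A.QQ "\<lambda>n. A.can n ` carrier (A.AA n)" A.Ex "A.dd k" by (rule A.af_tower_AA[OF k])
 interpret TB: af_tower B.QQ "\<lambda>n. B.can n ` carrier (B.AA n)" B.Ex "B.dd k" by (rule B.af_tower_AA[OF k])
 let ?A = "A.AA n" and ?D = "bounded_quot (DD Nm)"
 have AB: "A.AA n = B.AA n" by (rule AA_agree) simp
 have asa: "a \<in> self_adjoint A.QQ" and ac: "a \<in> carrier A.QQ" using a TA.lip_ball_iff A.Q.self_adjointD(1) by blast+
 have lip: "TA.res m a \<le> 1 / A.dd k m" for m by (rule TA.lip_ball_res[OF a])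
 obtain x where x: "x \<in> carrier ?A" "A.Ex n a = A.can n x" using A.Ex_in[OF ac, of n] by blast
 have xstar: "star ?A x = x"
 proof (rule A.can_inj[OF A.lev.star_closed[OF x(1)] x(1)])
  show "A.can n (star ?A x) = A.can n x"
   using A.Q.self_adjointD(2)[OF TA.self_adjoint_E[OF asa, of n]] unfolding x(2) A.can_hom(4)[OF x(1) x(1)] .
 qed
 define c where "c = A.sig a"
 have cnj: "cnj c = c"
  using A.Q.states_self_adjoint_bound(1)[OF _ asa, of A.sig] A.tracial_state_sig unfolding tracial_state_def c_def
  by (simp add: complex_eq_iff)
 define one where "one = c \<odot>\<^bsub>?A\<^esub> \<one>\<^bsub>?A\<^esub>"
 define x0 where "x0 = x \<ominus>\<^bsub>?A\<^esub> one"
 have one: "one \<in> carrier ?A" by (simp add: one_def)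
 have x0: "x0 \<in> carrier ?A" using x(1) one by (simp add: x0_def)
 have one_star: "star ?A one = one" by (simp add: one_def A.lev.star_smult cnj)
 have x0_star: "star ?A x0 = x0" using x(1) one by (simp add: x0_def A.lev.star_minus xstar one_star)
 have can_one: "A.can n one = c \<odot>\<^bsub>A.QQ\<^esub> \<one>\<^bsub>A.QQ\<^esub>" unfolding one_def A.can_hom(3)[OF A.lev.A.one_closed A.lev.A.one_closed] A.can_one ..
 have can_oneB: "B.can n one = c \<odot>\<^bsub>B.QQ\<^esub> \<one>\<^bsub>B.QQ\<^esub>" unfolding one_def AB B.can_hom(3)[OF B.lev.A.one_closed B.lev.A.one_closed] B.can_one ..
 have E_le: "TA.res m (A.Ex n a) \<le> TA.res m a" if m: "m \<le> n" for m
 proof -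
  obtain j where j: "n = m + j" using m le_iff_add by blast
  have "A.Ex m a \<in> A.can n ` carrier (A.AA n)" using TA.E_B[OF ac, of m] TA.B_le[OF m] by blast
  hence 1: "A.Ex n (A.Ex m a) = A.Ex m a" by (rule TA.E_id)
  have 2: "A.Ex m (A.Ex n a) = A.Ex m a" unfolding j by (rule A.Ex_tower[OF ac])
  have "A.Ex n a \<ominus>\<^bsub>A.QQ\<^esub> A.Ex m (A.Ex n a) = A.Ex n (a \<ominus>\<^bsub>A.QQ\<^esub> A.Ex m a)"
   using A.Ex_minus[OF ac A.Ex_closed[OF ac], of n m] 1 2 by simp
  thus ?thesis unfolding TA.res_def using A.Ex_norm[of "a \<ominus>\<^bsub>A.QQ\<^esub> A.Ex m a" n] ac by simp
 qed
 have can_x0: "A.can n x0 = A.Ex n a \<ominus>\<^bsub>A.QQ\<^esub> c \<odot>\<^bsub>A.QQ\<^esub> \<one>\<^bsub>A.QQ\<^esub>"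
  unfolding x0_def A.can_minus[OF x(1) one] x(2) can_one ..
 have res_one: "TA.res m (c \<odot>\<^bsub>A.QQ\<^esub> \<one>\<^bsub>A.QQ\<^esub>) = 0" for m
  using TA.res_smult[OF A.Q.A.one_closed, of m c] TA.res_B[OF TA.one_B order_refl, of m] by simp
 have res_oneB: "TB.res m (c \<odot>\<^bsub>B.QQ\<^esub> \<one>\<^bsub>B.QQ\<^esub>) = 0" for m
  using TB.res_smult[OF B.Q.A.one_closed, of m c] TB.res_B[OF TB.one_B order_refl, of m] by simp
 have resA: "TA.res m (A.can n x0) \<le> 1 / A.dd k m" if m: "m \<le> n" for m
  using TA.res_minus[OF A.Ex_closed[OF ac] A.Q.sclosed[OF A.Q.A.one_closed], of m n c] E_le[OF m] lip[of m] res_one[of m]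
  unfolding can_x0 by linarith
 have n0: "cnorm ?A x0 \<le> 1"
 proof -
  have "A.Ex n (A.Ex 0 a) = A.Ex 0 a"
   by (rule TA.E_id) (use TA.E_B[OF ac, of 0] TA.B_le[of 0 n] in blast)
  hence "A.can n x0 = A.Ex n (a \<ominus>\<^bsub>A.QQ\<^esub> A.Ex 0 a)"
   unfolding can_x0 A.Ex_minus[OF ac A.Ex_closed[OF ac]] using A.Ex_0[OF ac] by (simp add: c_def)
  hence "cnorm ?A x0 \<le> TA.res 0 a"
   unfolding TA.res_def A.can_norm[OF x0, symmetric] using A.Ex_norm[of "a \<ominus>\<^bsub>A.QQ\<^esub> A.Ex 0 a" n] ac by simp
  thus ?thesis using lip[of 0] by (simp add: A.dd_0)
 qed
 have resB: "TB.res m (B.can n x0) \<le> 1 / A.dd k m + real n * \<delta>" if m: "m \<le> n" for m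
 proof -
  obtain j where j: "n = m + j" using m le_iff_add by blast
  have x0A: "x0 \<in> carrier (A.AA (m + j))" and x0B: "x0 \<in> carrier (B.AA (m + j))" using x0 AB unfolding j by auto
  have FA: "A.Fc m j x0 \<in> carrier (A.AA m)" by (rule A.Fc_closed[OF x0A])
  have FB: "B.Fc m j x0 \<in> carrier (A.AA m)" using B.Fc_closed[OF x0B] AA_agree[of m] m by simp
  have "TB.res m (B.can n x0) = cdist (A.AA (m + j)) x0 (A.conn m j (B.Fc m j x0))"
   unfolding TB.res_def unfolding j B.res_can[OF x0B] using AB conn_agree[of m j] j by simp
  also have "\<dots> \<le> cdist (A.AA (m + j)) x0 (A.conn m j (A.Fc m j x0))
    + cdist (A.AA (m + j)) (A.conn m j (A.Fc m j x0)) (A.conn m j (B.Fc m j x0))"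
   by (rule A.lev.cnorm_dist_triangle[OF x0A A.conn_closed[OF FA] A.conn_closed[OF FB]])
  also have "cdist (A.AA (m + j)) x0 (A.conn m j (A.Fc m j x0)) = TA.res m (A.can n x0)"
   unfolding TA.res_def unfolding j A.res_can[OF x0A] ..
  also have "\<dots> \<le> 1 / A.dd k m" by (rule resA[OF m])
  also have "cdist (A.AA (m + j)) (A.conn m j (A.Fc m j x0)) (A.conn m j (B.Fc m j x0))
    = cdist (A.AA m) (A.Fc m j x0) (B.Fc m j x0)"
   unfolding A.conn_minus[OF FA FB, symmetric] by (rule A.conn_norm) (use FA FB in simp)
  also have "\<dots> \<le> real j * \<delta> * cnorm (A.AA (m + j)) x0" by (rule Fc_diff[OF \<delta> _ x0A]) (use j in simp_all)
  also have "\<dots> \<le> real n * \<delta> * 1"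
   using n0 \<delta>0 A.lev.cnorm_nonneg[OF x0] unfolding j by (intro mult_mono) auto
  finally show ?thesis by simp
 qed
 \<comment> \<open>Shrinking the trace zero part by \<open>\<mu>\<close> absorbs the growth of the seminorm.\<close>
 define \<mu> where "\<mu> = 1 / (1 + \<eta>)"
 have \<mu>: "0 < \<mu>" "\<mu> \<le> 1" "\<mu> * (1 + \<eta>) = 1" "1 - \<mu> \<le> \<eta>"
 proof -
  show "0 < \<mu>" "\<mu> \<le> 1" "\<mu> * (1 + \<eta>) = 1" using \<eta>0 by (simp_all add: \<mu>_def)
  hence "\<mu> * \<eta> \<le> \<eta>" using \<eta>0 mult_left_le_one_le[of \<eta> \<mu>] by simp
  thus "1 - \<mu> \<le> \<eta>" using \<open>\<mu> * (1 + \<eta>) = 1\<close> by (simp add: algebra_simps)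
 qed
 define y where "y = one \<oplus>\<^bsub>?A\<^esub> cor \<mu> \<odot>\<^bsub>?A\<^esub> x0"
 have mx0: "cor \<mu> \<odot>\<^bsub>?A\<^esub> x0 \<in> carrier ?A" using x0 by simp
 have y: "y \<in> carrier ?A" using one mx0 by (simp add: y_def)
 have y_star: "star ?A y = y" using one mx0 x0 by (simp add: y_def A.lev.star_add A.lev.star_smult one_star x0_star)
 have yB: "y \<in> carrier (B.AA n)" and x0B: "x0 \<in> carrier (B.AA n)" and xB: "x \<in> carrier (B.AA n)" and oneB: "one \<in> carrier (B.AA n)"
  and mx0B: "cor \<mu> \<odot>\<^bsub>B.AA n\<^esub> x0 \<in> carrier (B.AA n)" and ystB: "star (B.AA n) y = y"
  and yB_def: "y = one \<oplus>\<^bsub>B.AA n\<^esub> cor \<mu> \<odot>\<^bsub>B.AA n\<^esub> x0"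
  using y x0 x(1) one mx0 y_star y_def unfolding AB by auto
 define b where "b = B.can n y"
 have bB: "b \<in> B.can n ` carrier (B.AA n)" unfolding b_def using yB by blast
 have bc: "b \<in> carrier B.QQ" unfolding b_def by (rule B.can_closed[OF yB])
 have b_sum: "b = c \<odot>\<^bsub>B.QQ\<^esub> \<one>\<^bsub>B.QQ\<^esub> \<oplus>\<^bsub>B.QQ\<^esub> cor \<mu> \<odot>\<^bsub>B.QQ\<^esub> B.can n x0"
  unfolding b_def yB_def B.can_hom(1)[OF oneB mx0B] B.can_hom(3)[OF x0B x0B] can_oneB ..
 have "b \<in> lip_ball B.QQ TB.L"
  unfolding TB.lip_ball_iff
 proof (intro conjI allI)
  show "b \<in> self_adjoint B.QQ"
   using bc B.can_hom(4)[OF yB yB] unfolding ystB self_adjoint_def b_def by simp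
  fix m
  show "B.dd k m * TB.res m b \<le> 1"
  proof (cases "n \<le> m")
   case True
   thus ?thesis using TB.res_B[OF bB True] by simp
  next
   case False
   hence m: "m \<le> n" "m < n" by auto
   have "TB.res m b \<le> 0 + \<mu> * TB.res m (B.can n x0)"
    unfolding b_sum
    using TB.res_add[OF B.Q.sclosed[OF B.Q.A.one_closed] B.Q.sclosed[OF B.can_closed[OF x0B]], of m c "cor \<mu>"]
     TB.res_smult[OF B.can_closed[OF x0B], of m "cor \<mu>"] res_oneB[of m] \<mu>(1) by simp
   also have "\<dots> \<le> \<mu> * (1 / A.dd k m + real n * \<delta>)" using mult_left_mono[OF resB[OF m(1)], of \<mu>] \<mu>(1) by simp
   finally have "A.dd k m * TB.res m b \<le> A.dd k m * (\<mu> * (1 / A.dd k m + real n * \<delta>))"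
    by (rule mult_left_mono) simp
   also have "\<dots> = \<mu> * (1 + A.dd k m * (real n * \<delta>))" using A.dd_pos[of m k] by (simp add: field_simps)
   also have "\<dots> \<le> \<mu> * (1 + \<eta>)" using \<eta>[OF m(2)] \<mu>(1) by (intro mult_left_mono) auto
   finally show ?thesis using \<mu>(3) dd_agree[of m k] m by simp
  qed
 qed
 moreover have "cdist ?D (A.E.emb a \<otimes>\<^bsub>?D\<^esub> A.C.om) (A.C.om \<otimes>\<^bsub>?D\<^esub> B.E.emb b) \<le> 1 / A.dd k n + \<eta>"
 proof -
  let ?u = "A.E.emb (A.can n x)" and ?v = "B.E.emb (B.can n x)"
  have ea: "A.E.emb a \<in> carrier ?D" by (rule A.E.emb_closed[OF ac])
  have u: "?u \<in> carrier ?D" by (rule A.E.emb_closed[OF A.can_closed[OF x(1)]])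
  have v: "?v \<in> carrier ?D" by (rule B.E.emb_closed[OF B.can_closed[OF xB]])
  have eb: "B.E.emb b \<in> carrier ?D" by (rule B.E.emb_closed[OF bc])
  have om: "A.C.om \<in> carrier ?D" by (rule A.C.om_closed)
  have mid: "?u \<otimes>\<^bsub>?D\<^esub> A.C.om = A.C.om \<otimes>\<^bsub>?D\<^esub> ?v"
   unfolding A.emb_can_om(1)[OF x(1)] B.emb_can_om(2)[OF xB] using al_agree[of n] by simp
  have z: "A.C.om \<ominus>\<^bsub>?D\<^esub> A.C.om = \<zero>\<^bsub>?D\<^esub>" using om by (simp add: A.C.DQ.A.minus_eq A.C.DQ.A.r_neg)
  have om1: "cnorm ?D A.C.om \<le> 1" by (rule A.C.om_norm)
  have "cdist ?D (A.E.emb a \<otimes>\<^bsub>?D\<^esub> A.C.om) (?u \<otimes>\<^bsub>?D\<^esub> A.C.om) \<le> cdist ?D (A.E.emb a) ?u * 1"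
   using A.C.DQ.cnorm_mult_dist[OF ea om u om] mult_left_mono[OF om1 A.C.DQ.cnorm_nonneg[OF A.C.DQ.A.minus_closed[OF ea u]]] unfolding z by simp
  also have "\<dots> \<le> TA.res n a"
   unfolding x(2)[symmetric] A.E.emb_minus[OF ac A.Ex_closed[OF ac], symmetric] TA.res_def
   using A.E.emb_norm[of "a \<ominus>\<^bsub>A.QQ\<^esub> A.Ex n a"] ac by simp
  also have "\<dots> \<le> 1 / A.dd k n" by (rule lip)
  finally have 1: "cdist ?D (A.E.emb a \<otimes>\<^bsub>?D\<^esub> A.C.om) (?u \<otimes>\<^bsub>?D\<^esub> A.C.om) \<le> 1 / A.dd k n" .
  have "cdist ?D (A.C.om \<otimes>\<^bsub>?D\<^esub> ?v) (A.C.om \<otimes>\<^bsub>?D\<^esub> B.E.emb b) \<le> 1 * cdist ?D ?v (B.E.emb b)"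
   using A.C.DQ.cnorm_mult_dist[OF om v om eb] mult_right_mono[OF om1 A.C.DQ.cnorm_nonneg[OF A.C.DQ.A.minus_closed[OF v eb]]] unfolding z by simp
  also have "\<dots> \<le> cdist B.QQ (B.can n x) b"
   unfolding B.E.emb_minus[OF B.can_closed[OF xB] bc, symmetric]
   using B.E.emb_norm[of "B.can n x \<ominus>\<^bsub>B.QQ\<^esub> b"] B.can_closed[OF xB] bc by simp
  also have "\<dots> = cdist ?A x y"
   unfolding b_def B.can_minus[OF xB yB, symmetric] AB by (rule B.can_norm) (use xB yB in simp)
  also have "x \<ominus>\<^bsub>?A\<^esub> y = cor (1 - \<mu>) \<odot>\<^bsub>?A\<^esub> x0"
  proof -
   have "one \<oplus>\<^bsub>?A\<^esub> x0 = x"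
    unfolding x0_def A.lev.A.minus_eq A.lev.A.a_lcomm[OF one x(1) A.lev.A.a_inv_closed[OF one]]
    using x(1) one by (simp add: A.lev.A.r_neg)
   hence "x \<ominus>\<^bsub>?A\<^esub> y = (one \<oplus>\<^bsub>?A\<^esub> x0) \<ominus>\<^bsub>?A\<^esub> y" by simp
   also have "\<dots> = x0 \<ominus>\<^bsub>?A\<^esub> cor \<mu> \<odot>\<^bsub>?A\<^esub> x0" unfolding y_def by (rule A.lev.add_minus_add[OF one x0 mx0])
   also have "\<dots> = cor (1 - \<mu>) \<odot>\<^bsub>?A\<^esub> x0"
    using A.lev.smult_minus_left[OF x0, of 1 "cor \<mu>"] x0 by simp
   finally show ?thesis .
  qed
  also have "cnorm ?A (cor (1 - \<mu>) \<odot>\<^bsub>?A\<^esub> x0) = (1 - \<mu>) * cnorm ?A x0"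
   unfolding A.lev.cnorm_smult[OF x0] norm_of_real using \<mu>(2) by simp
  also have "\<dots> \<le> (1 - \<mu>) * 1" using n0 \<mu>(2) by (intro mult_left_mono) auto
  also have "\<dots> \<le> \<eta>" using \<mu>(4) by simp
  finally have 2: "cdist ?D (A.C.om \<otimes>\<^bsub>?D\<^esub> ?v) (A.C.om \<otimes>\<^bsub>?D\<^esub> B.E.emb b) \<le> \<eta>" .
  have "cdist ?D (A.E.emb a \<otimes>\<^bsub>?D\<^esub> A.C.om) (A.C.om \<otimes>\<^bsub>?D\<^esub> B.E.emb b)
   \<le> cdist ?D (A.E.emb a \<otimes>\<^bsub>?D\<^esub> A.C.om) (?u \<otimes>\<^bsub>?D\<^esub> A.C.om) + cdist ?D (?u \<otimes>\<^bsub>?D\<^esub> A.C.om) (A.C.om \<otimes>\<^bsub>?D\<^esub> B.E.emb b)"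
   by (rule A.C.DQ.cnorm_dist_triangle) (use ea u eb om in simp_all)
  thus ?thesis using 1 2 unfolding mid by linarith
 qed
 ultimately show ?thesis by blast
qed

end

section \<open>The length of the bridge\<close>

lemma propinquity_le_bridge_length:
 assumes "X \<in> qcms_class" "Y \<in> qcms_class" "is_bridge X Y \<gamma>"
 shows "propinquity X Y \<le> bridge_length X Y \<gamma>"
 unfolding propinquity_def propinquity_candidates_def by (rule SUP_least) (use assms in blast)

context bridge_pair
begin

lemma swap: "bridge_pair r' q' f' r q f Nm s n"
proof (rule bridge_pair.intro[OF B.bridge_side_axioms A.bridge_side_axioms bridge_pair_axioms.intro])
 show "r' (Suc j) = r (Suc j)" if "j \<le> n" for j using agree[OF that] by simp
qed

abbreviation DQ where "DQ \<equiv> bounded_quot (DD Nm)"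
abbreviation om where "om \<equiv> A.C.om"

text \<open>The pivot and both elements are self-adjoint, so the adjoint exchanges the two sides of the bridge.\<close>

lemma reach_symmetric:
 assumes a: "a \<in> self_adjoint A.QQ" and b: "b \<in> self_adjoint B.QQ"
 shows "cdist DQ (A.E.emb a \<otimes>\<^bsub>DQ\<^esub> om) (om \<otimes>\<^bsub>DQ\<^esub> B.E.emb b) = cdist DQ (B.E.emb b \<otimes>\<^bsub>DQ\<^esub> om) (om \<otimes>\<^bsub>DQ\<^esub> A.E.emb a)"
proof -
 have ac: "a \<in> carrier A.QQ" "star A.QQ a = a" and bc: "b \<in> carrier B.QQ" "star B.QQ b = b"
  using a b by (auto simp: self_adjoint_def)
 let ?a = "A.E.emb a" and ?b = "B.E.emb b"
 have c: "?a \<in> carrier DQ" "?b \<in> carrier DQ" "om \<in> carrier DQ"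
  using A.E.emb_closed[OF ac(1)] B.E.emb_closed[OF bc(1)] by simp_all
 have st: "star DQ ?a = ?a" "star DQ ?b = ?b"
  using A.E.emb_hom(4)[OF ac(1)] B.E.emb_hom(4)[OF bc(1)] ac(2) bc(2) by simp_all
 have p: "?a \<otimes>\<^bsub>DQ\<^esub> om \<in> carrier DQ" "om \<otimes>\<^bsub>DQ\<^esub> ?b \<in> carrier DQ" "om \<otimes>\<^bsub>DQ\<^esub> ?a \<in> carrier DQ" "?b \<otimes>\<^bsub>DQ\<^esub> om \<in> carrier DQ"
  using c by simp_all
 have "cdist DQ (?a \<otimes>\<^bsub>DQ\<^esub> om) (om \<otimes>\<^bsub>DQ\<^esub> ?b) = cnorm DQ (star DQ (?a \<otimes>\<^bsub>DQ\<^esub> om \<ominus>\<^bsub>DQ\<^esub> om \<otimes>\<^bsub>DQ\<^esub> ?b))"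
  by (rule A.C.DQ.cnorm_star[symmetric]) (use p in simp)
 also have "star DQ (?a \<otimes>\<^bsub>DQ\<^esub> om \<ominus>\<^bsub>DQ\<^esub> om \<otimes>\<^bsub>DQ\<^esub> ?b) = om \<otimes>\<^bsub>DQ\<^esub> ?a \<ominus>\<^bsub>DQ\<^esub> ?b \<otimes>\<^bsub>DQ\<^esub> om"
  unfolding A.C.DQ.star_minus[OF p(1,2)] A.C.DQ.star_mult[OF c(1,3)] A.C.DQ.star_mult[OF c(3,2)] st A.C.om_star ..
 also have "cnorm DQ \<dots> = cdist DQ (?b \<otimes>\<^bsub>DQ\<^esub> om) (om \<otimes>\<^bsub>DQ\<^esub> ?a)" by (rule A.C.DQ.cnorm_minus_commute[OF p(3,4)])
 finally show ?thesis .
qed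

theorem propinquity_le:
 assumes k: "0 < k"
  and \<delta>: "\<And>j. j < n ==> 2 * real (r (Suc j)) * \<bar>f j - f' j\<bar> \<le> \<delta>" and \<delta>0: "0 \<le> \<delta>"
  and \<eta>: "\<And>m. m < n ==> A.dd k m * (real n * \<delta>) \<le> \<eta>" and \<eta>0: "0 \<le> \<eta>"
 shows "propinquity (A.QQ, tower_lip A.QQ A.Ex (A.dd k)) (B.QQ, tower_lip B.QQ B.Ex (B.dd k)) \<le> ennreal (2 / A.dd k n + \<eta>)"
proof -
 let ?LA = "tower_lip A.QQ A.Ex (A.dd k)" and ?LB = "tower_lip B.QQ B.Ex (B.dd k)"
 let ?X = "(A.QQ, ?LA)" and ?Y = "(B.QQ, ?LB)" and ?\<gamma> = "(DQ, A.E.emb, B.E.emb, om)"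
 let ?c = "ennreal (2 / A.dd k n + \<eta>)"
 have XY: "?X \<in> qcms_class" "?Y \<in> qcms_class"
  by (rule af_tower.qcms[OF A.af_tower_AA[OF k]], rule af_tower.qcms[OF B.af_tower_AA[OF k]])
 have sa: "\<And>a. a \<in> lip_ball A.QQ ?LA ==> a \<in> self_adjoint A.QQ" "\<And>b. b \<in> lip_ball B.QQ ?LB ==> b \<in> self_adjoint B.QQ"
  by (simp_all add: lip_ball_def)
 have dn: "A.dd k n = B.dd k n" by (rule dd_agree) simp
 have dpos: "0 < A.dd k n" by (rule A.dd_pos)
 have c2: "ennreal (2 / A.dd k n) \<le> ?c" using \<eta>0 by (intro ennreal_leI) simp
 have c1: "ennreal (1 / A.dd k n + \<eta>) \<le> ?c" using dpos by (intro ennreal_leI) (simp add: divide_right_mono)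
 have bridge: "is_bridge ?X ?Y ?\<gamma>"
  using A.C.unital_DQ A.E.emb_mono B.E.emb_mono A.one_level_nonempty by simp
 have height: "bridge_height ?X ?Y ?\<gamma> \<le> ?c"
  unfolding bridge_height.simps
 proof (rule max.boundedI)
  show "hausdorff_dist (mk_dist A.QQ ?LA) (states A.QQ) (pullback_states A.QQ A.E.emb (one_level_states DQ om)) \<le> ?c"
   by (rule order_trans[OF A.side_height[OF k] c2])
  show "hausdorff_dist (mk_dist B.QQ ?LB) (states B.QQ) (pullback_states B.QQ B.E.emb (one_level_states DQ om)) \<le> ?c"
   by (rule order_trans[OF B.side_height[OF k, folded dn] c2])
 qed
 have reach: "bridge_reach ?X ?Y ?\<gamma> \<le> ?c"
  unfolding bridge_reach.simps hausdorff_dist_def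
 proof (intro max.boundedI SUP_least)
  fix a assume a: "a \<in> lip_ball A.QQ ?LA"
  have "\<exists>b\<in>lip_ball B.QQ ?LB.
   cdist DQ (A.E.emb a \<otimes>\<^bsub>DQ\<^esub> om) (om \<otimes>\<^bsub>DQ\<^esub> B.E.emb b) \<le> 1 / A.dd k n + \<eta>"
   by (rule reach_half[OF k _ \<delta>0 _ \<eta>0 a]) (rule \<delta>, assumption, rule \<eta>, assumption)
  then obtain b where b: "b \<in> lip_ball B.QQ ?LB"
   "cdist DQ (A.E.emb a \<otimes>\<^bsub>DQ\<^esub> om) (om \<otimes>\<^bsub>DQ\<^esub> B.E.emb b) \<le> 1 / A.dd k n + \<eta>" by (rule bexE)
  show "(INF b\<in>lip_ball B.QQ ?LB. ennreal (cdist DQ (A.E.emb a \<otimes>\<^bsub>DQ\<^esub> om) (om \<otimes>\<^bsub>DQ\<^esub> B.E.emb b))) \<le> ?c"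
   by (rule INF_lower2[OF b(1)]) (rule order_trans[OF ennreal_leI[OF b(2)] c1])
 next
  fix b assume b: "b \<in> lip_ball B.QQ ?LB"
  have \<delta>': "2 * real (r' (Suc j)) * \<bar>f' j - f j\<bar> \<le> \<delta>" if "j < n" for j
   using \<delta>[OF that] agree[of j] that by (simp add: abs_minus_commute)
  have \<eta>': "B.dd k m * (real n * \<delta>) \<le> \<eta>" if "m < n" for m
   using \<eta>[OF that] dd_agree[of m k] that by simp
  have "\<exists>a\<in>lip_ball A.QQ ?LA.
   cdist DQ (B.E.emb b \<otimes>\<^bsub>DQ\<^esub> om) (om \<otimes>\<^bsub>DQ\<^esub> A.E.emb a) \<le> 1 / B.dd k n + \<eta>"
   by (rule bridge_pair.reach_half[OF swap k _ \<delta>0 _ \<eta>0 b]) (rule \<delta>', assumption, rule \<eta>', assumption)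
  then obtain a where a: "a \<in> lip_ball A.QQ ?LA"
   "cdist DQ (B.E.emb b \<otimes>\<^bsub>DQ\<^esub> om) (om \<otimes>\<^bsub>DQ\<^esub> A.E.emb a) \<le> 1 / B.dd k n + \<eta>" by (rule bexE)
  have le: "cdist DQ (A.E.emb a \<otimes>\<^bsub>DQ\<^esub> om) (om \<otimes>\<^bsub>DQ\<^esub> B.E.emb b) \<le> 1 / A.dd k n + \<eta>"
   by (rule ord_eq_le_trans[OF reach_symmetric[OF sa(1)[OF a(1)] sa(2)[OF b]]]) (rule a(2)[folded dn])
  show "(INF a\<in>lip_ball A.QQ ?LA. ennreal (cdist DQ (A.E.emb a \<otimes>\<^bsub>DQ\<^esub> om) (om \<otimes>\<^bsub>DQ\<^esub> B.E.emb b))) \<le> ?c"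
   by (rule INF_lower2[OF a(1)]) (rule order_trans[OF ennreal_leI[OF le] c1])
 qed
 have len: "bridge_length ?X ?Y ?\<gamma> \<le> ?c"
  unfolding bridge_length_def using height reach by (rule max.boundedI)
 show ?thesis using propinquity_le_bridge_length[OF XY bridge] len by (rule order_trans)
qed

end

lemma bridge_pairI:
 assumes A: "cf_data r q f" and B: "cf_data r' q' f'" and agree: "\<And>j. j \<le> n ==> r (Suc j) = r' (Suc j)"
 shows "bridge_pair r q f r' q' f' (\<lambda>m. q m * q' m) (q (Suc n)) n"
proof -
 interpret A: cf_data r q f by (rule A)
 interpret B: cf_data r' q' f' by (rule B)
 have q: "j \<le> Suc n ==> q j = q' j \<and> A.qp j = B.qp j" for j
  by (induction j) (use agree in \<open>simp_all add: A.q_Suc B.q_Suc A.q0 B.q0\<close>)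
 have C: "corner (\<lambda>m. q m * q' m) (q (Suc n)) n"
 proof (rule corner.intro)
  show "0 < q m * q' m" for m using A.q_pos B.q_pos by simp
  show "q (Suc n) \<le> q m * q' m" if "Suc n \<le> m" for m
   using mult_le_mono[OF A.q_mono[OF that], of 1 "q' m"] B.q_pos[of m] by simp
 qed
 show ?thesis
  by (intro bridge_pair.intro bridge_side.intro bridge_side_axioms.intro bridge_pair_axioms.intro A B C agree)
   (use q[of "Suc n"] in simp_all)
qed

section \<open>Continued fractions\<close>

lemma cf_quotient_irrational: "\<theta> \<notin> \<rat> ==> cf_quotient \<theta> j \<notin> \<rat>"
proof (induction j)
 case (Suc j)
 show ?case
 proof
  assume "cf_quotient \<theta> (Suc j) \<in> \<rat>"
  hence "1 / cf_quotient \<theta> (Suc j) \<in> \<rat>" by (rule Rats_divide[OF Rats_1])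
  hence "frac (cf_quotient \<theta> j) \<in> \<rat>" by (simp only: cf_quotient.simps div_by_1 divide_divide_eq_right mult_1_left)
  hence "of_int \<lfloor>cf_quotient \<theta> j\<rfloor> + frac (cf_quotient \<theta> j) \<in> \<rat>" by (rule Rats_add[OF Rats_of_int])
  thus False using Suc by (simp add: frac_def)
 qed
qed simp

lemma cf_quotient_not_int: "\<theta> \<notin> \<rat> ==> cf_quotient \<theta> j \<notin> \<int>"
 using cf_quotient_irrational Ints_subset_Rats by blast

lemma cf_frac: assumes "\<theta> \<notin> \<rat>" shows "0 < frac (cf_quotient \<theta> j)" "frac (cf_quotient \<theta> j) < 1"
 using cf_quotient_not_int[OF assms, of j] by (simp_all add: frac_lt_1 frac_gt_0_iff)

lemma cf_data_theta: assumes \<theta>: "\<theta> \<notin> \<rat>"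
 shows "cf_data (cf_digit \<theta>) (cf_q \<theta>) (\<lambda>j. frac (cf_quotient \<theta> j))"
proof (rule cf_data.intro)
 fix j
 let ?x = "cf_quotient \<theta> (Suc j)"
 have gt: "1 < ?x" using cf_frac[OF \<theta>, of j] by simp
 hence fl: "1 \<le> \<lfloor>?x\<rfloor>" by simp
 show "0 < cf_digit \<theta> (Suc j)" unfolding cf_digit_def using fl by simp
 show "0 < frac (cf_quotient \<theta> j)" by (rule cf_frac(1)[OF \<theta>])
 have "real (cf_digit \<theta> (Suc j)) + frac ?x = ?x" unfolding cf_digit_def frac_def using fl by simp
 thus "frac (cf_quotient \<theta> j) * (real (cf_digit \<theta> (Suc j)) + frac ?x) = 1"
  using cf_frac(1)[OF \<theta>, of j] by simp
qed simp_all

lemma effros_shen_eq: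
 assumes \<theta>: "\<theta> \<notin> \<rat>"
 defines "r \<equiv> cf_digit \<theta>" and "q \<equiv> cf_q \<theta>" and "f \<equiv> \<lambda>j. frac (cf_quotient \<theta> j)"
 shows "effros_shen \<theta> = ind_lim (cf_data.AA q) (cf_data.al r)"
  and "effros_shen_lip k \<theta> = tower_lip (ind_lim (cf_data.AA q) (cf_data.al r))
   (ind_tower.Ex (cf_data.AA q) (cf_data.al r) (cf_data.FF r q f)) (\<lambda>n. real (cstar_dim (cf_data.AA q n)) powr k)"
proof -
 interpret cf_data r q f unfolding r_def q_def f_def by (rule cf_data_theta[OF \<theta>])
 have fd: "effros_shen_fd \<theta> = AA" by (rule ext) (simp only: effros_shen_fd_def AA_def qp_def, simp only: q_def)
 have map: "effros_shen_map \<theta> = al" by (rule ext) (simp only: effros_shen_map_def al_def blk_def, simp only: r_def)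
 show es: "effros_shen \<theta> = ind_lim AA al" unfolding effros_shen_def fd map ..
 have can: "effros_shen_can \<theta> = can" by (rule ext) (simp only: effros_shen_can_def fd map can_eq)
 have trace: "effros_shen_trace \<theta> = sig" unfolding effros_shen_trace_def es ind_lim_eq the_trace ..
 have expect: "effros_shen_expect \<theta> = Ex" by (rule ext) (simp only: effros_shen_expect_def es ind_lim_eq can fd trace the_expectation)
 show "effros_shen_lip k \<theta> = tower_lip (ind_lim AA al) Ex (\<lambda>n. real (cstar_dim (AA n)) powr k)"
  by (rule ext) (simp only: effros_shen_lip_def tower_lip_def es fd expect)
qed

lemma cf_quotient_continuous: "\<theta> \<notin> \<rat> ==> ((\<lambda>t. cf_quotient t j) \<longlongrightarrow> cf_quotient \<theta> j) (nhds \<theta>)"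
proof (induction j)
 case (Suc j)
 have "((\<lambda>t. frac (cf_quotient t j)) \<longlongrightarrow> frac (cf_quotient \<theta> j)) (nhds \<theta>)"
  by (rule isCont_tendsto_compose[OF continuous_frac[OF cf_quotient_not_int[OF Suc.prems]] Suc.IH[OF Suc.prems]])
 thus ?case using cf_frac(1)[OF Suc.prems, of j] by (auto intro!: tendsto_divide)
qed (simp add: filterlim_ident)

lemma cf_digit_locally_constant:
 assumes "\<theta> \<notin> \<rat>" shows "\<forall>\<^sub>F t in nhds \<theta>. cf_digit t j = cf_digit \<theta> j"
 using eventually_floor_eq[OF cf_quotient_continuous[OF assms] cf_quotient_not_int[OF assms], of j]
 by eventually_elim (simp add: cf_digit_def)

section \<open>Continuity\<close>

theorem theorem5p14:
 fixes k :: real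
 assumes "0 < k"
 shows "continuous_map (top_of_set ({0<..<1} - \<rat>)) propinquity_topology
  (\<lambda>\<theta>::real. (effros_shen \<theta>, effros_shen_lip k \<theta>))"
proof -
 let ?S = "{0<..<1} - \<rat> :: real set" and ?G = "\<lambda>\<theta>::real. (effros_shen \<theta>, effros_shen_lip k \<theta>)"
 have qcms: "?G \<theta> \<in> qcms_class" if \<theta>: "\<theta> \<notin> \<rat>" for \<theta>
 proof -
  interpret cf_data "cf_digit \<theta>" "cf_q \<theta>" "\<lambda>j. frac (cf_quotient \<theta> j)" by (rule cf_data_theta[OF \<theta>])
  show ?thesis unfolding effros_shen_eq[OF \<theta>] ind_lim_eq by (rule af_tower.qcms[OF af_tower_AA[OF assms]])
 qed
 have near: "\<forall>\<^sub>F t in nhds \<theta>. t \<notin> \<rat> \<longrightarrow> propinquity (?G \<theta>) (?G t) < ennreal \<epsilon>" if \<theta>: "\<theta> \<notin> \<rat>" and \<epsilon>: "0 < \<epsilon>" for \<theta> \<epsilon>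
 proof -
  interpret A: cf_data "cf_digit \<theta>" "cf_q \<theta>" "\<lambda>j. frac (cf_quotient \<theta> j)" by (rule cf_data_theta[OF \<theta>])
  have "\<forall>\<^sub>F n in sequentially. 4 / \<epsilon> < A.dd k n" using A.dim_weights(2)[OF assms] by (simp add: filterlim_at_top_dense)
  then obtain n where "4 / \<epsilon> < A.dd k n" by (auto simp: eventually_sequentially)
  hence n: "2 / A.dd k n < \<epsilon> / 2" using \<epsilon> A.dd_pos[of n k] by (simp add: field_simps)
  \<comment> \<open>The first summand of the bound is below half of \<open>\<epsilon>\<close>; \<open>C * \<delta>\<close> bounds \<open>\<eta>\<close> for all levels below \<open>n\<close> at once.\<close>
  define C where "C = (\<Sum>m<n. A.dd k m) * real n"
  have C0: "0 \<le> C" unfolding C_def by (intro mult_nonneg_nonneg sum_nonneg) auto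
  define \<delta> where "\<delta> = \<epsilon> / (2 * (C + 1))"
  have \<delta>: "0 < \<delta>" using \<epsilon> C0 by (simp add: \<delta>_def)
  have C\<delta>: "C * \<delta> < \<epsilon> / 2" using \<epsilon> C0 by (simp add: \<delta>_def field_simps)
  have \<eta>: "A.dd k m * (real n * \<delta>) \<le> C * \<delta>" if "m < n" for m
  proof -
   have "A.dd k m \<le> (\<Sum>m<n. A.dd k m)" using that by (intro member_le_sum) auto
   hence "A.dd k m * (real n * \<delta>) \<le> (\<Sum>m<n. A.dd k m) * (real n * \<delta>)" using \<delta> by (intro mult_right_mono) auto
   thus ?thesis by (simp add: C_def mult.assoc)
  qed
  have digits: "\<forall>\<^sub>F t in nhds \<theta>. \<forall>j\<in>{..n}. cf_digit t (Suc j) = cf_digit \<theta> (Suc j)"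
   by (intro eventually_ball_finite ballI cf_digit_locally_constant[OF \<theta>]) simp
  have weights: "\<forall>\<^sub>F t in nhds \<theta>. \<forall>j\<in>{..<n}. 2 * real (cf_digit \<theta> (Suc j)) * \<bar>frac (cf_quotient \<theta> j) - frac (cf_quotient t j)\<bar> < \<delta>"
  proof (intro eventually_ball_finite ballI)
   fix j
   have "((\<lambda>t. frac (cf_quotient t j)) \<longlongrightarrow> frac (cf_quotient \<theta> j)) (nhds \<theta>)"
    by (rule isCont_tendsto_compose[OF continuous_frac[OF cf_quotient_not_int[OF \<theta>]] cf_quotient_continuous[OF \<theta>]])
   hence "((\<lambda>t. 2 * real (cf_digit \<theta> (Suc j)) * \<bar>frac (cf_quotient \<theta> j) - frac (cf_quotient t j)\<bar>) \<longlongrightarrow>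
     2 * real (cf_digit \<theta> (Suc j)) * \<bar>frac (cf_quotient \<theta> j) - frac (cf_quotient \<theta> j)\<bar>) (nhds \<theta>)"
    by (intro tendsto_mult tendsto_const tendsto_rabs tendsto_diff)
   from order_tendstoD(2)[OF this, of \<delta>] \<delta>
   show "\<forall>\<^sub>F t in nhds \<theta>. 2 * real (cf_digit \<theta> (Suc j)) * \<bar>frac (cf_quotient \<theta> j) - frac (cf_quotient t j)\<bar> < \<delta>" by simp
  qed simp
  show ?thesis
   using digits weights
  proof eventually_elim
   case (elim t)
   show ?case
   proof
    assume t: "t \<notin> \<rat>"
    interpret P: bridge_pair "cf_digit \<theta>" "cf_q \<theta>" "\<lambda>j. frac (cf_quotient \<theta> j)" "cf_digit t" "cf_q t" "\<lambda>j. frac (cf_quotient t j)"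
      "\<lambda>m. cf_q \<theta> m * cf_q t m" "cf_q \<theta> (Suc n)" n
     by (rule bridge_pairI[OF cf_data_theta[OF \<theta>] cf_data_theta[OF t]]) (use elim(1) in simp)
    have w: "2 * real (cf_digit \<theta> (Suc j)) * \<bar>frac (cf_quotient \<theta> j) - frac (cf_quotient t j)\<bar> \<le> \<delta>" if "j < n" for j
     using elim(2) that by (simp add: less_imp_le)
    have "propinquity (?G \<theta>) (?G t) \<le> ennreal (2 / A.dd k n + C * \<delta>)"
     unfolding effros_shen_eq[OF \<theta>] effros_shen_eq[OF t] A.ind_lim_eq P.B.ind_lim_eq
     by (rule P.propinquity_le[OF assms w]) (use \<delta> \<eta> C0 in simp_all)
    also have "\<dots> < ennreal \<epsilon>" by (rule ennreal_lessI[OF \<epsilon>]) (use n C\<delta> in linarith)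
    finally show "propinquity (?G \<theta>) (?G t) < ennreal \<epsilon>" .
   qed
  qed
 qed
 show ?thesis
  unfolding continuous_map_def
 proof (intro conjI allI impI)
  show "?G \<in> topspace (top_of_set ?S) \<rightarrow> topspace propinquity_topology"
   unfolding topspace_propinquity_topology using qcms by auto
  fix U :: "af_elem lip_pair set" assume U: "openin propinquity_topology U"
  show "openin (top_of_set ?S) {\<theta> \<in> topspace (top_of_set ?S). ?G \<theta> \<in> U}"
   unfolding openin_euclidean_subtopology_iff
  proof (intro conjI ballI)
   fix \<theta> assume "\<theta> \<in> {\<theta> \<in> topspace (top_of_set ?S). ?G \<theta> \<in> U}"
   hence \<theta>: "\<theta> \<notin> \<rat>" "?G \<theta> \<in> U" by auto
   obtain \<epsilon> where \<epsilon>: "0 < \<epsilon>" "\<And>Y. Y \<in> qcms_class ==> propinquity (?G \<theta>) Y < ennreal \<epsilon> ==> Y \<in> U"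
    using U \<theta>(2) unfolding openin_propinquity_topology by blast
   obtain d where d: "0 < d" "\<And>t. dist t \<theta> < d ==> t \<notin> \<rat> ==> propinquity (?G \<theta>) (?G t) < ennreal \<epsilon>"
    using near[OF \<theta>(1) \<epsilon>(1)] unfolding eventually_nhds_metric by blast
   show "\<exists>e>0. \<forall>t\<in>?S. dist t \<theta> < e \<longrightarrow> t \<in> {\<theta> \<in> topspace (top_of_set ?S). ?G \<theta> \<in> U}"
    using d \<epsilon>(2) qcms by (intro exI[of _ d]) auto
  qed auto
 qed
qed

end
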